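(* Let $k$ be a field of characteristic $p>0$, let $R$ be a finitely generated $\mathbb{N}$-graded $k$-algebra, let $I\subseteq R$ be a homogeneous ideal of finite co-length, and let $M$ be a finitely generated $\mathbb{Z}$-graded $R$-module. For $n\in\mathbb{N}$ and $y\in\mathbb{C}$ set $$F_n(y)=\left(\frac{1}{p^n}\right)^{\dim(M)}\sum_{j=-\infty}^{\infty}\lambda\left(\left(\frac{M}{I^{[p^n]}M}\right)_j\right)e^{-iyj/p^n}.$$ Then the sequence $(F_n(y))_n$ converges for every complex number $y$. Furthermore, the convergence is uniform on every compact subset of the complex plane, and the limit is an entire function of $y$.
   Context: A finitely generated $\mathbb{N}$-graded $k$-algebra is an $\mathbb{N}$-graded commutative ring whose degree zero piece is $k$ and which is finitely generated over $k$. $I$ has finite co-length if $R/I$ has finite length. $I^{[p^n]}$ is the ideal of $R$ generated by the $p^n$-th powers of elements of $I$. $\lambda$ denotes length (dimension) over $k$; $(\cdot)_j$ is the degree $j$ graded piece. $\dim(M)$ is the Krull dimension of $M$. $i$ is a fixed complex square root of $-1$. The quotient $M/I^{[p^n]}M$ has only finitely many non-zero graded pieces, so each $F_n$ is a finite sum. An entire function is a function holomorphic everywhere on $\mathbb{C}$. *)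

theory Defs
  imports
    "HOL-Analysis.Analysis"
    "HOL-Algebra.Generated_Rings"
    "HOL-Algebra.Multiplicative_Group"
    "HOL-Algebra.QuotRing"
begin

section \<open>Characteristic, quotients and generation\<close>

text \<open>
  The order of \<open>\<one>\<close> in the additive group; \<^const>\<open>group.ord\<close> is \<open>0\<close> on elements of
  infinite order, which gives characteristic \<open>0\<close>.
\<close>
definition ring_characteristic :: "('a, 'b) ring_scheme \<Rightarrow> nat" where
  "ring_characteristic R = group.ord (add_monoid R) \<one>\<^bsub>R\<^esub>"

text \<open>
  The record type of modules extends that of rings, so its fields \<^const>\<open>mult\<close> and
  \<^const>\<open>one\<close> have to be filled in although the module locale does not refer to them.
  Scalar multiplication of a coset goes through all representatives, as in \<^const>\<open>rcoset_mult\<close>.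
\<close>
definition quotient_module ::
    "('a, 'b, 'c) module_scheme \<Rightarrow> 'b set \<Rightarrow> ('a, 'b set) module" where
  "quotient_module M N =
    \<lparr>carrier = a_rcosets\<^bsub>M\<^esub> N, mult = rcoset_mult M N, one = N +>\<^bsub>M\<^esub> \<one>\<^bsub>M\<^esub>,
     zero = N, add = set_add M, smult = (\<lambda>a A. \<Union>x\<in>A. N +>\<^bsub>M\<^esub> (a \<odot>\<^bsub>M\<^esub> x))\<rparr>"

definition regular_module :: "('a, 'b) ring_scheme \<Rightarrow> ('a, 'a) module" where
  "regular_module R =
    \<lparr>carrier = carrier R, mult = mult R, one = \<one>\<^bsub>R\<^esub>, zero = \<zero>\<^bsub>R\<^esub>, add = add R,
     smult = mult R\<rparr>"

definition submodule_generated ::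
    "('a, 'b) ring_scheme \<Rightarrow> ('a, 'c, 'd) module_scheme \<Rightarrow> 'c set \<Rightarrow> 'c set" where
  "submodule_generated R M S = \<Inter>{N. submodule N R M \<and> S \<subseteq> N}"

definition fg_module :: "('a, 'b) ring_scheme \<Rightarrow> ('a, 'c, 'd) module_scheme \<Rightarrow> bool" where
  "fg_module R M \<longleftrightarrow> Module.module R M \<and>
     (\<exists>S. finite S \<and> S \<subseteq> carrier M \<and> submodule_generated R M S = carrier M)"

definition ideal_smult_module ::
    "('a, 'b) ring_scheme \<Rightarrow> 'a set \<Rightarrow> ('a, 'c, 'd) module_scheme \<Rightarrow> 'c set" where
  "ideal_smult_module R J M = submodule_generated R M {a \<odot>\<^bsub>M\<^esub> x | a x. a \<in> J \<and> x \<in> carrier M}"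

definition frobenius_power :: "('a, 'b) ring_scheme \<Rightarrow> 'a set \<Rightarrow> nat \<Rightarrow> 'a set" where
  "frobenius_power R I q = Idl\<^bsub>R\<^esub> ((\<lambda>x. x [^]\<^bsub>R\<^esub> q) ` I)"


section \<open>Length and Krull dimension\<close>

definition module_length ::
    "('a, 'b) ring_scheme \<Rightarrow> ('a, 'c, 'd) module_scheme \<Rightarrow> enat" where
  "module_length R M = Sup {enat n | n. \<exists>C :: nat \<Rightarrow> 'c set.
     (\<forall>i\<le>n. submodule (C i) R M) \<and> (\<forall>i<n. C i \<subset> C (Suc i))}"

definition finite_colength :: "('a, 'b) ring_scheme \<Rightarrow> 'a set \<Rightarrow> bool" where
  "finite_colength R I \<longleftrightarrow> module_length R (quotient_module (regular_module R) I) < \<infinity>"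

definition krull_dim :: "('a, 'b) ring_scheme \<Rightarrow> enat" where
  "krull_dim R = Sup {enat n | n. \<exists>P :: nat \<Rightarrow> 'a set.
     (\<forall>i\<le>n. primeideal (P i) R) \<and> (\<forall>i<n. P i \<subset> P (Suc i))}"

definition annihilator ::
    "('a, 'b) ring_scheme \<Rightarrow> ('a, 'c, 'd) module_scheme \<Rightarrow> 'a set" where
  "annihilator R M = {a \<in> carrier R. \<forall>x\<in>carrier M. a \<odot>\<^bsub>M\<^esub> x = \<zero>\<^bsub>M\<^esub>}"

text \<open>The zero module gets dimension \<open>0\<close>, as \<open>Sup {} = 0\<close> in \<^typ>\<open>enat\<close>.\<close>
definition module_dim :: "('a, 'b) ring_scheme \<Rightarrow> ('a, 'c, 'd) module_scheme \<Rightarrow> enat" where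
  "module_dim R M = krull_dim (R Quot annihilator R M)"


section \<open>Gradings\<close>

definition internal_direct_sum :: "('a, 'b) ring_scheme \<Rightarrow> ('i \<Rightarrow> 'a set) \<Rightarrow> bool" where
  "internal_direct_sum G A \<longleftrightarrow>
     (\<forall>i. additive_subgroup (A i) G) \<and>
     (\<forall>x\<in>carrier G. \<exists>!f. (\<forall>i. f i \<in> A i) \<and> finite {i. f i \<noteq> \<zero>\<^bsub>G\<^esub>} \<and>
        x = finsum G f {i. f i \<noteq> \<zero>\<^bsub>G\<^esub>})"

text \<open>
  An \<open>\<nat>\<close>-graded commutative ring whose degree zero piece is the field \<open>k\<close> (a subset of the
  carrier), finitely generated as a \<open>k\<close>-algebra.
\<close>
locale fg_graded_algebra = cring R for R (structure) +
  fixes k :: "'a set" and Rg :: "nat \<Rightarrow> 'a set"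
  assumes field_k: "subfield k R"
    and degree_zero: "Rg 0 = k"
    and ring_decomposition: "internal_direct_sum R Rg"
    and graded_mult: "\<lbrakk>a \<in> Rg i; b \<in> Rg j\<rbrakk> \<Longrightarrow> a \<otimes> b \<in> Rg (i + j)"
    and finitely_generated: "\<exists>S. finite S \<and> S \<subseteq> carrier R \<and> generate_ring R (k \<union> S) = carrier R"

definition homogeneous_ideal ::
    "('a, 'b) ring_scheme \<Rightarrow> (nat \<Rightarrow> 'a set) \<Rightarrow> 'a set \<Rightarrow> bool" where
  "homogeneous_ideal R Rg I \<longleftrightarrow> ideal I R \<and> I = Idl\<^bsub>R\<^esub> (I \<inter> (\<Union>i. Rg i))"

definition graded_module ::
    "('a, 'b) ring_scheme \<Rightarrow> (nat \<Rightarrow> 'a set) \<Rightarrow> ('a, 'c, 'd) module_scheme \<Rightarrow> (int \<Rightarrow> 'c set) \<Rightarrow> bool"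
  where
  "graded_module R Rg M Mg \<longleftrightarrow> Module.module R M \<and> internal_direct_sum M Mg \<and>
     (\<forall>i j. \<forall>a\<in>Rg i. \<forall>x\<in>Mg j. a \<odot>\<^bsub>M\<^esub> x \<in> Mg (int i + j))"

text \<open>
  The degree \<open>j\<close> piece of the graded module \<open>M / N\<close>, for a homogeneous submodule \<open>N\<close>, is the
  image of \<open>M\<^sub>j\<close>.
\<close>
definition quotient_piece ::
    "('a, 'b, 'c) module_scheme \<Rightarrow> (int \<Rightarrow> 'b set) \<Rightarrow> 'b set \<Rightarrow> int \<Rightarrow> ('a, 'b set) module" where
  "quotient_piece M Mg N j =
     (quotient_module M N)\<lparr>carrier := (\<lambda>x. N +>\<^bsub>M\<^esub> x) ` Mg j\<rparr>"


section \<open>The normalised Hilbert series along the Frobenius powers\<close>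

text \<open>
  In the intended situation the Krull dimension and all lengths are finite, so that
  \<^const>\<open>the_enat\<close> loses nothing, and only finitely many summands are nonzero.
\<close>
definition frobenius_poincare_term ::
    "('a, 'b) ring_scheme \<Rightarrow> 'a set \<Rightarrow> nat \<Rightarrow> 'a set \<Rightarrow>
     ('a, 'c, 'd) module_scheme \<Rightarrow> (int \<Rightarrow> 'c set) \<Rightarrow> nat \<Rightarrow> complex \<Rightarrow> complex" where
  "frobenius_poincare_term R k p I M Mg n y =
     (1 / of_nat (p ^ n)) ^ the_enat (module_dim R M) *
     (\<Sum>\<^sub>\<infinity>j\<in>(UNIV :: int set).
        of_nat (the_enat (module_length (R\<lparr>carrier := k\<rparr>)
          (quotient_piece M Mg (ideal_smult_module R (frobenius_power R I (p ^ n)) M) j))) *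
        exp (- \<i> * y * of_int j / of_nat (p ^ n)))"

end

theory Submission
  imports Defs "HOL-Library.Multiset_Order" "HOL-Complex_Analysis.Complex_Analysis"
begin

text \<open>
  Why the theorem holds. Present R as a quotient of a polynomial ring S over k with positively
  weighted variables and M as a graded quotient V/U of a free S-module, and write q for \<open>p ^ n\<close>. Then
  the degree pieces of \<open>M / I\<^sup>[\<^sup>q\<^sup>] M\<close> are those of V modulo \<open>U + I\<^sup>[\<^sup>q\<^sup>] V\<close> up to a shift of the degree.
  They vanish above a fixed multiple of q, which makes the functions \<open>F\<^sub>n\<close> locally bounded as soon as
  their values at the single point \<open>- \<i>\<close> are bounded. By Montel's theorem and the identity theorem it is
  then enough to prove convergence at the points \<open>y = - \<i> \<tau>\<close> with \<open>\<tau> > 0\<close>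
  (\<open>locally_uniform_limit_from_ray\<close>, \<open>Fn_bounded\<close>).

  At such a point \<open>F\<^sub>n\<close> is, up to a factor tending to 1, the Hilbert series of \<open>V / (U + I\<^sup>[\<^sup>q\<^sup>] V)\<close> at
  \<open>t\<^sub>n = exp (- \<tau> / q)\<close> divided by \<open>q ^ D\<close>, where D is the dimension of M. As \<open>q (1 - t\<^sub>n)\<close> tends to
  \<open>\<tau>\<close>, one may normalise by \<open>(1 - t\<^sub>n) ^ D\<close> instead. These points fit together with Frobenius, because
  \<open>t\<^sub>n\<close> to the power p is \<open>t\<^sub>n\<^sub>-\<^sub>1\<close>: since S is free over the subalgebra generated by the p-th powers
  of the variables, the Hilbert series of \<open>S / J\<^sup>[\<^sup>Q\<^sup>]\<close> at t is an explicit factor times that of S/J at \<open>t ^ Q\<close> (\<open>Hs_frobI\<close>).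

  For a homogeneous prime P of dimension D, filter \<open>S / P\<^sup>[\<^sup>p\<^sup>]\<close> by quotients S/Q with Q a homogeneous
  prime. The factor S/P occurs at most \<open>p ^ s / p ^ D\<close> times (\<open>multiplicity_bound\<close>), all other factors
  have smaller dimension and contribute only \<open>O(1 - t)\<close>. So the normalised series of \<open>S / (P + I\<^sup>[\<^sup>q\<^sup>])\<close>
  at \<open>t\<^sub>n\<close> is bounded and increases in n up to a summable error, hence it converges
  (\<open>prime_convergent\<close>). For V/U a prime filtration bounds the normalised series from above by a
  combination of those of the top-dimensional primes. For a lower bound, let N be the intersection of
  the primes of the filtration: \<open>N\<^sup>[\<^sup>Q\<^sup>] V\<close> lies in U for some Q, the series of \<open>V / N\<^sup>[\<^sup>Q\<^sup>] V\<close> is known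
  from freeness, and one subtracts the contribution of a filtration of \<open>U / N\<^sup>[\<^sup>Q\<^sup>] V\<close>. The two bounds
  have the same limit, because the multiplicities in both filtrations together are bounded by the
  expected number (\<open>module_convergent\<close>).

  Finally, the dimension that governs the poles of these Hilbert series has to be the Krull dimension
  of \<open>R / Ann M\<close>. A homogeneous prime with a pole of order d is the start of a chain of d + 1
  homogeneous primes (\<open>hprime_growth\<close>), and chains of primes in S have length at most the number of
  variables (\<open>sprime_chain_bound\<close>), so that the Krull dimension is finite and bounds d
  (\<open>prime_dichotomy\<close>).
\<close>

section \<open>Lengths of chains\<close>

text \<open>
  Module lengths and Krull dimensions are both suprema of lengths of strict chains of this kind, so they
  can be compared by mapping chains to chains.
\<close>

definition chain_len :: "('c set \<Rightarrow> bool) \<Rightarrow> enat" where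
  "chain_len P = Sup {enat n | n. \<exists>C :: nat \<Rightarrow> 'c set. (\<forall>i\<le>n. P (C i)) \<and> (\<forall>i<n. C i \<subset> C (Suc i))}"

lemma chain_len_ge:
  assumes "\<And>i. i \<le> n \<Longrightarrow> P (C i)" "\<And>i. i < n \<Longrightarrow> C i \<subset> C (Suc i)"
  shows "enat n \<le> chain_len P"
  unfolding chain_len_def using assms by (intro Sup_upper) blast

lemma chain_len_le:
  assumes "\<And>n C. \<lbrakk>\<And>i. i \<le> n \<Longrightarrow> P (C i); \<And>i. i < n \<Longrightarrow> C i \<subset> C (Suc i)\<rbrakk> \<Longrightarrow> enat n \<le> b"
  shows "chain_len P \<le> b"
  unfolding chain_len_def by (rule Sup_least) (use assms in blast)

lemma chain_len_map:
  assumes "\<And>X. P X \<Longrightarrow> P' (g X)" "\<And>X Y. \<lbrakk>P X; P Y; X \<subset> Y\<rbrakk> \<Longrightarrow> g X \<subset> g Y"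
  shows "chain_len P \<le> chain_len P'"
proof (rule chain_len_le)
  fix n and C :: "nat \<Rightarrow> 'a set"
  assume C: "\<And>i. i \<le> n \<Longrightarrow> P (C i)" "\<And>i. i < n \<Longrightarrow> C i \<subset> C (Suc i)"
  show "enat n \<le> chain_len P'"
    by (rule chain_len_ge[where C = "\<lambda>i. g (C i)"]) (use C assms in auto)
qed

lemma chain_len_obtain:
  assumes "enat n \<le> chain_len P" "P X"
  obtains C where "\<And>i. i \<le> n \<Longrightarrow> P (C i)" "\<And>i. i < n \<Longrightarrow> C i \<subset> C (Suc i)"
proof (cases "\<exists>C. (\<forall>i\<le>n. P (C i)) \<and> (\<forall>i<n. C i \<subset> C (Suc i))")
  case False
  have "n \<noteq> 0"
    using False assms(2) by (auto dest: spec[of _ "\<lambda>_. X"])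
  have "chain_len P \<le> enat (n - 1)"
  proof (rule chain_len_le)
    fix m and C :: "nat \<Rightarrow> 'a set"
    assume C: "\<And>i. i \<le> m \<Longrightarrow> P (C i)" "\<And>i. i < m \<Longrightarrow> C i \<subset> C (Suc i)"
    have "\<not> n \<le> m"
      using False C by (metis le_trans less_le_trans)
    then show "enat m \<le> enat (n - 1)" by simp
  qed
  with assms(1) have "enat n \<le> enat (n - 1)" by (rule order_trans)
  with \<open>n \<noteq> 0\<close> show ?thesis by simp
qed (use that in blast)

lemma enat_add_leI_aux: "(\<And>m. enat m \<le> c) \<Longrightarrow> x \<le> c"
proof (cases c)
  case (enat k)
  assume "\<And>m. enat m \<le> c"
  from this[of "Suc k"] show ?thesis using enat by simp
qed simp

lemma enat_add_leI:
  assumes "\<And>m n. \<lbrakk>enat m \<le> a; enat n \<le> b\<rbrakk> \<Longrightarrow> enat (m + n) \<le> c"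
  shows "a + b \<le> c"
proof (cases a; cases b)
  fix m n assume "a = enat m" "b = enat n" then show ?thesis using assms[of m n] by simp
next
  fix n assume "a = \<infinity>" "b = enat n"
  then have "enat m \<le> c" for m using assms[of m 0] by (simp flip: zero_enat_def)
  then show ?thesis by (rule enat_add_leI_aux)
next
  fix n assume "b = \<infinity>" "a = enat n"
  then have "enat m \<le> c" for m using assms[of 0 m] by (simp flip: zero_enat_def)
  then show ?thesis by (rule enat_add_leI_aux)
next
  assume "b = \<infinity>" "a = \<infinity>"
  then have "enat m \<le> c" for m using assms[of 0 m] by (simp flip: zero_enat_def)
  then show ?thesis by (rule enat_add_leI_aux)
qed

text \<open>
  The lattice of subspaces of a vector space enters the theory of lengths only through intersections, sums
  and the modular law, stated here in the form in which chains use it.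
\<close>

locale modular_sets =
  fixes sub :: "'c set \<Rightarrow> bool" and jn :: "'c set \<Rightarrow> 'c set \<Rightarrow> 'c set"
  assumes sub_Int: "\<lbrakk>sub X; sub Y\<rbrakk> \<Longrightarrow> sub (X \<inter> Y)"
    and sub_jn: "\<lbrakk>sub X; sub Y\<rbrakk> \<Longrightarrow> sub (jn X Y)"
    and jn_upper1: "\<lbrakk>sub X; sub Y\<rbrakk> \<Longrightarrow> X \<subseteq> jn X Y"
    and jn_upper2: "\<lbrakk>sub X; sub Y\<rbrakk> \<Longrightarrow> Y \<subseteq> jn X Y"
    and jn_least: "\<lbrakk>sub X; sub Y; sub Z; X \<subseteq> Z; Y \<subseteq> Z\<rbrakk> \<Longrightarrow> jn X Y \<subseteq> Z"
    and modular: "\<lbrakk>sub X; sub Y; sub Z; X \<subseteq> Y; Y \<inter> Z \<subseteq> X; Y \<subseteq> jn X Z\<rbrakk> \<Longrightarrow> Y \<subseteq> X"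
begin

definition len :: "'c set \<Rightarrow> 'c set \<Rightarrow> enat" where
  "len U W = chain_len (\<lambda>X. sub X \<and> U \<subseteq> X \<and> X \<subseteq> W)"

lemma len_mono:
  assumes "U' \<subseteq> U" "W \<subseteq> W'"
  shows "len U W \<le> len U' W'"
  unfolding len_def by (rule chain_len_map[where g = "\<lambda>X. X"]) (use assms in auto)

lemma len_superadd:
  assumes "sub U" "sub V" "sub W" "U \<subseteq> V" "V \<subseteq> W"
  shows "len U V + len V W \<le> len U W"
proof (rule enat_add_leI)
  fix m n assume m: "enat m \<le> len U V" and n: "enat n \<le> len V W"
  obtain C where C: "\<And>i. i \<le> m \<Longrightarrow> sub (C i) \<and> U \<subseteq> C i \<and> C i \<subseteq> V" "\<And>i. i < m \<Longrightarrow> C i \<subset> C (Suc i)"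
    using chain_len_obtain[OF m[unfolded len_def], of U] assms by auto
  obtain D where D: "\<And>i. i \<le> n \<Longrightarrow> sub (D i) \<and> V \<subseteq> D i \<and> D i \<subseteq> W" "\<And>i. i < n \<Longrightarrow> D i \<subset> D (Suc i)"
    using chain_len_obtain[OF n[unfolded len_def], of V] assms by auto
  define E where "E i = (if i < m then C i else if i = m then (if n = 0 then C m else D 0) else D (i - m))" for i
  show "enat (m + n) \<le> len U W" unfolding len_def
  proof (rule chain_len_ge[where C = E])
    fix i assume "i \<le> m + n"
    then consider "i < m" | "i = m" | "i > m" "i - m \<le> n" by linarith
    then show "sub (E i) \<and> U \<subseteq> E i \<and> E i \<subseteq> W"
    proof cases
      case 1 then show ?thesis using C(1)[of i] assms by (simp add: E_def) blast
    next
      case 2 then show ?thesis using C(1)[of m] D(1)[of 0] assms by (simp add: E_def) blast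
    next
      case 3 then show ?thesis using D(1)[of "i - m"] assms by (simp add: E_def) blast
    qed
  next
    fix i assume i: "i < m + n"
    consider "Suc i < m" | "Suc i = m" | "i \<ge> m" by linarith
    then show "E i \<subset> E (Suc i)"
    proof cases
      case 1 then show ?thesis using C(2)[of i] by (simp add: E_def)
    next
      case 2 then show ?thesis using C(2)[of i] C(1)[of m] D(1)[of 0] by (auto simp: E_def)
    next
      case 3
      then have "Suc i - m = Suc (i - m)" "i - m < n" using i by auto
      then show ?thesis using 3 D(2)[of "i - m"] by (cases "i = m") (auto simp: E_def)
    qed
  qed
qed

lemma len_ge_1:
  assumes "sub U" "sub W" "U \<subset> W"
  shows "1 \<le> len U W"
  unfolding len_def one_enat_def
  by (rule chain_len_ge[where C = "\<lambda>i. if i = 0 then U else W"]) (use assms in auto)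

lemma len_self [simp]: "len U U = 0"
proof -
  have "len U U \<le> enat 0" unfolding len_def
  proof (rule chain_len_le)
    fix n and C :: "nat \<Rightarrow> 'c set"
    assume C: "\<And>i. i \<le> n \<Longrightarrow> sub (C i) \<and> U \<subseteq> C i \<and> C i \<subseteq> U" "\<And>i. i < n \<Longrightarrow> C i \<subset> C (Suc i)"
    show "enat n \<le> enat 0"
      using C(1)[of 0] C(1)[of 1] C(2)[of 0] by (cases n) auto
  qed
  then show ?thesis by (metis le_zero_eq zero_enat_def)
qed

text \<open>
  Intersect the members of a chain with V and add V to them. By the modular law a strict inclusion stays
  strict under at least one of the two operations, so the chain is not longer than the two lengths together.
\<close>

lemma len_add:
  assumes "sub U" "sub V" "sub W" "U \<subseteq> V" "V \<subseteq> W"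
  shows "len U W = len U V + len V W"
proof (rule antisym)
  show "len U W \<le> len U V + len V W"
    unfolding len_def[of U W]
  proof (rule chain_len_le)
    fix n and C :: "nat \<Rightarrow> 'c set"
    assume C: "\<And>i. i \<le> n \<Longrightarrow> sub (C i) \<and> U \<subseteq> C i \<and> C i \<subseteq> W" "\<And>i. i < n \<Longrightarrow> C i \<subset> C (Suc i)"
    have "i \<le> n \<Longrightarrow> enat i \<le> len U (C i \<inter> V) + len V (jn (C i) V)" for i
    proof (induction i)
      case 0 then show ?case by (simp flip: zero_enat_def)
    next
      case (Suc i)
      let ?X = "C i" and ?Y = "C (Suc i)"
      have s: "sub ?X" "sub ?Y" "U \<subseteq> ?X" "U \<subseteq> ?Y" "?X \<subset> ?Y" using C Suc.prems by auto
      have si: "sub (?X \<inter> V)" "sub (?Y \<inter> V)" "sub (jn ?X V)" "sub (jn ?Y V)"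
        using s assms sub_Int sub_jn by auto
      have jj: "jn ?X V \<subseteq> jn ?Y V"
        using jn_least[OF s(1) assms(2) si(4)] jn_upper1[OF s(2) assms(2)] jn_upper2[OF s(2) assms(2)] s by auto
      have m1: "len U (?X \<inter> V) \<le> len U (?Y \<inter> V)" and m2: "len V (jn ?X V) \<le> len V (jn ?Y V)"
        using s(5) jj by (auto intro!: len_mono)
      have "\<not> (?Y \<inter> V \<subseteq> ?X \<inter> V \<and> jn ?Y V \<subseteq> jn ?X V)"
        using modular[OF s(1,2) assms(2)] s jn_upper1[OF s(2) assms(2)] by blast
      then have "?X \<inter> V \<subset> ?Y \<inter> V \<or> jn ?X V \<subset> jn ?Y V" using s jj by auto
      then have "len U (?X \<inter> V) + len V (jn ?X V) + 1 \<le> len U (?Y \<inter> V) + len V (jn ?Y V)"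
      proof
        assume a: "?X \<inter> V \<subset> ?Y \<inter> V"
        have "len U (?X \<inter> V) + 1 \<le> len U (?Y \<inter> V)"
          using order_trans[OF add_left_mono[OF len_ge_1[OF si(1,2) a]] len_superadd[OF assms(1) si(1,2)]]
            a assms s by auto
        from add_mono[OF this m2] show ?thesis by (simp add: ac_simps)
      next
        assume a: "jn ?X V \<subset> jn ?Y V"
        have "len V (jn ?X V) + 1 \<le> len V (jn ?Y V)"
          using order_trans[OF add_left_mono[OF len_ge_1[OF si(3,4) a]] len_superadd[OF assms(2) si(3,4)]]
            a jn_upper2[OF s(1) assms(2)] by auto
        from add_mono[OF m1 this] show ?thesis by (simp add: ac_simps)
      qed
      moreover have "enat (Suc i) \<le> len U (?X \<inter> V) + len V (jn ?X V) + 1"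
        using add_right_mono[OF Suc.IH[OF Suc_leD[OF Suc.prems]], of 1]
        by (simp add: one_enat_def)
      ultimately show ?case by (rule order_trans[rotated])
    qed
    from this[of n] have "enat n \<le> len U (C n \<inter> V) + len V (jn (C n) V)" by simp
    also have "\<dots> \<le> len U V + len V W"
    proof (rule add_mono)
      show "len U (C n \<inter> V) \<le> len U V" by (rule len_mono) auto
      show "len V (jn (C n) V) \<le> len V W"
        using jn_least[of "C n" V W] C(1)[of n] assms by (intro len_mono) auto
    qed
    finally show "enat n \<le> len U V + len V W" .
  qed
qed (rule len_superadd[OF assms])

lemma len_Int_jn:
  assumes "sub X" "sub Y"
  shows "len (X \<inter> Y) X = len Y (jn X Y)"
proof -
  have i: "sub (X \<inter> Y)" "sub (jn X Y)" using assms sub_Int sub_jn by auto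
  have up: "X \<subseteq> jn X Y" "Y \<subseteq> jn X Y" using jn_upper1 jn_upper2 assms by auto
  have "len (X \<inter> Y) X \<le> len Y (jn X Y)" unfolding len_def
  proof (rule chain_len_map[where g = "\<lambda>Z. jn Z Y"], goal_cases)
    case (1 Z) then show ?case
      using sub_jn[of Z Y] jn_upper2[of Z Y] jn_least[of Z Y "jn X Y"] i up assms by blast
  next
    case (2 Z Z')
    have a: "jn Z Y \<subseteq> jn Z' Y"
      using 2 jn_least[of Z Y "jn Z' Y"] sub_jn jn_upper1[of Z' Y] jn_upper2[of Z' Y] assms by auto
    have "\<not> jn Z' Y \<subseteq> jn Z Y"
    proof
      assume "jn Z' Y \<subseteq> jn Z Y"
      then have "Z' \<subseteq> Z" using 2 by (intro modular[of Z Z' Y]) (use jn_upper1[of Z' Y] assms in blast)+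
      then show False using 2 by auto
    qed
    with a show ?case by auto
  qed
  moreover have "len Y (jn X Y) \<le> len (X \<inter> Y) X" unfolding len_def
  proof (rule chain_len_map[where g = "\<lambda>Z. Z \<inter> X"], goal_cases)
    case (1 Z) then show ?case using assms sub_Int by auto
  next
    case (2 Z Z')
    have "\<not> Z' \<inter> X \<subseteq> Z \<inter> X"
    proof
      assume a: "Z' \<inter> X \<subseteq> Z \<inter> X"
      have up: "Z \<subseteq> jn Z X" "X \<subseteq> jn Z X" "sub (jn Z X)"
        using 2 assms jn_upper1[of Z X] jn_upper2[of Z X] sub_jn by auto
      have "jn X Y \<subseteq> jn Z X"
        by (rule jn_least) (use assms 2 up in blast)+
      then have "Z' \<subseteq> jn Z X" using 2 by blast
      then have "Z' \<subseteq> Z" by (intro modular[of Z Z' X]) (use 2 a assms in blast)+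
      then show False using 2 by auto
    qed
    with 2 show ?case by auto
  qed
  ultimately show ?thesis by (rule antisym)
qed

end

section \<open>Polynomial rings\<close>

text \<open>
  A monomial is the multiset of its variables, so that divisibility is inclusion. There are infinitely many
  variables, which leaves room for the ring of the presentation and for the basis of a free module over it.
\<close>

definition mpoly_ring :: "('a, 'b) ring_scheme \<Rightarrow> (nat multiset \<Rightarrow> 'a) ring" where
  "mpoly_ring K = \<lparr>carrier = {f. (\<forall>m. f m \<in> carrier K) \<and> finite {m. f m \<noteq> \<zero>\<^bsub>K\<^esub>}},
     mult = (\<lambda>f g m. \<Oplus>\<^bsub>K\<^esub>a\<in>{a. a \<subseteq># m}. f a \<otimes>\<^bsub>K\<^esub> g (m - a)),
     one = (\<lambda>m. if m = {#} then \<one>\<^bsub>K\<^esub> else \<zero>\<^bsub>K\<^esub>),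
     zero = (\<lambda>m. \<zero>\<^bsub>K\<^esub>), add = (\<lambda>f g m. f m \<oplus>\<^bsub>K\<^esub> g m)\<rparr>"

definition monom :: "('a, 'b) ring_scheme \<Rightarrow> 'a \<Rightarrow> nat multiset \<Rightarrow> nat multiset \<Rightarrow> 'a" where
  "monom K c m = (\<lambda>m'. if m' = m then c else \<zero>\<^bsub>K\<^esub>)"

lemma finite_submultisets: "finite {a. a \<subseteq># (m :: 'b multiset)}"
proof (induction m)
  case (add x m)
  have "{a. a \<subseteq># add_mset x m} \<subseteq> {a. a \<subseteq># m} \<union> add_mset x ` {a. a \<subseteq># m}"
  proof
    fix a assume "a \<in> {a. a \<subseteq># add_mset x m}"
    then have a: "a \<subseteq># add_mset x m" by simp
    show "a \<in> {a. a \<subseteq># m} \<union> add_mset x ` {a. a \<subseteq># m}"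
    proof (cases "x \<in># a")
      case True
      then obtain b where "a = add_mset x b" by (metis insert_DiffM)
      with a show ?thesis by auto
    next
      case False
      then have "count a y \<le> count m y" for y
        using mset_subset_eq_count[OF a, of y] by (cases "y = x") (auto simp: not_in_iff)
      then show ?thesis by (auto simp: subseteq_mset_def)
    qed
  qed
  then show ?case using add finite_subset by auto
qed auto

context abelian_monoid begin

lemma finsum_Sigma_eq:
  assumes "finite A" "\<And>a. a \<in> A \<Longrightarrow> finite (B a)" "\<And>a b. \<lbrakk>a \<in> A; b \<in> B a\<rbrakk> \<Longrightarrow> g (a, b) \<in> carrier G"
  shows "(\<Oplus>a\<in>A. \<Oplus>b\<in>B a. g (a, b)) = (\<Oplus>z\<in>Sigma A B. g z)"
  using assms
proof (induction A rule: finite_induct)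
  case (insert x F)
  have e: "Sigma (insert x F) B = Pair x ` B x \<union> Sigma F B" by auto
  have "(\<Oplus>z\<in>Sigma (insert x F) B. g z) = (\<Oplus>z\<in>Pair x ` B x. g z) \<oplus> (\<Oplus>z\<in>Sigma F B. g z)"
    unfolding e using insert by (intro finsum_Un_disjoint) auto
  also have "(\<Oplus>z\<in>Pair x ` B x. g z) = (\<Oplus>b\<in>B x. g (x, b))"
    using insert by (intro finsum_reindex) (auto simp: inj_on_def)
  finally show ?case using insert by (subst finsum_insert) auto
qed simp

end

context cring begin

abbreviation "PA \<equiv> mpoly_ring R"

lemma PA_simps:
  "f \<in> carrier PA \<longleftrightarrow> (\<forall>m. f m \<in> carrier R) \<and> finite {m. f m \<noteq> \<zero>}"
  "(f \<oplus>\<^bsub>PA\<^esub> g) m = f m \<oplus> g m"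
  "\<zero>\<^bsub>PA\<^esub> m = \<zero>" "\<one>\<^bsub>PA\<^esub> = monom R \<one> {#}"
  by (auto simp: mpoly_ring_def monom_def)

lemma PA_mult: "(f \<otimes>\<^bsub>PA\<^esub> g) m = (\<Oplus>a\<in>{a. a \<subseteq># m}. f a \<otimes> g (m - a))"
  by (simp add: mpoly_ring_def)

lemma PA_coeff [simp]: "f \<in> carrier PA \<Longrightarrow> f m \<in> carrier R"
  by (simp add: PA_simps)

lemma finsum_single:
  assumes "finite A" "i \<in> A" "f i \<in> carrier R" "\<And>j. \<lbrakk>j \<in> A; j \<noteq> i\<rbrakk> \<Longrightarrow> f j = \<zero>"
  shows "(\<Oplus>j\<in>A. f j) = f i"
proof -
  have c: "f j \<in> carrier R" if "j \<in> A" for j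
    using assms(3) assms(4)[OF that] by (cases "j = i") auto
  have "(\<Oplus>j\<in>A. f j) = (\<Oplus>j\<in>A. if i = j then f j else \<zero>)"
    by (rule finsum_cong') (use assms c in auto)
  also have "\<dots> = f i" using assms c by (intro finsum_singleton) auto
  finally show ?thesis .
qed

lemma monom_closed [simp]: "c \<in> carrier R \<Longrightarrow> monom R c m \<in> carrier PA"
  by (auto simp: PA_simps monom_def intro: finite_subset[of _ "{m}"])

lemma PA_mult_closed:
  assumes f: "f \<in> carrier PA" and g: "g \<in> carrier PA"
  shows "f \<otimes>\<^bsub>PA\<^esub> g \<in> carrier PA"
proof -
  have "{m. (f \<otimes>\<^bsub>PA\<^esub> g) m \<noteq> \<zero>} \<subseteq> (\<lambda>(a, b). a + b) ` ({m. f m \<noteq> \<zero>} \<times> {m. g m \<noteq> \<zero>})"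
  proof
    fix m assume m: "m \<in> {m. (f \<otimes>\<^bsub>PA\<^esub> g) m \<noteq> \<zero>}"
    have "\<exists>a. a \<subseteq># m \<and> f a \<otimes> g (m - a) \<noteq> \<zero>"
    proof (rule ccontr)
      assume "\<not> ?thesis"
      then have "(\<Oplus>a\<in>{a. a \<subseteq># m}. f a \<otimes> g (m - a)) = \<zero>"
        by (intro add.finprod_one_eqI) auto
      with m show False by (simp add: PA_mult)
    qed
    then obtain a where a: "a \<subseteq># m" "f a \<otimes> g (m - a) \<noteq> \<zero>" by blast
    then have "f a \<noteq> \<zero>" "g (m - a) \<noteq> \<zero>" using f g by auto
    moreover have "m = a + (m - a)" using a by simp
    ultimately show "m \<in> (\<lambda>(a, b). a + b) ` ({m. f m \<noteq> \<zero>} \<times> {m. g m \<noteq> \<zero>})" by force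
  qed
  moreover have "finite ((\<lambda>(a, b). a + b) ` ({m. f m \<noteq> \<zero>} \<times> {m. g m \<noteq> \<zero>}))"
    using f g by (simp add: PA_simps)
  ultimately have "finite {m. (f \<otimes>\<^bsub>PA\<^esub> g) m \<noteq> \<zero>}" by (rule finite_subset)
  moreover have "(f \<otimes>\<^bsub>PA\<^esub> g) m \<in> carrier R" for m
    using f g by (auto simp: PA_mult intro!: finsum_closed)
  ultimately show ?thesis by (simp add: PA_simps)
qed

lemma PA_mult_comm:
  assumes f: "f \<in> carrier PA" and g: "g \<in> carrier PA"
  shows "f \<otimes>\<^bsub>PA\<^esub> g = g \<otimes>\<^bsub>PA\<^esub> f"
proof
  fix m
  have dd: "m - (m - a) = a" if "a \<subseteq># m" for a :: "nat multiset"
    using that by (metis add_diff_cancel_right' subset_mset.add_diff_inverse)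
  have im: "(\<lambda>a. m - a) ` {a. a \<subseteq># m} = {a. a \<subseteq># m}"
  proof (intro equalityI subsetI)
    fix a assume "a \<in> {a. a \<subseteq># m}"
    then show "a \<in> (\<lambda>a. m - a) ` {a. a \<subseteq># m}"
      using dd[of a] by (intro image_eqI[of _ _ "m - a"]) auto
  qed auto
  have "(\<Oplus>a\<in>{a. a \<subseteq># m}. f a \<otimes> g (m - a)) = (\<Oplus>a\<in>(\<lambda>a. m - a) ` {a. a \<subseteq># m}. f a \<otimes> g (m - a))"
    by (simp only: im)
  also have "\<dots> = (\<Oplus>a\<in>{a. a \<subseteq># m}. f (m - a) \<otimes> g (m - (m - a)))"
  proof (intro finsum_reindex)
    show "inj_on ((-) m) {a. a \<subseteq># m}"
      by (rule inj_onI) (metis dd mem_Collect_eq)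
  qed (use f g in auto)
  also have "\<dots> = (\<Oplus>a\<in>{a. a \<subseteq># m}. g a \<otimes> f (m - a))"
    using f g by (intro finsum_cong') (auto simp: dd m_comm)
  finally show "(f \<otimes>\<^bsub>PA\<^esub> g) m = (g \<otimes>\<^bsub>PA\<^esub> f) m" by (simp add: PA_mult)
qed

lemma PA_mult_assoc:
  assumes f: "f \<in> carrier PA" and g: "g \<in> carrier PA" and h: "h \<in> carrier PA"
  shows "(f \<otimes>\<^bsub>PA\<^esub> g) \<otimes>\<^bsub>PA\<^esub> h = f \<otimes>\<^bsub>PA\<^esub> (g \<otimes>\<^bsub>PA\<^esub> h)"
proof
  fix m :: "nat multiset"
  note fs = finite_submultisets
  let ?T = "Sigma {a. a \<subseteq># m} (\<lambda>a. {c. c \<subseteq># m - a})"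
  have "((f \<otimes>\<^bsub>PA\<^esub> g) \<otimes>\<^bsub>PA\<^esub> h) m
      = (\<Oplus>a\<in>{a. a \<subseteq># m}. (\<Oplus>b\<in>{b. b \<subseteq># a}. f b \<otimes> g (a - b) \<otimes> h (m - a)))"
    unfolding PA_mult using f g h by (intro finsum_cong' finsum_ldistr fs) (auto simp: fs intro!: finsum_closed)
  also have "\<dots> = (\<Oplus>z\<in>Sigma {a. a \<subseteq># m} (\<lambda>a. {b. b \<subseteq># a}). f (snd z) \<otimes> g (fst z - snd z) \<otimes> h (m - fst z))"
    using f g h finsum_Sigma_eq[OF fs fs, of m _ "\<lambda>z. f (snd z) \<otimes> g (fst z - snd z) \<otimes> h (m - fst z)"] by simp
  also have "Sigma {a. a \<subseteq># m} (\<lambda>a. {b. b \<subseteq># a}) = (\<lambda>(b, c). (b + c, b)) ` ?T"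
  proof (intro equalityI subsetI)
    fix z assume "z \<in> Sigma {a. a \<subseteq># m} (\<lambda>a. {b. b \<subseteq># a})"
    then obtain a b where z: "z = (a, b)" "a \<subseteq># m" "b \<subseteq># a" by auto
    then have "a - b \<subseteq># m - b" "b \<subseteq># m"
      by (auto simp: subseteq_mset_def diff_le_mono intro: order_trans)
    then show "z \<in> (\<lambda>(b, c). (b + c, b)) ` ?T"
      using z by (intro image_eqI[of _ _ "(b, a - b)"]) auto
  next
    fix z assume "z \<in> (\<lambda>(b, c). (b + c, b)) ` ?T"
    then obtain b c where z: "z = (b + c, b)" "b \<subseteq># m" "c \<subseteq># m - b" by auto
    then have "b + c \<subseteq># m" by (metis subset_mset.add_diff_inverse subset_mset.add_left_mono)
    then show "z \<in> Sigma {a. a \<subseteq># m} (\<lambda>a. {b. b \<subseteq># a})" using z by auto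
  qed
  also have "(\<Oplus>z\<in>(\<lambda>(b, c). (b + c, b)) ` ?T. f (snd z) \<otimes> g (fst z - snd z) \<otimes> h (m - fst z))
      = (\<Oplus>z\<in>?T. f (fst z) \<otimes> (g (snd z) \<otimes> h (m - fst z - snd z)))"
  proof (subst finsum_reindex)
    show "inj_on (\<lambda>(b, c). (b + c, b)) ?T" by (auto simp: inj_on_def)
    show "(\<Oplus>z\<in>?T. f (snd (case z of (b, c) \<Rightarrow> (b + c, b))) \<otimes>
       g (fst (case z of (b, c) \<Rightarrow> (b + c, b)) - snd (case z of (b, c) \<Rightarrow> (b + c, b))) \<otimes>
       h (m - fst (case z of (b, c) \<Rightarrow> (b + c, b)))) = (\<Oplus>z\<in>?T. f (fst z) \<otimes> (g (snd z) \<otimes> h (m - fst z - snd z)))"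
      using f g h by (intro finsum_cong') (auto simp: m_assoc)
  qed (use f g h in auto)
  also have "\<dots> = (\<Oplus>a\<in>{a. a \<subseteq># m}. \<Oplus>c\<in>{c. c \<subseteq># m - a}. f a \<otimes> (g c \<otimes> h (m - a - c)))"
    using f g h finsum_Sigma_eq[OF fs fs, of m "\<lambda>a. m - a" "\<lambda>z. f (fst z) \<otimes> (g (snd z) \<otimes> h (m - fst z - snd z))"] by simp
  also have "\<dots> = (f \<otimes>\<^bsub>PA\<^esub> (g \<otimes>\<^bsub>PA\<^esub> h)) m"
    unfolding PA_mult using f g h
    by (intro finsum_cong' finsum_rdistr[symmetric] fs) (auto simp: fs intro!: finsum_closed)
  finally show "((f \<otimes>\<^bsub>PA\<^esub> g) \<otimes>\<^bsub>PA\<^esub> h) m = (f \<otimes>\<^bsub>PA\<^esub> (g \<otimes>\<^bsub>PA\<^esub> h)) m" .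
qed

lemma monom_mult:
  assumes c: "c \<in> carrier R" and f: "f \<in> carrier PA"
  shows "(monom R c a \<otimes>\<^bsub>PA\<^esub> f) m = (if a \<subseteq># m then c \<otimes> f (m - a) else \<zero>)"
proof (cases "a \<subseteq># m")
  case True
  have "(\<Oplus>b\<in>{b. b \<subseteq># m}. monom R c a b \<otimes> f (m - b)) = monom R c a a \<otimes> f (m - a)"
    using True c f by (intro finsum_single finite_submultisets) (auto simp: monom_def)
  then show ?thesis using True by (simp add: PA_mult monom_def)
next
  case False
  have "(\<Oplus>b\<in>{b. b \<subseteq># m}. monom R c a b \<otimes> f (m - b)) = \<zero>"
    using False c f by (intro add.finprod_one_eqI) (auto simp: monom_def)
  then show ?thesis using False by (simp add: PA_mult)
qed

lemma PA_add_closed: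
  assumes "f \<in> carrier PA" "g \<in> carrier PA"
  shows "f \<oplus>\<^bsub>PA\<^esub> g \<in> carrier PA"
proof -
  have "{m. f m \<oplus> g m \<noteq> \<zero>} \<subseteq> {m. f m \<noteq> \<zero>} \<union> {m. g m \<noteq> \<zero>}" using assms by (auto simp: PA_simps)
  then show ?thesis using assms by (auto simp: PA_simps intro: finite_subset)
qed

lemma PA_cring: "cring PA"
proof (rule cringI)
  show "abelian_group PA"
  proof (rule abelian_groupI)
    fix f assume f: "f \<in> carrier PA"
    have "(\<lambda>m. \<ominus> f m) \<in> carrier PA"
      using f by (auto simp: PA_simps intro: finite_subset[rotated])
    moreover have "(\<lambda>m. \<ominus> f m) \<oplus>\<^bsub>PA\<^esub> f = \<zero>\<^bsub>PA\<^esub>"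
      using f by (auto simp: PA_simps l_neg)
    ultimately show "\<exists>y\<in>carrier PA. y \<oplus>\<^bsub>PA\<^esub> f = \<zero>\<^bsub>PA\<^esub>" by blast
  next
    fix f g assume "f \<in> carrier PA" "g \<in> carrier PA"
    then show "f \<oplus>\<^bsub>PA\<^esub> g = g \<oplus>\<^bsub>PA\<^esub> f" by (auto simp: PA_simps a_comm)
  qed (blast intro: PA_add_closed | auto simp: PA_simps a_assoc)+
  show "comm_monoid PA"
  proof (rule comm_monoidI)
    show "\<one>\<^bsub>PA\<^esub> \<in> carrier PA" by (simp add: PA_simps(4))
    fix f assume "f \<in> carrier PA"
    then show "\<one>\<^bsub>PA\<^esub> \<otimes>\<^bsub>PA\<^esub> f = f" by (auto simp: PA_simps(4) monom_mult)
  qed (simp_all only: PA_mult_closed PA_mult_assoc, rule PA_mult_comm)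
  fix f g h assume fgh: "f \<in> carrier PA" "g \<in> carrier PA" "h \<in> carrier PA"
  show "(f \<oplus>\<^bsub>PA\<^esub> g) \<otimes>\<^bsub>PA\<^esub> h = f \<otimes>\<^bsub>PA\<^esub> h \<oplus>\<^bsub>PA\<^esub> g \<otimes>\<^bsub>PA\<^esub> h"
  proof
    fix m
    have "((f \<oplus>\<^bsub>PA\<^esub> g) \<otimes>\<^bsub>PA\<^esub> h) m = (\<Oplus>a\<in>{a. a \<subseteq># m}. f a \<otimes> h (m - a) \<oplus> g a \<otimes> h (m - a))"
      using fgh unfolding PA_mult by (intro finsum_cong') (auto simp: PA_simps(2) l_distr)
    also have "\<dots> = (\<Oplus>a\<in>{a. a \<subseteq># m}. f a \<otimes> h (m - a)) \<oplus> (\<Oplus>a\<in>{a. a \<subseteq># m}. g a \<otimes> h (m - a))"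
      using fgh by (intro finsum_addf) auto
    finally show "((f \<oplus>\<^bsub>PA\<^esub> g) \<otimes>\<^bsub>PA\<^esub> h) m = (f \<otimes>\<^bsub>PA\<^esub> h \<oplus>\<^bsub>PA\<^esub> g \<otimes>\<^bsub>PA\<^esub> h) m"
      by (simp add: PA_mult PA_simps(2))
  qed
qed

end

section \<open>Graded subspaces of a polynomial ring\<close>

text \<open>
  The variable i has degree \<open>w i\<close>. The variables below s generate the ring S of the presentation, the later
  ones serve as basis elements of free S-modules, which thus consist of polynomials too.
\<close>

locale graded_poly = field K for K (structure) +
  fixes w :: "nat \<Rightarrow> nat" and s :: nat
  assumes w_pos: "\<And>i. 1 \<le> w i"

sublocale graded_poly \<subseteq> A: cring "mpoly_ring K"
  by (rule PA_cring)

context graded_poly begin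

abbreviation pmul (infixl "\<boxtimes>" 70) where "f \<boxtimes> g \<equiv> f \<otimes>\<^bsub>PA\<^esub> g"
abbreviation padd (infixl "\<boxplus>" 65) where "f \<boxplus> g \<equiv> f \<oplus>\<^bsub>PA\<^esub> g"
abbreviation "cst c \<equiv> monom K c {#}"

lemma cst_mult: "\<lbrakk>c \<in> carrier K; f \<in> carrier PA\<rbrakk> \<Longrightarrow> (cst c \<boxtimes> f) m = c \<otimes> f m"
  by (simp add: monom_mult)

lemma monom_monom:
  "\<lbrakk>c \<in> carrier K; d \<in> carrier K\<rbrakk> \<Longrightarrow> monom K c a \<boxtimes> monom K d b = monom K (c \<otimes> d) (a + b)"
  by (rule ext) (auto simp: monom_mult, auto simp: monom_def subset_mset.add_diff_inverse)

lemma cst_monom: "\<lbrakk>c \<in> carrier K; d \<in> carrier K\<rbrakk> \<Longrightarrow> cst c \<boxtimes> monom K d b = monom K (c \<otimes> d) b"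
  using monom_monom[of c d "{#}" b] by simp

lemma PA_zero_fun: "\<zero>\<^bsub>PA\<^esub> = (\<lambda>m. \<zero>)" by (auto simp: PA_simps)

text \<open>
  The linear subspaces over the base field; they form the lattice in which lengths are measured.
\<close>

definition sub :: "(nat multiset \<Rightarrow> 'a) set \<Rightarrow> bool" where
  "sub U \<longleftrightarrow> U \<subseteq> carrier PA \<and> \<zero>\<^bsub>PA\<^esub> \<in> U \<and> (\<forall>f\<in>U. \<forall>g\<in>U. f \<boxplus> g \<in> U) \<and>
    (\<forall>c\<in>carrier K. \<forall>f\<in>U. cst c \<boxtimes> f \<in> U)"

lemma subD:
  assumes "sub U"
  shows "U \<subseteq> carrier PA" "\<zero>\<^bsub>PA\<^esub> \<in> U" "\<lbrakk>f \<in> U; g \<in> U\<rbrakk> \<Longrightarrow> f \<boxplus> g \<in> U"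
    "\<lbrakk>c \<in> carrier K; f \<in> U\<rbrakk> \<Longrightarrow> cst c \<boxtimes> f \<in> U" "f \<in> U \<Longrightarrow> f \<in> carrier PA"
  using assms by (auto simp: sub_def)

lemma sub_neg: assumes "sub U" "f \<in> U" shows "\<ominus>\<^bsub>PA\<^esub> f \<in> U"
proof -
  have f: "f \<in> carrier PA" using assms subD by auto
  have "cst (\<ominus> \<one>) \<boxtimes> f \<boxplus> f = \<zero>\<^bsub>PA\<^esub>"
    using f by (auto simp: PA_simps cst_mult l_minus l_neg)
  then have "\<ominus>\<^bsub>PA\<^esub> f = cst (\<ominus> \<one>) \<boxtimes> f"
    using f by (intro A.minus_equality) auto
  then show ?thesis using subD(4)[OF assms(1), of "\<ominus> \<one>" f] assms by simp
qed

lemma sub_diff: "\<lbrakk>sub U; f \<in> U; g \<in> U\<rbrakk> \<Longrightarrow> f \<ominus>\<^bsub>PA\<^esub> g \<in> U"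
  unfolding a_minus_def using subD(3) sub_neg by auto

lemma sub_add_cancel: "\<lbrakk>sub U; f \<boxplus> g \<in> U; f \<in> U; g \<in> carrier PA\<rbrakk> \<Longrightarrow> g \<in> U"
  using subD(3)[of U "\<ominus>\<^bsub>PA\<^esub> f" "f \<boxplus> g"] sub_neg[of U f] subD(5)[of U f] by (simp add: A.r_neg1)

definition sm where "sm U W = {u \<boxplus> v | u v. u \<in> U \<and> v \<in> W}"

lemma smE: "f \<in> sm X Y \<Longrightarrow> (\<And>u v. \<lbrakk>f = u \<boxplus> v; u \<in> X; v \<in> Y\<rbrakk> \<Longrightarrow> P) \<Longrightarrow> P"
  unfolding sm_def by blast

lemma smI: "\<lbrakk>u \<in> X; v \<in> Y\<rbrakk> \<Longrightarrow> u \<boxplus> v \<in> sm X Y"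
  unfolding sm_def by blast

lemma sub_Int: "\<lbrakk>sub X; sub Y\<rbrakk> \<Longrightarrow> sub (X \<inter> Y)"
  unfolding sub_def by blast

lemma sub_sm: assumes "sub X" "sub Y" shows "sub (sm X Y)"
  unfolding sub_def
proof (intro conjI ballI)
  show "sm X Y \<subseteq> carrier PA" using assms by (auto simp: sm_def dest: subD(5))
  show "\<zero>\<^bsub>PA\<^esub> \<in> sm X Y" using smI[OF subD(2)[OF assms(1)] subD(2)[OF assms(2)]] by simp
next
  fix f g assume "f \<in> sm X Y" "g \<in> sm X Y"
  then obtain u v u' v' where *: "f = u \<boxplus> v" "g = u' \<boxplus> v'" "u \<in> X" "u' \<in> X" "v \<in> Y" "v' \<in> Y" by (auto simp: sm_def)
  have "f \<boxplus> g = (u \<boxplus> u') \<boxplus> (v \<boxplus> v')"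
    using * assms[THEN subD(5)] by (simp add: A.a_ac)
  then show "f \<boxplus> g \<in> sm X Y" using * assms[THEN subD(3)] by (simp add: smI)
next
  fix c f assume c: "c \<in> carrier K" and "f \<in> sm X Y"
  then obtain u v where *: "f = u \<boxplus> v" "u \<in> X" "v \<in> Y" by (auto simp: sm_def)
  have "cst c \<boxtimes> f = cst c \<boxtimes> u \<boxplus> cst c \<boxtimes> v" using * c assms[THEN subD(5)] by (simp add: A.r_distr)
  then show "cst c \<boxtimes> f \<in> sm X Y" using * c assms[THEN subD(4)] by (simp add: smI A.r_distr)
qed

lemma sm_upper1: "\<lbrakk>sub X; sub Y\<rbrakk> \<Longrightarrow> X \<subseteq> sm X Y"
  using smI[OF _ subD(2)[of Y], of _ X] subD(5)[of X] by fastforce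

lemma sm_comm: "\<lbrakk>sub X; sub Y\<rbrakk> \<Longrightarrow> sm X Y = sm Y X"
  unfolding sm_def using subD(5)[of X] subD(5)[of Y] A.a_comm by blast

lemma sm_upper2: "\<lbrakk>sub X; sub Y\<rbrakk> \<Longrightarrow> Y \<subseteq> sm X Y"
  using sm_upper1 sm_comm by blast

lemma sm_least: "\<lbrakk>sub Z; X \<subseteq> Z; Y \<subseteq> Z\<rbrakk> \<Longrightarrow> sm X Y \<subseteq> Z"
  unfolding sm_def using subD(3) by blast

lemma sm_mono: "\<lbrakk>X \<subseteq> X'; Y \<subseteq> Y'\<rbrakk> \<Longrightarrow> sm X Y \<subseteq> sm X' Y'"
  unfolding sm_def by blast

end

sublocale graded_poly \<subseteq> L: modular_sets sub sm
proof
  fix X Y Z assume a: "sub X" "sub Y" "sub Z" "X \<subseteq> Y" "Y \<inter> Z \<subseteq> X" "Y \<subseteq> sm X Z"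
  show "Y \<subseteq> X"
  proof
    fix y assume y: "y \<in> Y"
    then obtain x z where xz: "y = x \<boxplus> z" "x \<in> X" "z \<in> Z" using a smE by blast
    have "z \<in> Y" using sub_add_cancel[OF a(2), of x z] y xz a subD(5) by auto
    then have "z \<in> X" using a xz by blast
    then show "y \<in> X" using xz subD(3)[OF a(1)] by simp
  qed
qed (fact sub_Int sub_sm sm_upper1 sm_upper2 | rule sm_least, assumption+)+

context graded_poly begin

definition Pol :: "nat multiset set \<Rightarrow> (nat multiset \<Rightarrow> 'a) set" where
  "Pol X = {f \<in> carrier PA. \<forall>m. f m \<noteq> \<zero> \<longrightarrow> m \<in> X}"

lemma Pol_carrier: "Pol X \<subseteq> carrier PA" by (auto simp: Pol_def)
lemma PolD: "f \<in> Pol X \<Longrightarrow> f \<in> carrier PA" by (auto simp: Pol_def)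

lemma sub_Pol: "sub (Pol X)"
  unfolding sub_def
proof (intro conjI ballI)
  fix f g assume fg: "f \<in> Pol X" "g \<in> Pol X"
  then show "f \<boxplus> g \<in> Pol X"
    unfolding Pol_def by (simp add: PA_simps(2)) (metis PA_coeff l_zero zero_closed)
next
  fix c f assume "c \<in> carrier K" "f \<in> Pol X"
  then have "f m = \<zero> \<Longrightarrow> (cst c \<boxtimes> f) m = \<zero>" "cst c \<boxtimes> f \<in> carrier PA" for m
    by (auto simp: cst_mult Pol_def)
  with \<open>f \<in> Pol X\<close> show "cst c \<boxtimes> f \<in> Pol X" unfolding Pol_def by blast
qed (auto simp: Pol_def PA_simps)

lemma Pol_Int: "Pol X \<inter> Pol Y = Pol (X \<inter> Y)" by (auto simp: Pol_def)
lemma Pol_mono: "X \<subseteq> Y \<Longrightarrow> Pol X \<subseteq> Pol Y" by (auto simp: Pol_def)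
lemma Pol_empty: "Pol {} = {\<zero>\<^bsub>PA\<^esub>}" by (auto simp: Pol_def PA_zero_fun PA_simps(1))
lemma Pol_UNIV: "Pol UNIV = carrier PA" by (auto simp: Pol_def)

lemma monom_Pol: "\<lbrakk>c \<in> carrier K; m \<in> X\<rbrakk> \<Longrightarrow> monom K c m \<in> Pol X"
  by (simp add: Pol_def) (simp add: monom_def)

definition restr where "restr X f = (\<lambda>m. if m \<in> X then f m else \<zero>)"

lemma Pol_coeff: "\<lbrakk>f \<in> Pol X; m \<notin> X\<rbrakk> \<Longrightarrow> f m = \<zero>"
  unfolding Pol_def by blast

lemma restr_apply: "restr X f m = (if m \<in> X then f m else \<zero>)"
  by (simp add: restr_def)

lemma restr_closed: "f \<in> carrier PA \<Longrightarrow> restr X f \<in> Pol X"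
  by (auto simp: Pol_def restr_def PA_simps(1) intro: finite_subset[rotated])

lemma restr_carrier [simp]: "f \<in> carrier PA \<Longrightarrow> restr X f \<in> carrier PA"
  using restr_closed Pol_carrier by blast

lemma restr_Pol: "f \<in> Pol Y \<Longrightarrow> restr X f \<in> Pol Y"
  by (auto simp: Pol_def restr_def PA_simps(1) intro: finite_subset[rotated])

lemma restr_id: "f \<in> Pol X \<Longrightarrow> restr X f = f"
  by (rule ext) (auto simp: restr_apply Pol_coeff)

lemma restr_add: "restr X (f \<boxplus> g) = restr X f \<boxplus> restr X g"
  by (auto simp: restr_def PA_simps)

lemma restr_Un: "\<lbrakk>f \<in> carrier PA; X \<inter> Y = {}\<rbrakk> \<Longrightarrow> restr (X \<union> Y) f = restr X f \<boxplus> restr Y f"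
  by (rule ext) (auto simp: restr_def PA_simps)

lemma restr_cst: "\<lbrakk>c \<in> carrier K; f \<in> carrier PA\<rbrakk> \<Longrightarrow> restr X (cst c \<boxtimes> f) = cst c \<boxtimes> restr X f"
  by (auto simp: fun_eq_iff cst_mult) (auto simp: restr_def cst_mult)

lemma restr_zero [simp]: "restr X \<zero>\<^bsub>PA\<^esub> = \<zero>\<^bsub>PA\<^esub>"
  by (rule ext) (simp add: restr_def PA_zero_fun)

lemma restr_single: "f \<in> carrier PA \<Longrightarrow> restr {m} f = monom K (f m) m"
  by (auto simp: restr_def monom_def)

lemma Pol_induct [consumes 1, case_names zero add]:
  assumes f: "f \<in> Pol X" and z: "P \<zero>\<^bsub>PA\<^esub>"
    and a: "\<And>f c m. \<lbrakk>f \<in> Pol X; c \<in> carrier K; m \<in> X; P f\<rbrakk> \<Longrightarrow> P (f \<boxplus> monom K c m)"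
  shows "P f"
proof -
  have fc: "f \<in> carrier PA" using f PolD by auto
  have "P (restr Y f)" if "finite Y" "Y \<subseteq> X" for Y
    using that
  proof (induction Y)
    case empty
    have "restr {} f = \<zero>\<^bsub>PA\<^esub>" by (auto simp: restr_def PA_zero_fun)
    then show ?case using z by simp
  next
    case (insert m Y)
    have "restr (insert m Y) f = restr Y f \<boxplus> monom K (f m) m"
      using restr_Un[OF fc, of Y "{m}"] insert restr_single[OF fc] by simp
    moreover have "P (restr Y f \<boxplus> monom K (f m) m)"
      using insert fc restr_Pol[OF f] by (intro a) auto
    ultimately show ?case by simp
  qed
  from this[of "{m. f m \<noteq> \<zero>}"] have "P (restr {m. f m \<noteq> \<zero>} f)"
    using f by (auto simp: Pol_def PA_simps(1))
  moreover have "restr {m. f m \<noteq> \<zero>} f = f" by (auto simp: restr_def)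
  ultimately show ?thesis by simp
qed

lemma monom_mult_Pol:
  assumes "c \<in> carrier K" "f \<in> Pol X" "\<And>m. m \<in> X \<Longrightarrow> a + m \<in> Y"
  shows "monom K c a \<boxtimes> f \<in> Pol Y"
proof -
  have "m \<in> Y" if "(monom K c a \<boxtimes> f) m \<noteq> \<zero>" for m
  proof -
    have "a \<subseteq># m" "f (m - a) \<noteq> \<zero>"
      using that assms(1) PolD[OF assms(2)] by (auto simp: monom_mult split: if_splits)
    then have "a + (m - a) \<in> Y" using assms(2) by (intro assms(3)) (simp add: Pol_def)
    then show ?thesis using \<open>a \<subseteq># m\<close> by simp
  qed
  moreover have "monom K c a \<boxtimes> f \<in> carrier PA" using assms PolD by simp
  ultimately show ?thesis unfolding Pol_def by blast
qed

lemma mult_Pol: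
  assumes "f \<in> Pol X" "g \<in> Pol Y" "\<And>a b. \<lbrakk>a \<in> X; b \<in> Y\<rbrakk> \<Longrightarrow> a + b \<in> Z"
  shows "f \<boxtimes> g \<in> Pol Z"
  using assms(1)
proof (induction rule: Pol_induct)
  case zero then show ?case using assms(2) PolD sub_Pol subD(2) by auto
next
  case (add f c m)
  then have "(f \<boxplus> monom K c m) \<boxtimes> g = f \<boxtimes> g \<boxplus> monom K c m \<boxtimes> g"
    using assms(2) PolD by (intro A.l_distr) auto
  then show ?case using add subD(3)[OF sub_Pol] monom_mult_Pol[OF _ assms(2), of c m Z] assms(3) by auto
qed

definition wt :: "nat multiset \<Rightarrow> nat" where "wt m = (\<Sum>i\<in>#m. w i)"

lemma wt_add [simp]: "wt (a + b) = wt a + wt b" by (simp add: wt_def)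
lemma wt_empty [simp]: "wt {#} = 0" by (simp add: wt_def)
lemma wt_diff: "a \<subseteq># m \<Longrightarrow> wt (m - a) = wt m - wt a"
  by (metis add_diff_cancel_left' subset_mset.add_diff_inverse wt_add)
lemma wt_le: "a \<subseteq># m \<Longrightarrow> wt a \<le> wt m"
  by (metis le_add1 subset_mset.add_diff_inverse wt_add)

lemma size_le_wt: "size m \<le> wt m"
proof (induction m)
  case (add x m) then show ?case using w_pos[of x] by (simp add: wt_def)
qed simp

lemma wt_eq_0: "wt m = 0 \<longleftrightarrow> m = {#}"
  using size_le_wt[of m] by auto

abbreviation "Dg j \<equiv> {m. wt m = j}"
abbreviation "Hm j \<equiv> Pol (Dg j)"
abbreviation "cmp j f \<equiv> restr (Dg j) f"

lemma cmp_Hm: "f \<in> Hm i \<Longrightarrow> cmp j f = (if i = j then f else \<zero>\<^bsub>PA\<^esub>)"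
  by (rule ext) (auto simp: restr_apply PA_zero_fun Pol_coeff[of f "Dg i"])

lemma cmp_monom_mult:
  assumes "c \<in> carrier K" "f \<in> carrier PA"
  shows "cmp j (monom K c a \<boxtimes> f) = (if wt a \<le> j then monom K c a \<boxtimes> cmp (j - wt a) f else \<zero>\<^bsub>PA\<^esub>)"
proof (rule ext)
  fix m
  show "cmp j (monom K c a \<boxtimes> f) m = (if wt a \<le> j then monom K c a \<boxtimes> cmp (j - wt a) f else \<zero>\<^bsub>PA\<^esub>) m"
    using assms wt_le[of a m] wt_diff[of a m]
    by (cases "wt a \<le> j"; cases "a \<subseteq># m") (auto simp: monom_mult restr_apply PA_zero_fun)
qed

text \<open>
  A polynomial is the finite sum of its homogeneous components.
\<close>

lemma sub_of_cmp:
  assumes U: "sub U" and f: "f \<in> carrier PA" and c: "\<And>j. cmp j f \<in> U"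
  shows "f \<in> U"
proof -
  have "restr {m. wt m \<in> J} f \<in> U" if "finite J" for J
    using that
  proof (induction J)
    case empty
    have "restr {m. wt m \<in> {}} f = \<zero>\<^bsub>PA\<^esub>" by (auto simp: restr_def PA_zero_fun)
    then show ?case using subD[OF U] by simp
  next
    case (insert j J)
    have e: "{m. wt m \<in> insert j J} = {m. wt m \<in> J} \<union> Dg j" by auto
    have "restr {m. wt m \<in> insert j J} f = restr {m. wt m \<in> J} f \<boxplus> cmp j f"
      unfolding e using insert by (intro restr_Un[OF f]) auto
    then show ?case using insert c subD(3)[OF U] by simp
  qed
  from this[of "wt ` {m. f m \<noteq> \<zero>}"] have "restr {m. wt m \<in> wt ` {m. f m \<noteq> \<zero>}} f \<in> U"
    using f by (simp add: PA_simps)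
  moreover have "restr {m. wt m \<in> wt ` {m. f m \<noteq> \<zero>}} f = f" by (rule ext) (auto simp: restr_def)
  ultimately show ?thesis by simp
qed

definition Bs :: "nat multiset set" where "Bs = {m. set_mset m \<subseteq> {..<s}}"
abbreviation "S \<equiv> Pol Bs"

lemma Bs_add: "\<lbrakk>a \<in> Bs; b \<in> Bs\<rbrakk> \<Longrightarrow> a + b \<in> Bs" by (auto simp: Bs_def)
lemma Bs_empty [simp]: "{#} \<in> Bs" by (simp add: Bs_def)
lemma S_mult: "\<lbrakk>f \<in> S; g \<in> S\<rbrakk> \<Longrightarrow> f \<boxtimes> g \<in> S" by (rule mult_Pol) (auto intro: Bs_add)
lemma cst_S: "c \<in> carrier K \<Longrightarrow> cst c \<in> S" by (intro monom_Pol) auto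
lemma S_carrier: "f \<in> S \<Longrightarrow> f \<in> carrier PA" by (rule PolD)
lemma one_S: "\<one>\<^bsub>PA\<^esub> \<in> S" using cst_S[of \<one>] by (simp add: PA_simps)

text \<open>
  The graded S-submodules of the module spanned by the monomials in B. For \<open>B = Bs\<close> these are the homogeneous
  ideals of S.
\<close>

definition gsub :: "nat multiset set \<Rightarrow> (nat multiset \<Rightarrow> 'a) set \<Rightarrow> bool" where
  "gsub B U \<longleftrightarrow> sub U \<and> U \<subseteq> Pol B \<and> (\<forall>g\<in>S. \<forall>f\<in>U. g \<boxtimes> f \<in> U) \<and> (\<forall>j. \<forall>f\<in>U. cmp j f \<in> U)"

text \<open>
  Sets of monomials spanning a graded S-submodule, with the finiteness needed for Noetherianity: only finitely
  many variables occur, and a divisor inside B is a divisor by a monomial of S.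
\<close>

definition nice :: "nat multiset set \<Rightarrow> bool" where
  "nice B \<longleftrightarrow> (\<forall>a\<in>Bs. \<forall>m\<in>B. a + m \<in> B) \<and> (\<forall>m\<in>B. \<forall>m'\<in>B. m \<subseteq># m' \<longrightarrow> m' - m \<in> Bs) \<and>
     (\<exists>N. \<forall>m\<in>B. set_mset m \<subseteq> {..<N})"

lemma nice_Bs: "nice Bs"
  unfolding nice_def by (auto simp: Bs_def dest: in_diffD)

lemma gsubD:
  assumes "gsub B U"
  shows "sub U" "U \<subseteq> Pol B" "\<lbrakk>g \<in> S; f \<in> U\<rbrakk> \<Longrightarrow> g \<boxtimes> f \<in> U" "f \<in> U \<Longrightarrow> cmp j f \<in> U" "f \<in> U \<Longrightarrow> f \<in> carrier PA"
  using assms by (auto simp: gsub_def sub_def)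

lemma gsub_Pol: "nice B \<Longrightarrow> gsub B (Pol B)"
  unfolding gsub_def
proof (intro conjI ballI allI sub_Pol restr_Pol order_refl)
  fix g f assume "nice B" "g \<in> S" "f \<in> Pol B"
  then show "g \<boxtimes> f \<in> Pol B" unfolding nice_def by (elim mult_Pol) auto
qed

lemma gsub_Int: "\<lbrakk>gsub B U; gsub B W\<rbrakk> \<Longrightarrow> gsub B (U \<inter> W)"
  unfolding gsub_def using sub_Int by (metis Int_iff le_infI1)

lemma gsub_sm: assumes "gsub B U" "gsub B W" shows "gsub B (sm U W)"
  unfolding gsub_def
proof (intro conjI ballI allI)
  show "sub (sm U W)" using sub_sm gsubD(1)[OF assms(1)] gsubD(1)[OF assms(2)] .
  show "sm U W \<subseteq> Pol B" using sm_least[OF sub_Pol] gsubD(2)[OF assms(1)] gsubD(2)[OF assms(2)] .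
next
  fix g f assume g: "g \<in> S" and "f \<in> sm U W"
  then obtain u v where *: "f = u \<boxplus> v" "u \<in> U" "v \<in> W" by (auto simp: sm_def)
  have "g \<boxtimes> f = g \<boxtimes> u \<boxplus> g \<boxtimes> v" using * PolD[OF g] gsubD(5)[OF assms(1)] gsubD(5)[OF assms(2)] by (simp add: A.r_distr)
  then show "g \<boxtimes> f \<in> sm U W" using * g gsubD(3)[OF assms(1)] gsubD(3)[OF assms(2)] by (simp add: smI)
next
  fix j f assume "f \<in> sm U W"
  then obtain u v where *: "f = u \<boxplus> v" "u \<in> U" "v \<in> W" by (auto simp: sm_def)
  then show "cmp j f \<in> sm U W" using gsubD(4)[OF assms(1)] gsubD(4)[OF assms(2)] by (simp add: smI restr_add)
qed

end

section \<open>Hilbert functions\<close>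

context graded_poly begin

abbreviation "len \<equiv> L.len"

definition line where "line f = {cst c \<boxtimes> f | c. c \<in> carrier K}"

lemma cst_add: "\<lbrakk>c \<in> carrier K; d \<in> carrier K\<rbrakk> \<Longrightarrow> cst c \<boxplus> cst d = cst (c \<oplus> d)"
  by (rule ext) (auto simp: PA_simps monom_def)

lemma cst_zero: "cst \<zero> = \<zero>\<^bsub>PA\<^esub>" by (rule ext) (simp add: monom_def PA_zero_fun)
lemma cst_one: "cst \<one> = \<one>\<^bsub>PA\<^esub>" by (simp add: PA_simps)

lemma sub_line: assumes f: "f \<in> carrier PA" shows "sub (line f)"
  unfolding sub_def
proof (intro conjI ballI)
  show "line f \<subseteq> carrier PA" using f by (auto simp: line_def)
  show "\<zero>\<^bsub>PA\<^esub> \<in> line f" unfolding line_def using f cst_zero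
    by (intro CollectI exI[of _ \<zero>]) simp
next
  fix g h assume "g \<in> line f" "h \<in> line f"
  then obtain c d where *: "g = cst c \<boxtimes> f" "h = cst d \<boxtimes> f" "c \<in> carrier K" "d \<in> carrier K"
    by (auto simp: line_def)
  then have "g \<boxplus> h = cst (c \<oplus> d) \<boxtimes> f" using f by (simp flip: cst_add add: A.l_distr)
  then show "g \<boxplus> h \<in> line f" unfolding line_def using * by blast
next
  fix c g assume c: "c \<in> carrier K" and "g \<in> line f"
  then obtain d where *: "g = cst d \<boxtimes> f" "d \<in> carrier K" by (auto simp: line_def)
  then have "cst c \<boxtimes> g = cst (c \<otimes> d) \<boxtimes> f" using c f by (simp flip: cst_monom add: A.m_assoc)
  then show "cst c \<boxtimes> g \<in> line f" unfolding line_def using * c by blast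
qed

lemma in_line: "f \<in> carrier PA \<Longrightarrow> f \<in> line f"
  unfolding line_def using cst_one by (intro CollectI exI[of _ \<one>]) simp

lemma line_least: "\<lbrakk>sub U; f \<in> U\<rbrakk> \<Longrightarrow> line f \<subseteq> U"
  unfolding line_def using subD(4) by blast

lemma cst_inv_cancel:
  assumes "sub U" "c \<in> carrier K" "c \<noteq> \<zero>" "f \<in> carrier PA" "cst c \<boxtimes> f \<in> U"
  shows "f \<in> U"
proof -
  have c: "inv c \<in> carrier K" "inv c \<otimes> c = \<one>" using assms field_Units by auto
  have "cst (inv c) \<boxtimes> (cst c \<boxtimes> f) = f"
    using assms c by (simp flip: A.m_assoc add: cst_monom cst_one)
  with subD(4)[OF assms(1) c(1) assms(5)] show ?thesis by simp
qed

text \<open>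
  A subspace strictly larger than U inside U plus a line contains a nonzero multiple of the spanning vector,
  hence the whole line.
\<close>

lemma len_line_le:
  assumes U: "sub U" and f: "f \<in> carrier PA"
  shows "len U (sm U (line f)) \<le> 1"
  unfolding L.len_def one_enat_def
proof (rule chain_len_le)
  fix n and C :: "nat \<Rightarrow> (nat multiset \<Rightarrow> 'a) set"
  assume C: "\<And>i. i \<le> n \<Longrightarrow> sub (C i) \<and> U \<subseteq> C i \<and> C i \<subseteq> sm U (line f)" "\<And>i. i < n \<Longrightarrow> C i \<subset> C (Suc i)"
  have full: "sm U (line f) \<subseteq> X" if X: "sub X" "U \<subset> X" "X \<subseteq> sm U (line f)" for X
  proof -
    obtain x where x: "x \<in> X" "x \<notin> U" using X by auto
    then obtain u c where uc: "x = u \<boxplus> cst c \<boxtimes> f" "u \<in> U" "c \<in> carrier K"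
      using X by (auto simp: line_def elim!: smE dest!: subsetD)
    have coord: "cst c \<boxtimes> f \<in> X"
      by (rule sub_add_cancel[OF X(1), of u]) (use uc x X f in auto)
    have "c \<noteq> \<zero>" using uc x f subD(5)[OF U] by (auto simp: cst_zero)
    then have "f \<in> X" using cst_inv_cancel[OF X(1) uc(3) _ f coord] by simp
    then show ?thesis using X by (intro sm_least line_least) auto
  qed
  show "enat n \<le> enat 1"
  proof (rule ccontr)
    assume "\<not> enat n \<le> enat 1"
    then have n: "2 \<le> n" by simp
    then have "U \<subset> C 1" "C 1 \<subset> C 2" "sub (C 1)" "C 1 \<subseteq> sm U (line f)" "C 2 \<subseteq> sm U (line f)"
      using C(1)[of 0] C(1)[of 1] C(1)[of 2] C(2)[of 0] C(2)[of 1] by (auto simp: numeral_2_eq_2)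
    with full[of "C 1"] show False by blast
  qed
qed

definition spn where "spn U fs = foldr (\<lambda>f W. sm W (line f)) fs U"

lemma spn_simps [simp]: "spn U [] = U" "spn U (f # fs) = sm (spn U fs) (line f)"
  by (simp_all add: spn_def)

lemma sub_spn: "\<lbrakk>sub U; set fs \<subseteq> carrier PA\<rbrakk> \<Longrightarrow> sub (spn U fs)"
  by (induction fs) (auto intro: sub_sm sub_line)

lemma spn_upper: "\<lbrakk>sub U; set fs \<subseteq> carrier PA\<rbrakk> \<Longrightarrow> U \<subseteq> spn U fs"
proof (induction fs)
  case (Cons f fs)
  then show ?case using sm_upper1[OF sub_spn[of U fs] sub_line[of f]] by auto
qed simp

lemma spn_set: "\<lbrakk>sub U; set fs \<subseteq> carrier PA\<rbrakk> \<Longrightarrow> set fs \<subseteq> spn U fs"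
proof (induction fs)
  case (Cons f fs)
  then show ?case using sm_upper1[OF sub_spn[of U fs] sub_line[of f]] sm_upper2[OF sub_spn[of U fs] sub_line[of f]]
      in_line[of f] by auto
qed simp

lemma spn_least: "\<lbrakk>sub W; U \<subseteq> W; set fs \<subseteq> W\<rbrakk> \<Longrightarrow> spn U fs \<subseteq> W"
proof (induction fs)
  case (Cons f fs)
  then show ?case using sm_least[OF Cons.prems(1) _ line_least[OF Cons.prems(1)], of "spn U fs" f] by simp
qed simp

lemma len_spn_le:
  assumes U: "sub U"
  shows "set fs \<subseteq> carrier PA \<Longrightarrow> len U (spn U fs) \<le> enat (length fs)"
proof (induction fs)
  case Nil then show ?case by (simp flip: zero_enat_def)
next
  case (Cons f fs)
  have s: "sub (spn U fs)" using sub_spn U Cons by auto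
  have f: "f \<in> carrier PA" using Cons by auto
  have "len U (spn U (f # fs)) = len U (spn U fs) + len (spn U fs) (sm (spn U fs) (line f))"
    using L.len_add[of U "spn U fs" "sm (spn U fs) (line f)"] U s sub_sm sub_line[OF f] spn_upper[OF U] Cons
      sm_upper1[OF s sub_line[OF f]] by auto
  also have "\<dots> \<le> enat (length fs) + 1"
    using Cons len_line_le[OF s f] by (intro add_mono) auto
  finally show ?case by (simp add: one_enat_def)
qed

lemma len_eq_0:
  assumes "sub U" "sub W" "U \<subseteq> W" "len U W = 0" shows "U = W"
  using L.len_ge_1[OF assms(1,2)] assms(3,4) by (metis not_one_le_zero psubsetI)

text \<open>
  Lengths of subspaces are dimensions: a space of relative length r needs r further spanning vectors.
  This allows bounding the length of an image under the semilinear Frobenius map.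
\<close>

lemma spanning_list:
  assumes "sub U" "sub W" "U \<subseteq> W" "len U W = enat r"
  shows "\<exists>fs. length fs = r \<and> set fs \<subseteq> W \<and> W = spn U fs"
  using assms
proof (induction r arbitrary: W)
  case 0
  then have "U = W" using len_eq_0 by (simp add: zero_enat_def)
  then show ?case by (intro exI[of _ "[]"]) simp
next
  case (Suc r W)
  \<comment> \<open>A maximal chain ends with a step of length one, which a single vector spans.\<close>
  have "enat (Suc r) \<le> len U W" using Suc by simp
  then obtain C where C: "\<And>i. i \<le> Suc r \<Longrightarrow> sub (C i) \<and> U \<subseteq> C i \<and> C i \<subseteq> W" "\<And>i. i < Suc r \<Longrightarrow> C i \<subset> C (Suc i)"
    unfolding L.len_def using chain_len_obtain[of "Suc r" "\<lambda>X. sub X \<and> U \<subseteq> X \<and> X \<subseteq> W" U] Suc.prems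
    by (metis (no_types, lifting) order_refl)
  have Cr: "sub (C r)" "U \<subseteq> C r" "C r \<subseteq> W" "C r \<subset> C (Suc r)" using C(1)[of r] C(2)[of r] by auto
  have "enat r \<le> len U (C r)" unfolding L.len_def
  proof (rule chain_len_ge[where C = C])
    show "sub (C i) \<and> U \<subseteq> C i \<and> C i \<subseteq> C r" if "i \<le> r" for i
    proof -
      have "C i \<subseteq> C r" using that 
      proof (induction rule: inc_induct)
        case (step n) then show ?case using C(2)[of n] by auto
      qed simp
      then show ?thesis using C(1)[of i] that by auto
    qed
  qed (use C in auto)
  moreover have add: "len U W = len U (C r) + len (C r) W" using L.len_add Suc.prems Cr by blast
  moreover have "1 \<le> len (C r) W" using L.len_ge_1[of "C r" W] Cr C(1)[of "Suc r"] Suc.prems by auto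
  ultimately have lr: "len U (C r) = enat r" and l1: "len (C r) W = 1"
    using Suc.prems(4) by (cases "len U (C r)"; cases "len (C r) W"; simp add: one_enat_def)+
  obtain fs where fs: "length fs = r" "set fs \<subseteq> C r" "C r = spn U fs"
    using Suc.IH[OF Suc.prems(1) Cr(1,2) lr] by blast
  obtain f where f: "f \<in> W" "f \<notin> C r" using Cr C(1)[of "Suc r"] by blast
  have fc: "f \<in> carrier PA" using f subD(5)[OF Suc.prems(2)] by auto
  let ?X = "sm (C r) (line f)"
  have X: "sub ?X" "C r \<subseteq> ?X" "f \<in> ?X" "?X \<subseteq> W"
    using sub_sm sub_line[OF fc] Cr sm_upper1[OF Cr(1) sub_line[OF fc]] sm_upper2[OF Cr(1) sub_line[OF fc]] in_line[OF fc]
      sm_least[OF Suc.prems(2) Cr(3) line_least[OF Suc.prems(2) f(1)]] by auto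
  have "len (C r) W = len (C r) ?X + len ?X W" using L.len_add Cr X Suc.prems by blast
  moreover have "1 \<le> len (C r) ?X" using L.len_ge_1[OF Cr(1) X(1)] X f by auto
  ultimately have "len ?X W = 0" using l1
    by (cases "len (C r) ?X"; cases "len ?X W"; simp add: one_enat_def zero_enat_def)
  then have "?X = W" using len_eq_0 X Suc.prems by auto
  then show ?case using fs f Cr by (intro exI[of _ "f # fs"]) auto
qed

lemma len_Pol:
  assumes "finite X"
  shows "len (Pol {}) (Pol X) = enat (card X)"
  using assms
proof (induction X)
  case empty then show ?case by (simp flip: zero_enat_def)
next
  case (insert m X)
  let ?M = "monom K \<one> m"
  have M: "?M \<in> carrier PA" "?M \<in> Pol (insert m X)" by (auto intro: monom_Pol)
  have e: "Pol (insert m X) = sm (Pol X) (line ?M)"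
  proof
    show "sm (Pol X) (line ?M) \<subseteq> Pol (insert m X)"
      using M by (intro sm_least sub_Pol line_least Pol_mono) auto
    show "Pol (insert m X) \<subseteq> sm (Pol X) (line ?M)"
    proof
      fix f assume f: "f \<in> Pol (insert m X)"
      have fc: "f \<in> carrier PA" using f PolD by auto
      have "f = restr (insert m X) f" using restr_id[OF f] by simp
      also have "\<dots> = restr X f \<boxplus> restr {m} f" using restr_Un[OF fc, of X "{m}"] insert by simp
      also have "restr {m} f = cst (f m) \<boxtimes> ?M" using fc by (simp add: restr_single cst_monom)
      also have "restr X f \<boxplus> cst (f m) \<boxtimes> ?M \<in> sm (Pol X) (line ?M)"
        using fc restr_closed[OF fc, of X] by (intro smI) (auto simp: line_def)
      finally show "f \<in> sm (Pol X) (line ?M)" .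
    qed
  qed
  have "len (Pol {}) (Pol (insert m X)) = len (Pol {}) (Pol X) + len (Pol X) (Pol (insert m X))"
    by (intro L.len_add sub_Pol Pol_mono) auto
  moreover have "len (Pol X) (Pol (insert m X)) = 1"
  proof (rule antisym)
    show "len (Pol X) (Pol (insert m X)) \<le> 1" unfolding e using M by (intro len_line_le sub_Pol)
    have "?M \<notin> Pol X" using insert by (auto simp: Pol_def monom_def)
    then show "1 \<le> len (Pol X) (Pol (insert m X))" using M by (intro L.len_ge_1 sub_Pol) (auto intro: Pol_mono[THEN subsetD])
  qed
  ultimately show ?case using insert by (simp add: one_enat_def)
qed

lemma finite_monos:
  assumes "\<forall>m\<in>B. set_mset m \<subseteq> {..<N}"
  shows "finite {m \<in> B. wt m \<le> j}" "card {m \<in> B. wt m \<le> j} \<le> (j + 1) ^ N"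
proof -
  let ?X = "{m \<in> B. wt m \<le> j}" and ?F = "{..<N} \<rightarrow>\<^sub>E {..j}"
  have inj: "inj_on (\<lambda>m. restrict (count m) {..<N}) ?X"
  proof (rule inj_onI)
    fix a b assume a: "a \<in> ?X" and b: "b \<in> ?X" and e: "restrict (count a) {..<N} = restrict (count b) {..<N}"
    show "a = b"
    proof (rule multiset_eqI)
      fix i
      show "count a i = count b i"
      proof (cases "i < N")
        case False
        then have "i \<notin># a" "i \<notin># b" using a b assms by auto
        then show ?thesis by (simp add: not_in_iff)
      qed (use fun_cong[OF e, of i] in auto)
    qed
  qed
  have im: "(\<lambda>m. restrict (count m) {..<N}) ` ?X \<subseteq> ?F"
  proof
    fix g assume "g \<in> (\<lambda>m. restrict (count m) {..<N}) ` ?X"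
    then obtain m where m: "g = restrict (count m) {..<N}" "wt m \<le> j" by auto
    have "count m i \<le> j" for i using count_le_size[of m i] size_le_wt[of m] m by linarith
    then show "g \<in> ?F" using m by (auto simp: PiE_def restrict_def extensional_def)
  qed
  have F: "finite ?F" by (intro finite_PiE) auto
  show "finite ?X" using finite_imageD[OF finite_subset[OF im F] inj] .
  have "card ?X \<le> card ?F" using card_inj_on_le[OF inj im F] .
  also have "card ?F = (j + 1) ^ N" by (simp add: card_PiE)
  finally show "card ?X \<le> (j + 1) ^ N" .
qed

text \<open>
  The Hilbert function of the graded module \<open>Pol B / U\<close>.
\<close>

definition HF :: "nat multiset set \<Rightarrow> (nat multiset \<Rightarrow> 'a) set \<Rightarrow> nat \<Rightarrow> nat" where
  "HF B U j = the_enat (len (U \<inter> Hm j) (Pol B \<inter> Hm j))"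

lemma nice_finite:
  assumes "nice B" shows "finite (B \<inter> Dg j)"
proof -
  obtain N where "\<forall>m\<in>B. set_mset m \<subseteq> {..<N}" using assms by (auto simp: nice_def)
  from finite_monos(1)[OF this, of j] show ?thesis by (rule finite_subset[rotated]) auto
qed

lemma len_piece_finite:
  assumes "nice B" "sub U" "sub W" "U \<subseteq> W" "W \<subseteq> Pol B \<inter> Hm j"
  shows "len U W \<noteq> \<infinity>" "len U W \<le> enat (card (B \<inter> Dg j))"
proof -
  have "len U W \<le> len (Pol {}) (Pol (B \<inter> Dg j))"
    using assms subD(2)[OF assms(2)] by (intro L.len_mono) (auto simp: Pol_empty Pol_Int)
  then show "len U W \<le> enat (card (B \<inter> Dg j))" using len_Pol[OF nice_finite[OF assms(1)]] by simp
  then show "len U W \<noteq> \<infinity>" by (cases "len U W") auto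
qed

lemma HF_len:
  assumes "nice B" "sub U" "U \<subseteq> Pol B"
  shows "enat (HF B U j) = len (U \<inter> Hm j) (Pol B \<inter> Hm j)"
  using len_piece_finite(1)[OF assms(1) sub_Int[OF assms(2) sub_Pol] sub_Int[OF sub_Pol sub_Pol], of "Dg j" B "Dg j" j] assms(3)
  unfolding HF_def by (cases "len (U \<inter> Hm j) (Pol B \<inter> Hm j)") auto

lemma HF_diff:
  assumes "nice B" "sub U" "sub W" "U \<subseteq> W" "W \<subseteq> Pol B"
  shows "enat (HF B U j) = len (U \<inter> Hm j) (W \<inter> Hm j) + enat (HF B W j)"
  using assms by (subst (1 2) HF_len) (auto intro!: L.len_add sub_Int sub_Pol)

lemma HF_mono:
  assumes "nice B" "sub U" "sub W" "U \<subseteq> W" "W \<subseteq> Pol B"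
  shows "HF B W j \<le> HF B U j"
  using HF_diff[OF assms, of j] by (cases "len (U \<inter> Hm j) (W \<inter> Hm j)") auto

lemma HF_full: "HF B (Pol B) j = 0" by (simp add: HF_def zero_enat_def)

lemma HF_le_card: "\<lbrakk>nice B; sub U; U \<subseteq> Pol B\<rbrakk> \<Longrightarrow> HF B U j \<le> card (B \<inter> Dg j)"
  using len_piece_finite(2)[of B "U \<inter> Hm j" "Pol B \<inter> Hm j" j] HF_len[of B U j]
    sub_Int[of U "Hm j"] sub_Int[of "Pol B" "Hm j"] sub_Pol by (metis Int_mono enat_ord_simps(1) order_refl)

lemma HF_zero: "nice B \<Longrightarrow> HF B {\<zero>\<^bsub>PA\<^esub>} j = card (B \<inter> Dg j)"
  using len_Pol[OF nice_finite, of B j] HF_len[of B "Pol {}" j] Pol_mono[of "{}" B]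
  by (simp add: Pol_Int sub_Pol flip: Pol_empty)

text \<open>
  A monomial of weight j has exponents at most j, as all weights are positive; so the Hilbert functions grow
  polynomially.
\<close>

lemma HF_bound:
  assumes "nice B" shows "\<exists>N. \<forall>U j. sub U \<and> U \<subseteq> Pol B \<longrightarrow> HF B U j \<le> (j + 1) ^ N"
proof -
  obtain N where N: "\<forall>m\<in>B. set_mset m \<subseteq> {..<N}" using assms by (auto simp: nice_def)
  have "card (B \<inter> Dg j) \<le> (j + 1) ^ N" for j
    by (rule order_trans[OF card_mono[OF finite_monos(1)[OF N, of j]] finite_monos(2)[OF N, of j]]) auto
  then show ?thesis using HF_le_card[OF assms] by (meson order_trans)
qed

lemma HF_Int_sm:
  assumes "nice B" "gsub B U" "gsub B W"
  shows "HF B (U \<inter> W) j + HF B (sm U W) j = HF B U j + HF B W j"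
proof -
  note [simp] = gsubD(1)[OF assms(2)] gsubD(1)[OF assms(3)] gsubD(2)[OF assms(2)] gsubD(2)[OF assms(3)]
  have j: "sm U W \<inter> Hm j = sm (U \<inter> Hm j) (W \<inter> Hm j)"
  proof
    show "sm (U \<inter> Hm j) (W \<inter> Hm j) \<subseteq> sm U W \<inter> Hm j"
      using sm_mono sm_least[OF sub_Pol] by (metis Int_lower1 Int_lower2 le_inf_iff)
    show "sm U W \<inter> Hm j \<subseteq> sm (U \<inter> Hm j) (W \<inter> Hm j)"
    proof
      fix f assume f: "f \<in> sm U W \<inter> Hm j"
      then obtain u v where uv: "f = u \<boxplus> v" "u \<in> U" "v \<in> W" by (auto elim: smE)
      have "f = cmp j u \<boxplus> cmp j v" using f uv cmp_Hm[of f j j] by (simp flip: restr_add)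
      then show "f \<in> sm (U \<inter> Hm j) (W \<inter> Hm j)"
        using uv gsubD(4,5)[OF assms(2)] gsubD(4,5)[OF assms(3)] restr_closed by (auto intro!: smI)
    qed
  qed
  have "len ((U \<inter> Hm j) \<inter> (W \<inter> Hm j)) (U \<inter> Hm j) = len (W \<inter> Hm j) (sm (U \<inter> Hm j) (W \<inter> Hm j))"
    by (intro L.len_Int_jn sub_Int sub_Pol) simp_all
  then have l: "len ((U \<inter> W) \<inter> Hm j) (U \<inter> Hm j) = len (W \<inter> Hm j) (sm U W \<inter> Hm j)"
    unfolding j by (simp add: Int_ac)
  have s: "sub (sm U W)" "sm U W \<subseteq> Pol B" "W \<subseteq> sm U W" "sub (U \<inter> W)"
    using sub_sm sm_least[OF sub_Pol] sm_upper2 sub_Int by simp_all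
  have 1: "enat (HF B (U \<inter> W) j) = len ((U \<inter> W) \<inter> Hm j) (U \<inter> Hm j) + enat (HF B U j)"
    using s by (intro HF_diff assms) auto
  have 2: "enat (HF B W j) = len (W \<inter> Hm j) (sm U W \<inter> Hm j) + enat (HF B (sm U W) j)"
    using s by (intro HF_diff assms) auto
  from 1 2 show ?thesis unfolding l by (cases "len (W \<inter> Hm j) (sm U W \<inter> Hm j)") auto
qed

text \<open>Colon ideals inside S, and the submodule obtained by adding one generator.\<close>

definition colon where "colon W f = {g \<in> S. g \<boxtimes> f \<in> W}"
definition adj where "adj W f = sm W {g \<boxtimes> f | g. g \<in> S}"

lemma gsub_gen:
  assumes "nice B" "f \<in> Pol B" "f \<in> Hm a"
  shows "gsub B {g \<boxtimes> f | g. g \<in> S}" (is "gsub B ?P")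
  unfolding gsub_def
proof (intro conjI ballI allI)
  have fc: "f \<in> carrier PA" using assms PolD by auto
  show "sub ?P" unfolding sub_def
  proof (intro conjI ballI)
    show "?P \<subseteq> carrier PA" using fc PolD by auto
    show "\<zero>\<^bsub>PA\<^esub> \<in> ?P" using subD(2)[OF sub_Pol] fc by (metis (mono_tags, lifting) A.l_null mem_Collect_eq)
  next
    fix x y assume "x \<in> ?P" "y \<in> ?P"
    then obtain g h where "x = g \<boxtimes> f" "y = h \<boxtimes> f" "g \<in> S" "h \<in> S" by auto
    moreover from this have "x \<boxplus> y = (g \<boxplus> h) \<boxtimes> f" using fc PolD by (simp add: A.l_distr)
    ultimately show "x \<boxplus> y \<in> ?P" using subD(3)[OF sub_Pol] by blast
  next
    fix c x assume c: "c \<in> carrier K" and "x \<in> ?P"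
    then obtain g where "x = g \<boxtimes> f" "g \<in> S" by auto
    moreover from this have "cst c \<boxtimes> x = (cst c \<boxtimes> g) \<boxtimes> f" using c fc PolD by (simp add: A.m_assoc)
    ultimately show "cst c \<boxtimes> x \<in> ?P" using subD(4)[OF sub_Pol] c by blast
  qed
  show "?P \<subseteq> Pol B" using mult_Pol[of _ Bs f B B] assms by (auto simp: nice_def)
next
  fix h x assume h: "h \<in> S" and "x \<in> ?P"
  then obtain g where "x = g \<boxtimes> f" "g \<in> S" by auto
  moreover from this have "h \<boxtimes> x = (h \<boxtimes> g) \<boxtimes> f" using h assms PolD by (simp add: A.m_assoc)
  ultimately show "h \<boxtimes> x \<in> ?P" using S_mult h by blast
next
  fix j x assume "x \<in> ?P"
  then obtain g where g: "x = g \<boxtimes> f" "g \<in> S" by auto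
  have "cmp j (g \<boxtimes> f) \<in> ?P" using g(2)
  proof (induction rule: Pol_induct)
    case zero
    have "cmp j (\<zero>\<^bsub>PA\<^esub> \<boxtimes> f) = \<zero>\<^bsub>PA\<^esub> \<boxtimes> f" using PolD[OF assms(2)] by simp
    then show ?case using subD(2)[OF sub_Pol] by blast
  next
    case (add g c m)
    have fc: "f \<in> carrier PA" "g \<in> carrier PA" using assms add PolD by auto
    obtain g' where g': "cmp j (g \<boxtimes> f) = g' \<boxtimes> f" "g' \<in> S" using add by auto
    have "cmp j (monom K c m \<boxtimes> f) = (if wt m + a = j then monom K c m else \<zero>\<^bsub>PA\<^esub>) \<boxtimes> f"
      using add fc cmp_Hm[OF assms(3), of "j - wt m"] by (auto simp: cmp_monom_mult)
    then have "cmp j ((g \<boxplus> monom K c m) \<boxtimes> f) = (g' \<boxplus> (if wt m + a = j then monom K c m else \<zero>\<^bsub>PA\<^esub>)) \<boxtimes> f"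
      using add fc g' PolD by (simp add: A.l_distr restr_add)
    moreover have "g' \<boxplus> (if wt m + a = j then monom K c m else \<zero>\<^bsub>PA\<^esub>) \<in> S"
      using g' add monom_Pol[of c m Bs] subD(2,3)[OF sub_Pol[of Bs]] by auto
    ultimately show ?case by blast
  qed
  then show "cmp j x \<in> ?P" using g by simp
qed

lemma cmp_mult:
  assumes "g \<in> carrier PA" "f \<in> Hm a"
  shows "cmp j (g \<boxtimes> f) = (if a \<le> j then cmp (j - a) g \<boxtimes> f else \<zero>\<^bsub>PA\<^esub>)"
proof -
  have fc: "f \<in> carrier PA" using assms PolD by auto
  have "g \<in> Pol UNIV" using assms by (simp add: Pol_UNIV)
  then show ?thesis
  proof (induction rule: Pol_induct)
    case zero
    have "cmp i \<zero>\<^bsub>PA\<^esub> = \<zero>\<^bsub>PA\<^esub>" for i by (rule ext) (auto simp: restr_def PA_zero_fun)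
    then show ?case using fc by simp
  next
    case (add g c m)
    have gc: "g \<in> carrier PA" using add by (simp add: Pol_UNIV)
    have "cmp j (monom K c m \<boxtimes> f) = (if a \<le> j then cmp (j - a) (monom K c m) \<boxtimes> f else \<zero>\<^bsub>PA\<^esub>)"
    proof -
      have "cmp i (monom K c m) = (if wt m = i then monom K c m else \<zero>\<^bsub>PA\<^esub>)" for i
        by (rule ext) (auto simp: restr_def PA_zero_fun monom_def)
      then show ?thesis using add fc cmp_Hm[OF assms(2), of "j - wt m"] by (auto simp: cmp_monom_mult)
    qed
    then show ?case using add fc gc by (auto simp: A.l_distr restr_add)
  qed
qed

lemma gsub_colon:
  assumes "nice B" "gsub B W" "f \<in> Pol B" "f \<in> Hm a"
  shows "gsub Bs (colon W f)"
proof -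
  have fc: "f \<in> carrier PA" using assms PolD by auto
  show ?thesis unfolding gsub_def
  proof (intro conjI ballI allI)
  note W = gsubD[OF assms(2)]
  show "sub (colon W f)" unfolding sub_def
  proof (intro conjI ballI)
    show "colon W f \<subseteq> carrier PA" using PolD by (auto simp: colon_def)
    show "\<zero>\<^bsub>PA\<^esub> \<in> colon W f" using fc subD(2)[OF sub_Pol] subD(2)[OF W(1)] by (simp add: colon_def)
  next
    fix g h assume "g \<in> colon W f" "h \<in> colon W f"
    then show "g \<boxplus> h \<in> colon W f" using fc S_carrier subD(3)[OF sub_Pol] subD(3)[OF W(1)] by (simp add: colon_def A.l_distr)
  next
    fix c g assume "c \<in> carrier K" "g \<in> colon W f"
    then show "cst c \<boxtimes> g \<in> colon W f" using fc S_carrier subD(4)[OF sub_Pol] subD(4)[OF W(1)] by (simp add: colon_def A.m_assoc)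
  qed
  show "colon W f \<subseteq> Pol Bs" by (auto simp: colon_def)
next
  fix h g assume "h \<in> S" "g \<in> colon W f"
  then show "h \<boxtimes> g \<in> colon W f" using fc S_carrier S_mult gsubD(3)[OF assms(2)] by (simp add: colon_def A.m_assoc)
next
  fix j g assume g: "g \<in> colon W f"
  then have "cmp (j + a) (g \<boxtimes> f) \<in> W" using gsubD(4)[OF assms(2)] by (auto simp: colon_def)
  then have "cmp j g \<boxtimes> f \<in> W" using cmp_mult[OF _ assms(4), of g "j + a"] g S_carrier by (simp add: colon_def)
  then show "cmp j g \<in> colon W f" using g restr_Pol by (auto simp: colon_def)
  qed
qed

lemma gsub_adj:
  assumes "nice B" "gsub B W" "f \<in> Pol B" "f \<in> Hm a"
  shows "gsub B (adj W f)" "W \<subseteq> adj W f" "f \<in> adj W f"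
proof -
  note g = gsub_gen[OF assms(1,3,4)]
  show "gsub B (adj W f)" unfolding adj_def by (intro gsub_sm assms g)
  show "W \<subseteq> adj W f" unfolding adj_def by (intro sm_upper1 gsubD(1)[OF g] gsubD(1)[OF assms(2)])
  have "f \<in> {g \<boxtimes> f | g. g \<in> S}" 
    using one_S PolD[OF assms(3)] by (intro CollectI exI[of _ "\<one>\<^bsub>PA\<^esub>"]) simp
  then show "f \<in> adj W f" unfolding adj_def using sm_upper2[OF gsubD(1)[OF assms(2)] gsubD(1)[OF g]] by auto
qed

lemma adj_least: "\<lbrakk>gsub B X; W \<subseteq> X; f \<in> X\<rbrakk> \<Longrightarrow> adj W f \<subseteq> X"
  unfolding adj_def using gsubD(1,3) by (intro sm_least) auto

text \<open>Multiplication by f identifies S/(W : f), shifted by deg f, with (W + Sf)/W.\<close>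

lemma len_adj:
  assumes "nice B" "gsub B W" "f \<in> Pol B" "f \<in> Hm a"
  shows "len (W \<inter> Hm j) (adj W f \<inter> Hm j) = (if a \<le> j then enat (HF Bs (colon W f) (j - a)) else 0)"
proof -
  have fc: "f \<in> carrier PA" using assms PolD by auto
  note W = gsubD[OF assms(2)]
  have adjE: "\<exists>u g. x = u \<boxplus> g \<boxtimes> f \<and> u \<in> W \<inter> Hm j \<and> g \<in> S \<and> (if a \<le> j then g \<in> Hm (j - a) else g = \<zero>\<^bsub>PA\<^esub>)"
    if x: "x \<in> adj W f \<inter> Hm j" for x
  proof -
    obtain u g where ug: "x = u \<boxplus> g \<boxtimes> f" "u \<in> W" "g \<in> S" using x by (auto simp: adj_def elim!: smE)
    have "x = cmp j u \<boxplus> cmp j (g \<boxtimes> f)" using x ug cmp_Hm[of x j j] by (simp flip: restr_add)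
    also have "cmp j (g \<boxtimes> f) = (if a \<le> j then cmp (j - a) g else \<zero>\<^bsub>PA\<^esub>) \<boxtimes> f"
      using cmp_mult[OF _ assms(4), of g j] ug fc PolD by simp
    finally have "x = cmp j u \<boxplus> (if a \<le> j then cmp (j - a) g else \<zero>\<^bsub>PA\<^esub>) \<boxtimes> f" .
    moreover have "cmp j u \<in> W \<inter> Hm j" using W(4,5) ug restr_closed by auto
    moreover have "(if a \<le> j then cmp (j - a) g else \<zero>\<^bsub>PA\<^esub>) \<in> S"
      using restr_Pol[OF ug(3)] subD(2)[OF sub_Pol] by simp
    moreover have "a \<le> j \<Longrightarrow> cmp (j - a) g \<in> Hm (j - a)" using restr_closed[OF S_carrier[OF ug(3)]] .
    ultimately show ?thesis by (intro exI[of _ "cmp j u"] exI[of _ "if a \<le> j then cmp (j - a) g else \<zero>\<^bsub>PA\<^esub>"]) simp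
  qed
  note ga = gsub_adj[OF assms]
  show ?thesis
  proof (cases "a \<le> j")
    case False
    have "adj W f \<inter> Hm j \<subseteq> W \<inter> Hm j" using adjE False W(5) fc by fastforce
    then have "adj W f \<inter> Hm j = W \<inter> Hm j" using ga by auto
    then show ?thesis using False by simp
  next
    case True
    let ?i = "j - a"
    note gc = gsub_colon[OF assms]
    define \<phi> where "\<phi> X = {g \<in> S \<inter> Hm ?i. g \<boxtimes> f \<in> X}" for X
    define \<psi> where "\<psi> Y = sm (W \<inter> Hm j) {g \<boxtimes> f | g. g \<in> Y}" for Y
    have deg: "g \<boxtimes> f \<in> Hm j" if "g \<in> Hm ?i" for g
      using mult_Pol[OF that assms(4), of "Dg j"] True by auto
    have sub_img: "sub {g \<boxtimes> f | g. g \<in> Y}" if Y: "sub Y" for Y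
      unfolding sub_def
    proof (intro conjI ballI)
      show "{g \<boxtimes> f | g. g \<in> Y} \<subseteq> carrier PA" using fc subD(5)[OF Y] by auto
      show "\<zero>\<^bsub>PA\<^esub> \<in> {g \<boxtimes> f | g. g \<in> Y}" using subD(2)[OF Y] fc by (metis (mono_tags, lifting) A.l_null mem_Collect_eq)
    next
      fix x y assume "x \<in> {g \<boxtimes> f | g. g \<in> Y}" "y \<in> {g \<boxtimes> f | g. g \<in> Y}"
      then obtain g h where "x = g \<boxtimes> f" "y = h \<boxtimes> f" "g \<in> Y" "h \<in> Y" by auto
      moreover from this have "x \<boxplus> y = (g \<boxplus> h) \<boxtimes> f" using fc subD(5)[OF Y] by (simp add: A.l_distr)
      ultimately show "x \<boxplus> y \<in> {g \<boxtimes> f | g. g \<in> Y}" using subD(3)[OF Y] by blast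
    next
      fix c x assume c: "c \<in> carrier K" and "x \<in> {g \<boxtimes> f | g. g \<in> Y}"
      then obtain g where "x = g \<boxtimes> f" "g \<in> Y" by auto
      moreover from this have "cst c \<boxtimes> x = (cst c \<boxtimes> g) \<boxtimes> f" using c fc subD(5)[OF Y] by (simp add: A.m_assoc)
      ultimately show "cst c \<boxtimes> x \<in> {g \<boxtimes> f | g. g \<in> Y}" using subD(4)[OF Y] c by blast
    qed
    have sW: "sub (W \<inter> Hm j)" using W(1) sub_Int sub_Pol by auto
    have sS: "sub (S \<inter> Hm ?i)" using sub_Int sub_Pol by auto
    have sub_phi: "sub (\<phi> X)" if X: "sub X" for X
      unfolding sub_def \<phi>_def
      using subD(2-5)[OF sS] subD(2-5)[OF X] fc by (auto simp: A.l_distr A.m_assoc)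
    have mono: "\<phi> X \<subset> \<phi> Y"
      if X: "sub X" "W \<inter> Hm j \<subseteq> X" and Y: "sub Y" "Y \<subseteq> adj W f \<inter> Hm j" and XY: "X \<subset> Y" for X Y
    proof -
      obtain y where y: "y \<in> Y" "y \<notin> X" using XY by auto
      then obtain u g where ug: "y = u \<boxplus> g \<boxtimes> f" "u \<in> W \<inter> Hm j" "g \<in> S" "g \<in> Hm ?i"
        using adjE[of y] Y True by auto
      have "g \<boxtimes> f \<in> Y"
        by (rule sub_add_cancel[OF Y(1), of u]) (use ug y X XY fc PolD in auto)
      moreover have "g \<boxtimes> f \<notin> X" using y ug X subD(3)[OF X(1)] by auto
      ultimately have "g \<in> \<phi> Y" "g \<notin> \<phi> X" using ug by (auto simp: \<phi>_def)
      moreover have "\<phi> X \<subseteq> \<phi> Y" using XY by (auto simp: \<phi>_def)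
      ultimately show ?thesis by blast
    qed
    have "len (W \<inter> Hm j) (adj W f \<inter> Hm j) \<le> len (colon W f \<inter> Hm ?i) (S \<inter> Hm ?i)"
      unfolding L.len_def
    proof (rule chain_len_map[where g = \<phi>], goal_cases)
      case (1 X)
      have "colon W f \<inter> Hm ?i \<subseteq> \<phi> X" using 1 deg by (auto simp: \<phi>_def colon_def)
      moreover have "\<phi> X \<subseteq> S \<inter> Hm ?i" by (auto simp: \<phi>_def)
      ultimately show ?case using 1 sub_phi by auto
    next
      case (2 X Y) then show ?case by (intro mono) auto
    qed
    moreover have "len (colon W f \<inter> Hm ?i) (S \<inter> Hm ?i) \<le> len (W \<inter> Hm j) (adj W f \<inter> Hm j)"
      unfolding L.len_def
    proof (rule chain_len_map[where g = \<psi>], goal_cases)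
      case (1 Y)
      then have sY: "sub Y" by simp
      have "{g \<boxtimes> f | g. g \<in> Y} \<subseteq> adj W f \<inter> Hm j"
        using 1 deg sm_upper2[OF W(1) gsubD(1)[OF gsub_gen[OF assms(1,3,4)]]] unfolding adj_def by blast
      then have "\<psi> Y \<subseteq> adj W f \<inter> Hm j"
        unfolding \<psi>_def using ga by (intro sm_least sub_Int gsubD(1)[OF ga(1)] sub_Pol) auto
      then show ?case using sub_sm[OF sW sub_img[OF sY]] sm_upper1[OF sW sub_img[OF sY]] by (simp add: \<psi>_def)
    next
      case (2 X Y)
      have le: "\<psi> X \<subseteq> \<psi> Y" unfolding \<psi>_def using 2 by (intro sm_mono) auto
      obtain y where y: "y \<in> Y" "y \<notin> X" using 2 by auto
      have yS: "y \<in> S" "y \<in> Hm ?i" "y \<in> carrier PA" using y 2 PolD by auto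
      have sX: "sub X" "colon W f \<inter> Hm ?i \<subseteq> X" "X \<subseteq> S \<inter> Hm ?i" using 2 by auto
      have "y \<boxtimes> f \<in> \<psi> Y"
        using sm_upper2[OF sW sub_img[of Y]] 2 y by (auto simp: \<psi>_def)
      moreover have "y \<boxtimes> f \<notin> \<psi> X"
      proof
        assume "y \<boxtimes> f \<in> \<psi> X"
        then obtain u g where ug: "y \<boxtimes> f = u \<boxplus> g \<boxtimes> f" "u \<in> W" "g \<in> X" by (auto simp: \<psi>_def elim!: smE)
        have gc: "g \<in> carrier PA" "u \<in> carrier PA" using ug sX(1) subD(5) W(5) by auto
        have "(y \<ominus>\<^bsub>PA\<^esub> g) \<boxtimes> f = y \<boxtimes> f \<ominus>\<^bsub>PA\<^esub> g \<boxtimes> f"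
          using yS gc fc by (simp add: A.minus_eq A.l_distr A.l_minus)
        also have "\<dots> = u" using ug(1) gc fc by (simp add: A.minus_eq A.a_assoc A.r_neg)
        finally have "(y \<ominus>\<^bsub>PA\<^esub> g) \<boxtimes> f \<in> W" using ug by simp
        moreover have "y \<ominus>\<^bsub>PA\<^esub> g \<in> S \<inter> Hm ?i" using sub_diff[OF sS, of y g] yS ug sX by blast
        ultimately have "y \<ominus>\<^bsub>PA\<^esub> g \<in> X" using sX by (auto simp: colon_def)
        then have "y \<ominus>\<^bsub>PA\<^esub> g \<boxplus> g \<in> X" using subD(3)[OF sX(1)] ug by blast
        then show False using y gc yS by (simp add: A.minus_eq A.a_assoc A.l_neg)
      qed
      ultimately show ?case using le by blast
    qed
    ultimately have "len (W \<inter> Hm j) (adj W f \<inter> Hm j) = len (colon W f \<inter> Hm ?i) (S \<inter> Hm ?i)"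
      by (rule antisym)
    also have "\<dots> = enat (HF Bs (colon W f) ?i)" using HF_len[OF nice_Bs gsubD(1,2)[OF gc]] by simp
    finally show ?thesis using True by simp
  qed
qed

lemma HF_adj:
  assumes "nice B" "gsub B W" "f \<in> Pol B" "f \<in> Hm a"
  shows "HF B W j = HF B (adj W f) j + (if a \<le> j then HF Bs (colon W f) (j - a) else 0)"
  using HF_diff[OF assms(1) gsubD(1)[OF assms(2)] gsubD(1)[OF gsub_adj(1)[OF assms]] gsub_adj(2)[OF assms] gsubD(2)[OF gsub_adj(1)[OF assms]], of j]
  unfolding len_adj[OF assms] by (auto simp: zero_enat_def split: if_splits)

end

section \<open>Hilbert series\<close>

lemma summable_poly_geometric:
  fixes t :: real
  assumes "0 \<le> t" "t < 1"
  shows "summable (\<lambda>j. real ((j + 1) ^ N) * t ^ j)"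
proof (cases "t = 0")
  case True
  then show ?thesis by (intro summable_finite[of "{0}"]) auto
next
  case False
  define c where "c = (1 + t) / 2"
  have c: "t < c" "c < 1" using assms by (auto simp: c_def)
  have "(\<lambda>j. (real (j + 2) / real (j + 1)) ^ N * t) \<longlonglongrightarrow> 1 ^ N * t"
    by (intro tendsto_intros) real_asymp
  then have "\<forall>\<^sub>F j in sequentially. (real (j + 2) / real (j + 1)) ^ N * t < c"
    using c by (intro order_tendstoD(2)[where y = "1 ^ N * t"]) auto
  then obtain n0 where n0: "\<And>j. j \<ge> n0 \<Longrightarrow> (real (j + 2) / real (j + 1)) ^ N * t < c"
    by (auto simp: eventually_sequentially)
  show ?thesis
  proof (rule summable_ratio_test[OF c(2), of n0])
    fix j assume "n0 \<le> j"
    have "real ((Suc j + 1) ^ N) * t ^ Suc j = ((real (j + 2) / real (j + 1)) ^ N * t) * (real ((j + 1) ^ N) * t ^ j)"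
      by (simp add: power_divide add.commute)
    also have "\<dots> \<le> c * (real ((j + 1) ^ N) * t ^ j)"
      using n0[OF \<open>n0 \<le> j\<close>] assms by (intro mult_right_mono) auto
    finally show "norm (real ((Suc j + 1) ^ N) * t ^ Suc j) \<le> c * norm (real ((j + 1) ^ N) * t ^ j)"
      using assms by simp
  qed
qed

context graded_poly begin

definition Hs :: "nat multiset set \<Rightarrow> (nat multiset \<Rightarrow> 'a) set \<Rightarrow> real \<Rightarrow> real" where
  "Hs B U t = (\<Sum>j. real (HF B U j) * t ^ j)"

lemma Hs_summable:
  assumes "nice B" "sub U" "U \<subseteq> Pol B" "0 \<le> t" "t < 1"
  shows "summable (\<lambda>j. real (HF B U j) * t ^ j)"
proof -
  obtain N where N: "HF B U j \<le> (j + 1) ^ N" for j using HF_bound[OF assms(1)] assms by blast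
  show ?thesis
  proof (rule summable_comparison_test'[OF summable_poly_geometric[OF assms(4,5), of N], of 0])
    fix j
    show "norm (real (HF B U j) * t ^ j) \<le> real ((j + 1) ^ N) * t ^ j"
      using N[of j] assms by (auto simp del: of_nat_power intro!: mult_right_mono)
  qed
qed

lemma Hs_nonneg:
  assumes "nice B" "sub U" "U \<subseteq> Pol B" "0 \<le> t" "t < 1" shows "0 \<le> Hs B U t"
  unfolding Hs_def using assms Hs_summable by (intro suminf_nonneg) auto

lemma Hs_mono:
  assumes "nice B" "sub U" "sub W" "U \<subseteq> W" "W \<subseteq> Pol B" "0 \<le> t" "t < 1"
  shows "Hs B W t \<le> Hs B U t"
  unfolding Hs_def
proof (intro suminf_le)
  show "real (HF B W j) * t ^ j \<le> real (HF B U j) * t ^ j" for j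
    using HF_mono[OF assms(1-5)] assms by (intro mult_right_mono) auto
qed (use assms in \<open>auto intro!: Hs_summable\<close>)

lemma Hs_full [simp]: "Hs B (Pol B) t = 0" by (simp add: Hs_def HF_full)

lemma shifted_sums:
  fixes h :: "nat \<Rightarrow> real"
  assumes "(\<lambda>j. h j * t ^ j) sums X"
  shows "(\<lambda>j. (if a \<le> j then h (j - a) else 0) * t ^ j) sums (t ^ a * X)"
proof -
  have "(\<lambda>j. t ^ a * (h j * t ^ j)) sums (t ^ a * X)" by (rule sums_mult[OF assms])
  then have "(\<lambda>j. (if a \<le> j + a then h (j + a - a) else 0) * t ^ (j + a)) sums (t ^ a * X)"
    by (simp add: power_add mult_ac)
  then show ?thesis
    by (subst (asm) sums_zero_iff_shift[where f = "\<lambda>j. (if a \<le> j then h (j - a) else 0) * t ^ j"]) auto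
qed

lemma Hs_adj:
  assumes "nice B" "gsub B W" "f \<in> Pol B" "f \<in> Hm a" "0 \<le> t" "t < 1"
  shows "Hs B W t = Hs B (adj W f) t + t ^ a * Hs Bs (colon W f) t"
proof -
  note ga = gsub_adj[OF assms(1-4)] and gc = gsub_colon[OF assms(1-4)]
  have 1: "(\<lambda>j. real (HF B (adj W f) j) * t ^ j) sums Hs B (adj W f) t"
    unfolding Hs_def using Hs_summable[OF assms(1) gsubD(1,2)[OF ga(1)] assms(5,6)] by (rule summable_sums)
  have "(\<lambda>j. real (HF Bs (colon W f) j) * t ^ j) sums Hs Bs (colon W f) t"
    unfolding Hs_def using Hs_summable[OF nice_Bs gsubD(1,2)[OF gc] assms(5,6)] by (rule summable_sums)
  note 2 = shifted_sums[OF this, of a]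
  have "(\<lambda>j. real (HF B W j) * t ^ j) sums (Hs B (adj W f) t + t ^ a * Hs Bs (colon W f) t)"
  proof (rule sums_cong[THEN iffD1, OF _ sums_add[OF 1 2]])
    show "real (HF B (adj W f) j) * t ^ j + (if a \<le> j then real (HF Bs (colon W f) (j - a)) else 0) * t ^ j
        = real (HF B W j) * t ^ j" for j
      using HF_adj[OF assms(1-4), of j] by (auto simp: algebra_simps)
  qed
  then show ?thesis unfolding Hs_def[of B W] by (rule sums_unique[symmetric])
qed

lemma Hs_Int_sm:
  assumes "nice B" "gsub B U" "gsub B W" "0 \<le> t" "t < 1"
  shows "Hs B (U \<inter> W) t + Hs B (sm U W) t = Hs B U t + Hs B W t"
proof -
  have g: "gsub B (U \<inter> W)" "gsub B (sm U W)" using assms gsub_Int gsub_sm by auto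
  note su = Hs_summable[OF assms(1) _ _ assms(4,5), THEN summable_sums, folded Hs_def, OF gsubD(1,2)]
  have "(\<lambda>j. real (HF B (U \<inter> W) j) * t ^ j + real (HF B (sm U W) j) * t ^ j)
     = (\<lambda>j. real (HF B U j) * t ^ j + real (HF B W j) * t ^ j)"
  proof
    fix j
    show "real (HF B (U \<inter> W) j) * t ^ j + real (HF B (sm U W) j) * t ^ j = real (HF B U j) * t ^ j + real (HF B W j) * t ^ j"
      using HF_Int_sm[OF assms(1-3), of j] by (metis distrib_right of_nat_add)
  qed
  then show ?thesis
    using sums_unique2[OF sums_add[OF su[OF g(1) g(1)] su[OF g(2) g(2)]], of "Hs B U t + Hs B W t"]
      sums_add[OF su[OF assms(2) assms(2)] su[OF assms(3) assms(3)]] by simp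
qed

end

section \<open>Noetherianity\<close>

lemma nat_seq_incseq: "\<exists>r. strict_mono r \<and> incseq (\<lambda>n. (x :: nat \<Rightarrow> nat) (r n))"
proof -
  obtain g where g: "strict_mono (g :: nat \<Rightarrow> nat)" "monoseq (\<lambda>n. x (g n))" using seq_monosub[of x] by blast
  show ?thesis
  proof (cases "incseq (\<lambda>n. x (g n))")
    case False
    then have d: "decseq (\<lambda>n. x (g n))" using g by (auto simp: monoseq_iff)
    define v where "v = (LEAST v. \<exists>n. x (g n) = v)"
    have "\<exists>n. x (g n) = v" unfolding v_def by (rule LeastI_ex) auto
    then obtain n0 where n0: "x (g n0) = v" by blast
    have ge: "v \<le> x (g n)" for n unfolding v_def by (rule Least_le) auto
    have "x (g (n0 + n)) = v" for n
      using decseqD[OF d, of n0 "n0 + n"] ge[of "n0 + n"] n0 by simp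
    then show ?thesis using g(1)
      by (intro exI[of _ "\<lambda>n. g (n0 + n)"]) (auto simp: strict_mono_def incseq_def)
  qed (use g in blast)
qed

text \<open>
  Pass to a subsequence along which one exponent after the other is increasing.
\<close>

lemma dickson:
  fixes m :: "nat \<Rightarrow> nat multiset"
  assumes "\<And>n. set_mset (m n) \<subseteq> {..<N}"
  shows "\<exists>i j. i < j \<and> m i \<subseteq># m j"
proof -
  have "\<exists>r. strict_mono r \<and> (\<forall>i<k. incseq (\<lambda>n. count (m (r n)) i))" for k
  proof (induction k)
    case 0 then show ?case by (intro exI[of _ "\<lambda>n. n"]) (auto simp: strict_mono_def)
  next
    case (Suc k)
    then obtain r where r: "strict_mono r" "\<And>i. i < k \<Longrightarrow> incseq (\<lambda>n. count (m (r n)) i)" by blast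
    obtain q where q: "strict_mono q" "incseq (\<lambda>n. count (m (r (q n))) k)"
      using nat_seq_incseq[of "\<lambda>n. count (m (r n)) k"] by blast
    have "incseq (\<lambda>n. count (m (r (q n))) i)" if "i < Suc k" for i
    proof (cases "i = k")
      case False
      then have "incseq (\<lambda>n. count (m (r n)) i)" using r that by simp
      then show ?thesis using q(1) by (simp add: incseq_def strict_mono_less_eq)
    qed (use q in simp)
    then show ?case using strict_mono_o[OF r(1) q(1)] by (intro exI[of _ "r \<circ> q"]) (simp add: comp_def)
  qed
  from this[of N] obtain r where r: "strict_mono r" "\<And>i. i < N \<Longrightarrow> incseq (\<lambda>n. count (m (r n)) i)" by blast
  have "count (m (r 0)) i \<le> count (m (r 1)) i" for i
  proof (cases "i < N")
    case True then show ?thesis using incseqD[OF r(2), of i 0 1] by simp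
  next
    case False
    then have "i \<notin># m (r 0)" using assms[of "r 0"] by auto
    then show ?thesis by (simp add: not_in_iff)
  qed
  then have "m (r 0) \<subseteq># m (r 1)" by (simp add: subseteq_mset_def)
  then show ?thesis using strict_monoD[OF r(1), of 0 1] by auto
qed

context graded_poly begin

text \<open>
  The leading monomial for the linear order on multisets, which is compatible with multiplication.
\<close>

definition lm :: "(nat multiset \<Rightarrow> 'a) \<Rightarrow> nat multiset" where "lm f = Max {m. f m \<noteq> \<zero>}"

lemma lm_props:
  assumes "f \<in> carrier PA" "f \<noteq> \<zero>\<^bsub>PA\<^esub>"
  shows "f (lm f) \<noteq> \<zero>" "f m \<noteq> \<zero> \<Longrightarrow> m \<le> lm f"
proof -
  have fin: "finite {m. f m \<noteq> \<zero>}" using assms by (simp add: PA_simps)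
  have ne: "{m. f m \<noteq> \<zero>} \<noteq> {}" using assms by (auto simp: PA_zero_fun)
  show "f (lm f) \<noteq> \<zero>" using Max_in[OF fin ne] by (simp add: lm_def)
  show "f m \<noteq> \<zero> \<Longrightarrow> m \<le> lm f" using Max_ge[OF fin] by (simp add: lm_def)
qed

text \<open>
  Hilbert's basis theorem by leading monomials: along an infinite strictly increasing chain pick new elements with
  least leading monomial. By Dickson's lemma one of these monomials divides a later one, and cancelling the leading term
  gives a new element with a smaller leading monomial.
\<close>

theorem gsub_noetherian:
  assumes "nice B"
  shows "wf {(U', U). gsub B U \<and> gsub B U' \<and> U \<subset> U'}"
  unfolding wf_iff_no_infinite_down_chain
proof clarify
  fix C assume C: "\<forall>i. (C (Suc i), C i) \<in> {(U', U). gsub B U \<and> gsub B U' \<and> U \<subset> U'}"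
  have g: "gsub B (C i)" and lt: "C i \<subset> C (Suc i)" for i using C by auto
  have mono: "C i \<subseteq> C j" if "i \<le> j" for i j
    by (rule lift_Suc_mono_le[OF _ that]) (use lt in blast)
  \<comment> \<open>In each step pick a new polynomial whose leading monomial is least possible.\<close>
  have "\<exists>f. f \<in> C (Suc n) - C n \<and> (\<forall>h\<in>C (Suc n) - C n. lm f \<le> lm h)" for n
  proof -
    let ?L = "lm ` (C (Suc n) - C n)"
    have "\<exists>v. v \<in> ?L" using lt[of n] by auto
    then have "(LEAST v. v \<in> ?L) \<in> ?L" by (rule LeastI_ex)
    moreover have "\<And>v. v \<in> ?L \<Longrightarrow> (LEAST v. v \<in> ?L) \<le> v" by (rule Least_le)
    moreover obtain h where "(LEAST v. v \<in> ?L) = lm h" "h \<in> C (Suc n) - C n"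
      using calculation(1) by (rule imageE)
    ultimately show ?thesis by (intro exI[of _ h]) simp
  qed
  then obtain f where f: "\<And>n. f n \<in> C (Suc n) - C n" "\<And>n h. h \<in> C (Suc n) - C n \<Longrightarrow> lm (f n) \<le> lm h"
    by metis
  have fc: "f n \<in> carrier PA" "f n \<in> Pol B" "f n \<noteq> \<zero>\<^bsub>PA\<^esub>" for n
    using f(1)[of n] gsubD[OF g[of "Suc n"]] subD(2)[OF gsubD(1)[OF g[of n]]] by auto
  have fB: "lm (f n) \<in> B" for n using lm_props(1)[OF fc(1,3)] fc(2) by (auto simp: Pol_def)
  obtain N where N: "\<forall>m\<in>B. set_mset m \<subseteq> {..<N}" using assms by (auto simp: nice_def)
  obtain i j where ij: "i < j" "lm (f i) \<subseteq># lm (f j)"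
    using dickson[of "\<lambda>n. lm (f n)" N] fB N by auto
  define b where "b = lm (f j) - lm (f i)"
  have b: "b \<in> Bs" "lm (f j) = lm (f i) + b" using assms fB[of i] fB[of j] ij unfolding nice_def b_def by auto
  define c where "c = f j (lm (f j)) \<otimes> inv (f i (lm (f i)))"
  have ci: "inv (f i (lm (f i))) \<in> carrier K" "inv (f i (lm (f i))) \<otimes> f i (lm (f i)) = \<one>"
    using lm_props(1)[OF fc(1,3), of i] fc(1)[of i] field_Units by auto
  have c: "c \<in> carrier K" "c \<otimes> f i (lm (f i)) = f j (lm (f j))"
    using ci fc by (auto simp: c_def m_assoc)
  define h where "h = f j \<ominus>\<^bsub>PA\<^esub> monom K c b \<boxtimes> f i"
  have fi: "monom K c b \<boxtimes> f i \<in> C j"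
    using gsubD(3)[OF g[of "Suc i"]] monom_Pol[OF c(1) b(1)] f(1)[of i] mono[of "Suc i" j] ij by auto
  have hC: "h \<in> C (Suc j)" unfolding h_def
    using sub_diff[OF gsubD(1)[OF g]] f(1)[of j] fi mono[of j "Suc j"] by auto
  have h_add: "h \<boxplus> monom K c b \<boxtimes> f i = f j"
    unfolding h_def using fc c by (simp add: A.minus_eq A.a_assoc A.l_neg)
  have hN: "h \<notin> C j"
  proof
    assume "h \<in> C j"
    then have "f j \<in> C j" using subD(3)[OF gsubD(1)[OF g[of j]] _ fi] h_add by metis
    then show False using f(1)[of j] by simp
  qed
  have hc: "h \<in> carrier PA" "h \<noteq> \<zero>\<^bsub>PA\<^esub>"
    using hC hN gsubD(5)[OF g[of "Suc j"]] subD(2)[OF gsubD(1)[OF g[of j]]] by auto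
  have le: "lm (f j) \<le> lm h" using f(2) hC hN by blast
  have coeff: "h m \<oplus> (monom K c b \<boxtimes> f i) m = f j m" for m using h_add by (metis PA_simps(2))
  have "h (lm (f j)) = \<zero>"
  proof -
    have e: "(monom K c b \<boxtimes> f i) (lm (f j)) = f j (lm (f j))"
      using c fc(1)[of i] b by (simp add: monom_mult)
    have "h (lm (f j)) \<oplus> f j (lm (f j)) = \<zero> \<oplus> f j (lm (f j))" using coeff[of "lm (f j)"] fc(1)[of j] e by simp
    then show ?thesis using hc(1) fc(1)[of j] by (subst (asm) add.right_cancel) auto
  qed
  then have "lm (f j) \<noteq> lm h" using lm_props(1)[OF hc] by metis
  with le have lt': "lm (f j) < lm h" by simp
  have "f j (lm h) = \<zero>" using lm_props(2)[OF fc(1,3), of j "lm h"] lt' by (meson leD)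
  moreover have "(monom K c b \<boxtimes> f i) (lm h) = \<zero>"
  proof (rule ccontr)
    assume a: "\<not> ?thesis"
    then have "b \<subseteq># lm h" "f i (lm h - b) \<noteq> \<zero>" using c fc(1)[of i] by (auto simp: monom_mult split: if_splits)
    then have "lm h - b \<le> lm (f i)" using lm_props(2)[OF fc(1,3)] by auto
    then have "lm h - b + b \<le> lm (f i) + b" by (rule add_right_mono)
    then show False using lt' b \<open>b \<subseteq># lm h\<close> by simp
  qed
  ultimately have "h (lm h) = \<zero>" using coeff[of "lm h"] hc(1) by simp
  then show False using lm_props(1)[OF hc] by simp
qed

section \<open>Filtrations with prime factors\<close>

text \<open>
  Homogeneous prime ideals, with primality tested on homogeneous elements only.
\<close>

definition hprime :: "(nat multiset \<Rightarrow> 'a) set \<Rightarrow> bool" where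
  "hprime P \<longleftrightarrow> gsub Bs P \<and> \<one>\<^bsub>PA\<^esub> \<notin> P \<and>
     (\<forall>a b f g. f \<in> S \<longrightarrow> f \<in> Hm a \<longrightarrow> g \<in> S \<longrightarrow> g \<in> Hm b \<longrightarrow> f \<boxtimes> g \<in> P \<longrightarrow> f \<in> P \<or> g \<in> P)"

lemma hprimeD:
  assumes "hprime P"
  shows "gsub Bs P" "\<one>\<^bsub>PA\<^esub> \<notin> P" "\<lbrakk>f \<in> S; f \<in> Hm a; g \<in> S; g \<in> Hm b; f \<boxtimes> g \<in> P\<rbrakk> \<Longrightarrow> f \<in> P \<or> g \<in> P"
  using assms unfolding hprime_def by blast+

text \<open>
  Filtrations from U up to W whose factors are shifted quotients of S by homogeneous primes; the list records the
  shifts and the primes.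
\<close>

inductive prime_filt :: "nat multiset set \<Rightarrow> (nat multiset \<Rightarrow> 'a) set \<Rightarrow> (nat \<times> (nat multiset \<Rightarrow> 'a) set) list \<Rightarrow> (nat multiset \<Rightarrow> 'a) set \<Rightarrow> bool"
  for B where
  prime_filt_Nil: "gsub B U \<Longrightarrow> prime_filt B U [] U"
| prime_filt_Cons: "\<lbrakk>gsub B U; f \<in> Pol B; f \<in> Hm a; hprime (colon U f); prime_filt B (adj U f) l W\<rbrakk> \<Longrightarrow> prime_filt B U ((a, colon U f) # l) W"

lemma prime_filt_gsub: "prime_filt B U l W \<Longrightarrow> nice B \<Longrightarrow> gsub B U \<and> gsub B W \<and> U \<subseteq> W"
proof (induction rule: prime_filt.induct)
  case (prime_filt_Cons U f a l W)
  then show ?case using gsub_adj(2)[of B U f a] by blast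
qed auto

lemma prime_filt_append: "prime_filt B U l V \<Longrightarrow> prime_filt B V l' W \<Longrightarrow> prime_filt B U (l @ l') W"
  by (induction rule: prime_filt.induct) (auto intro: prime_filt.intros)

lemma prime_filt_hprime: "prime_filt B U l W \<Longrightarrow> (a, Q) \<in> set l \<Longrightarrow> hprime Q"
  by (induction rule: prime_filt.induct) auto

lemma exists_homogeneous:
  assumes "gsub B U" "gsub B W" "U \<subset> W"
  obtains f a where "f \<in> W" "f \<notin> U" "f \<in> Hm a"
proof -
  obtain f where f: "f \<in> W" "f \<notin> U" using assms by auto
  have fc: "f \<in> carrier PA" using f gsubD(5)[OF assms(2)] by simp
  obtain a where "cmp a f \<notin> U" using sub_of_cmp[OF gsubD(1)[OF assms(1)] fc] f by blast
  moreover have "cmp a f \<in> W" "cmp a f \<in> Hm a" using gsubD(4)[OF assms(2)] f restr_closed[OF fc] by auto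
  ultimately show ?thesis using that by blast
qed

text \<open>An annihilator of a homogeneous element that is maximal among these annihilators is prime.\<close>

lemma exists_prime_colon:
  assumes "nice B" "gsub B U" "gsub B W" "U \<subset> W"
  obtains f a where "f \<in> W" "f \<in> Hm a" "hprime (colon U f)"
proof -
  let ?C = "{colon U f | f a. f \<in> W \<and> f \<notin> U \<and> f \<in> Hm a}"
  obtain f0 a0 where "f0 \<in> W" "f0 \<notin> U" "f0 \<in> Hm a0" using exists_homogeneous[OF assms(2-4)] .
  then have "\<exists>X. X \<in> ?C" by (intro exI[of _ "colon U f0"] CollectI exI[of _ f0] exI[of _ a0]) simp
  then obtain X where X: "X \<in> ?C" and max: "\<And>Y. (Y, X) \<in> {(U', U). gsub Bs U \<and> gsub Bs U' \<and> U \<subset> U'} \<Longrightarrow> Y \<notin> ?C"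
    using wfE_min[OF gsub_noetherian[OF nice_Bs], of _ ?C] by (metis (no_types, lifting))
  obtain f a where f: "X = colon U f" "f \<in> W" "f \<notin> U" "f \<in> Hm a" using X by blast
  have fB: "f \<in> Pol B" using f gsubD(2)[OF assms(3)] by auto
  have fc: "f \<in> carrier PA" using PolD[OF fB] .
  note gc = gsub_colon[OF assms(1,2)]
  have "hprime (colon U f)" unfolding hprime_def
  proof (intro conjI allI impI)
    show "gsub Bs (colon U f)" using gc[OF fB f(4)] .
    show "\<one>\<^bsub>PA\<^esub> \<notin> colon U f" using f fc by (simp add: colon_def)
  next
    fix i j g h assume g: "g \<in> S" "g \<in> Hm i" and h: "h \<in> S" "h \<in> Hm j" and gh: "g \<boxtimes> h \<in> colon U f"
    show "g \<in> colon U f \<or> h \<in> colon U f"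
    proof (rule disjCI)
      assume hn: "h \<notin> colon U f"
      have gS: "g \<in> carrier PA" "h \<in> carrier PA" using g h S_carrier by auto
      have hf: "h \<boxtimes> f \<in> W" "h \<boxtimes> f \<notin> U" "h \<boxtimes> f \<in> Hm (j + a)"
        using gsubD(3)[OF assms(3) h(1) f(2)] hn h mult_Pol[OF h(2) f(4), of "Dg (j + a)"] by (auto simp: colon_def)
      have hfB: "h \<boxtimes> f \<in> Pol B" using hf gsubD(2)[OF assms(3)] by auto
      have le: "colon U f \<subseteq> colon U (h \<boxtimes> f)"
      proof
        fix x assume x: "x \<in> colon U f"
        have "x \<boxtimes> (h \<boxtimes> f) = h \<boxtimes> (x \<boxtimes> f)" using x S_carrier gS fc by (simp add: colon_def A.m_lcomm)
        then show "x \<in> colon U (h \<boxtimes> f)" using x gsubD(3)[OF assms(2) h(1)] by (simp add: colon_def)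
      qed
      have "colon U (h \<boxtimes> f) \<in> ?C" using hf by blast
      then have "\<not> colon U f \<subset> colon U (h \<boxtimes> f)" using max f(1) gc[OF fB f(4)] gc[OF hfB hf(3)] by blast
      then have "colon U (h \<boxtimes> f) = colon U f" using le by blast
      moreover have "g \<in> colon U (h \<boxtimes> f)" using g gh gS fc by (simp add: colon_def A.m_assoc)
      ultimately show "g \<in> colon U f" by simp
    qed
  qed
  then show ?thesis using that f by blast
qed

lemma prime_filt_exists:
  assumes "nice B" "gsub B U" "gsub B W" "U \<subseteq> W"
  shows "\<exists>l. prime_filt B U l W"
  using gsub_noetherian[OF assms(1)] assms(2,4)
proof (induction U rule: wf_induct_rule)
  case (less U)
  show ?case
  proof (cases "U = W")
    case True then show ?thesis using prime_filt_Nil less by blast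
  next
    case False
    then obtain f a where f: "f \<in> W" "f \<in> Hm a" "hprime (colon U f)"
      using exists_prime_colon[OF assms(1) less(2) assms(3)] less by blast
    have fB: "f \<in> Pol B" using f gsubD(2)[OF assms(3)] by auto
    note ga = gsub_adj[OF assms(1) less(2) fB f(2)]
    have "f \<notin> U" using hprimeD(2)[OF f(3)] one_S PolD[OF fB] by (auto simp: colon_def)
    then have "U \<subset> adj U f" using ga by auto
    moreover have "adj U f \<subseteq> W" using adj_least[OF assms(3) less(3) f(1)] .
    ultimately obtain l where "prime_filt B (adj U f) l W" using less ga by blast
    then show ?thesis using prime_filt_Cons[OF less(2) fB f(2,3)] by blast
  qed
qed

lemma prime_filt_Hs:
  assumes "prime_filt B U l W" "nice B" "0 \<le> t" "t < 1"
  shows "Hs B U t = Hs B W t + (\<Sum>(a, Q)\<leftarrow>l. t ^ a * Hs Bs Q t)"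
  using assms by (induction rule: prime_filt.induct) (auto simp: Hs_adj)

text \<open>
  Adding a submodule Y to all members of a filtration can only shrink the factors. If q annihilates
  the module modulo Y, a factor S/Q shrinks to a quotient of S/(Q + q).
\<close>

lemma prime_filt_Hs_le:
  assumes "prime_filt B U l W" "nice B" "gsub B Y" "gsub Bs q" "\<And>g f. \<lbrakk>g \<in> q; f \<in> Pol B\<rbrakk> \<Longrightarrow> g \<boxtimes> f \<in> Y" "0 \<le> t" "t < 1"
  shows "Hs B (sm U Y) t \<le> Hs B (sm W Y) t + (\<Sum>(a, Q)\<leftarrow>l. t ^ a * Hs Bs (sm Q q) t)"
  using assms
proof (induction rule: prime_filt.induct)
  case (prime_filt_Cons U f a l W)
  have sY: "sub Y" and sq: "sub q" using prime_filt_Cons.prems gsubD(1) by blast+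
  have gUY: "gsub B (sm U Y)" using prime_filt_Cons gsub_sm by blast
  note ga = gsub_adj[OF prime_filt_Cons.prems(1) prime_filt_Cons.hyps(1-3)]
  have 1: "Hs B (sm U Y) t = Hs B (adj (sm U Y) f) t + t ^ a * Hs Bs (colon (sm U Y) f) t"
    using prime_filt_Cons gUY by (intro Hs_adj) auto
  have UY: "U \<subseteq> sm U Y" "Y \<subseteq> sm U Y"
    using sm_upper1 sm_upper2 sY gsubD(1)[OF prime_filt_Cons.hyps(1)] by auto
  note gaUY = gsub_adj[OF prime_filt_Cons.prems(1) gUY prime_filt_Cons.hyps(2,3)]
  have "adj U f \<subseteq> adj (sm U Y) f" unfolding adj_def using UY by (intro sm_mono) auto
  then have "sm (adj U f) Y \<subseteq> adj (sm U Y) f"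
    using gaUY UY by (intro sm_least gsubD(1)[OF gaUY(1)]) auto
  then have 2: "Hs B (adj (sm U Y) f) t \<le> Hs B (sm (adj U f) Y) t"
    using prime_filt_Cons.prems gaUY(1) gsub_sm[OF ga(1) prime_filt_Cons.prems(2)] by (intro Hs_mono) (auto dest: gsubD(1,2))
  note gc = gsub_colon[OF prime_filt_Cons.prems(1) prime_filt_Cons.hyps(1-3)] and gcUY = gsub_colon[OF prime_filt_Cons.prems(1) gUY prime_filt_Cons.hyps(2,3)]
  have "colon U f \<subseteq> colon (sm U Y) f" using UY by (auto simp: colon_def)
  moreover have "q \<subseteq> colon (sm U Y) f" using UY prime_filt_Cons.prems(4) prime_filt_Cons.hyps(2) gsubD(2)[OF prime_filt_Cons.prems(3)] by (auto simp: colon_def)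
  ultimately have "sm (colon U f) q \<subseteq> colon (sm U Y) f" by (intro sm_least gsubD(1)[OF gcUY])
  then have 3: "Hs Bs (colon (sm U Y) f) t \<le> Hs Bs (sm (colon U f) q) t"
    using prime_filt_Cons.prems gcUY gsub_sm[OF gc prime_filt_Cons.prems(3)] by (intro Hs_mono nice_Bs) (auto dest: gsubD(1,2))
  have 4: "t ^ a * Hs Bs (colon (sm U Y) f) t \<le> t ^ a * Hs Bs (sm (colon U f) q) t"
    using 3 prime_filt_Cons.prems by (intro mult_left_mono) auto
  have 5: "Hs B (sm (adj U f) Y) t \<le> Hs B (sm W Y) t + (\<Sum>(a, Q)\<leftarrow>l. t ^ a * Hs Bs (sm Q q) t)"
    by (rule prime_filt_Cons.IH[OF prime_filt_Cons.prems])
  show ?case using 1 2 4 5 by simp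
qed simp

lemma prime_filt_annihilates:
  assumes "prime_filt B U l W" "nice B" "g \<in> S" "\<And>v. v \<in> W \<Longrightarrow> g \<boxtimes> v \<in> U" "(a, Q) \<in> set l"
  shows "g \<in> Q"
  using assms
proof (induction rule: prime_filt.induct)
  case (prime_filt_Cons U f b l W)
  note ga = gsub_adj[OF prime_filt_Cons.prems(1) prime_filt_Cons.hyps(1-3)]
  have f: "f \<in> W" using ga prime_filt_gsub[OF prime_filt_Cons.hyps(5) prime_filt_Cons.prems(1)] by auto
  show ?case
  proof (cases "(a, Q) = (b, colon U f)")
    case True then show ?thesis using f prime_filt_Cons.prems by (auto simp: colon_def)
  next
    case False
    then show ?thesis using prime_filt_Cons.IH prime_filt_Cons.prems ga(2) by auto
  qed
qed simp

text \<open>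
  An element of all primes of the filtration moves each member of it one step down.
\<close>

lemma prime_filt_power:
  assumes "prime_filt B U l W" "nice B" "g \<in> S" "\<And>a Q. (a, Q) \<in> set l \<Longrightarrow> g \<in> Q" "v \<in> W" "length l \<le> n"
  shows "g [^]\<^bsub>PA\<^esub> n \<boxtimes> v \<in> U"
  using assms
proof (induction arbitrary: n rule: prime_filt.induct)
  case (prime_filt_Nil U)
  have "g [^]\<^bsub>PA\<^esub> n \<in> S" for n :: nat
    using prime_filt_Nil one_S S_mult by (induction n) auto
  then show ?case using prime_filt_Nil gsubD(3) by blast
next
  case (prime_filt_Cons U f b l W)
  note ga = gsub_adj[OF prime_filt_Cons.prems(1) prime_filt_Cons.hyps(1-3)]
  have gc: "g \<in> carrier PA" "v \<in> carrier PA" "f \<in> carrier PA"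
    using prime_filt_Cons.prems S_carrier gsubD(5) prime_filt_gsub[OF prime_filt_Cons.hyps(5) prime_filt_Cons.prems(1)] prime_filt_Cons.hyps PolD by blast+
  obtain n' where n: "n = Suc n'" "length l \<le> n'" using prime_filt_Cons.prems by (cases n) auto
  have "g [^]\<^bsub>PA\<^esub> n' \<boxtimes> v \<in> adj U f" using prime_filt_Cons n by auto
  then obtain u h where uh: "g [^]\<^bsub>PA\<^esub> n' \<boxtimes> v = u \<boxplus> h \<boxtimes> f" "u \<in> U" "h \<in> S" by (auto simp: adj_def elim!: smE)
  have hc: "h \<in> carrier PA" "u \<in> carrier PA" using uh S_carrier gsubD(5)[OF prime_filt_Cons.hyps(1)] by auto
  have "g [^]\<^bsub>PA\<^esub> n \<boxtimes> v = g \<boxtimes> (g [^]\<^bsub>PA\<^esub> n' \<boxtimes> v)" using gc n by (simp add: A.m_ac)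
  also have "\<dots> = g \<boxtimes> u \<boxplus> h \<boxtimes> (g \<boxtimes> f)" unfolding uh using gc hc by (simp add: A.r_distr A.m_lcomm)
  also have "\<dots> \<in> U"
  proof (rule subD(3)[OF gsubD(1)[OF prime_filt_Cons.hyps(1)]])
    have "g \<boxtimes> f \<in> U" using prime_filt_Cons.prems(3)[of b "colon U f"] by (auto simp: colon_def)
    then show "h \<boxtimes> (g \<boxtimes> f) \<in> U" using gsubD(3)[OF prime_filt_Cons.hyps(1) uh(3)] by simp
    show "g \<boxtimes> u \<in> U" using gsubD(3)[OF prime_filt_Cons.hyps(1)] prime_filt_Cons.prems uh by simp
  qed
  finally show ?case .
qed

text \<open>
  Multiplication by a homogeneous element outside P is injective on S/P, so every factor S/P of a
  filtration of V/U is visible already in V/(U : z).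
\<close>

definition vcolon where "vcolon B U z = {v \<in> Pol B. z \<boxtimes> v \<in> U}"

lemma gsub_vcolon:
  assumes "nice B" "gsub B U" "z \<in> S" "z \<in> Hm e"
  shows "gsub B (vcolon B U z)"
proof -
  have zc: "z \<in> carrier PA" using assms S_carrier by auto
  note U = gsubD[OF assms(2)]
  show ?thesis unfolding gsub_def
  proof (intro conjI ballI allI)
    have "z \<boxtimes> (cst c \<boxtimes> f) = cst c \<boxtimes> (z \<boxtimes> f)" if "c \<in> carrier K" "f \<in> Pol B" for c f
      using zc that PolD[of f B] by (simp add: A.m_lcomm)
    then show "sub (vcolon B U z)" unfolding sub_def vcolon_def
      using zc subD(2-4)[OF sub_Pol[of B]] subD(2-4)[OF U(1)] PolD
      by (auto simp: A.r_distr)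
    show "vcolon B U z \<subseteq> Pol B" by (auto simp: vcolon_def)
  next
    fix g f assume "g \<in> S" "f \<in> vcolon B U z"
    then show "g \<boxtimes> f \<in> vcolon B U z"
      using zc U(3) gsubD(3)[OF gsub_Pol[OF assms(1)]] S_carrier PolD[of f B] by (auto simp: vcolon_def A.m_lcomm)
  next
    fix j f assume f: "f \<in> vcolon B U z"
    then have fc: "f \<in> carrier PA" using PolD by (auto simp: vcolon_def)
    have "cmp (j + e) (f \<boxtimes> z) \<in> U" using f U(4) zc fc by (auto simp: vcolon_def A.m_comm)
    then have "cmp j f \<boxtimes> z \<in> U" using cmp_mult[OF fc assms(4), of "j + e"] by simp
    then show "cmp j f \<in> vcolon B U z" using f restr_Pol zc fc by (auto simp: vcolon_def A.m_comm)
  qed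
qed

lemma prime_filt_multiplicity:
  assumes "prime_filt B U l W" "nice B" "hprime P" "z \<in> S" "z \<in> Hm e" "z \<notin> P" "0 \<le> t" "t < 1"
  shows "(\<Sum>(a, Q)\<leftarrow>l. if Q = P then t ^ a * Hs Bs P t else 0) \<le> Hs B (vcolon B U z) t"
  using assms
proof (induction rule: prime_filt.induct)
  case (prime_filt_Nil U)
  then show ?case using gsub_vcolon Hs_nonneg gsubD(1,2) by (metis (no_types, lifting) list.map(1) sum_list.Nil)
next
  case (prime_filt_Cons U f a l W)
  note ga = gsub_adj[OF prime_filt_Cons.prems(1) prime_filt_Cons.hyps(1-3)]
  have zc: "z \<in> carrier PA" "f \<in> carrier PA" using prime_filt_Cons S_carrier PolD by blast+
  let ?U = "vcolon B U z" and ?A = "vcolon B (adj U f) z"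
  have gv: "gsub B ?U" "gsub B ?A" using gsub_vcolon prime_filt_Cons ga by blast+
  have le: "?U \<subseteq> ?A" using ga by (auto simp: vcolon_def)
  have IH: "(\<Sum>(a, Q)\<leftarrow>l. if Q = P then t ^ a * Hs Bs P t else 0) \<le> Hs B ?A t"
    using prime_filt_Cons by blast
  show ?case
  proof (cases "colon U f = P")
    case False
    have "Hs B ?A t \<le> Hs B ?U t" using prime_filt_Cons.prems gv le by (intro Hs_mono) (auto dest: gsubD(1,2))
    then show ?thesis using IH False by simp
  next
    case True
    have c: "colon ?U f = P"
    proof (intro equalityI subsetI)
      fix g assume "g \<in> P"
      then have g: "g \<in> S" "g \<boxtimes> f \<in> U" using True by (auto simp: colon_def)
      then have "z \<boxtimes> (g \<boxtimes> f) \<in> U" using gsubD(3)[OF prime_filt_Cons.hyps(1) prime_filt_Cons.prems(3)] by simp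
      moreover have "g \<boxtimes> f \<in> Pol B" using g gsubD(2)[OF prime_filt_Cons.hyps(1)] by auto
      ultimately show "g \<in> colon ?U f" using g by (simp add: colon_def vcolon_def)
    next
      fix g assume "g \<in> colon ?U f"
      then have g: "g \<in> S" "z \<boxtimes> (g \<boxtimes> f) \<in> U" by (auto simp: colon_def vcolon_def)
      have "z \<boxtimes> g \<in> colon U f"
        using g S_carrier zc prime_filt_Cons.prems(3) S_mult by (auto simp: colon_def A.m_assoc)
      then have zg: "g \<boxtimes> z \<in> P" using True g S_carrier zc by (simp add: A.m_comm)
      have gP: "gsub Bs P" using hprimeD prime_filt_Cons by blast
      have "cmp j g \<in> P" for j
      proof -
        have "cmp (j + e) (g \<boxtimes> z) \<in> P" using gsubD(4)[OF gP zg] .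
        then have "cmp j g \<boxtimes> z \<in> P" using cmp_mult[OF _ prime_filt_Cons.prems(4), of g "j + e"] S_carrier g by simp
        then show ?thesis
          using hprimeD(3)[OF prime_filt_Cons.prems(2) _ _ prime_filt_Cons.prems(3,4), of "cmp j g" j] prime_filt_Cons.prems(5)
            restr_Pol[OF g(1)] restr_closed[OF S_carrier[OF g(1)]] by blast
      qed
      then show "g \<in> P" using sub_of_cmp gsubD(1)[OF gP] S_carrier g by blast
    qed
    have fA: "f \<in> ?A" using gsubD(3)[OF ga(1) prime_filt_Cons.prems(3) ga(3)] prime_filt_Cons.hyps by (simp add: vcolon_def)
    have "adj ?U f \<subseteq> ?A" using adj_least[OF gv(2) le fA] .
    then have "Hs B ?A t \<le> Hs B (adj ?U f) t"
      using prime_filt_Cons.prems gv gsub_adj(1)[OF prime_filt_Cons.prems(1) gv(1) prime_filt_Cons.hyps(2,3)] by (intro Hs_mono) (auto dest: gsubD(1,2))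
    moreover have "Hs B ?U t = Hs B (adj ?U f) t + t ^ a * Hs Bs P t"
      using Hs_adj[OF prime_filt_Cons.prems(1) gv(1) prime_filt_Cons.hyps(2,3) prime_filt_Cons.prems(6,7)] c by simp
    ultimately show ?thesis using IH True by simp
  qed
qed

end

section \<open>Growth of prime quotients\<close>

lemma one_minus_power_bounds:
  fixes t :: real
  assumes "0 \<le> t" "t \<le> 1" "1 \<le> e"
  shows "1 - t \<le> 1 - t ^ e" "1 - t ^ e \<le> real e * (1 - t)"
proof -
  have "t ^ e \<le> t ^ 1" using assms by (intro power_decreasing) auto
  then show "1 - t \<le> 1 - t ^ e" by simp
  show "1 - t ^ e \<le> real e * (1 - t)"
    using Bernoulli_inequality[of "t - 1" e] assms by (simp add: algebra_simps)
qed

context graded_poly begin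

text \<open>
  The Hilbert series of S/P has a pole of exact order d at 1, in the form of two-sided bounds.
\<close>

definition grows :: "nat \<Rightarrow> (nat multiset \<Rightarrow> 'a) set \<Rightarrow> bool" where
  "grows d P \<longleftrightarrow> (\<exists>c C. c > 0 \<and> (\<forall>t. 1/2 \<le> t \<longrightarrow> t < 1 \<longrightarrow> c \<le> (1 - t) ^ d * Hs Bs P t \<and> (1 - t) ^ d * Hs Bs P t \<le> C))"

lemma hprime_cancel:
  assumes "hprime P" "z \<in> S" "z \<in> Hm e" "z \<notin> P" "g \<in> S" "g \<boxtimes> z \<in> P"
  shows "g \<in> P"
proof -
  note P = hprimeD[OF assms(1)]
  have "cmp j g \<in> P" for j
  proof -
    have "cmp (j + e) (g \<boxtimes> z) \<in> P" using gsubD(4)[OF P(1) assms(6)] .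
    then have "cmp j g \<boxtimes> z \<in> P" using cmp_mult[OF S_carrier[OF assms(5)] assms(3), of "j + e"] by simp
    then show ?thesis
      using P(3)[OF restr_Pol[OF assms(5)] restr_closed[OF S_carrier[OF assms(5)]] assms(2,3)] assms(4) by blast
  qed
  then show "g \<in> P" using sub_of_cmp gsubD(1)[OF P(1)] S_carrier assms(5) by blast
qed

lemma hprime_colon:
  assumes "hprime P" "z \<in> S" "z \<in> Hm e" "z \<notin> P"
  shows "colon P z = P"
proof (intro equalityI subsetI)
  fix g assume "g \<in> P"
  then have "g \<in> S" "g \<in> carrier PA" using gsubD(2,5)[OF hprimeD(1)[OF assms(1)]] by auto
  moreover have "z \<boxtimes> g \<in> P" using gsubD(3)[OF hprimeD(1)[OF assms(1)] assms(2) \<open>g \<in> P\<close>] .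
  ultimately show "g \<in> colon P z" using S_carrier assms(2) by (simp add: colon_def A.m_comm)
next
  fix g assume "g \<in> colon P z"
  then show "g \<in> P" using hprime_cancel[OF assms] by (simp add: colon_def)
qed

text \<open>
  Multiplication by z is injective on S/P, so cutting by z multiplies the series by \<open>1 - t ^ e\<close>.
\<close>

lemma hprime_Hs_adj:
  assumes "hprime P" "z \<in> S" "z \<in> Hm e" "z \<notin> P" "0 \<le> t" "t < 1"
  shows "(1 - t ^ e) * Hs Bs P t = Hs Bs (adj P z) t"
  using Hs_adj[OF nice_Bs hprimeD(1)[OF assms(1)] assms(2,3,5,6)] hprime_colon[OF assms(1-4)]
  by (simp add: algebra_simps)

lemma one_Hm0: "\<one>\<^bsub>PA\<^esub> \<in> Hm 0"
  using monom_Pol[of \<one> "{#}" "Dg 0"] by (simp add: PA_simps)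

lemma prime_filt_factor_supset:
  assumes "prime_filt Bs J l S" "(a, Q) \<in> set l" shows "J \<subseteq> Q"
proof
  fix g assume g: "g \<in> J"
  have J: "gsub Bs J" using prime_filt_gsub[OF assms(1) nice_Bs] by simp
  have gS: "g \<in> S" using gsubD(2)[OF J] g by auto
  show "g \<in> Q"
  proof (rule prime_filt_annihilates[OF assms(1) nice_Bs gS _ assms(2)])
    fix v assume "v \<in> S"
    then show "g \<boxtimes> v \<in> J" using gsubD(3)[OF J _ g] A.m_comm[of g v] S_carrier gS by simp
  qed
qed

text \<open>
  A homogeneous element z of positive degree outside P cuts S/P down to a module filtered by
  strictly larger primes, and (1 - t^e) times the Hilbert series of S/P is the series of the cut.
  So the order of the pole of S/P at 1 is one more than the largest order among these primes.
\<close>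

theorem hprime_growth:
  assumes "hprime P"
  shows "\<exists>d. grows d P \<and> (\<exists>C :: nat \<Rightarrow> _ set. C 0 = P \<and> (\<forall>i\<le>d. hprime (C i)) \<and> (\<forall>i<d. C i \<subset> C (Suc i)))"
  using gsub_noetherian[OF nice_Bs] assms
proof (induction P rule: wf_induct_rule)
  case (less P)
  note P = hprimeD[OF less(2)]
  show ?case
  proof (cases "\<exists>f e. f \<in> S \<and> f \<in> Hm e \<and> f \<notin> P \<and> 1 \<le> e")
    case False
    have HF0: "HF Bs P j = 0" if "1 \<le> j" for j
    proof -
      have "S \<inter> Hm j \<subseteq> P \<inter> Hm j" using False that by blast
      then have "P \<inter> Hm j = S \<inter> Hm j" using gsubD(2)[OF P(1)] by auto
      then show ?thesis by (simp add: HF_def zero_enat_def)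
    qed
    have "Bs \<inter> Dg 0 = {{#}}" by (auto simp: wt_eq_0)
    then have "HF Bs P 0 \<le> 1" using HF_le_card[OF nice_Bs gsubD(1,2)[OF P(1)], of 0] by simp
    moreover have "1 \<le> len (P \<inter> Hm 0) (S \<inter> Hm 0)"
      using P(2) one_S one_Hm0 gsubD(1,2)[OF P(1)] by (intro L.len_ge_1 sub_Int sub_Pol) auto
    then have "1 \<le> HF Bs P 0" using HF_len[OF nice_Bs gsubD(1,2)[OF P(1)], of 0] by (metis enat_ord_simps(1) one_enat_def)
    ultimately have "HF Bs P 0 = 1" by simp
    then have "(\<lambda>j. real (HF Bs P j) * t ^ j) = (\<lambda>j. if j = 0 then 1 else 0)" for t :: real
      using HF0 by (auto simp: fun_eq_iff)
    then have "Hs Bs P t = 1" for t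
      unfolding Hs_def using sums_single[of 0 "\<lambda>_. 1 :: real"] by (auto dest: sums_unique)
    then have "grows 0 P" unfolding grows_def by (intro exI[of _ 1]) auto
    then show ?thesis using less by (intro exI[of _ 0]) auto
  next
    case True
    then obtain z e where z: "z \<in> S" "z \<in> Hm e" "z \<notin> P" "1 \<le> e" by blast
    note ga = gsub_adj[OF nice_Bs P(1) z(1,2)]
    have Hse: "(1 - t ^ e) * Hs Bs P t = Hs Bs (adj P z) t" if "0 \<le> t" "t < 1" for t
      by (rule hprime_Hs_adj[OF less(2) z(1-3) that])
    obtain l where l: "prime_filt Bs (adj P z) l S"
      using prime_filt_exists[OF nice_Bs ga(1) gsub_Pol[OF nice_Bs] gsubD(2)[OF ga(1)]] by blast
    have "\<one>\<^bsub>PA\<^esub> \<notin> adj P z"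
    proof
      assume "\<one>\<^bsub>PA\<^esub> \<in> adj P z"
      then obtain u g where ug: "\<one>\<^bsub>PA\<^esub> = u \<boxplus> g \<boxtimes> z" "u \<in> P" "g \<in> S" by (auto simp: adj_def elim!: smE)
      have "\<one>\<^bsub>PA\<^esub> = cmp 0 u \<boxplus> cmp 0 (g \<boxtimes> z)" using ug(1) cmp_Hm[OF one_Hm0, of 0] by (simp flip: restr_add)
      also have "cmp 0 (g \<boxtimes> z) = \<zero>\<^bsub>PA\<^esub>" using cmp_mult[OF S_carrier[OF ug(3)] z(2), of 0] z(4) by simp
      finally have "\<one>\<^bsub>PA\<^esub> = cmp 0 u" using gsubD(5)[OF P(1) ug(2)] by simp
      then show False using P(2) gsubD(4)[OF P(1) ug(2), of 0] by simp
    qed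
    then have "adj P z \<noteq> S" using one_S by auto
    then have ne: "l \<noteq> []" using l by (auto elim: prime_filt.cases)
    have Q: "hprime Q" "P \<subset> Q" if "(a, Q) \<in> set l" for a Q
      using prime_filt_hprime[OF l that] prime_filt_factor_supset[OF l that] ga z by auto
    have "\<exists>d. grows d Q \<and> (\<exists>C :: nat \<Rightarrow> _ set. C 0 = Q \<and> (\<forall>i\<le>d. hprime (C i)) \<and> (\<forall>i<d. C i \<subset> C (Suc i)))"
      if "Q \<in> snd ` set l" for Q
      using that Q less(1) P(1) hprimeD(1) by force
    then obtain d where d: "\<And>Q. Q \<in> snd ` set l \<Longrightarrow> grows (d Q) Q"
      "\<And>Q. Q \<in> snd ` set l \<Longrightarrow> \<exists>C :: nat \<Rightarrow> _ set. C 0 = Q \<and> (\<forall>i\<le>d Q. hprime (C i)) \<and> (\<forall>i<d Q. C i \<subset> C (Suc i))"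
      by metis
    define m where "m = Max (d ` snd ` set l)"
    have dm: "d Q \<le> m" if "Q \<in> snd ` set l" for Q unfolding m_def using that by (intro Max_ge) auto
    have "m \<in> d ` snd ` set l" unfolding m_def using ne by (intro Max_in) auto
    then obtain a0 Q0 where Q0: "(a0, Q0) \<in> set l" "m = d Q0" by auto
    have Q0l: "Q0 \<in> snd ` set l" using Q0 by force
    have HQ0: "0 \<le> Hs Bs Q t" if "(a, Q) \<in> set l" "0 \<le> t" "t < 1" for a Q t
      using Hs_nonneg[OF nice_Bs gsubD(1,2)[OF hprimeD(1)[OF Q(1)[OF that(1)]]] that(2,3)] .
    have sum: "Hs Bs (adj P z) t = (\<Sum>(a, Q)\<leftarrow>l. t ^ a * Hs Bs Q t)" if "0 \<le> t" "t < 1" for t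
      using prime_filt_Hs[OF l nice_Bs that] by simp
    obtain c0 where c0: "c0 > 0" "\<And>t. 1/2 \<le> t \<Longrightarrow> t < 1 \<Longrightarrow> c0 \<le> (1 - t) ^ m * Hs Bs Q0 t"
      using d(1)[OF Q0l] Q0 unfolding grows_def by blast
    have "\<exists>C. \<forall>t. 1/2 \<le> t \<longrightarrow> t < 1 \<longrightarrow> (1 - t) ^ m * Hs Bs Q t \<le> C" if "Q \<in> snd ` set l" for Q
    proof -
      obtain C where C: "\<And>t. 1/2 \<le> t \<Longrightarrow> t < 1 \<Longrightarrow> (1 - t) ^ d Q * Hs Bs Q t \<le> C"
        using d(1)[OF \<open>Q \<in> snd ` set l\<close>] unfolding grows_def by blast
      obtain a where a: "(a, Q) \<in> set l" using \<open>Q \<in> snd ` set l\<close> by force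
      have "(1 - t) ^ m * Hs Bs Q t \<le> C" if t: "1/2 \<le> t" "t < 1" for t
      proof -
        have "(1 - t) ^ m \<le> (1 - t) ^ d Q" using t dm[OF \<open>Q \<in> snd ` set l\<close>] by (intro power_decreasing) auto
        then have "(1 - t) ^ m * Hs Bs Q t \<le> (1 - t) ^ d Q * Hs Bs Q t"
          using HQ0[OF a] t by (intro mult_right_mono) auto
        then show ?thesis using C[OF t] by simp
      qed
      then show ?thesis by blast
    qed
    then obtain C where C: "\<And>Q t. Q \<in> snd ` set l \<Longrightarrow> 1/2 \<le> t \<Longrightarrow> t < 1 \<Longrightarrow> (1 - t) ^ m * Hs Bs Q t \<le> C Q"
      by metis
    have "grows (Suc m) P" unfolding grows_def
    proof (intro exI conjI allI impI)
      show "0 < (1/2) ^ a0 * c0 / real e" using c0 z(4) by simp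
      fix t :: real assume t: "1/2 \<le> t" "t < 1"
      have b: "1 - t \<le> 1 - t ^ e" "1 - t ^ e \<le> real e * (1 - t)" using one_minus_power_bounds[of t e] t z by auto
      have HP: "0 \<le> Hs Bs P t" using Hs_nonneg[OF nice_Bs gsubD(1,2)[OF P(1)]] t by simp
      have "(1 - t) ^ Suc m * Hs Bs P t = (1 - t) ^ m * ((1 - t) * Hs Bs P t)" by simp
      also have "\<dots> \<le> (1 - t) ^ m * ((1 - t ^ e) * Hs Bs P t)"
        using b HP t by (intro mult_left_mono mult_right_mono) auto
      also have "\<dots> = (\<Sum>(a, Q)\<leftarrow>l. t ^ a * ((1 - t) ^ m * Hs Bs Q t))"
        using Hse[of t] sum[of t] t by (simp add: sum_list_const_mult[symmetric] case_prod_unfold mult_ac)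
      also have "\<dots> \<le> (\<Sum>(a, Q)\<leftarrow>l. C Q)"
      proof (rule sum_list_mono, clarify)
        fix a Q assume aQ: "(a, Q) \<in> set l"
        have "t ^ a * ((1 - t) ^ m * Hs Bs Q t) \<le> 1 * ((1 - t) ^ m * Hs Bs Q t)"
          using t HQ0[OF aQ, of t] by (intro mult_right_mono power_le_one) auto
        also have "\<dots> \<le> C Q" using C[of Q t] aQ t by force
        finally show "t ^ a * ((1 - t) ^ m * Hs Bs Q t) \<le> C Q" .
      qed
      finally show "(1 - t) ^ Suc m * Hs Bs P t \<le> (\<Sum>(a, Q)\<leftarrow>l. C Q)" .
      have "(1/2) ^ a0 * c0 \<le> t ^ a0 * ((1 - t) ^ m * Hs Bs Q0 t)"
        using t c0 by (intro mult_mono power_mono) auto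
      also have "\<dots> \<le> (\<Sum>(a, Q)\<leftarrow>l. t ^ a * ((1 - t) ^ m * Hs Bs Q t))"
      proof (rule member_le_sum_list)
        show "t ^ a0 * ((1 - t) ^ m * Hs Bs Q0 t) \<in> set (map (\<lambda>(a, Q). t ^ a * ((1 - t) ^ m * Hs Bs Q t)) l)"
          using Q0 by force
        fix x assume "x \<in> set (map (\<lambda>(a, Q). t ^ a * ((1 - t) ^ m * Hs Bs Q t)) l)"
        then show "0 \<le> x" using HQ0 t by auto
      qed
      also have "\<dots> = (1 - t) ^ m * ((1 - t ^ e) * Hs Bs P t)"
        using Hse[of t] sum[of t] t by (simp add: sum_list_const_mult[symmetric] case_prod_unfold mult_ac)
      also have "\<dots> \<le> (1 - t) ^ m * ((real e * (1 - t)) * Hs Bs P t)"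
        using b HP t by (intro mult_left_mono mult_right_mono) auto
      finally show "(1/2) ^ a0 * c0 / real e \<le> (1 - t) ^ Suc m * Hs Bs P t"
        using z(4) by (simp add: field_simps)
    qed
    moreover obtain Ch where Ch: "Ch 0 = Q0" "\<forall>i\<le>m. hprime (Ch i)" "\<forall>i<m. Ch i \<subset> Ch (Suc i)"
      using d(2)[OF Q0l] Q0 by metis
    have "\<exists>C :: nat \<Rightarrow> _ set. C 0 = P \<and> (\<forall>i\<le>Suc m. hprime (C i)) \<and> (\<forall>i<Suc m. C i \<subset> C (Suc i))"
      using Ch less(2) Q[OF Q0(1)]
      by (intro exI[of _ "\<lambda>i. case i of 0 \<Rightarrow> P | Suc i \<Rightarrow> Ch i"]) (auto split: nat.split)
    ultimately show ?thesis by blast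
  qed
qed

end

section \<open>Frobenius powers\<close>

context cring begin

lemma add_pow_dvd_zero:
  assumes "add_pow R (p :: nat) \<one> = \<zero>" "p dvd k" "z \<in> carrier R"
  shows "add_pow R k z = \<zero>"
proof -
  obtain m where m: "k = p * m" using assms by blast
  have "add_pow R p \<one> \<otimes> z = add_pow R p z" by (subst add_pow_ldistr) (use assms(3) in auto)
  then have "add_pow R p z = \<zero>" using assms by simp
  then show ?thesis unfolding m using assms by (simp flip: add.nat_pow_pow)
qed

lemma binomial_cring:
  assumes x: "x \<in> carrier R" and y: "y \<in> carrier R"
  shows "(x \<oplus> y) [^] (n :: nat) = (\<Oplus>i\<in>{..n}. add_pow R (n choose i) (x [^] i \<otimes> y [^] (n - i)))"
proof (induction n)
  case 0 then show ?case by simp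
next
  case (Suc n)
  define T where "T n i = add_pow R (n choose i) (x [^] i \<otimes> y [^] (n - i))" for n i
  have Tc [simp]: "T n i \<in> carrier R" for n i using x y by (simp add: T_def)
  have ex: "x [^] i \<otimes> y [^] k \<otimes> x = x [^] Suc i \<otimes> y [^] k" for i k :: nat using x y by (simp add: m_ac)
  have ey: "x [^] i \<otimes> y [^] k \<otimes> y = x [^] i \<otimes> y [^] Suc k" for i k :: nat using x y by (simp add: m_ac)
  have Tx: "T n i \<otimes> x = add_pow R (n choose i) (x [^] Suc i \<otimes> y [^] (n - i))" for i
    unfolding T_def by (subst add_pow_ldistr) (use x y ex in auto)
  have Ty: "T n (Suc i) \<otimes> y = add_pow R (n choose Suc i) (x [^] Suc i \<otimes> y [^] (n - i))" if "i \<le> n" for i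
  proof (cases "i = n")
    case False
    then have "n - i = Suc (n - Suc i)" using that by simp
    then show ?thesis unfolding T_def by (subst add_pow_ldistr) (use x y in \<open>auto simp: m_assoc\<close>)
  next
    case True
    have c: "n choose Suc n = 0" by (rule binomial_eq_0) simp
    have "T n (Suc n) = \<zero>" unfolding T_def c by simp
    moreover have "add_pow R (n choose Suc n) z = \<zero>" for z unfolding c by simp
    ultimately show ?thesis unfolding True by (simp only: l_null[OF y])
  qed
  have step: "T (Suc n) (Suc i) = T n i \<otimes> x \<oplus> T n (Suc i) \<otimes> y" if "i \<le> n" for i
    unfolding Tx Ty[OF that] using x y by (simp add: T_def add.nat_pow_mult add.m_comm)
  have z: "T n (Suc n) = \<zero>" by (simp add: T_def binomial_eq_0)
  have "(x \<oplus> y) [^] Suc n = (\<Oplus>i\<in>{..n}. T n i) \<otimes> (x \<oplus> y)" using Suc x y by (simp add: T_def)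
  also have "\<dots> = (\<Oplus>i\<in>{..n}. T n i \<otimes> x) \<oplus> (\<Oplus>i\<in>{..n}. T n i \<otimes> y)"
    using x y by (simp add: r_distr finsum_ldistr)
  also have "(\<Oplus>i\<in>{..n}. T n i \<otimes> y) = (\<Oplus>i\<in>{..Suc n}. T n i \<otimes> y)"
    using x y z by (subst finsum_Suc) auto
  also have "\<dots> = (\<Oplus>i\<in>{..n}. T n (Suc i) \<otimes> y) \<oplus> T n 0 \<otimes> y"
    using x y by (subst finsum_Suc2) auto
  also have "(\<Oplus>i\<in>{..n}. T n i \<otimes> x) \<oplus> ((\<Oplus>i\<in>{..n}. T n (Suc i) \<otimes> y) \<oplus> T n 0 \<otimes> y)
     = (\<Oplus>i\<in>{..n}. T n i \<otimes> x \<oplus> T n (Suc i) \<otimes> y) \<oplus> T n 0 \<otimes> y"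
    using x y by (simp add: finsum_addf a_assoc)
  also have "(\<Oplus>i\<in>{..n}. T n i \<otimes> x \<oplus> T n (Suc i) \<otimes> y) = (\<Oplus>i\<in>{..n}. T (Suc n) (Suc i))"
    using x y step by (intro finsum_cong') auto
  also have "T n 0 \<otimes> y = T (Suc n) 0" using x y by (simp add: T_def m_ac)
  also have "(\<Oplus>i\<in>{..n}. T (Suc n) (Suc i)) \<oplus> T (Suc n) 0 = (\<Oplus>i\<in>{..Suc n}. T (Suc n) i)"
    by (subst finsum_Suc2) auto
  finally show ?case by (simp only: T_def)
qed

text \<open>
  The inner binomial coefficients are divisible by p.
\<close>

lemma frobenius_add_prime:
  assumes "prime (p :: nat)" "add_pow R p \<one> = \<zero>" and x: "x \<in> carrier R" and y: "y \<in> carrier R"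
  shows "(x \<oplus> y) [^] p = x [^] p \<oplus> y [^] p"
proof -
  have p: "p > 0" using assms prime_gt_0_nat by simp
  let ?T = "\<lambda>i. add_pow R (p choose i) (x [^] i \<otimes> y [^] (p - i))"
  have Tc: "?T i \<in> carrier R" for i using x y by simp
  have T0: "?T i = \<zero>" if "0 < i" "i < p" for i
  proof (rule add_pow_dvd_zero[OF assms(2)])
    show "p dvd p choose i" using that assms(1) by (intro dvd_choose_prime) auto
  qed (use x y in simp)
  have "(x \<oplus> y) [^] p = (\<Oplus>i\<in>{..p}. ?T i)" by (rule binomial_cring[OF x y])
  also have "\<dots> = (\<Oplus>i\<in>{0, p}. ?T i)"
    using T0 Tc by (intro add.finprod_mono_neutral_cong_right) auto
  also have "\<dots> = x [^] p \<oplus> y [^] p" using x y p by (simp add: a_comm)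
  finally show ?thesis .
qed

lemma frobenius_add:
  assumes "prime (p :: nat)" "add_pow R p \<one> = \<zero>" and x: "x \<in> carrier R" and y: "y \<in> carrier R"
  shows "(x \<oplus> y) [^] (p ^ e) = x [^] (p ^ e) \<oplus> y [^] (p ^ e)"
proof (induction e)
  case (Suc e)
  have "(x \<oplus> y) [^] (p ^ Suc e) = ((x \<oplus> y) [^] (p ^ e)) [^] p"
    using x y by (simp add: nat_pow_pow mult.commute)
  also have "\<dots> = (x [^] (p ^ e)) [^] p \<oplus> (y [^] (p ^ e)) [^] p"
    using Suc x y frobenius_add_prime[OF assms(1,2)] by simp
  finally show ?case using x y by (simp add: nat_pow_pow mult.commute)
qed (use x y in simp)

end

lemma enat_sum: "enat (sum f A) = (\<Sum>a\<in>A. enat (f a))"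
  by (induction A rule: infinite_finite_induct) (simp_all add: zero_enat_def flip: plus_enat_simps(1))

locale frob_poly = graded_poly +
  fixes p :: nat
  assumes prime_p: "prime p" and char_p: "add_pow K p \<one> = \<zero>"

context graded_poly begin

lemma PA_add_pow: "f \<in> carrier PA \<Longrightarrow> (add_pow PA (n :: nat) f) m = add_pow K n (f m)"
proof (induction n)
  case (Suc n)
  then show ?case by (simp add: PA_simps(2))
qed (simp add: PA_zero_fun)

lemma monom_pow: "c \<in> carrier K \<Longrightarrow> monom K c m [^]\<^bsub>PA\<^esub> (n :: nat) = monom K (c [^] n) (repeat_mset n m)"
proof (induction n)
  case (Suc n)
  then show ?case by (simp add: monom_monom add.commute)
qed (simp add: PA_simps)

lemma S_pow: "f \<in> S \<Longrightarrow> f [^]\<^bsub>PA\<^esub> (n :: nat) \<in> S"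
  by (induction n) (auto intro: one_S S_mult)

lemma wt_repeat [simp]: "wt (repeat_mset n m) = n * wt m"
  by (induction n) auto

lemma Bs_repeat: "m \<in> Bs \<Longrightarrow> repeat_mset n m \<in> Bs"
  by (induction n) (auto intro: Bs_add)

lemma Hm_pow: "f \<in> Hm i \<Longrightarrow> f [^]\<^bsub>PA\<^esub> (n :: nat) \<in> Hm (n * i)"
proof (induction n)
  case 0 then show ?case using one_Hm0 by simp
next
  case (Suc n)
  then show ?case using mult_Pol[of "f [^]\<^bsub>PA\<^esub> n" "Dg (n * i)" f "Dg i" "Dg (Suc n * i)"] by auto
qed

lemma Hm_mult: "\<lbrakk>f \<in> Hm i; g \<in> Hm j\<rbrakk> \<Longrightarrow> f \<boxtimes> g \<in> Hm (i + j)"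
  by (rule mult_Pol) auto

definition kspan where "kspan G = \<Inter>{X. sub X \<and> G \<subseteq> X}"

lemma kspan_least: "\<lbrakk>sub X; G \<subseteq> X\<rbrakk> \<Longrightarrow> kspan G \<subseteq> X" by (auto simp: kspan_def)
lemma kspan_upper: "G \<subseteq> kspan G" by (auto simp: kspan_def)
lemma sub_carrier: "sub (carrier PA)" using sub_Pol[of UNIV] by (simp add: Pol_UNIV)
lemma sub_kspan: assumes "G \<subseteq> carrier PA" shows "sub (kspan G)"
proof -
  have "kspan G \<subseteq> carrier PA" using kspan_least[OF sub_carrier assms] .
  moreover have "\<zero>\<^bsub>PA\<^esub> \<in> kspan G" by (auto simp: kspan_def dest: subD(2))
  moreover have "f \<boxplus> g \<in> kspan G" if "f \<in> kspan G" "g \<in> kspan G" for f g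
    using that by (auto simp: kspan_def dest: subD(3))
  moreover have "cst c \<boxtimes> f \<in> kspan G" if "c \<in> carrier K" "f \<in> kspan G" for f c
    using that by (auto simp: kspan_def dest: subD(4))
  ultimately show ?thesis unfolding sub_def by blast
qed

lemma kspan_mono: "G \<subseteq> H \<Longrightarrow> kspan G \<subseteq> kspan H" by (auto simp: kspan_def)

lemma sub_vimage_mult: "\<lbrakk>sub X; g \<in> carrier PA\<rbrakk> \<Longrightarrow> sub {f \<in> carrier PA. g \<boxtimes> f \<in> X}"
proof -
  assume X: "sub X" and g: "g \<in> carrier PA"
  have "g \<boxtimes> (cst c \<boxtimes> f) = cst c \<boxtimes> (g \<boxtimes> f)" if "c \<in> carrier K" "f \<in> carrier PA" for c f
    using g that by (simp add: A.m_lcomm)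
  then show ?thesis using X g subD(2-4)[OF X] unfolding sub_def[of "Collect _"] by (auto simp: A.r_distr)
qed

lemma sub_vimage_restr: "sub X \<Longrightarrow> sub {f \<in> carrier PA. restr Y f \<in> X}"
  using subD(2-4) unfolding sub_def[of "Collect _"] by (auto simp: restr_add restr_cst)

text \<open>S is spanned by its monomials.\<close>

lemma S_closedI:
  assumes X: "sub X" and m: "\<And>a f. \<lbrakk>a \<in> Bs; f \<in> X\<rbrakk> \<Longrightarrow> monom K \<one> a \<boxtimes> f \<in> X"
    and g: "g \<in> S" and f: "f \<in> X"
  shows "g \<boxtimes> f \<in> X"
  using g
proof (induction rule: Pol_induct)
  case zero then show ?case using subD[OF X] f by auto
next
  case (add g c a)
  have fc: "f \<in> carrier PA" using subD(5)[OF X f] .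
  have "monom K c a \<boxtimes> f = cst c \<boxtimes> (monom K \<one> a \<boxtimes> f)"
    using add fc by (simp flip: A.m_assoc add: cst_monom)
  then have "monom K c a \<boxtimes> f \<in> X" using m[OF _ f, of a] subD(4)[OF X] add by simp
  then show ?case using add fc S_carrier subD(3)[OF X] by (simp add: A.l_distr)
qed

definition mset_fun :: "(nat \<Rightarrow> nat) \<Rightarrow> nat multiset" where
  "mset_fun g = (\<Sum>i<s. replicate_mset (g i) i)"

lemma count_mset_fun: "count (mset_fun g) x = (if x < s then g x else 0)"
  by (simp add: mset_fun_def count_sum)

text \<open>
  The monomials with all exponents below Q: division with remainder of exponents by Q makes them a basis of S over
  the subalgebra generated by the Q-th powers of the variables.
\<close>

definition Lam :: "nat \<Rightarrow> nat multiset set" where "Lam Q = {\<alpha> \<in> Bs. \<forall>i. count \<alpha> i < Q}"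

lemma Lam_decomp:
  assumes "m \<in> Bs" "0 < Q"
  shows "\<exists>\<alpha> m'. \<alpha> \<in> Lam Q \<and> m' \<in> Bs \<and> m = \<alpha> + repeat_mset Q m'"
proof -
  define m' where "m' = mset_fun (\<lambda>i. count m i div Q)"
  define \<alpha> where "\<alpha> = mset_fun (\<lambda>i. count m i mod Q)"
  have Bsf: "mset_fun g \<in> Bs" for g
    unfolding Bs_def by (auto simp flip: count_greater_zero_iff simp: count_mset_fun split: if_splits)
  have "count m i = 0" if "\<not> i < s" for i using assms(1) that by (auto simp: Bs_def not_in_iff)
  then have "m = \<alpha> + repeat_mset Q m'"
    by (intro multiset_eqI) (auto simp: \<alpha>_def m'_def count_mset_fun)
  then show ?thesis using assms(2) Bsf
    by (intro exI[of _ \<alpha>] exI[of _ m']) (auto simp: Lam_def \<alpha>_def m'_def count_mset_fun)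
qed

lemma Lam_unique:
  assumes "\<alpha> \<in> Lam Q" "\<beta> \<in> Lam Q" "\<alpha> + repeat_mset Q m = \<beta> + repeat_mset Q m'"
  shows "\<alpha> = \<beta>" "m = m'"
proof -
  have c: "count \<alpha> i + Q * count m i = count \<beta> i + Q * count m' i" for i
    using arg_cong[OF assms(3), of "\<lambda>m. count m i"] by simp
  have lt: "count \<alpha> i < Q" "count \<beta> i < Q" for i using assms by (auto simp: Lam_def)
  show "\<alpha> = \<beta>"
  proof (rule multiset_eqI)
    fix i show "count \<alpha> i = count \<beta> i"
      using arg_cong[OF c[of i], of "\<lambda>n. n mod Q"] lt[of i] by simp
  qed
  then show "m = m'" using c lt by (intro multiset_eqI) (metis add_left_cancel gr_implies_not_zero mult_cancel1)
qed

lemma finite_Lam: "0 < Q \<Longrightarrow> finite (Lam Q)" and card_Lam: "0 < Q \<Longrightarrow> card (Lam Q) = Q ^ s"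
proof -
  assume Q: "0 < Q"
  have Bsf: "mset_fun g \<in> Bs" for g
    unfolding Bs_def by (auto simp flip: count_greater_zero_iff simp: count_mset_fun split: if_splits)
  have b: "bij_betw (\<lambda>m. restrict (count m) {..<s}) (Lam Q) ({..<s} \<rightarrow>\<^sub>E {..<Q})"
  proof (rule bij_betwI[where g = mset_fun])
    show "(\<lambda>m. restrict (count m) {..<s}) \<in> Lam Q \<rightarrow> ({..<s} \<rightarrow>\<^sub>E {..<Q})" by (auto simp: Lam_def)
    show "mset_fun \<in> ({..<s} \<rightarrow>\<^sub>E {..<Q}) \<rightarrow> Lam Q"
      unfolding Lam_def using Bsf Q by (auto simp: count_mset_fun)
    show "mset_fun (restrict (count m) {..<s}) = m" if "m \<in> Lam Q" for m
    proof (rule multiset_eqI)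
      fix i
      have "\<not> i < s \<Longrightarrow> i \<notin># m" using that by (auto simp: Lam_def Bs_def)
      then show "count (mset_fun (restrict (count m) {..<s})) i = count m i"
        by (auto simp: count_mset_fun not_in_iff)
    qed
    show "restrict (count (mset_fun g)) {..<s} = g" if "g \<in> {..<s} \<rightarrow>\<^sub>E {..<Q}" for g
      using that by (auto simp: count_mset_fun fun_eq_iff PiE_def extensional_def)
  qed
  show "finite (Lam Q)" using bij_betw_finite[OF b] by (simp add: finite_PiE)
  show "card (Lam Q) = Q ^ s" using bij_betw_same_card[OF b] by (simp add: card_PiE)
qed

end

context frob_poly begin

lemma PA_char: "add_pow PA p \<one>\<^bsub>PA\<^esub> = \<zero>\<^bsub>PA\<^esub>"
  using char_p by (auto simp: fun_eq_iff PA_add_pow PA_zero_fun) (auto simp: PA_simps(4) monom_def)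

lemma p_pos: "0 < p" using prime_p prime_gt_0_nat by simp

lemma fr_add: "\<lbrakk>f \<in> carrier PA; g \<in> carrier PA\<rbrakk> \<Longrightarrow>
    (f \<boxplus> g) [^]\<^bsub>PA\<^esub> (p ^ e) = f [^]\<^bsub>PA\<^esub> (p ^ e) \<boxplus> g [^]\<^bsub>PA\<^esub> (p ^ e)"
  by (rule A.frobenius_add[OF prime_p PA_char])

lemma fr_zero: "\<zero>\<^bsub>PA\<^esub> [^]\<^bsub>PA\<^esub> (p ^ e) = \<zero>\<^bsub>PA\<^esub>"
  using p_pos by (simp add: A.nat_pow_zero)

lemma sub_vimage_fr:
  assumes X: "sub X" and g: "g \<in> carrier PA"
  shows "sub {f \<in> carrier PA. g \<boxtimes> f [^]\<^bsub>PA\<^esub> (p ^ e) \<in> X}"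
proof -
  have "g \<boxtimes> (cst c \<boxtimes> f) [^]\<^bsub>PA\<^esub> (p ^ e) = cst (c [^] (p ^ e)) \<boxtimes> (g \<boxtimes> f [^]\<^bsub>PA\<^esub> (p ^ e))"
    if "c \<in> carrier K" "f \<in> carrier PA" for c f
    using g that by (simp add: A.nat_pow_distrib monom_pow A.m_lcomm)
  then show ?thesis using X g subD(2-4)[OF X] unfolding sub_def[of "Collect _"]
    by (auto simp: A.r_distr fr_add fr_zero)
qed

lemma cmp_fr:
  assumes "f \<in> carrier PA"
  shows "cmp j (f [^]\<^bsub>PA\<^esub> (p ^ e)) = (if p ^ e dvd j then (cmp (j div p ^ e) f) [^]\<^bsub>PA\<^esub> (p ^ e) else \<zero>\<^bsub>PA\<^esub>)"
proof -
  have "f \<in> Pol UNIV" using assms by (simp add: Pol_UNIV)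
  then show ?thesis
  proof (induction rule: Pol_induct)
    case zero then show ?case by (simp add: fr_zero)
  next
    case (add f c m)
    have fc: "f \<in> carrier PA" using add by (simp add: Pol_UNIV)
    have Q: "0 < p ^ e" using p_pos by simp
    have cm: "cmp i (monom K c m) = (if wt m = i then monom K c m else \<zero>\<^bsub>PA\<^esub>)" for i c m
      by (rule ext) (auto simp: restr_def PA_zero_fun monom_def)
    have "cmp j (monom K c m [^]\<^bsub>PA\<^esub> (p ^ e))
        = (if p ^ e dvd j then (cmp (j div p ^ e) (monom K c m)) [^]\<^bsub>PA\<^esub> (p ^ e) else \<zero>\<^bsub>PA\<^esub>)"
    proof -
      have "wt (repeat_mset (p ^ e) m) = j \<longleftrightarrow> p ^ e dvd j \<and> wt m = j div p ^ e"
        using Q by (auto simp: nonzero_mult_div_cancel_left)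
      then show ?thesis using add(2) by (auto simp: monom_pow cm fr_zero simp del: wt_repeat)
    qed
    then show ?case using add fc by (auto simp: fr_add restr_add)
  qed
qed

text \<open>
  The extension of the Frobenius twist of J; for an ideal J it is the ideal generated by the
  powers of the elements of J, because S is free over the subalgebra generated by the powers of the
  variables, with basis the monomials in \<open>Lam\<close>.
\<close>

definition frobI :: "nat \<Rightarrow> (nat multiset \<Rightarrow> 'a) set \<Rightarrow> (nat multiset \<Rightarrow> 'a) set" where
  "frobI e J = kspan {monom K \<one> \<alpha> \<boxtimes> f [^]\<^bsub>PA\<^esub> (p ^ e) | \<alpha> f. \<alpha> \<in> Lam (p ^ e) \<and> f \<in> J}"

lemma Lam_Bs: "\<alpha> \<in> Lam Q \<Longrightarrow> \<alpha> \<in> Bs" by (simp add: Lam_def)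

context
  fixes e :: nat and J
  assumes J: "gsub Bs J"
begin

lemma frob_gen_S: "\<lbrakk>\<alpha> \<in> Lam (p ^ e); f \<in> J\<rbrakk> \<Longrightarrow> monom K \<one> \<alpha> \<boxtimes> f [^]\<^bsub>PA\<^esub> (p ^ e) \<in> S"
  using gsubD(2)[OF J] Lam_Bs by (intro S_mult S_pow monom_Pol) auto

lemma sub_frobI: "sub (frobI e J)"
  unfolding frobI_def
proof (rule sub_kspan, rule subsetI, elim CollectE exE conjE)
  fix x \<alpha> f assume "x = monom K \<one> \<alpha> \<boxtimes> f [^]\<^bsub>PA\<^esub> (p ^ e)" "\<alpha> \<in> Lam (p ^ e)" "f \<in> J"
  then show "x \<in> carrier PA" using S_carrier[OF frob_gen_S] by simp
qed

lemma frobI_gen: "\<lbrakk>\<alpha> \<in> Lam (p ^ e); f \<in> J\<rbrakk> \<Longrightarrow> monom K \<one> \<alpha> \<boxtimes> f [^]\<^bsub>PA\<^esub> (p ^ e) \<in> frobI e J"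
  unfolding frobI_def by (rule subsetD[OF kspan_upper], intro CollectI exI conjI, rule refl)

lemma frobI_least: "\<lbrakk>sub X; \<And>\<alpha> f. \<lbrakk>\<alpha> \<in> Lam (p ^ e); f \<in> J\<rbrakk> \<Longrightarrow> monom K \<one> \<alpha> \<boxtimes> f [^]\<^bsub>PA\<^esub> (p ^ e) \<in> X\<rbrakk>
    \<Longrightarrow> frobI e J \<subseteq> X"
  unfolding frobI_def by (rule kspan_least) auto

lemma frobI_monom:
  assumes "a \<in> Bs" "f \<in> J"
  shows "monom K \<one> a \<boxtimes> f [^]\<^bsub>PA\<^esub> (p ^ e) \<in> frobI e J"
proof -
  have Q: "0 < p ^ e" using p_pos by simp
  obtain \<alpha> m where am: "\<alpha> \<in> Lam (p ^ e)" "m \<in> Bs" "a = \<alpha> + repeat_mset (p ^ e) m"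
    using Lam_decomp[OF assms(1) Q] by blast
  have fc: "f \<in> carrier PA" using gsubD(5)[OF J] assms by simp
  have "monom K \<one> a = monom K \<one> \<alpha> \<boxtimes> monom K \<one> m [^]\<^bsub>PA\<^esub> (p ^ e)"
    by (simp add: monom_pow monom_monom am)
  then have "monom K \<one> a \<boxtimes> f [^]\<^bsub>PA\<^esub> (p ^ e) = monom K \<one> \<alpha> \<boxtimes> (monom K \<one> m \<boxtimes> f) [^]\<^bsub>PA\<^esub> (p ^ e)"
    using fc by (simp add: A.nat_pow_distrib A.m_assoc)
  moreover have "monom K \<one> m \<boxtimes> f \<in> J" using gsubD(3)[OF J _ assms(2)] monom_Pol am by simp
  ultimately show ?thesis using frobI_gen am by simp
qed

lemma frobI_pow: "f \<in> J \<Longrightarrow> f [^]\<^bsub>PA\<^esub> (p ^ e) \<in> frobI e J"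
  using frobI_monom[of "{#}" f] gsubD(5)[OF J] by (simp add: cst_one)

lemma gsub_frobI: "gsub Bs (frobI e J)"
  unfolding gsub_def
proof (intro conjI ballI allI)
  show "sub (frobI e J)" by (rule sub_frobI)
  show S: "frobI e J \<subseteq> S" using frobI_least[OF sub_Pol] frob_gen_S by blast
next
  fix g f assume g: "g \<in> S" and f: "f \<in> frobI e J"
  show "g \<boxtimes> f \<in> frobI e J"
  proof (rule S_closedI[OF sub_frobI _ g f])
    fix a f assume a: "a \<in> Bs" and f: "f \<in> frobI e J"
    let ?X = "{f \<in> carrier PA. monom K \<one> a \<boxtimes> f \<in> frobI e J}"
    have "frobI e J \<subseteq> ?X"
    proof (rule frobI_least)
      show "sub ?X" by (intro sub_vimage_mult sub_frobI) simp
      fix \<alpha> f assume af: "\<alpha> \<in> Lam (p ^ e)" "f \<in> J"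
      have fc: "f \<in> carrier PA" using gsubD(5)[OF J] af by simp
      have "monom K \<one> a \<boxtimes> (monom K \<one> \<alpha> \<boxtimes> f [^]\<^bsub>PA\<^esub> (p ^ e)) = monom K \<one> (a + \<alpha>) \<boxtimes> f [^]\<^bsub>PA\<^esub> (p ^ e)"
        using fc by (simp flip: A.m_assoc add: monom_monom)
      then show "monom K \<one> \<alpha> \<boxtimes> f [^]\<^bsub>PA\<^esub> (p ^ e) \<in> ?X"
        using frobI_monom[of "a + \<alpha>" f] a af Lam_Bs Bs_add fc by simp
    qed
    then show "monom K \<one> a \<boxtimes> f \<in> frobI e J" using f by auto
  qed
next
  fix j f assume f: "f \<in> frobI e J"
  let ?X = "{f \<in> carrier PA. cmp j f \<in> frobI e J}"
  have "frobI e J \<subseteq> ?X"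
  proof (rule frobI_least)
    show "sub ?X" by (intro sub_vimage_restr sub_frobI)
    fix \<alpha> f assume af: "\<alpha> \<in> Lam (p ^ e)" "f \<in> J"
    have fc: "f \<in> carrier PA" using gsubD(5)[OF J] af by simp
    show "monom K \<one> \<alpha> \<boxtimes> f [^]\<^bsub>PA\<^esub> (p ^ e) \<in> ?X"
      using fc frobI_gen[OF af(1) gsubD(4)[OF J af(2)]] subD(2)[OF sub_frobI]
      by (auto simp: cmp_monom_mult cmp_fr)
  qed
  then show "cmp j f \<in> frobI e J" using f by auto
qed

text \<open>
  Frobenius multiplies degrees by \<open>p ^ e\<close>, so splitting f into its components splits the generators of
  \<open>frobI e J\<close> into homogeneous ones.
\<close>

lemma frobI_piece:
  assumes X: "sub X"
    and gen: "\<And>\<alpha> f. \<lbrakk>\<alpha> \<in> Lam (p ^ e); wt \<alpha> \<le> j; p ^ e dvd j - wt \<alpha>; f \<in> J \<inter> Hm ((j - wt \<alpha>) div p ^ e)\<rbrakk>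
      \<Longrightarrow> monom K \<one> \<alpha> \<boxtimes> f [^]\<^bsub>PA\<^esub> (p ^ e) \<in> X"
  shows "frobI e J \<inter> Hm j \<subseteq> X"
proof -
  let ?Y = "{f \<in> carrier PA. cmp j f \<in> X}"
  have "frobI e J \<subseteq> ?Y"
  proof (rule frobI_least)
    show "sub ?Y" by (intro sub_vimage_restr X)
    fix \<alpha> f assume af: "\<alpha> \<in> Lam (p ^ e)" "f \<in> J"
    have fc: "f \<in> carrier PA" using gsubD(5)[OF J] af by simp
    show "monom K \<one> \<alpha> \<boxtimes> f [^]\<^bsub>PA\<^esub> (p ^ e) \<in> ?Y"
      using fc gen[OF af(1)] gsubD(4)[OF J af(2)] restr_closed[OF fc] subD(2)[OF X]
      by (auto simp: cmp_monom_mult cmp_fr)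
  qed
  then show ?thesis using cmp_Hm[of _ j j] by (auto dest!: subsetD)
qed

end

lemma frobI_mono: "J \<subseteq> J' \<Longrightarrow> frobI e J \<subseteq> frobI e J'"
  unfolding frobI_def by (rule kspan_mono) blast

lemma frobI_S: "frobI e S = S"
proof
  have gS: "gsub Bs S" using gsub_Pol[OF nice_Bs] .
  show "frobI e S \<subseteq> S" using gsubD(2)[OF gsub_frobI[OF gS]] .
  have "\<one>\<^bsub>PA\<^esub> \<in> frobI e S" using frobI_pow[OF gS one_S, of e] by simp
  show "S \<subseteq> frobI e S"
  proof
    fix f assume "f \<in> S"
    then show "f \<in> frobI e S" using gsubD(3)[OF gsub_frobI[OF gS] _ \<open>\<one>\<^bsub>PA\<^esub> \<in> frobI e S\<close>, of f] S_carrier by simp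
  qed
qed

lemma gsub_zero: "nice B \<Longrightarrow> gsub B {\<zero>\<^bsub>PA\<^esub>}"
  unfolding gsub_def using sub_Pol[of "{}"] subD(2)[OF sub_Pol] S_carrier by (auto simp: Pol_empty)

lemma frobI_zero: "frobI e {\<zero>\<^bsub>PA\<^esub>} = {\<zero>\<^bsub>PA\<^esub>}"
proof
  show "frobI e {\<zero>\<^bsub>PA\<^esub>} \<subseteq> {\<zero>\<^bsub>PA\<^esub>}"
    using frobI_least[OF gsub_zero[OF nice_Bs]] sub_Pol[of "{}"] by (auto simp: Pol_empty fr_zero)
  show "{\<zero>\<^bsub>PA\<^esub>} \<subseteq> frobI e {\<zero>\<^bsub>PA\<^esub>}" using subD(2)[OF sub_frobI[OF gsub_zero[OF nice_Bs]]] by simp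
qed

text \<open>
  The basis monomials that contribute to degree j.
\<close>

definition idx :: "nat \<Rightarrow> nat \<Rightarrow> nat multiset set" where
  "idx Q j = {\<alpha> \<in> Lam Q. wt \<alpha> \<le> j \<and> Q dvd j - wt \<alpha>}"

lemma finite_idx: "0 < Q \<Longrightarrow> finite (idx Q j)" using finite_Lam by (simp add: idx_def)

text \<open>
  Spanning vectors of the pieces of J' modulo J are mapped by Frobenius and multiplication with \<open>\<alpha>\<close> to spanning
  vectors on the other side. Only this inequality is proved directly; the equality follows by
  applying it to J inside S and to zero inside J, as the two bounds add up to a known number.
\<close>

lemma frobI_len_le:
  assumes J: "gsub Bs J" and J': "gsub Bs J'" and le: "J \<subseteq> J'"
  shows "len (frobI e J \<inter> Hm j) (frobI e J' \<inter> Hm j)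
    \<le> (\<Sum>\<alpha>\<in>idx (p ^ e) j. len (J \<inter> Hm ((j - wt \<alpha>) div p ^ e)) (J' \<inter> Hm ((j - wt \<alpha>) div p ^ e)))"
proof -
  let ?Q = "p ^ e"
  have Q: "0 < ?Q" using p_pos by simp
  define i where "i \<alpha> = (j - wt \<alpha>) div ?Q" for \<alpha>
  have sJ: "sub (J \<inter> Hm k)" "sub (J' \<inter> Hm k)" for k using sub_Int gsubD(1)[OF J] gsubD(1)[OF J'] sub_Pol by auto
  have "\<exists>fs. enat (length fs) = len (J \<inter> Hm (i \<alpha>)) (J' \<inter> Hm (i \<alpha>)) \<and> set fs \<subseteq> J' \<inter> Hm (i \<alpha>)
      \<and> J' \<inter> Hm (i \<alpha>) = spn (J \<inter> Hm (i \<alpha>)) fs" for \<alpha>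
  proof -
    have "len (J \<inter> Hm (i \<alpha>)) (J' \<inter> Hm (i \<alpha>)) \<noteq> \<infinity>"
      using len_piece_finite(1)[OF nice_Bs sJ, of "i \<alpha>" "i \<alpha>" "i \<alpha>"] le gsubD(2)[OF J'] by auto
    then obtain r where r: "len (J \<inter> Hm (i \<alpha>)) (J' \<inter> Hm (i \<alpha>)) = enat r" by auto
    then show ?thesis using spanning_list[OF sJ _ r] le by auto
  qed
  then obtain fs where fs: "\<And>\<alpha>. enat (length (fs \<alpha>)) = len (J \<inter> Hm (i \<alpha>)) (J' \<inter> Hm (i \<alpha>))"
    "\<And>\<alpha>. set (fs \<alpha>) \<subseteq> J' \<inter> Hm (i \<alpha>)" "\<And>\<alpha>. J' \<inter> Hm (i \<alpha>) = spn (J \<inter> Hm (i \<alpha>)) (fs \<alpha>)"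
    by metis
  obtain as where as: "set as = idx ?Q j" "distinct as" using finite_distinct_list[OF finite_idx[OF Q]] by blast
  define L where "L = concat (map (\<lambda>\<alpha>. map (\<lambda>f. monom K \<one> \<alpha> \<boxtimes> f [^]\<^bsub>PA\<^esub> ?Q) (fs \<alpha>)) as)"
  let ?F = "frobI e J \<inter> Hm j"
  have sF: "sub ?F" using sub_Int gsubD(1)[OF gsub_frobI[OF J]] sub_Pol by auto
  have Lc: "set L \<subseteq> carrier PA"
  proof
    fix x assume "x \<in> set L"
    then obtain \<alpha> f where "x = monom K \<one> \<alpha> \<boxtimes> f [^]\<^bsub>PA\<^esub> ?Q" "f \<in> set (fs \<alpha>)" by (auto simp: L_def)
    moreover from this have "f \<in> carrier PA" using fs(2) gsubD(5)[OF J'] by blast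
    ultimately show "x \<in> carrier PA" by simp
  qed
  have sX: "sub (spn ?F L)" using sub_spn[OF sF Lc] .
  have "frobI e J' \<inter> Hm j \<subseteq> spn ?F L"
  proof (rule frobI_piece[OF J' sX])
    fix \<alpha> f assume a: "\<alpha> \<in> Lam ?Q" "wt \<alpha> \<le> j" "?Q dvd j - wt \<alpha>" and f: "f \<in> J' \<inter> Hm ((j - wt \<alpha>) div ?Q)"
    have a': "\<alpha> \<in> set as" using a by (simp add: as idx_def)
    let ?Y = "{f \<in> carrier PA. monom K \<one> \<alpha> \<boxtimes> f [^]\<^bsub>PA\<^esub> ?Q \<in> spn ?F L}"
    have "spn (J \<inter> Hm (i \<alpha>)) (fs \<alpha>) \<subseteq> ?Y"
    proof (rule spn_least)
      show "sub ?Y" by (intro sub_vimage_fr sX) simp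
      show "J \<inter> Hm (i \<alpha>) \<subseteq> ?Y"
      proof
        fix g assume g: "g \<in> J \<inter> Hm (i \<alpha>)"
        have "wt \<alpha> + ?Q * i \<alpha> = j" using a by (simp add: i_def)
        then have "monom K \<one> \<alpha> \<boxtimes> g [^]\<^bsub>PA\<^esub> ?Q \<in> Hm j"
          using Hm_mult[of "monom K \<one> \<alpha>" "wt \<alpha>" "g [^]\<^bsub>PA\<^esub> ?Q" "?Q * i \<alpha>"] Hm_pow g monom_Pol by auto
        then have "monom K \<one> \<alpha> \<boxtimes> g [^]\<^bsub>PA\<^esub> ?Q \<in> ?F" using frobI_gen[OF J a(1)] g by auto
        then show "g \<in> ?Y" using spn_upper[OF sF Lc] gsubD(5)[OF J] g by auto
      qed
      show "set (fs \<alpha>) \<subseteq> ?Y"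
      proof
        fix g assume g: "g \<in> set (fs \<alpha>)"
        then have "monom K \<one> \<alpha> \<boxtimes> g [^]\<^bsub>PA\<^esub> ?Q \<in> set L" using a' by (auto simp: L_def)
        then show "g \<in> ?Y" using spn_set[OF sF Lc] gsubD(5)[OF J'] fs(2)[of \<alpha>] g by auto
      qed
    qed
    then show "monom K \<one> \<alpha> \<boxtimes> f [^]\<^bsub>PA\<^esub> ?Q \<in> spn ?F L" using f fs(3)[of \<alpha>] by (auto simp: i_def)
  qed
  then have "len ?F (frobI e J' \<inter> Hm j) \<le> len ?F (spn ?F L)" by (intro L.len_mono) auto
  also have "\<dots> \<le> enat (length L)" using len_spn_le[OF sF Lc] .
  also have "length L = (\<Sum>\<alpha>\<in>idx ?Q j. length (fs \<alpha>))"
    using as by (simp add: L_def length_concat comp_def sum_list_distinct_conv_sum_set)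
  also have "enat \<dots> = (\<Sum>\<alpha>\<in>idx ?Q j. enat (length (fs \<alpha>)))"
    by (rule enat_sum)
  finally show ?thesis by (simp add: fs(1) i_def)
qed

theorem HF_frobI:
  assumes J: "gsub Bs J"
  shows "HF Bs (frobI e J) j = (\<Sum>\<alpha>\<in>idx (p ^ e) j. HF Bs J ((j - wt \<alpha>) div p ^ e))"
proof -
  let ?Q = "p ^ e"
  define i where "i \<alpha> = (j - wt \<alpha>) div ?Q" for \<alpha>
  have Q: "0 < ?Q" using p_pos by simp
  note z = gsub_zero[OF nice_Bs] and gS = gsub_Pol[OF nice_Bs]
  have z0: "{\<zero>\<^bsub>PA\<^esub>} \<inter> Hm k = {\<zero>\<^bsub>PA\<^esub>}" for k using subD(2)[OF sub_Pol] by auto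
  have fin: "\<exists>r. len {\<zero>\<^bsub>PA\<^esub>} (X \<inter> Hm k) = enat r" if "gsub Bs X" for X k
    using len_piece_finite(1)[OF nice_Bs gsubD(1)[OF z] sub_Int[OF gsubD(1)[OF that] sub_Pol], of "Dg k" k]
      gsubD(2)[OF that] subD(2)[OF gsubD(1)[OF that]] subD(2)[OF sub_Pol[of "Dg k"]] by auto
  obtain d where d: "len {\<zero>\<^bsub>PA\<^esub>} (J \<inter> Hm k) = enat (d k)" for k using fin[OF J] by metis
  obtain D where D: "len {\<zero>\<^bsub>PA\<^esub>} (frobI e J \<inter> Hm j) = enat D" using fin[OF gsub_frobI[OF J]] by blast
  have 1: "HF Bs (frobI e J) j \<le> (\<Sum>\<alpha>\<in>idx ?Q j. HF Bs J (i \<alpha>))"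
  proof -
    have "enat (HF Bs (frobI e J) j) \<le> (\<Sum>\<alpha>\<in>idx ?Q j. enat (HF Bs J (i \<alpha>)))"
      using frobI_len_le[OF J gS gsubD(2)[OF J], of e j]
      unfolding frobI_S HF_len[OF nice_Bs gsubD(1)[OF gsub_frobI[OF J]] gsubD(2)[OF gsub_frobI[OF J]]]
        HF_len[OF nice_Bs gsubD(1)[OF J] gsubD(2)[OF J]] i_def .
    then show ?thesis by (simp flip: enat_sum)
  qed
  have 2: "D \<le> (\<Sum>\<alpha>\<in>idx ?Q j. d (i \<alpha>))"
  proof -
    have "enat D \<le> (\<Sum>\<alpha>\<in>idx ?Q j. enat (d (i \<alpha>)))"
      using frobI_len_le[OF z J, of e j] subD(2)[OF gsubD(1)[OF J]] by (simp add: frobI_zero z0 d D i_def)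
    then show ?thesis by (simp flip: enat_sum)
  qed
  have tot: "d k + HF Bs J k = card (Bs \<inter> Dg k)" for k
    using HF_diff[OF nice_Bs gsubD(1)[OF z] gsubD(1)[OF J], of k] gsubD(2)[OF J] subD(2)[OF gsubD(1)[OF J]]
    by (simp add: z0 d HF_zero[OF nice_Bs])
  have totF: "D + HF Bs (frobI e J) j = card (Bs \<inter> Dg j)"
    using HF_diff[OF nice_Bs gsubD(1)[OF z] gsubD(1)[OF gsub_frobI[OF J, of e]], of j] gsubD(2)[OF gsub_frobI[OF J]]
      subD(2)[OF gsubD(1)[OF gsub_frobI[OF J]]]
    by (simp add: z0 D HF_zero[OF nice_Bs])
  have 3: "(\<Sum>\<alpha>\<in>idx ?Q j. card (Bs \<inter> Dg (i \<alpha>))) \<le> card (Bs \<inter> Dg j)"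
  proof -
    let ?f = "\<lambda>(\<alpha>, m). \<alpha> + repeat_mset ?Q m"
    have "(\<Sum>\<alpha>\<in>idx ?Q j. card (Bs \<inter> Dg (i \<alpha>))) = card (Sigma (idx ?Q j) (\<lambda>\<alpha>. Bs \<inter> Dg (i \<alpha>)))"
      using finite_idx[OF Q] nice_finite[OF nice_Bs] by (simp add: card_SigmaI)
    also have "\<dots> \<le> card (Bs \<inter> Dg j)"
    proof (rule card_inj_on_le[of ?f])
      show "inj_on ?f (Sigma (idx ?Q j) (\<lambda>\<alpha>. Bs \<inter> Dg (i \<alpha>)))"
      proof (rule inj_onI, clarify)
        fix \<alpha> m \<beta> m' assume "\<alpha> \<in> idx ?Q j" "\<beta> \<in> idx ?Q j" "\<alpha> + repeat_mset ?Q m = \<beta> + repeat_mset ?Q m'"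
        then show "\<alpha> = \<beta> \<and> m = m'" using Lam_unique[of \<alpha> ?Q \<beta> m m'] by (simp add: idx_def)
      qed
      show "?f ` Sigma (idx ?Q j) (\<lambda>\<alpha>. Bs \<inter> Dg (i \<alpha>)) \<subseteq> Bs \<inter> Dg j"
        using Bs_add Lam_Bs Bs_repeat by (auto simp: idx_def i_def)
      show "finite (Bs \<inter> Dg j)" by (rule nice_finite[OF nice_Bs])
    qed
    finally show ?thesis .
  qed
  have "(\<Sum>\<alpha>\<in>idx ?Q j. card (Bs \<inter> Dg (i \<alpha>))) = (\<Sum>\<alpha>\<in>idx ?Q j. d (i \<alpha>)) + (\<Sum>\<alpha>\<in>idx ?Q j. HF Bs J (i \<alpha>))"
    by (simp flip: tot add: sum.distrib)
  with 1 2 3 totF show ?thesis unfolding i_def by linarith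
qed

text \<open>
  The sum over this basis of the monomials counted by weight: the factor between the Hilbert series of S and that of the
  subalgebra.
\<close>

definition ZQ :: "nat \<Rightarrow> real \<Rightarrow> real" where "ZQ Q t = (\<Sum>\<alpha>\<in>Lam Q. t ^ wt \<alpha>)"

lemma ZQ_bounds:
  assumes "0 < Q" "0 \<le> t" "t \<le> 1"
  shows "ZQ Q t \<le> real (Q ^ s)" "\<exists>A. \<forall>t. 0 \<le> t \<longrightarrow> t \<le> 1 \<longrightarrow> real (Q ^ s) * t ^ A \<le> ZQ Q t"
proof -
  have "ZQ Q t \<le> (\<Sum>\<alpha>\<in>Lam Q. 1)" unfolding ZQ_def using assms by (intro sum_mono power_le_one) auto
  then show "ZQ Q t \<le> real (Q ^ s)" using card_Lam[OF assms(1)] by simp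
  define A where "A = Max (wt ` Lam Q)"
  show "\<exists>A. \<forall>t. 0 \<le> t \<longrightarrow> t \<le> 1 \<longrightarrow> real (Q ^ s) * t ^ A \<le> ZQ Q t"
  proof (intro exI[of _ A] allI impI)
    fix t :: real assume t: "0 \<le> t" "t \<le> 1"
    have "(\<Sum>\<alpha>\<in>Lam Q. t ^ A) \<le> ZQ Q t" unfolding ZQ_def
      using t finite_Lam[OF assms(1)] by (intro sum_mono power_decreasing) (auto simp: A_def)
    then show "real (Q ^ s) * t ^ A \<le> ZQ Q t" using card_Lam[OF assms(1)] by simp
  qed
qed

text \<open>Kunz's theorem for the polynomial ring, in the form of an identity of Hilbert series.\<close>

theorem Hs_frobI:
  assumes J: "gsub Bs J" and t: "0 \<le> t" "t < 1"
  shows "Hs Bs (frobI e J) t = ZQ (p ^ e) t * Hs Bs J (t ^ (p ^ e))"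
proof -
  let ?Q = "p ^ e"
  have Q: "0 < ?Q" using p_pos by simp
  have tQ: "0 \<le> t ^ ?Q" "t ^ ?Q < 1" using t Q by (auto simp: power_less_one_iff)
  have "(\<lambda>j. real (HF Bs J j) * (t ^ ?Q) ^ j) sums Hs Bs J (t ^ ?Q)"
    unfolding Hs_def using Hs_summable[OF nice_Bs gsubD(1,2)[OF J] tQ] by (rule summable_sums)
  then have "(\<lambda>j. (if ?Q dvd ?Q * j then real (HF Bs J (?Q * j div ?Q)) else 0) * t ^ (?Q * j)) sums Hs Bs J (t ^ ?Q)"
    using Q by (simp add: power_mult)
  then have a: "(\<lambda>j. (if ?Q dvd j then real (HF Bs J (j div ?Q)) else 0) * t ^ j) sums Hs Bs J (t ^ ?Q)"
    by (subst (asm) sums_mono_reindex[where g = "\<lambda>j. ?Q * j" and f = "\<lambda>j. (if ?Q dvd j then real (HF Bs J (j div ?Q)) else 0) * t ^ j"])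
      (use Q in \<open>auto simp: strict_mono_def\<close>)
  have "(\<lambda>j. \<Sum>\<alpha>\<in>Lam ?Q. (if wt \<alpha> \<le> j then (if ?Q dvd j - wt \<alpha> then real (HF Bs J ((j - wt \<alpha>) div ?Q)) else 0) else 0) * t ^ j)
      sums (\<Sum>\<alpha>\<in>Lam ?Q. t ^ wt \<alpha> * Hs Bs J (t ^ ?Q))"
    by (intro sums_sum shifted_sums[OF a])
  moreover have "(\<Sum>\<alpha>\<in>Lam ?Q. (if wt \<alpha> \<le> j then (if ?Q dvd j - wt \<alpha> then real (HF Bs J ((j - wt \<alpha>) div ?Q)) else 0) else 0) * t ^ j)
      = real (HF Bs (frobI e J) j) * t ^ j" for j
  proof -
    have "real (HF Bs (frobI e J) j) = (\<Sum>\<alpha>\<in>Lam ?Q. if wt \<alpha> \<le> j \<and> ?Q dvd j - wt \<alpha> then real (HF Bs J ((j - wt \<alpha>) div ?Q)) else 0)"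
      unfolding HF_frobI[OF J] idx_def using finite_Lam[OF Q] by (auto simp: sum.inter_filter intro!: sum.cong)
    then show ?thesis by (auto simp: sum_distrib_right intro!: sum.cong)
  qed
  ultimately have "(\<lambda>j. real (HF Bs (frobI e J) j) * t ^ j) sums (ZQ ?Q t * Hs Bs J (t ^ ?Q))"
    by (simp add: ZQ_def sum_distrib_right)
  then show ?thesis unfolding Hs_def[of Bs "frobI e J"] by (rule sums_unique[symmetric])
qed

end

section \<open>Free modules and ideals generated by powers\<close>

context graded_poly begin

text \<open>
  The free S-module of rank r has the monomials that contain exactly one of the variables \<open>s, \<dots>, s + r - 1\<close>,
  exactly once.
\<close>

definition Bv :: "nat \<Rightarrow> nat multiset set" where
  "Bv r = {add_mset (s + l) m | l m. l < r \<and> m \<in> Bs}"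

lemma Bs_not: "m \<in> Bs \<Longrightarrow> s + l \<notin># m" by (auto simp: Bs_def)

lemma Bv_inj:
  assumes "add_mset (s + l) m = add_mset (s + l') m'" "m \<in> Bs" "m' \<in> Bs"
  shows "l = l'" "m = m'"
proof -
  have "s + l \<in># add_mset (s + l') m'" using assms(1) by (metis union_single_eq_member)
  then show "l = l'" using Bs_not[OF assms(3), of l] by auto
  then show "m = m'" using assms(1) by simp
qed

lemma nice_Bv: "nice (Bv r)"
  unfolding nice_def
proof (intro conjI ballI impI)
  fix a m assume "a \<in> Bs" "m \<in> Bv r"
  then obtain l m' where "m = add_mset (s + l) m'" "l < r" "m' \<in> Bs" by (auto simp: Bv_def)
  then show "a + m \<in> Bv r" using Bs_add[OF \<open>a \<in> Bs\<close>] unfolding Bv_def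
    by (intro CollectI exI[of _ l] exI[of _ "a + m'"]) auto
next
  fix m m' assume "m \<in> Bv r" "m' \<in> Bv r" and le: "m \<subseteq># m'"
  then obtain l a l' a' where *: "m = add_mset (s + l) a" "a \<in> Bs" "m' = add_mset (s + l') a'" "a' \<in> Bs" by (auto simp: Bv_def)
  have "s + l \<in># m'" using le * by (auto dest: mset_subset_eqD)
  then have "l = l'" using * Bs_not by auto
  then have "m' - m = a' - a" using * by simp
  then show "m' - m \<in> Bs" using * by (auto simp: Bs_def dest: in_diffD)
next
  show "\<exists>N. \<forall>m\<in>Bv r. set_mset m \<subseteq> {..<N}"
    by (intro exI[of _ "s + r"]) (force simp: Bv_def Bs_def)
qed

text \<open>
  The coordinate of f at the basis element \<open>s + l\<close>.
\<close>

definition coord :: "nat \<Rightarrow> (nat multiset \<Rightarrow> 'a) \<Rightarrow> nat multiset \<Rightarrow> 'a" where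
  "coord l f = (\<lambda>m. if m \<in> Bs then f (add_mset (s + l) m) else \<zero>)"

lemma coord_S: "f \<in> carrier PA \<Longrightarrow> coord l f \<in> S"
proof -
  assume f: "f \<in> carrier PA"
  have "{m. coord l f m \<noteq> \<zero>} \<subseteq> add_mset (s + l) -` {m. f m \<noteq> \<zero>}" by (auto simp: coord_def)
  moreover have "finite (add_mset (s + l) -` {m. f m \<noteq> \<zero>})"
    using f by (intro finite_vimageI) (auto simp: PA_simps inj_def)
  ultimately have "finite {m. coord l f m \<noteq> \<zero>}" by (rule finite_subset)
  moreover have "coord l f m \<in> carrier K" "coord l f m \<noteq> \<zero> \<Longrightarrow> m \<in> Bs" for m
    using f by (cases "m \<in> Bs"; simp add: coord_def)+
  ultimately show ?thesis unfolding Pol_def PA_simps(1) by blast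
qed

lemma coord_add: "coord l (f \<boxplus> g) = coord l f \<boxplus> coord l g"
  by (rule ext) (auto simp: coord_def PA_simps(2))

lemma coord_zero: "coord l \<zero>\<^bsub>PA\<^esub> = \<zero>\<^bsub>PA\<^esub>"
  by (rule ext) (auto simp: coord_def PA_zero_fun)

lemma coord_cmp:
  "coord l (cmp j f) = (if w (s + l) \<le> j then cmp (j - w (s + l)) (coord l f) else \<zero>\<^bsub>PA\<^esub>)"
  by (rule ext) (auto simp: coord_def restr_apply PA_zero_fun wt_def)

lemma coord_mult:
  assumes g: "g \<in> S" and f: "f \<in> carrier PA"
  shows "coord l (g \<boxtimes> f) = g \<boxtimes> coord l f"
  using g
proof (induction rule: Pol_induct)
  case zero then show ?case using f S_carrier[OF coord_S[OF f]] by (simp add: coord_zero)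
next
  case (add g c a)
  have cS: "coord l f \<in> carrier PA" using S_carrier[OF coord_S[OF f]] .
  have "coord l (monom K c a \<boxtimes> f) = monom K c a \<boxtimes> coord l f"
  proof (rule ext)
    fix m
    have xa: "s + l \<notin># a" using Bs_not add by blast
    have sub: "a \<subseteq># add_mset (s + l) m \<longleftrightarrow> a \<subseteq># m"
    proof
      assume le: "a \<subseteq># add_mset (s + l) m"
      have "count a i \<le> count m i" for i
        using mset_subset_eq_count[OF le, of i] xa by (cases "i = s + l") (auto simp: not_in_iff)
      then show "a \<subseteq># m" by (simp add: subseteq_mset_def)
    qed (simp add: subset_mset.add_increasing subset_mset.order_trans[of a m])
    have dif: "a \<subseteq># m \<Longrightarrow> add_mset (s + l) m - a = add_mset (s + l) (m - a)"
      using xa by (simp add: add_mset_diff_bothsides diff_add_mset_swap)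
    have mB: "a \<subseteq># m \<Longrightarrow> m \<in> Bs \<longleftrightarrow> m - a \<in> Bs"
      using Bs_add[of a "m - a"] add by (auto simp: Bs_def dest: in_diffD)
    show "coord l (monom K c a \<boxtimes> f) m = (monom K c a \<boxtimes> coord l f) m"
      using add f cS by (cases "a \<subseteq># m") (auto simp: coord_def monom_mult sub dif mB)
  qed
  then show ?case using add f cS S_carrier by (simp add: A.l_distr coord_add)
qed

lemma coord_cst: "\<lbrakk>c \<in> carrier K; f \<in> carrier PA\<rbrakk> \<Longrightarrow> coord l (cst c \<boxtimes> f) = cst c \<boxtimes> coord l f"
  by (intro coord_mult cst_S)

definition basis_vec where "basis_vec l = monom K \<one> {#s + l#}"

lemma basis_vec: "basis_vec l \<in> carrier PA" "l < r \<Longrightarrow> basis_vec l \<in> Pol (Bv r)" "basis_vec l \<in> Hm (w (s + l))"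
  unfolding basis_vec_def by (auto intro!: monom_Pol simp: Bv_def wt_def)

lemma coord_basis_vec: "coord l (basis_vec l') = (if l = l' then \<one>\<^bsub>PA\<^esub> else \<zero>\<^bsub>PA\<^esub>)"
  by (rule ext) (auto simp: coord_def basis_vec_def monom_def PA_simps(4) PA_zero_fun)

lemma coord_mult_basis_vec: "g \<in> S \<Longrightarrow> coord l (g \<boxtimes> basis_vec l') = (if l = l' then g else \<zero>\<^bsub>PA\<^esub>)"
  using coord_mult[OF _ basis_vec(1), of g l l'] S_carrier[of g] by (simp add: coord_basis_vec)

lemma coord_decomp:
  assumes f: "f \<in> Pol (Bv r)" and U: "sub U" and c: "\<And>l. l < r \<Longrightarrow> coord l f \<boxtimes> basis_vec l \<in> U"
  shows "f \<in> U"
proof -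
  have fc: "f \<in> carrier PA" using PolD[OF f] .
  have "i \<le> r \<Longrightarrow> restr (Bv i) f \<in> U" for i
  proof (induction i)
    case 0
    have "restr (Bv 0) f = \<zero>\<^bsub>PA\<^esub>" by (rule ext) (simp add: restr_def Bv_def PA_zero_fun)
    then show ?case using subD(2)[OF U] by simp
  next
    case (Suc i)
    let ?Y = "add_mset (s + i) ` Bs"
    have e: "Bv (Suc i) = Bv i \<union> ?Y" by (auto simp: Bv_def less_Suc_eq)
    have d: "Bv i \<inter> ?Y = {}" using Bv_inj(1) by (fastforce simp: Bv_def)
    have "restr ?Y f = basis_vec i \<boxtimes> coord i f"
    proof (rule ext)
      fix m
      show "restr ?Y f m = (basis_vec i \<boxtimes> coord i f) m"
      proof (cases "s + i \<in># m")
        case True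
        then obtain m' where "m = add_mset (s + i) m'" by (metis insert_DiffM)
        then show ?thesis using S_carrier[OF coord_S[OF fc]] fc
          by (auto simp: basis_vec_def monom_mult restr_apply) (auto simp: coord_def)
      next
        case False
        then show ?thesis using S_carrier[OF coord_S[OF fc]] by (auto simp: basis_vec_def monom_mult restr_apply)
      qed
    qed
    also have "\<dots> = coord i f \<boxtimes> basis_vec i" using S_carrier[OF coord_S[OF fc]] basis_vec(1) by (simp add: A.m_comm)
    finally have "restr (Bv (Suc i)) f = restr (Bv i) f \<boxplus> coord i f \<boxtimes> basis_vec i"
      unfolding e using restr_Un[OF fc d] by simp
    then show ?case using Suc c[of i] subD(3)[OF U] by simp
  qed
  from this[of r] show ?thesis using restr_id[OF f] by simp
qed

text \<open>
  For \<open>i = 0\<close> this is JV; the coordinates below i are unrestricted in order to pass from JV to V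
  one coordinate at a time.
\<close>

definition extJ :: "nat \<Rightarrow> nat \<Rightarrow> (nat multiset \<Rightarrow> 'a) set \<Rightarrow> (nat multiset \<Rightarrow> 'a) set" where
  "extJ r i J = {f \<in> Pol (Bv r). \<forall>l. i \<le> l \<longrightarrow> l < r \<longrightarrow> coord l f \<in> J}"

lemma gsub_extJ:
  assumes "gsub Bs J" shows "gsub (Bv r) (extJ r i J)"
  unfolding gsub_def
proof (intro conjI ballI allI)
  note J = gsubD[OF assms] and V = gsubD[OF gsub_Pol[OF nice_Bv, of r]]
  show "sub (extJ r i J)"
    using subD(2-4)[OF J(1)] subD(2-5)[OF V(1)] unfolding sub_def extJ_def
    by (auto simp: coord_add coord_zero coord_cst)
  show "extJ r i J \<subseteq> Pol (Bv r)" by (auto simp: extJ_def)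
  show "g \<boxtimes> f \<in> extJ r i J" if "g \<in> S" "f \<in> extJ r i J" for g f
    using that J(3) V(3,5) by (auto simp: extJ_def coord_mult)
  show "cmp j f \<in> extJ r i J" if "f \<in> extJ r i J" for j f
    using that J(4) V(4) subD(2)[OF J(1)] by (auto simp: extJ_def coord_cmp)
qed

lemma Hs_extJ:
  assumes J: "gsub Bs J" and t: "0 \<le> t" "t < 1"
  shows "Hs (Bv r) (extJ r 0 J) t = (\<Sum>l<r. t ^ w (s + l)) * Hs Bs J t"
proof -
  have z: "\<zero>\<^bsub>PA\<^esub> \<in> J" using subD(2)[OF gsubD(1)[OF J]] .
  have "i \<le> r \<Longrightarrow> Hs (Bv r) (extJ r 0 J) t = Hs (Bv r) (extJ r i J) t + (\<Sum>l<i. t ^ w (s + l)) * Hs Bs J t" for i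
  proof (induction i)
    case (Suc i)
    then have ir: "i < r" by simp
    note g = gsub_extJ[OF J, of r i] and X = basis_vec(2)[OF ir] basis_vec(3)[of i]
    have "colon (extJ r i J) (basis_vec i) = J"
    proof (intro equalityI subsetI)
      fix g assume "g \<in> colon (extJ r i J) (basis_vec i)"
      then have "g \<in> S" "coord i (g \<boxtimes> basis_vec i) \<in> J" using ir by (auto simp: colon_def extJ_def)
      then show "g \<in> J" by (simp add: coord_mult_basis_vec)
    next
      fix g assume g: "g \<in> J"
      then have gS: "g \<in> S" using gsubD(2)[OF J] by auto
      have "g \<boxtimes> basis_vec i \<in> Pol (Bv r)" using gsubD(3)[OF gsub_Pol[OF nice_Bv] gS X(1)] .
      then show "g \<in> colon (extJ r i J) (basis_vec i)" using gS g z by (auto simp: colon_def extJ_def coord_mult_basis_vec)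
    qed
    moreover have "adj (extJ r i J) (basis_vec i) = extJ r (Suc i) J"
    proof
      show "adj (extJ r i J) (basis_vec i) \<subseteq> extJ r (Suc i) J"
        using gsub_extJ[OF J] X z by (intro adj_least) (auto simp: extJ_def coord_basis_vec)
      show "extJ r (Suc i) J \<subseteq> adj (extJ r i J) (basis_vec i)"
      proof
        fix f assume f: "f \<in> extJ r (Suc i) J"
        have fc: "f \<in> Pol (Bv r)" "f \<in> carrier PA" using f PolD by (auto simp: extJ_def)
        have c: "coord i f \<in> S" "coord i f \<boxtimes> basis_vec i \<in> Pol (Bv r)"
          using coord_S[OF fc(2)] gsubD(3)[OF gsub_Pol[OF nice_Bv] _ X(1)] by auto
        define g where "g = f \<ominus>\<^bsub>PA\<^esub> coord i f \<boxtimes> basis_vec i"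
        have gV: "g \<in> Pol (Bv r)" unfolding g_def using sub_diff[OF sub_Pol fc(1) c(2)] .
        have gf: "g \<boxplus> coord i f \<boxtimes> basis_vec i = f"
          unfolding g_def using fc PolD[OF c(2)] by (simp add: A.minus_eq A.a_assoc A.l_neg)
        have cg: "coord l g \<boxplus> coord l (coord i f \<boxtimes> basis_vec i) = coord l f" for l using gf by (metis coord_add)
        have cS: "coord l g \<in> carrier PA" "coord l f \<in> carrier PA" for l using S_carrier[OF coord_S] PolD[OF gV] fc by auto
        have "coord l g \<in> J" if "i \<le> l" "l < r" for l
        proof (cases "l = i")
          case True
          have "coord i g \<boxplus> coord i f = \<zero>\<^bsub>PA\<^esub> \<boxplus> coord i f" using cg[of i] c cS by (simp add: coord_mult_basis_vec)
          then have "coord i g = \<zero>\<^bsub>PA\<^esub>" using cS A.add.right_cancel[of "coord i f" "coord i g" "\<zero>\<^bsub>PA\<^esub>"] by simp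
          then show ?thesis using True z by simp
        next
          case False
          then have "coord l g = coord l f" using cg[of l] c cS by (simp add: coord_mult_basis_vec)
          then show ?thesis using False that f by (simp add: extJ_def)
        qed
        then have "g \<in> extJ r i J" using gV by (simp add: extJ_def)
        then have "g \<in> adj (extJ r i J) (basis_vec i)" using gsub_adj(2)[OF nice_Bv g X] by auto
        moreover have "coord i f \<boxtimes> basis_vec i \<in> adj (extJ r i J) (basis_vec i)"
          using gsubD(3)[OF gsub_adj(1)[OF nice_Bv g X] c(1) gsub_adj(3)[OF nice_Bv g X]] .
        ultimately show "f \<in> adj (extJ r i J) (basis_vec i)"
          using subD(3)[OF gsubD(1)[OF gsub_adj(1)[OF nice_Bv g X]]] gf by metis
      qed
    qed
    ultimately have "Hs (Bv r) (extJ r i J) t = Hs (Bv r) (extJ r (Suc i) J) t + t ^ w (s + i) * Hs Bs J t"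
      using Hs_adj[OF nice_Bv g X t] by simp
    then show ?case using Suc by (simp add: algebra_simps)
  qed simp
  from this[of r] have "Hs (Bv r) (extJ r 0 J) t = Hs (Bv r) (extJ r r J) t + (\<Sum>l<r. t ^ w (s + l)) * Hs Bs J t" by simp
  moreover have "extJ r r J = Pol (Bv r)" by (auto simp: extJ_def)
  ultimately show ?thesis by simp
qed

definition prodV :: "nat multiset set \<Rightarrow> (nat multiset \<Rightarrow> 'a) set \<Rightarrow> (nat multiset \<Rightarrow> 'a) set" where
  "prodV B G = kspan {f \<boxtimes> v | f v. f \<in> G \<and> v \<in> Pol B}"

lemma prodV_least: "\<lbrakk>sub X; \<And>f v. \<lbrakk>f \<in> G; v \<in> Pol B\<rbrakk> \<Longrightarrow> f \<boxtimes> v \<in> X\<rbrakk> \<Longrightarrow> prodV B G \<subseteq> X"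
  unfolding prodV_def by (rule kspan_least) auto

lemma prodV_gen: "\<lbrakk>f \<in> G; v \<in> Pol B\<rbrakk> \<Longrightarrow> f \<boxtimes> v \<in> prodV B G"
  unfolding prodV_def by (rule subsetD[OF kspan_upper], intro CollectI exI conjI, rule refl)

lemma gsub_prodV:
  assumes B: "nice B" and G: "G \<subseteq> S" and hom: "\<And>f. f \<in> G \<Longrightarrow> \<exists>a. f \<in> Hm a"
  shows "gsub B (prodV B G)"
proof -
  note V = gsubD[OF gsub_Pol[OF B]]
  have Gc: "f \<in> G \<Longrightarrow> f \<in> carrier PA" for f using G S_carrier by auto
  have sub: "sub (prodV B G)" unfolding prodV_def
  proof (rule sub_kspan, rule subsetI, elim CollectE exE conjE)
    fix x f v assume "x = f \<boxtimes> v" "f \<in> G" "v \<in> Pol B"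
    then show "x \<in> carrier PA" using Gc PolD by simp
  qed
  show ?thesis unfolding gsub_def
  proof (intro conjI ballI allI)
    show "sub (prodV B G)" by (rule sub)
    show "prodV B G \<subseteq> Pol B" using V(3) G by (intro prodV_least sub_Pol) auto
  next
    fix g f assume g: "g \<in> S" and f: "f \<in> prodV B G"
    have "prodV B G \<subseteq> {f \<in> carrier PA. g \<boxtimes> f \<in> prodV B G}"
    proof (rule prodV_least)
      show "sub {f \<in> carrier PA. g \<boxtimes> f \<in> prodV B G}" using sub_vimage_mult sub S_carrier[OF g] by auto
      fix f v assume fv: "f \<in> G" "v \<in> Pol B"
      then have "g \<boxtimes> (f \<boxtimes> v) = f \<boxtimes> (g \<boxtimes> v)" using Gc PolD S_carrier[OF g] by (simp add: A.m_lcomm)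
      then show "f \<boxtimes> v \<in> {f \<in> carrier PA. g \<boxtimes> f \<in> prodV B G}"
        using prodV_gen[OF fv(1) V(3)[OF g fv(2)]] fv Gc PolD by simp
    qed
    then show "g \<boxtimes> f \<in> prodV B G" using f by auto
  next
    fix j f assume f: "f \<in> prodV B G"
    have "prodV B G \<subseteq> {f \<in> carrier PA. cmp j f \<in> prodV B G}"
    proof (rule prodV_least)
      show "sub {f \<in> carrier PA. cmp j f \<in> prodV B G}" by (intro sub_vimage_restr sub)
      fix f v assume fv: "f \<in> G" "v \<in> Pol B"
      obtain a where a: "f \<in> Hm a" using hom fv by blast
      have c: "f \<in> carrier PA" "v \<in> carrier PA" using fv Gc PolD by auto
      have "cmp j (f \<boxtimes> v) = (if a \<le> j then f \<boxtimes> cmp (j - a) v else \<zero>\<^bsub>PA\<^esub>)"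
        using cmp_mult[OF c(2) a, of j] c by (simp add: A.m_comm)
      then show "f \<boxtimes> v \<in> {f \<in> carrier PA. cmp j f \<in> prodV B G}"
        using c prodV_gen[OF fv(1) V(4)[OF fv(2)]] subD(2)[OF sub] by simp
    qed
    then show "cmp j f \<in> prodV B G" using f by auto
  qed
qed

lemma prodV_mult:
  assumes B: "nice B" and G: "G \<subseteq> S" "\<And>f. f \<in> G \<Longrightarrow> \<exists>a. f \<in> Hm a" and g: "g \<in> prodV Bs G" and v: "v \<in> Pol B"
  shows "g \<boxtimes> v \<in> prodV B G"
proof -
  have vc: "v \<in> carrier PA" using PolD[OF v] .
  have sub: "sub (prodV B G)" using gsubD(1)[OF gsub_prodV[OF B G]] .
  have "prodV Bs G \<subseteq> {g \<in> carrier PA. v \<boxtimes> g \<in> prodV B G}"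
  proof (rule prodV_least)
    show "sub {g \<in> carrier PA. v \<boxtimes> g \<in> prodV B G}" by (intro sub_vimage_mult sub vc)
    fix f h assume fh: "f \<in> G" "h \<in> Pol Bs"
    have c: "f \<in> carrier PA" "h \<in> carrier PA" using fh G S_carrier by auto
    have "v \<boxtimes> (f \<boxtimes> h) = f \<boxtimes> (h \<boxtimes> v)" using c vc by (simp add: A.m_ac)
    then show "f \<boxtimes> h \<in> {g \<in> carrier PA. v \<boxtimes> g \<in> prodV B G}"
      using prodV_gen[OF fh(1) gsubD(3)[OF gsub_Pol[OF B] fh(2) v]] c by simp
  qed
  then show ?thesis using g vc by (auto simp: A.m_comm)
qed

end

context frob_poly begin

text \<open>
  For \<open>q = p ^ n\<close> and \<open>V = Pol B\<close>, \<open>frobV I B n\<close> is \<open>I\<^sup>[\<^sup>q\<^sup>] V\<close>. Only powers of homogeneous elements are used, so that it is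
  visibly graded; \<open>frobV_pow\<close> shows that nothing is lost, by additivity of Frobenius.
\<close>

definition frobG :: "(nat multiset \<Rightarrow> 'a) set \<Rightarrow> nat \<Rightarrow> (nat multiset \<Rightarrow> 'a) set" where
  "frobG I n = {f [^]\<^bsub>PA\<^esub> (p ^ n) | f. f \<in> I \<and> f \<in> S \<and> (\<exists>a. f \<in> Hm a)}"

definition frobV :: "(nat multiset \<Rightarrow> 'a) set \<Rightarrow> nat multiset set \<Rightarrow> nat \<Rightarrow> (nat multiset \<Rightarrow> 'a) set" where
  "frobV I B n = prodV B (frobG I n)"

lemma frobG: "frobG I n \<subseteq> S" "f \<in> frobG I n \<Longrightarrow> \<exists>a. f \<in> Hm a"
  unfolding frobG_def using S_pow Hm_pow by blast+

lemma gsub_frobV: "nice B \<Longrightarrow> gsub B (frobV I B n)"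
  unfolding frobV_def by (rule gsub_prodV[OF _ frobG])

lemma frobV_mult: "\<lbrakk>nice B; g \<in> frobV I Bs n; v \<in> Pol B\<rbrakk> \<Longrightarrow> g \<boxtimes> v \<in> frobV I B n"
  unfolding frobV_def by (rule prodV_mult[OF _ frobG])

lemma frobV_gen: "\<lbrakk>f \<in> I; f \<in> S; f \<in> Hm a; v \<in> Pol B\<rbrakk> \<Longrightarrow> f [^]\<^bsub>PA\<^esub> (p ^ n) \<boxtimes> v \<in> frobV I B n"
  unfolding frobV_def frobG_def by (rule prodV_gen) auto

lemma frobV_least:
  "\<lbrakk>sub X; \<And>f v a. \<lbrakk>f \<in> I; f \<in> S; f \<in> Hm a; v \<in> Pol B\<rbrakk> \<Longrightarrow> f [^]\<^bsub>PA\<^esub> (p ^ n) \<boxtimes> v \<in> X\<rbrakk> \<Longrightarrow> frobV I B n \<subseteq> X"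
  unfolding frobV_def frobG_def by (rule prodV_least) auto

lemma frobV_pow:
  assumes I: "gsub Bs I" and B: "nice B" and f: "f \<in> I" and v: "v \<in> Pol B"
  shows "f [^]\<^bsub>PA\<^esub> (p ^ n) \<boxtimes> v \<in> frobV I B n"
proof -
  have c: "f \<in> carrier PA" "v \<in> carrier PA" using gsubD(5)[OF I f] PolD[OF v] by auto
  have "f \<in> {f \<in> carrier PA. v \<boxtimes> f [^]\<^bsub>PA\<^esub> (p ^ n) \<in> frobV I B n}"
  proof (rule sub_of_cmp)
    show "sub {f \<in> carrier PA. v \<boxtimes> f [^]\<^bsub>PA\<^esub> (p ^ n) \<in> frobV I B n}"
      using sub_vimage_fr gsubD(1)[OF gsub_frobV[OF B]] c by auto
    fix j
    have "cmp j f \<in> I" "cmp j f \<in> Hm j" "cmp j f \<in> S"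
      using gsubD(2,4)[OF I] f restr_closed[OF c(1)] by auto
    then show "cmp j f \<in> {f \<in> carrier PA. v \<boxtimes> f [^]\<^bsub>PA\<^esub> (p ^ n) \<in> frobV I B n}"
      using frobV_gen[of "cmp j f" I j v B n] v c by (simp add: A.m_comm)
  qed (use c in auto)
  then show ?thesis using c by (simp add: A.m_comm)
qed

lemma frobV_frobI: "frobV I Bs (n + e) \<subseteq> frobI e (frobV I Bs n)"
proof (rule frobV_least)
  note g = gsub_frobI[OF gsub_frobV[OF nice_Bs], of e I n]
  show "sub (frobI e (frobV I Bs n))" using gsubD(1)[OF g] .
  fix f v a assume f: "f \<in> I" "f \<in> S" "f \<in> Hm a" and v: "v \<in> S"
  have c: "f \<in> carrier PA" "v \<in> carrier PA" using f v S_carrier by auto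
  have "f [^]\<^bsub>PA\<^esub> (p ^ n) \<in> frobV I Bs n" using frobV_gen[OF f one_S, of n] c by simp
  then have "(f [^]\<^bsub>PA\<^esub> (p ^ n)) [^]\<^bsub>PA\<^esub> (p ^ e) \<in> frobI e (frobV I Bs n)"
    by (rule frobI_pow[OF gsub_frobV[OF nice_Bs]])
  then have "f [^]\<^bsub>PA\<^esub> (p ^ (n + e)) \<in> frobI e (frobV I Bs n)"
    using c by (simp add: A.nat_pow_pow power_add)
  then have "v \<boxtimes> f [^]\<^bsub>PA\<^esub> (p ^ (n + e)) \<in> frobI e (frobV I Bs n)" by (rule gsubD(3)[OF g v])
  then show "f [^]\<^bsub>PA\<^esub> (p ^ (n + e)) \<boxtimes> v \<in> frobI e (frobV I Bs n)" using c by (simp add: A.m_comm)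
qed

end

section \<open>Asymptotics along the Frobenius powers\<close>

lemma geometric_decay_False:
  fixes x :: "nat \<Rightarrow> real"
  assumes "0 < c" "\<And>j. c \<le> x j" "\<And>j. x (Suc j) \<le> \<theta> * x j" "0 \<le> \<theta>" "\<theta> < 1"
  shows False
proof -
  have le: "x j \<le> \<theta> ^ j * x 0" for j
  proof (induction j)
    case (Suc j)
    have "x (Suc j) \<le> \<theta> * (\<theta> ^ j * x 0)" using assms(3)[of j] mult_left_mono[OF Suc assms(4)] by linarith
    then show ?case by simp
  qed simp
  have "(\<lambda>j. \<theta> ^ j * x 0) \<longlonglongrightarrow> 0 * x 0" using assms by (intro tendsto_intros LIMSEQ_realpow_zero) auto
  then have "c \<le> 0 * x 0"
    using assms(2) le by (intro LIMSEQ_le_const[where X = "\<lambda>j. \<theta> ^ j * x 0"]) (auto intro: order_trans)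
  then show False using assms(1) by simp
qed

lemma convergent_almost_increasing:
  fixes a :: "nat \<Rightarrow> real"
  assumes "\<And>n. n0 \<le> n \<Longrightarrow> a n \<le> C" "\<And>n. n0 \<le> n \<Longrightarrow> a n - B * \<rho> ^ n \<le> a (Suc n)" "0 < \<rho>" "\<rho> < 1"
  shows "convergent a"
proof -
  define D where "D = \<bar>B\<bar> / (1 - \<rho>)"
  have D: "0 \<le> D" "D * (1 - \<rho>) = \<bar>B\<bar>" using assms by (auto simp: D_def)
  define b where "b n = a (n + n0) - D * \<rho> ^ (n + n0)" for n
  have "b n \<le> b (Suc n)" for n
  proof -
    have "B * \<rho> ^ (n + n0) \<le> \<bar>B\<bar> * \<rho> ^ (n + n0)" using assms by (intro mult_right_mono) auto
    also have "\<dots> = D * \<rho> ^ (n + n0) - D * \<rho> ^ (Suc n + n0)" using D(2) by (simp flip: D(2) add: algebra_simps)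
    finally show ?thesis using assms(2)[of "n + n0"] unfolding b_def by simp
  qed
  then have inc: "incseq b" by (rule incseq_SucI)
  moreover have "b n \<le> C" for n using assms(1)[of "n + n0"] D assms(3) unfolding b_def by (smt (verit) le_add2 mult_nonneg_nonneg zero_le_power)
  ultimately obtain L where "b \<longlonglongrightarrow> L" using incseq_convergent by blast
  moreover have "(\<lambda>n. D * \<rho> ^ (n + n0)) \<longlonglongrightarrow> D * 0"
    using assms by (intro tendsto_intros LIMSEQ_ignore_initial_segment LIMSEQ_realpow_zero) auto
  ultimately have "(\<lambda>n. b n + D * \<rho> ^ (n + n0)) \<longlonglongrightarrow> L + D * 0" by (rule tendsto_add)
  then have "(\<lambda>n. a (n + n0)) \<longlonglongrightarrow> L" by (simp add: b_def)
  then show ?thesis using LIMSEQ_offset convergent_def by blast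
qed

lemma one_minus_power_ge:
  fixes t :: real
  assumes "0 \<le> t" "t < 1" "1 \<le> Q"
  shows "real Q * t ^ Q * (1 - t) \<le> 1 - t ^ Q"
proof -
  have "real Q * t ^ Q = (\<Sum>i<Q. t ^ Q)" by simp
  also have "\<dots> \<le> (\<Sum>i<Q. t ^ i)" using assms by (intro sum_mono power_decreasing) auto
  finally have "real Q * t ^ Q * (1 - t) \<le> (\<Sum>i<Q. t ^ i) * (1 - t)" using assms by (intro mult_right_mono) auto
  also have "\<dots> = 1 - t ^ Q" using one_diff_power_eq[of t Q] by (simp add: mult.commute)
  finally show ?thesis .
qed

context frob_poly begin

context
  fixes D :: nat
begin

text \<open>
  The primes whose quotient attains the pole order D, and the ideals whose quotient has at most the order D - 1,
  which do not contribute to limits normalised by \<open>(1 - t) ^ D\<close>.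
\<close>

definition topdim :: "(nat multiset \<Rightarrow> 'a) set \<Rightarrow> bool" where "topdim P \<longleftrightarrow> hprime P \<and> grows D P"

definition small :: "(nat multiset \<Rightarrow> 'a) set \<Rightarrow> bool" where
  "small J \<longleftrightarrow> (\<exists>C. \<forall>t. 1/2 \<le> t \<longrightarrow> t < 1 \<longrightarrow> (1 - t) ^ D * Hs Bs J t \<le> C * (1 - t))"

lemma Hs_pos: "\<lbrakk>gsub Bs J; 0 \<le> t; t < 1\<rbrakk> \<Longrightarrow> 0 \<le> Hs Bs J t"
  using Hs_nonneg[OF nice_Bs] gsubD by blast

lemma Hs_anti: "\<lbrakk>gsub Bs J; gsub Bs J'; J \<subseteq> J'; 0 \<le> t; t < 1\<rbrakk> \<Longrightarrow> Hs Bs J' t \<le> Hs Bs J t"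
  using Hs_mono[OF nice_Bs] gsubD by blast

lemma grows_small:
  assumes "gsub Bs P" "grows d P" "d < D" shows "small P"
proof -
  obtain C where C: "\<And>t. 1/2 \<le> t \<Longrightarrow> t < 1 \<Longrightarrow> (1 - t) ^ d * Hs Bs P t \<le> C"
    using assms(2) unfolding grows_def by blast
  have "(1 - t) ^ D * Hs Bs P t \<le> C * (1 - t)" if t: "1/2 \<le> t" "t < 1" for t
  proof -
    have "(1 - t) ^ D \<le> (1 - t) ^ Suc d" using t assms by (intro power_decreasing) auto
    then have "(1 - t) ^ D * Hs Bs P t \<le> (1 - t) ^ Suc d * Hs Bs P t"
      using Hs_pos[OF assms(1)] t by (intro mult_right_mono) auto
    also have "\<dots> = (1 - t) * ((1 - t) ^ d * Hs Bs P t)" by simp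
    also have "\<dots> \<le> (1 - t) * C" using C[OF t] t by (intro mult_left_mono) auto
    finally show ?thesis by (simp add: mult.commute)
  qed
  then show ?thesis unfolding small_def by blast
qed

lemma top_gsub: "topdim P \<Longrightarrow> gsub Bs P" using hprimeD by (auto simp: topdim_def)

lemma top_bounds:
  assumes "topdim P"
  obtains c C where "0 < c" "\<And>t. 1/2 \<le> t \<Longrightarrow> t < 1 \<Longrightarrow> c \<le> (1 - t) ^ D * Hs Bs P t"
    "\<And>t. 1/2 \<le> t \<Longrightarrow> t < 1 \<Longrightarrow> (1 - t) ^ D * Hs Bs P t \<le> C"
  using assms unfolding topdim_def grows_def by blast

lemma top_not_small:
  assumes "topdim P" "small P" shows False
proof -
  obtain c where c: "0 < c" "\<And>t. 1/2 \<le> t \<Longrightarrow> t < 1 \<Longrightarrow> c \<le> (1 - t) ^ D * Hs Bs P t"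
    using top_bounds[OF assms(1)] by metis
  obtain C where C: "\<And>t. 1/2 \<le> t \<Longrightarrow> t < 1 \<Longrightarrow> (1 - t) ^ D * Hs Bs P t \<le> C * (1 - t)"
    using assms(2) unfolding small_def by blast
  define x where "x = min (1/2) (c / (2 * (\<bar>C\<bar> + 1)))"
  have x: "0 < x" "x \<le> 1/2" "x \<le> c / (2 * (\<bar>C\<bar> + 1))" using c unfolding x_def by (simp, intro min.cobounded1, intro min.cobounded2)
  have "c \<le> C * x" using c(2)[of "1 - x"] C[of "1 - x"] x by simp
  also have "\<dots> \<le> (\<bar>C\<bar> + 1) * (c / (2 * (\<bar>C\<bar> + 1)))" using x by (intro mult_mono) auto
  also have "\<dots> = c / 2" by (simp add: field_simps)
  finally show False using c by simp
qed

lemma small_mono: "\<lbrakk>small J; gsub Bs J; gsub Bs J'; J \<subseteq> J'\<rbrakk> \<Longrightarrow> small J'"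
  unfolding small_def
proof (elim exE)
  fix C assume g: "gsub Bs J" "gsub Bs J'" "J \<subseteq> J'" and C: "\<forall>t. 1/2 \<le> t \<longrightarrow> t < 1 \<longrightarrow> (1 - t) ^ D * Hs Bs J t \<le> C * (1 - t)"
  have "(1 - t) ^ D * Hs Bs J' t \<le> C * (1 - t)" if t: "1/2 \<le> t" "t < 1" for t
  proof -
    have "(1 - t) ^ D * Hs Bs J' t \<le> (1 - t) ^ D * Hs Bs J t" using t Hs_anti[OF g] by (intro mult_left_mono) auto
    moreover have "(1 - t) ^ D * Hs Bs J t \<le> C * (1 - t)" using C t by blast
    ultimately show ?thesis by (rule order_trans)
  qed
  then show "\<exists>C. \<forall>t. 1/2 \<le> t \<longrightarrow> t < 1 \<longrightarrow> (1 - t) ^ D * Hs Bs J' t \<le> C * (1 - t)" by blast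
qed

text \<open>
  An element outside P cuts the order of the pole of S/P down by one.
\<close>

lemma top_supset_small:
  assumes "topdim P" "gsub Bs J" "P \<subset> J" shows "small J"
proof -
  obtain z e where z: "z \<in> J" "z \<notin> P" "z \<in> Hm e" using exists_homogeneous[OF top_gsub[OF assms(1)] assms(2,3)] .
  have zS: "z \<in> S" using z gsubD(2)[OF assms(2)] by auto
  have hp: "hprime P" using assms by (simp add: topdim_def)
  obtain c C where C: "\<And>t. 1/2 \<le> t \<Longrightarrow> t < 1 \<Longrightarrow> (1 - t) ^ D * Hs Bs P t \<le> C"
    using top_bounds[OF assms(1)] by metis
  have "(1 - t) ^ D * Hs Bs J t \<le> (real e * C) * (1 - t)" if t: "1/2 \<le> t" "t < 1" for t
  proof -
    have "Hs Bs J t \<le> Hs Bs (adj P z) t"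
      using t assms z adj_least[OF assms(2) _ z(1)] gsub_adj(1)[OF nice_Bs top_gsub[OF assms(1)] zS z(3)] by (intro Hs_anti) auto
    also have "\<dots> = (1 - t ^ e) * Hs Bs P t" using hprime_Hs_adj[OF hp zS z(3,2)] t by simp
    also have "\<dots> \<le> (real e * (1 - t)) * Hs Bs P t"
    proof (rule mult_right_mono)
      show "1 - t ^ e \<le> real e * (1 - t)" using one_minus_power_bounds(2)[of t e] t by (cases "e = 0") auto
    qed (use Hs_pos[OF top_gsub[OF assms(1)]] t in auto)
    finally have "(1 - t) ^ D * Hs Bs J t \<le> (1 - t) ^ D * ((real e * (1 - t)) * Hs Bs P t)"
      using t by (intro mult_left_mono) auto
    also have "\<dots> = (real e * (1 - t)) * ((1 - t) ^ D * Hs Bs P t)" by simp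
    also have "\<dots> \<le> (real e * (1 - t)) * C" using C[OF t] t by (intro mult_left_mono) auto
    finally show ?thesis by (simp add: mult_ac)
  qed
  then show ?thesis unfolding small_def by blast
qed

text \<open>
  The multiplicity of a top-dimensional prime in a filtration is controlled by comparing Hilbert
  series at points \<open>u\<^sub>0, u\<^sub>1, \<dots>\<close> with \<open>u\<^sub>j\<^sub>+\<^sub>1 ^ Q = u\<^sub>j\<close>: a larger multiplicity would force
  the values of \<open>(1 - t) ^ D\<close> times the series of S/P at these points to decay geometrically, although they are
  bounded below by a positive constant.
\<close>

lemma multiplicity_bound:
  assumes "topdim P" "1 \<le> e"
    and le: "\<And>t. 0 \<le> t \<Longrightarrow> t < 1 \<Longrightarrow>
      (\<Sum>(a, Q)\<leftarrow>l. if Q = P then t ^ a * Hs Bs P t else 0) \<le> real N * (ZQ (p ^ e) t * Hs Bs P (t ^ (p ^ e)))"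
  shows "real (length (filter (\<lambda>(a, Q). Q = P) l)) \<le> real N * (real (p ^ e) ^ s / real (p ^ e) ^ D)"
proof (rule ccontr)
  define q where "q = p ^ e"
  let ?Q = q and ?k = "length (filter (\<lambda>(a, Q). Q = P) l)"
  note le = le[folded q_def]
  define \<beta> where "\<beta> = real N * (real ?Q ^ s / real ?Q ^ D)"
  assume "\<not> ?thesis"
  then have k: "\<beta> < real ?k" by (simp add: \<beta>_def q_def)
  have Q2: "2 \<le> ?Q" using assms(2) prime_ge_2_nat[OF prime_p] self_le_power[of p e] p_pos unfolding q_def by linarith
  have b0: "0 \<le> \<beta>" by (simp add: \<beta>_def)
  obtain c C where c: "0 < c" "\<And>t. 1/2 \<le> t \<Longrightarrow> t < 1 \<Longrightarrow> c \<le> (1 - t) ^ D * Hs Bs P t"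
    "\<And>t. 1/2 \<le> t \<Longrightarrow> t < 1 \<Longrightarrow> (1 - t) ^ D * Hs Bs P t \<le> C" by (rule top_bounds[OF assms(1)]) blast
  note gP = top_gsub[OF assms(1)]
  define A where "A = sum_list (map fst l)"
  have A: "a \<le> A" if "(a, Q) \<in> set l" for a Q
    unfolding A_def using that by (intro member_le_sum_list) (force, simp)
  define E where "E t = (1 - t) ^ D * Hs Bs P t" for t
  have key: "real ?k * t ^ (A + ?Q * D) * E t \<le> \<beta> * E (t ^ ?Q)" if t: "0 < t" "t < 1" for t
  proof -
    have tQ: "0 \<le> t ^ ?Q" "t ^ ?Q < 1" using t Q2 by (auto simp: power_less_one_iff)
    have HP: "0 \<le> Hs Bs P t" "0 \<le> Hs Bs P (t ^ ?Q)" using Hs_pos[OF gP] t tQ by auto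
    have "real ?k * (t ^ A * Hs Bs P t) \<le> (\<Sum>(a, Q)\<leftarrow>l. if Q = P then t ^ a * Hs Bs P t else 0)"
      using A
    proof (induction l)
      case (Cons x l)
      obtain a Q where x: "x = (a, Q)" by force
      have "t ^ A * Hs Bs P t \<le> t ^ a * Hs Bs P t"
        using Cons.prems[of a Q] x t HP by (intro mult_right_mono power_decreasing) auto
      moreover have "real (length (filter (\<lambda>(a, Q). Q = P) l)) * (t ^ A * Hs Bs P t)
          \<le> (\<Sum>(a, Q)\<leftarrow>l. if Q = P then t ^ a * Hs Bs P t else 0)" using Cons by auto
      ultimately show ?case by (auto simp: x algebra_simps)
    qed simp
    also have "\<dots> \<le> real N * (ZQ ?Q t * Hs Bs P (t ^ ?Q))" using le[of t] t by simp
    also have "\<dots> \<le> real N * (real (?Q ^ s) * Hs Bs P (t ^ ?Q))"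
      using ZQ_bounds(1)[of ?Q t] t Q2 HP by (intro mult_left_mono mult_right_mono) auto
    finally have 1: "real ?k * (t ^ A * Hs Bs P t) \<le> real N * (real (?Q ^ s) * Hs Bs P (t ^ ?Q))" .
    have "(real ?Q * t ^ ?Q * (1 - t)) ^ D \<le> (1 - t ^ ?Q) ^ D"
      using one_minus_power_ge[of t ?Q] t Q2 by (intro power_mono) auto
    then have 2: "real ?Q ^ D * t ^ (?Q * D) * (1 - t) ^ D \<le> (1 - t ^ ?Q) ^ D"
      by (simp add: power_mult_distrib power_mult)
    have "real ?Q ^ D * (real ?k * t ^ (A + ?Q * D) * E t)
        = (real ?Q ^ D * t ^ (?Q * D) * (1 - t) ^ D) * (real ?k * (t ^ A * Hs Bs P t))"
      by (simp add: E_def power_add)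
    also have "\<dots> \<le> (1 - t ^ ?Q) ^ D * (real N * (real (?Q ^ s) * Hs Bs P (t ^ ?Q)))"
      using t HP power_le_one[of t ?Q] by (intro mult_mono[OF 2 1]) auto
    also have "\<dots> = real ?Q ^ D * (\<beta> * E (t ^ ?Q))" using Q2 by (simp add: E_def \<beta>_def)
    finally show ?thesis using Q2 by simp
  qed
  \<comment> \<open>Start so close to 1 that the factor \<open>\<theta>\<close> below is less than one.\<close>
  have "(\<lambda>n. - 1 / real ?Q ^ n) \<longlonglongrightarrow> 0" using Q2 by (intro LIMSEQ_divide_realpow_zero) auto
  from tendsto_exp[OF this] have lim: "(\<lambda>n. exp (- 1 / real ?Q ^ n)) \<longlonglongrightarrow> 1" by simp
  have "(\<lambda>n. real ?k * (exp (- 1 / real ?Q ^ n)) ^ (A + ?Q * D)) \<longlonglongrightarrow> real ?k * 1 ^ (A + ?Q * D)"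
    by (intro tendsto_intros lim)
  then have "\<forall>\<^sub>F n in sequentially. \<beta> < real ?k * (exp (- 1 / real ?Q ^ n)) ^ (A + ?Q * D)"
    using k by (intro order_tendstoD(1)) auto
  moreover have "\<forall>\<^sub>F n in sequentially. 1/2 < exp (- 1 / real ?Q ^ n)"
    using lim by (intro order_tendstoD(1)) auto
  ultimately have "\<forall>\<^sub>F n in sequentially. \<beta> < real ?k * (exp (- 1 / real ?Q ^ n)) ^ (A + ?Q * D) \<and> 1/2 < exp (- 1 / real ?Q ^ n)"
    by (rule eventually_conj)
  then obtain n0 where n0: "\<beta> < real ?k * (exp (- 1 / real ?Q ^ n0)) ^ (A + ?Q * D)" "1/2 < exp (- 1 / real ?Q ^ n0)"
    by (auto simp: eventually_sequentially)
  define u where "u j = exp (- 1 / real ?Q ^ (n0 + j))" for j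
  have u: "0 < u j" "u j < 1" for j using Q2 by (auto simp: u_def)
  have n0u: "1/2 < u 0" "\<beta> < real ?k * u 0 ^ (A + ?Q * D)" using n0 by (simp_all add: u_def)
  have uQ: "u (Suc j) ^ ?Q = u j" for j
    unfolding u_def exp_of_nat_mult[symmetric] using Q2 by (simp add: field_simps)
  have u_mono: "u 0 \<le> u j" for j
  proof -
    have "1 / real ?Q ^ (n0 + j) \<le> 1 / real ?Q ^ n0"
      using Q2 by (intro divide_left_mono power_increasing mult_pos_pos) auto
    then show ?thesis by (simp add: u_def)
  qed
  have u_half: "1/2 \<le> u j" for j using u_mono[of j] n0u(1) by linarith
  define M where "M = real ?k * u 0 ^ (A + ?Q * D)"
  have M: "\<beta> < M" using n0u by (simp add: M_def)
  show False
  proof (rule geometric_decay_False[of c "\<lambda>j. E (u j)" "\<beta> / M"])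
    show "c \<le> E (u j)" for j unfolding E_def using c(2) u_half u by simp
    show "E (u (Suc j)) \<le> \<beta> / M * E (u j)" for j
    proof -
      have E0: "0 \<le> E (u (Suc j))" unfolding E_def using Hs_pos[OF gP, of "u (Suc j)"] u[of "Suc j"] by simp
      have "M * E (u (Suc j)) \<le> real ?k * u (Suc j) ^ (A + ?Q * D) * E (u (Suc j))"
        unfolding M_def using u[of 0] u_mono[of "Suc j"] E0 by (intro mult_right_mono mult_left_mono power_mono) auto
      also have "\<dots> \<le> \<beta> * E (u j)" using key[OF u[of "Suc j"]] uQ[of j] by simp
      finally show ?thesis using M b0 by (simp add: field_simps)
    qed
  qed (use c M b0 in auto)
qed

lemma ptp: "1 \<le> e \<Longrightarrow> 2 \<le> p ^ e"
  using prime_ge_2_nat[OF prime_p] self_le_power[of p e] p_pos by linarith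

lemma gsub_sm_S: "gsub Bs q \<Longrightarrow> sm S q = S"
  using sm_least[OF sub_Pol, of S Bs q] sm_upper1[OF sub_Pol gsubD(1), of Bs q] gsubD(2) by blast

lemma small_sm:
  assumes "small J" "gsub Bs J"
  obtains C where "\<And>q t. \<lbrakk>gsub Bs q; 1/2 \<le> t; t < 1\<rbrakk> \<Longrightarrow> (1 - t) ^ D * Hs Bs (sm J q) t \<le> C * (1 - t)"
proof -
  obtain C where C: "\<And>t. 1/2 \<le> t \<Longrightarrow> t < 1 \<Longrightarrow> (1 - t) ^ D * Hs Bs J t \<le> C * (1 - t)"
    using assms(1) unfolding small_def by blast
  have "(1 - t) ^ D * Hs Bs (sm J q) t \<le> C * (1 - t)" if "gsub Bs q" "1/2 \<le> t" "t < 1" for q t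
  proof -
    have "Hs Bs (sm J q) t \<le> Hs Bs J t"
      using that assms(2) gsub_sm sm_upper1 gsubD(1) by (intro Hs_anti) auto
    then have "(1 - t) ^ D * Hs Bs (sm J q) t \<le> (1 - t) ^ D * Hs Bs J t" using that by (intro mult_left_mono) auto
    then show ?thesis using C[of t] that by linarith
  qed
  then show ?thesis using that by blast
qed

text \<open>The factors S/Q outside T contribute only O(1 - t), also after enlarging Q by q, as this decreases their series.\<close>

lemma filtration_contribution:
  assumes "\<And>Q. Q \<in> snd ` set l \<Longrightarrow> gsub Bs Q \<and> (Q \<in> T \<or> small Q)" "finite T" "\<And>P. P \<in> T \<Longrightarrow> topdim P"
  shows "\<exists>C. \<forall>q t. gsub Bs q \<longrightarrow> 1/2 \<le> t \<longrightarrow> t < 1 \<longrightarrow>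
    (1 - t) ^ D * (\<Sum>(a, Q)\<leftarrow>l. t ^ a * Hs Bs (sm Q q) t)
     \<le> (\<Sum>P\<in>T. real (length (filter (\<lambda>(a, Q). Q = P) l)) * ((1 - t) ^ D * Hs Bs (sm P q) t)) + C * (1 - t)"
  using assms(1)
proof (induction l)
  case Nil then show ?case by (intro exI[of _ 0]) auto
next
  case (Cons x l)
  obtain b R where x: "x = (b, R)" by force
  have "\<exists>C. \<forall>q t. gsub Bs q \<longrightarrow> 1/2 \<le> t \<longrightarrow> t < 1 \<longrightarrow>
    (1 - t) ^ D * (\<Sum>(a, Q)\<leftarrow>l. t ^ a * Hs Bs (sm Q q) t)
     \<le> (\<Sum>P\<in>T. real (length (filter (\<lambda>(a, Q). Q = P) l)) * ((1 - t) ^ D * Hs Bs (sm P q) t)) + C * (1 - t)"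
    by (rule Cons.IH) (rule Cons.prems, auto)
  then obtain C where C: "\<And>q t. \<lbrakk>gsub Bs q; 1/2 \<le> t; t < 1\<rbrakk> \<Longrightarrow>
    (1 - t) ^ D * (\<Sum>(a, Q)\<leftarrow>l. t ^ a * Hs Bs (sm Q q) t)
     \<le> (\<Sum>P\<in>T. real (length (filter (\<lambda>(a, Q). Q = P) l)) * ((1 - t) ^ D * Hs Bs (sm P q) t)) + C * (1 - t)"
    by blast
  have R: "gsub Bs R" "R \<in> T \<or> small R" using Cons.prems x by auto
  have "\<exists>C'\<ge>0. R \<notin> T \<longrightarrow> (\<forall>q t. gsub Bs q \<longrightarrow> 1/2 \<le> t \<longrightarrow> t < 1 \<longrightarrow> (1 - t) ^ D * Hs Bs (sm R q) t \<le> C' * (1 - t))"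
  proof (cases "R \<in> T")
    case False
    then obtain C' where C': "\<And>q t. \<lbrakk>gsub Bs q; 1/2 \<le> t; t < 1\<rbrakk> \<Longrightarrow> (1 - t) ^ D * Hs Bs (sm R q) t \<le> C' * (1 - t)"
      using small_sm[of R] R by blast
    have "(1 - t) ^ D * Hs Bs (sm R q) t \<le> \<bar>C'\<bar> * (1 - t)" if "gsub Bs q" "1/2 \<le> t" "t < 1" for q t
    proof -
      have "C' * (1 - t) \<le> \<bar>C'\<bar> * (1 - t)" using that by (intro mult_right_mono) auto
      then show ?thesis using C'[OF that] by linarith
    qed
    then show ?thesis by (intro exI[of _ "\<bar>C'\<bar>"]) auto
  qed auto
  then obtain C' where C': "0 \<le> C'" "\<And>q t. \<lbrakk>R \<notin> T; gsub Bs q; 1/2 \<le> t; t < 1\<rbrakk> \<Longrightarrow> (1 - t) ^ D * Hs Bs (sm R q) t \<le> C' * (1 - t)"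
    by blast
  show ?case
  proof (intro exI[of _ "C + C'"] allI impI)
    fix q and t :: real assume q: "gsub Bs q" and t: "1/2 \<le> t" "t < 1"
    let ?h = "\<lambda>P. (1 - t) ^ D * Hs Bs (sm P q) t"
    have h0: "0 \<le> ?h R" using Hs_pos[OF gsub_sm[OF R(1) q]] t by simp
    have "(1 - t) ^ D * (t ^ b * Hs Bs (sm R q) t) = t ^ b * ?h R" by simp
    also have "\<dots> \<le> ?h R" using h0 t by (intro mult_left_le_one_le power_le_one) auto
    also have "\<dots> \<le> (\<Sum>P\<in>T. (if R = P then 1 else 0) * ?h P) + C' * (1 - t)"
    proof (cases "R \<in> T")
      case True
      then have "(\<Sum>P\<in>T. (if R = P then 1 else 0) * ?h P) = ?h R"
        using assms(2) by (simp add: if_distrib[of "\<lambda>x. x * _"] cong: if_cong)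
      then show ?thesis using C'(1) t by simp
    next
      case False
      then have "(\<Sum>P\<in>T. (if R = P then 1 else 0) * ?h P) = 0" by (intro sum.neutral) auto
      then show ?thesis using C'(2)[OF False q t] by simp
    qed
    finally have 1: "(1 - t) ^ D * (t ^ b * Hs Bs (sm R q) t) \<le> (\<Sum>P\<in>T. (if R = P then 1 else 0) * ?h P) + C' * (1 - t)" .
    have "(\<Sum>P\<in>T. real (length (filter (\<lambda>(a, Q). Q = P) (x # l))) * ?h P)
        = (\<Sum>P\<in>T. (if R = P then 1 else 0) * ?h P) + (\<Sum>P\<in>T. real (length (filter (\<lambda>(a, Q). Q = P) l)) * ?h P)"
      by (auto simp: x sum.distrib[symmetric] algebra_simps intro!: sum.cong)
    then show "(1 - t) ^ D * (\<Sum>(a, Q)\<leftarrow>x # l. t ^ a * Hs Bs (sm Q q) t)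
      \<le> (\<Sum>P\<in>T. real (length (filter (\<lambda>(a, Q). Q = P) (x # l))) * ?h P) + (C + C') * (1 - t)"
      using 1 C[OF q t] by (simp add: x algebra_simps)
  qed
qed

text \<open>Multiply one homogeneous element outside P from each of the ideals.\<close>

lemma prime_avoidance:
  assumes "hprime P" "finite F" "\<And>J. J \<in> F \<Longrightarrow> gsub Bs J \<and> \<not> J \<subseteq> P"
  shows "\<exists>z a. z \<in> S \<and> z \<in> Hm a \<and> z \<notin> P \<and> (\<forall>J\<in>F. z \<in> J)"
  using assms(2,3)
proof (induction F)
  case empty
  then show ?case using one_S one_Hm0 hprimeD(2)[OF assms(1)] by blast
next
  case (insert J F)
  then obtain z a where z: "z \<in> S" "z \<in> Hm a" "z \<notin> P" "\<forall>J\<in>F. z \<in> J" by auto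
  have J: "gsub Bs J" "\<not> J \<subseteq> P" using insert by auto
  then obtain y0 where y0: "y0 \<in> J" "y0 \<notin> P" by blast
  obtain b where b: "cmp b y0 \<notin> P"
    using sub_of_cmp[OF gsubD(1)[OF hprimeD(1)[OF assms(1)]] gsubD(5)[OF J(1) y0(1)]] y0 by blast
  define y where "y = cmp b y0"
  have y: "y \<in> J" "y \<in> Hm b" "y \<notin> P" "y \<in> S"
    unfolding y_def using gsubD(4)[OF J(1) y0(1)] b restr_closed[OF gsubD(5)[OF J(1) y0(1)]] gsubD(2)[OF J(1)] by auto
  have c: "z \<in> carrier PA" "y \<in> carrier PA" using z y S_carrier by auto
  have "z \<boxtimes> y \<notin> P" using hprimeD(3)[OF assms(1) z(1,2) y(4,2)] z y by blast
  moreover have "z \<boxtimes> y \<in> J" using gsubD(3)[OF J(1) z(1) y(1)] .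
  moreover have "z \<boxtimes> y \<in> J'" if "J' \<in> F" for J'
  proof -
    have "gsub Bs J'" using insert that by auto
    then have "y \<boxtimes> z \<in> J'" using gsubD(3) y(4) z(4) that by blast
    then show ?thesis using c by (simp add: A.m_comm)
  qed
  ultimately show ?case using S_mult[OF z(1) y(4)] Hm_mult[OF z(2) y(2)] by blast
qed

lemma hprime_pow:
  assumes "hprime P" "f \<in> S" "f [^]\<^bsub>PA\<^esub> (Suc n) \<in> P" "f \<in> Hm a"
  shows "f \<in> P"
  using assms(3)
proof (induction n)
  case 0 then show ?case using S_carrier[OF assms(2)] by simp
next
  case (Suc n)
  then have "f [^]\<^bsub>PA\<^esub> (Suc n) \<boxtimes> f \<in> P" by simp
  then show ?case using hprimeD(3)[OF assms(1) S_pow[OF assms(2)] Hm_pow[OF assms(4)] assms(2,4)] Suc.IH by blast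
qed

lemma hprime_pow_gsub:
  assumes P: "hprime P" and J: "gsub Bs J" and f: "\<And>f. f \<in> J \<Longrightarrow> f [^]\<^bsub>PA\<^esub> (Suc n) \<in> P"
  shows "J \<subseteq> P"
proof
  fix f assume fJ: "f \<in> J"
  show "f \<in> P"
  proof (rule sub_of_cmp[OF gsubD(1)[OF hprimeD(1)[OF P]] gsubD(5)[OF J fJ]])
    fix j
    have "cmp j f \<in> J" "cmp j f \<in> Hm j" using gsubD(4)[OF J fJ] restr_closed[OF gsubD(5)[OF J fJ]] by auto
    then show "cmp j f \<in> P" using hprime_pow[OF P _ f[of "cmp j f"]] gsubD(2)[OF J] by blast
  qed
qed

lemma frobI_supset_prime:
  assumes P: "hprime P" and J: "gsub Bs J" and le: "frobI e J \<subseteq> P"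
  shows "J \<subseteq> P"
proof -
  obtain n where n: "p ^ e = Suc n" using p_pos by (metis gr0_implies_Suc zero_less_power)
  show ?thesis
    by (rule hprime_pow_gsub[OF P J, of n]) (use frobI_pow[OF J, of _ e] le n in auto)
qed

lemma HsQ_ratio:
  assumes "0 < t" "t < 1" "1 \<le> e"
  shows "t ^ (p ^ e) < 1" "0 < t ^ (p ^ e)"
    "((1 - t ^ (p ^ e)) / (real (p ^ e))) ^ D \<le> (1 - t) ^ D"
proof -
  have Q: "2 \<le> p ^ e" using ptp assms by simp
  show "t ^ (p ^ e) < 1" "0 < t ^ (p ^ e)" using assms Q p_pos by (auto simp: power_less_one_iff)
  have "1 - t ^ (p ^ e) \<le> real (p ^ e) * (1 - t)" using one_minus_power_bounds(2)[of t "p ^ e"] assms Q by linarith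
  then have "(1 - t ^ (p ^ e)) / real (p ^ e) \<le> 1 - t"
    using Q p_pos by (subst pos_divide_le_eq) (simp_all add: mult.commute del: of_nat_power)
  then show "((1 - t ^ (p ^ e)) / (real (p ^ e))) ^ D \<le> (1 - t) ^ D"
    using \<open>t ^ (p ^ e) < 1\<close> by (intro power_mono) auto
qed

end

context
  fixes D :: nat and I :: "(nat multiset \<Rightarrow> 'a) set" and \<tau> :: real
  assumes tau: "0 < \<tau>"
begin

definition tn :: "nat \<Rightarrow> real" where "tn n = exp (- \<tau> / real p ^ n)"

lemma tn_pos: "0 < tn n" and tn_less: "tn n < 1"
  using tau p_pos by (auto simp: tn_def)

lemma tn_pow: "tn (n + e) ^ (p ^ e) = tn n"
  unfolding tn_def exp_of_nat_mult[symmetric] using p_pos by (simp add: power_add field_simps)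

lemma tn_lim: "tn \<longlonglongrightarrow> 1"
proof -
  have "(\<lambda>n. - \<tau> / real p ^ n) \<longlonglongrightarrow> 0"
    using prime_gt_1_nat[OF prime_p] LIMSEQ_divide_realpow_zero[of "real p" "- \<tau>"] by simp
  from tendsto_exp[OF this] show ?thesis by (simp add: tn_def[abs_def])
qed

lemma one_minus_tn: "1 - tn n \<le> \<tau> * (1 / real p) ^ n"
proof -
  have "1 - tn n \<le> \<tau> / real p ^ n"
    using exp_ge_add_one_self[of "- (\<tau> / real p ^ n)"] by (simp add: tn_def)
  then show ?thesis by (simp add: power_one_over)
qed

lemma tn_half: "\<exists>n0. \<forall>n\<ge>n0. 1/2 \<le> tn n"
proof -
  have "\<forall>\<^sub>F n in sequentially. 1/2 < tn n" using tn_lim by (intro order_tendstoD(1)) auto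
  then show ?thesis by (auto simp: eventually_sequentially intro: less_imp_le)
qed

abbreviation "qn n \<equiv> frobV I Bs n"
abbreviation aP :: "(nat multiset \<Rightarrow> 'a) set \<Rightarrow> nat \<Rightarrow> real" where
  "aP P n \<equiv> (1 - tn n) ^ D * Hs Bs (sm P (qn n)) (tn n)"

lemma gsub_qn: "gsub Bs (qn n)" using gsub_frobV[OF nice_Bs] .

text \<open>
  Filter \<open>S/P\<^sup>[\<^sup>p\<^sup>]\<close> by prime factors. The factors other than S/P have smaller dimension, S/P occurs
  at most \<open>p ^ s / p ^ D\<close> times, and the length of \<open>S/(P + I\<^sub>n)\<^sup>[\<^sup>p\<^sup>]\<close> is known from flatness. So the
  normalised lengths increase up to a summable error.
\<close>

theorem prime_convergent:
  assumes P: "topdim D P"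
  shows "convergent (aP P)"
proof -
  have hp: "hprime P" and gP: "gsub Bs P" using P top_gsub by (auto simp: topdim_def)
  note gF = gsub_frobI[OF gP, of 1]
  obtain l where l: "prime_filt Bs (frobI 1 P) l S"
    using prime_filt_exists[OF nice_Bs gF gsub_Pol[OF nice_Bs] gsubD(2)[OF gF]] by blast
  have Q: "gsub Bs Q \<and> (Q \<in> {P} \<or> small D Q)" if "Q \<in> snd ` set l" for Q
  proof -
    obtain a where that: "(a, Q) \<in> set l" using \<open>Q \<in> snd ` set l\<close> by force
    have hQ: "hprime Q" using prime_filt_hprime[OF l that] .
    have "P \<subseteq> Q" using frobI_supset_prime[OF hQ gP] prime_filt_factor_supset[OF l that] by blast
    then show ?thesis using top_supset_small[OF P hprimeD(1)[OF hQ]] hprimeD(1)[OF hQ] by blast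
  qed
  obtain C where C: "\<And>q t. \<lbrakk>gsub Bs q; 1/2 \<le> t; t < 1\<rbrakk> \<Longrightarrow>
    (1 - t) ^ D * (\<Sum>(a, Q)\<leftarrow>l. t ^ a * Hs Bs (sm Q q) t)
     \<le> (\<Sum>P\<in>{P}. real (length (filter (\<lambda>(a, Q). Q = P) l)) * ((1 - t) ^ D * Hs Bs (sm P q) t)) + C * (1 - t)"
    using filtration_contribution[of l "{P}" D, OF Q] P by blast
  define \<beta> where "\<beta> = real p ^ s / real p ^ D"
  have b0: "0 < \<beta>" using p_pos by (simp add: \<beta>_def)
  have mult: "real (length (filter (\<lambda>(a, Q). Q = P) l)) \<le> \<beta>"
  proof -
    have "real (length (filter (\<lambda>(a, Q). Q = P) l)) \<le> real 1 * (real (p ^ 1) ^ s / real (p ^ 1) ^ D)"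
    proof (rule multiplicity_bound[OF P])
      fix t :: real assume t: "0 \<le> t" "t < 1"
      have "(\<Sum>(a, Q)\<leftarrow>l. if Q = P then t ^ a * Hs Bs P t else 0) \<le> Hs Bs (vcolon Bs (frobI 1 P) \<one>\<^bsub>PA\<^esub>) t"
        by (rule prime_filt_multiplicity[OF l nice_Bs hp one_S one_Hm0 hprimeD(2)[OF hp] t])
      also have "vcolon Bs (frobI 1 P) \<one>\<^bsub>PA\<^esub> = frobI 1 P"
        using gsubD(2,5)[OF gF] S_carrier by (auto simp: vcolon_def)
      also have "Hs Bs (frobI 1 P) t = ZQ (p ^ 1) t * Hs Bs P (t ^ (p ^ 1))" by (rule Hs_frobI[OF gP t])
      finally show "(\<Sum>(a, Q)\<leftarrow>l. if Q = P then t ^ a * Hs Bs P t else 0) \<le> real 1 * (ZQ (p ^ 1) t * Hs Bs P (t ^ (p ^ 1)))" by simp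
    qed simp
    then show ?thesis by (simp add: \<beta>_def)
  qed
  obtain A where A: "\<And>t. 0 \<le> t \<Longrightarrow> t \<le> 1 \<Longrightarrow> real (p ^ s) * t ^ A \<le> ZQ p t"
    using ZQ_bounds(2)[OF p_pos, of 0] by auto
  obtain n0 where n0: "\<And>n. n0 \<le> n \<Longrightarrow> 1/2 \<le> tn n" using tn_half by blast
  obtain c0 C0 where C0: "\<And>t. 1/2 \<le> t \<Longrightarrow> t < 1 \<Longrightarrow> (1 - t) ^ D * Hs Bs P t \<le> C0"
    using top_bounds[OF P] by metis
  have a0: "0 \<le> aP P n" for n
    using Hs_pos[OF gsub_sm[OF gP gsub_qn]] tn_pos[of n] tn_less[of n] by simp
  have aC: "aP P n \<le> C0" if "n0 \<le> n" for n
  proof -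
    have "Hs Bs (sm P (qn n)) (tn n) \<le> Hs Bs P (tn n)"
      using gsub_sm[OF gP gsub_qn] gP sm_upper1[OF gsubD(1)[OF gP] gsubD(1)[OF gsub_qn]] tn_pos[of n] tn_less[of n] by (intro Hs_anti) auto
    then have "aP P n \<le> (1 - tn n) ^ D * Hs Bs P (tn n)" using tn_less[of n] by (intro mult_left_mono) auto
    then show ?thesis using C0[OF n0[OF that] tn_less] by simp
  qed
  have step: "\<beta> * tn (Suc n) ^ A * aP P n \<le> \<beta> * aP P (Suc n) + C * (1 - tn (Suc n))" if n: "n0 \<le> n" for n
  proof -
    let ?t = "tn (Suc n)"
    have t: "0 < ?t" "?t < 1" "1/2 \<le> ?t" using tn_pos tn_less n0[of "Suc n"] n by auto
    have tp: "?t ^ p = tn n" using tn_pow[of n 1] by simp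
    have gPq: "gsub Bs (sm P (qn n))" by (rule gsub_sm[OF gP gsub_qn])
    have gFq: "gsub Bs (sm (frobI 1 P) (qn (Suc n)))" by (rule gsub_sm[OF gF gsub_qn])
    have "qn (Suc n) \<subseteq> frobI 1 (qn n)" using frobV_frobI[of I n 1] by simp
    then have "sm (frobI 1 P) (qn (Suc n)) \<subseteq> frobI 1 (sm P (qn n))"
      using frobI_mono[OF sm_upper1[OF gsubD(1)[OF gP] gsubD(1)[OF gsub_qn]], of 1 n]
        frobI_mono[OF sm_upper2[OF gsubD(1)[OF gP] gsubD(1)[OF gsub_qn]], of 1 n]
      by (intro sm_least gsubD(1)[OF gsub_frobI[OF gPq]]) auto
    then have "Hs Bs (frobI 1 (sm P (qn n))) ?t \<le> Hs Bs (sm (frobI 1 P) (qn (Suc n))) ?t"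
      using gFq gsub_frobI[OF gPq] t by (intro Hs_anti) auto
    also have "\<dots> \<le> Hs Bs (sm S (qn (Suc n))) ?t + (\<Sum>(a, Q)\<leftarrow>l. ?t ^ a * Hs Bs (sm Q (qn (Suc n))) ?t)"
      using t by (intro prime_filt_Hs_le[OF l nice_Bs gsub_qn gsub_qn] frobV_mult nice_Bs) auto
    also have "Hs Bs (sm S (qn (Suc n))) ?t = 0" by (simp add: gsub_sm_S[OF gsub_qn])
    finally have 1: "ZQ p ?t * Hs Bs (sm P (qn n)) (tn n) \<le> (\<Sum>(a, Q)\<leftarrow>l. ?t ^ a * Hs Bs (sm Q (qn (Suc n))) ?t)"
      using Hs_frobI[OF gPq, of ?t 1] t tp by simp
    have H0: "0 \<le> Hs Bs (sm P (qn n)) (tn n)" using Hs_pos[OF gPq] tn_pos[of n] tn_less[of n] by simp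
    have "((1 - tn n) / real p) ^ D * (real (p ^ s) * ?t ^ A * Hs Bs (sm P (qn n)) (tn n))
        \<le> (1 - ?t) ^ D * (ZQ p ?t * Hs Bs (sm P (qn n)) (tn n))"
    proof (rule mult_mono)
      show "((1 - tn n) / real p) ^ D \<le> (1 - ?t) ^ D" using HsQ_ratio(3)[OF t(1,2), of 1 D] tp by simp
      show "real (p ^ s) * ?t ^ A * Hs Bs (sm P (qn n)) (tn n) \<le> ZQ p ?t * Hs Bs (sm P (qn n)) (tn n)"
        using A[of ?t] t H0 by (intro mult_right_mono) auto
    qed (use t H0 in auto)
    also have "\<dots> \<le> (1 - ?t) ^ D * (\<Sum>(a, Q)\<leftarrow>l. ?t ^ a * Hs Bs (sm Q (qn (Suc n))) ?t)"
      using 1 t by (intro mult_left_mono) auto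
    also have "\<dots> \<le> real (length (filter (\<lambda>(a, Q). Q = P) l)) * aP P (Suc n) + C * (1 - ?t)"
      using C[OF gsub_qn t(3,2), of "Suc n"] by simp
    also have "\<dots> \<le> \<beta> * aP P (Suc n) + C * (1 - ?t)" using mult a0[of "Suc n"] by (intro add_right_mono mult_right_mono)
    finally show ?thesis by (simp add: \<beta>_def power_divide mult_ac)
  qed
  have A1: "1 - t ^ A \<le> real A * (1 - t)" if "0 \<le> t" "t \<le> 1" for t :: real
    using one_minus_power_bounds(2)[of t A] that by (cases "A = 0") auto
  define B where "B = (real A * C0 + \<bar>C\<bar> / \<beta>) * \<tau>"
  show ?thesis
  proof (rule convergent_almost_increasing[of n0 _ C0 B "1 / real p"])
    fix n assume n: "n0 \<le> n"
    let ?t = "tn (Suc n)"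
    have t: "0 < ?t" "?t < 1" using tn_pos tn_less by auto
    have "aP P n - aP P n * ?t ^ A \<le> C0 * (real A * (1 - ?t))"
    proof -
      have "aP P n * (1 - ?t ^ A) \<le> C0 * (real A * (1 - ?t))"
        using A1[of ?t] t a0[of n] aC[OF n] by (intro mult_mono) (auto simp: power_le_one)
      then show ?thesis by (simp add: algebra_simps)
    qed
    moreover have "aP P n * ?t ^ A \<le> aP P (Suc n) + \<bar>C\<bar> / \<beta> * (1 - ?t)"
    proof -
      have "\<beta> * (aP P n * ?t ^ A) \<le> \<beta> * aP P (Suc n) + \<bar>C\<bar> * (1 - ?t)"
      proof -
        have "C * (1 - ?t) \<le> \<bar>C\<bar> * (1 - ?t)" using t by (intro mult_right_mono) auto
        then show ?thesis using step[OF n] by (simp add: mult_ac)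
      qed
      then show ?thesis using b0 by (simp add: field_simps)
    qed
    ultimately have "aP P n \<le> aP P (Suc n) + (real A * C0 + \<bar>C\<bar> / \<beta>) * (1 - ?t)" by (simp add: algebra_simps)
    also have "\<dots> \<le> aP P (Suc n) + (real A * C0 + \<bar>C\<bar> / \<beta>) * (\<tau> * (1 / real p) ^ n)"
    proof -
      have "1 - ?t \<le> \<tau> * (1 / real p) ^ Suc n" by (rule one_minus_tn)
      also have "\<dots> \<le> \<tau> * (1 / real p) ^ n" using tau p_pos by (intro mult_left_mono power_decreasing) auto
      finally show ?thesis using a0[of n] aC[OF n] b0 by (intro add_left_mono mult_left_mono) auto
    qed
    finally show "aP P n - B * (1 / real p) ^ n \<le> aP P (Suc n)" by (simp add: B_def mult_ac)
  qed (use aC prime_gt_1_nat[OF prime_p] in auto)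
qed

end
end

context frob_poly begin

lemma gsub_INT:
  assumes "finite F" "\<And>J. J \<in> F \<Longrightarrow> gsub Bs J"
  shows "gsub Bs (S \<inter> \<Inter>F)"
  using assms
proof (induction F)
  case empty then show ?case using gsub_Pol[OF nice_Bs] by simp
next
  case (insert J F)
  have "S \<inter> \<Inter>(insert J F) = J \<inter> (S \<inter> \<Inter>F)" by auto
  then show ?case using insert gsub_Int by auto
qed

text \<open>
  For distinct top primes the map from S modulo their intersection to the sum of the quotients has
  a cokernel of smaller dimension.
\<close>

lemma top_intersection:
  assumes "finite T" "\<And>P. P \<in> T \<Longrightarrow> topdim D P"
  shows "\<exists>C. \<forall>q t. gsub Bs q \<longrightarrow> 1/2 \<le> t \<longrightarrow> t < 1 \<longrightarrow>
    (\<Sum>P\<in>T. (1 - t) ^ D * Hs Bs (sm P q) t) \<le> (1 - t) ^ D * Hs Bs (sm (S \<inter> \<Inter>T) q) t + C * (1 - t)"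
  using assms
proof (induction T)
  case empty
  show ?case using Hs_pos gsub_sm_S gsub_Pol[OF nice_Bs] by (intro exI[of _ 0]) (auto simp: gsub_sm_S)
next
  case (insert P T)
  let ?N = "S \<inter> \<Inter>T"
  have gT: "gsub Bs J" if "J \<in> T" for J using insert.prems that top_gsub by blast
  have gN: "gsub Bs ?N" using gsub_INT[OF insert.hyps(1)] gT by blast
  have tP: "topdim D P" using insert.prems by blast
  have gP: "gsub Bs P" and hp: "hprime P" using tP top_gsub by (auto simp: topdim_def)
  have "\<not> J \<subseteq> P" if "J \<in> T" for J
  proof
    assume "J \<subseteq> P"
    then have "J \<subset> P" using insert.hyps that by auto
    moreover have "topdim D J" using insert.prems that by blast
    ultimately have "small D P" using top_supset_small gP by blast
    then show False using top_not_small tP by blast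
  qed
  then obtain z where z: "z \<in> S" "z \<notin> P" "\<forall>J\<in>T. z \<in> J"
    using prime_avoidance[OF hp insert.hyps(1)] gT by metis
  have gNP: "gsub Bs (sm ?N P)" using gsub_sm[OF gN gP] .
  have up: "?N \<subseteq> sm ?N P" "P \<subseteq> sm ?N P"
    using sm_upper1[OF gsubD(1)[OF gN] gsubD(1)[OF gP]] sm_upper2[OF gsubD(1)[OF gN] gsubD(1)[OF gP]] by auto
  have "P \<subset> sm ?N P" using up z by auto
  then have "small D (sm ?N P)" using top_supset_small[OF tP gNP] by blast
  then obtain C' where C': "\<And>q t. \<lbrakk>gsub Bs q; 1/2 \<le> t; t < 1\<rbrakk> \<Longrightarrow> (1 - t) ^ D * Hs Bs (sm (sm ?N P) q) t \<le> C' * (1 - t)"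
    using small_sm[OF _ gNP] by blast
  have "\<And>P. P \<in> T \<Longrightarrow> topdim D P" using insert.prems by blast
  then obtain C where C: "\<And>q t. \<lbrakk>gsub Bs q; 1/2 \<le> t; t < 1\<rbrakk> \<Longrightarrow>
      (\<Sum>P\<in>T. (1 - t) ^ D * Hs Bs (sm P q) t) \<le> (1 - t) ^ D * Hs Bs (sm ?N q) t + C * (1 - t)"
    using insert.IH by blast
  show ?case
  proof (intro exI[of _ "C + C'"] allI impI)
    fix q and t :: real assume q: "gsub Bs q" and t: "1/2 \<le> t" "t < 1"
    note sN = gsubD(1)[OF gN] and sP = gsubD(1)[OF gP] and sq = gsubD(1)[OF q]
    note gNq = gsub_sm[OF gN q] and gPq = gsub_sm[OF gP q]
    have e: "S \<inter> \<Inter>(insert P T) = P \<inter> ?N" by auto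
    have "sm (P \<inter> ?N) q \<subseteq> sm ?N q \<inter> sm P q"
      by (intro Int_greatest sm_mono) auto
    then have 1: "Hs Bs (sm ?N q \<inter> sm P q) t \<le> Hs Bs (sm (P \<inter> ?N) q) t"
      using gsub_Int[OF gNq gPq] gsub_sm[OF gsub_Int[OF gP gN] q] t by (intro Hs_anti) auto
    have "sm (sm ?N P) q \<subseteq> sm (sm ?N q) (sm P q)"
    proof -
      have sZ: "sub (sm (sm ?N q) (sm P q))" using gsubD(1)[OF gsub_sm[OF gNq gPq]] .
      have 1: "?N \<subseteq> sm (sm ?N q) (sm P q)"
        using sm_upper1[OF sN sq] sm_upper1[OF gsubD(1)[OF gNq] gsubD(1)[OF gPq]] by (rule order_trans)
      have 2: "P \<subseteq> sm (sm ?N q) (sm P q)"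
        using sm_upper1[OF sP sq] sm_upper2[OF gsubD(1)[OF gNq] gsubD(1)[OF gPq]] by (rule order_trans)
      have 3: "q \<subseteq> sm (sm ?N q) (sm P q)"
        using sm_upper2[OF sP sq] sm_upper2[OF gsubD(1)[OF gNq] gsubD(1)[OF gPq]] by (rule order_trans)
      show ?thesis by (rule sm_least[OF sZ sm_least[OF sZ 1 2] 3])
    qed
    then have "Hs Bs (sm (sm ?N q) (sm P q)) t \<le> Hs Bs (sm (sm ?N P) q) t"
      using gsub_sm[OF gNP q] gsub_sm[OF gNq gPq] t by (intro Hs_anti) auto
    then have "(1 - t) ^ D * Hs Bs (sm (sm ?N q) (sm P q)) t \<le> (1 - t) ^ D * Hs Bs (sm (sm ?N P) q) t"
      using t by (intro mult_left_mono) auto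
    then have 2: "(1 - t) ^ D * Hs Bs (sm (sm ?N q) (sm P q)) t \<le> C' * (1 - t)"
      using C'[OF q t] by linarith
    have "Hs Bs (sm ?N q) t + Hs Bs (sm P q) t \<le> Hs Bs (sm (P \<inter> ?N) q) t + Hs Bs (sm (sm ?N q) (sm P q)) t"
      using Hs_Int_sm[OF nice_Bs gNq gPq, of t] t 1 by simp
    then have "(1 - t) ^ D * (Hs Bs (sm ?N q) t + Hs Bs (sm P q) t)
        \<le> (1 - t) ^ D * (Hs Bs (sm (P \<inter> ?N) q) t + Hs Bs (sm (sm ?N q) (sm P q)) t)"
      using t by (intro mult_left_mono) auto
    then show "(\<Sum>P\<in>insert P T. (1 - t) ^ D * Hs Bs (sm P q) t)
        \<le> (1 - t) ^ D * Hs Bs (sm (S \<inter> \<Inter>(insert P T)) q) t + (C + C') * (1 - t)"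
      unfolding e using insert.hyps C[OF q t] 2 by (simp add: algebra_simps)
  qed
qed

context
  fixes D :: nat and I :: "(nat multiset \<Rightarrow> 'a) set" and \<tau> :: real
  assumes tau: "0 < \<tau>"
begin

abbreviation "tt \<equiv> tn \<tau>"
abbreviation "qq n \<equiv> frobV I Bs n"

text \<open>
  The upper bound comes from a prime filtration of V/U. The lower bound compares V modulo \<open>N\<^sup>[\<^sup>Q\<^sup>] V\<close> with V/U, where N
  is the intersection of the primes of that filtration: its series at \<open>t\<^sub>n\<close> is governed by that of S/N at an earlier
  point of the sequence, and S/N is asymptotically the sum of the S/P over the top-dimensional primes P.
\<close>

theorem module_convergent:
  assumes U: "gsub (Bv r) U"
    and dim: "\<And>P. \<lbrakk>hprime P; \<And>g. \<lbrakk>g \<in> S; \<And>v. v \<in> Pol (Bv r) \<Longrightarrow> g \<boxtimes> v \<in> U\<rbrakk> \<Longrightarrow> g \<in> P\<rbrakk> \<Longrightarrow> topdim D P \<or> small D P"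
  shows "convergent (\<lambda>n. (1 - tt n) ^ D * Hs (Bv r) (sm U (frobV I (Bv r) n)) (tt n))"
proof -
  note nB = nice_Bv[of r]
  have t01: "0 < tt n" "tt n < 1" for n using tn_pos[OF tau] tn_less[OF tau] by auto
  have gqq: "gsub Bs (qq n)" and gqV: "gsub (Bv r) (frobV I (Bv r) n)" for n using gsub_frobV nice_Bs nB by auto
  obtain l2 where l2: "prime_filt (Bv r) U l2 (Pol (Bv r))"
    using prime_filt_exists[OF nB U gsub_Pol[OF nB] gsubD(2)[OF U]] by blast
  define PS where "PS = snd ` set l2"
  have PS: "finite PS" "\<And>P. P \<in> PS \<Longrightarrow> hprime P" using prime_filt_hprime[OF l2] by (auto simp: PS_def)
  have ann_PS: "g \<in> P" if "P \<in> PS" "g \<in> S" "\<And>v. v \<in> Pol (Bv r) \<Longrightarrow> g \<boxtimes> v \<in> U" for P g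
    using prime_filt_annihilates[OF l2 nB that(2,3)] that(1) by (auto simp: PS_def)
  have PS_dim: "topdim D P \<or> small D P" if "P \<in> PS" for P using dim[OF PS(2)[OF that]] ann_PS[OF that] by blast
  define N where "N = S \<inter> \<Inter>PS"
  have gN: "gsub Bs N" unfolding N_def using gsub_INT PS hprimeD(1) by blast
  \<comment> \<open>A Frobenius power of the radical N of the annihilator kills V/U.\<close>
  define e where "e = Suc (length l2)"
  have e1: "1 \<le> e" by (simp add: e_def)
  have eQ: "length l2 \<le> p ^ e"
    using less_exp[of e] power_mono[OF prime_ge_2_nat[OF prime_p], of e] unfolding e_def by linarith
  let ?Q = "p ^ e"
  have Q: "0 < ?Q" using p_pos by simp
  note gFN = gsub_frobI[OF gN, of e]
  define X where "X = extJ r 0 (frobI e N)"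
  have gX: "gsub (Bv r) X" unfolding X_def by (rule gsub_extJ[OF gFN])
  have FN_U: "g \<boxtimes> v \<in> U" if "g \<in> frobI e N" "v \<in> Pol (Bv r)" for g v
  proof -
    have vc: "v \<in> carrier PA" using PolD[OF that(2)] .
    have "frobI e N \<subseteq> {g \<in> carrier PA. v \<boxtimes> g \<in> U}"
    proof (rule frobI_least[OF gN])
      show "sub {g \<in> carrier PA. v \<boxtimes> g \<in> U}" by (intro sub_vimage_mult gsubD(1)[OF U] vc)
      fix \<alpha> f assume af: "\<alpha> \<in> Lam ?Q" "f \<in> N"
      have f: "f \<in> S" "f \<in> carrier PA" using af gsubD(2,5)[OF gN] by auto
      have "f [^]\<^bsub>PA\<^esub> ?Q \<boxtimes> v \<in> U"
      proof (rule prime_filt_power[OF l2 nB f(1) _ that(2) eQ])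
        show "f \<in> Q" if "(a, Q) \<in> set l2" for a Q using af that by (force simp: N_def PS_def)
      qed
      then have "monom K \<one> \<alpha> \<boxtimes> (f [^]\<^bsub>PA\<^esub> ?Q \<boxtimes> v) \<in> U"
        using gsubD(3)[OF U] monom_Pol Lam_Bs[OF af(1)] by blast
      then show "monom K \<one> \<alpha> \<boxtimes> f [^]\<^bsub>PA\<^esub> ?Q \<in> {g \<in> carrier PA. v \<boxtimes> g \<in> U}"
        using f vc by (simp add: A.m_ac)
    qed
    then show ?thesis using that vc by (auto simp: A.m_comm)
  qed
  have XU: "X \<subseteq> U"
  proof
    fix x assume x: "x \<in> X"
    show "x \<in> U"
    proof (rule coord_decomp[of x r])
      show "x \<in> Pol (Bv r)" using x by (simp add: X_def extJ_def)
      show "coord l x \<boxtimes> basis_vec l \<in> U" if "l < r" for l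
        using FN_U[OF _ basis_vec(2)[OF that]] x that by (simp add: X_def extJ_def)
    qed (rule gsubD(1)[OF U])
  qed
  obtain l1 where l1: "prime_filt (Bv r) X l1 U" using prime_filt_exists[OF nB gX U XU] by blast
  define l where "l = l1 @ l2"
  have l: "prime_filt (Bv r) X l (Pol (Bv r))" unfolding l_def by (rule prime_filt_append[OF l1 l2])
  define T where "T = {P \<in> PS. topdim D P}"
  have T: "finite T" "\<And>P. P \<in> T \<Longrightarrow> topdim D P" using PS by (auto simp: T_def)
  \<comment> \<open>A prime of either filtration contains N, hence one of the primes of the filtration of V/U.\<close>
  have factor: "gsub Bs Q \<and> (Q \<in> T \<or> small D Q)" if "(a, Q) \<in> set l" for a Q
  proof -
    have hQ: "hprime Q" using prime_filt_hprime[OF l that] .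
    have "frobI e N \<subseteq> Q"
    proof
      fix g assume g: "g \<in> frobI e N"
      have gS: "g \<in> S" using gsubD(2)[OF gFN] g by auto
      show "g \<in> Q"
      proof (rule prime_filt_annihilates[OF l nB gS _ that])
        fix v assume v: "v \<in> Pol (Bv r)"
        have "g \<boxtimes> v \<in> Pol (Bv r)" using gsubD(3)[OF gsub_Pol[OF nB] gS v] .
        moreover have "coord i (g \<boxtimes> v) \<in> frobI e N" for i
          using gsubD(3)[OF gFN coord_S[OF PolD[OF v]] g, of i] coord_mult[OF gS PolD[OF v], of i] S_carrier[OF gS]
            S_carrier[OF coord_S[OF PolD[OF v]], of i] by (simp add: A.m_comm)
        ultimately show "g \<boxtimes> v \<in> X" by (simp add: X_def extJ_def)
      qed
    qed
    then have NQ: "N \<subseteq> Q" using frobI_supset_prime[OF hQ gN] by blast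
    have "\<exists>P\<in>PS. P \<subseteq> Q"
    proof (rule ccontr)
      assume "\<not> ?thesis"
      then obtain z where "z \<in> S" "z \<notin> Q" "\<forall>J\<in>PS. z \<in> J"
        using prime_avoidance[OF hQ PS(1)] PS(2) hprimeD(1) by metis
      then show False using NQ by (auto simp: N_def)
    qed
    then obtain P where P: "P \<in> PS" "P \<subseteq> Q" by blast
    note gQ = hprimeD(1)[OF hQ] and gP = hprimeD(1)[OF PS(2)[OF P(1)]]
    have "Q \<in> T \<or> small D Q"
    proof (cases "topdim D P")
      case True
      then show ?thesis using top_supset_small[OF True gQ] P by (cases "P = Q") (auto simp: T_def)
    next
      case False
      then show ?thesis using PS_dim[OF P(1)] small_mono[OF _ gP gQ P(2)] by blast
    qed
    then show ?thesis using gQ by blast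
  qed
  define k1 where "k1 P = real (length (filter (\<lambda>(a, Q). Q = P) l1))" for P
  define k2 where "k2 P = real (length (filter (\<lambda>(a, Q). Q = P) l2))" for P
  define \<beta> where "\<beta> = real r * (real ?Q ^ s / real ?Q ^ D)"
  \<comment> \<open>Away from the other primes, that is up to multiplication by z, the ideals N and P agree.\<close>
  have mult: "k1 P + k2 P \<le> \<beta>" if P: "P \<in> T" for P
  proof -
    have tP: "topdim D P" and hp: "hprime P" and gP: "gsub Bs P" using T(2)[OF P] top_gsub by (auto simp: topdim_def)
    have "\<not> J \<subseteq> P" if J: "J \<in> PS - {P}" for J
    proof
      assume "J \<subseteq> P"
      then have JP: "J \<subset> P" using J by auto
      have gJ: "gsub Bs J" using J PS(2) hprimeD(1) by blast
      have "small D P"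
        using PS_dim[of J] J top_supset_small[OF _ gP JP] small_mono[OF _ gJ gP] JP by blast
      then show False using top_not_small tP by blast
    qed
    then obtain z b where z: "z \<in> S" "z \<in> Hm b" "z \<notin> P" "\<forall>J\<in>PS - {P}. z \<in> J"
      using prime_avoidance[OF hp, of "PS - {P}"] PS hprimeD(1) by (metis finite_Diff DiffE)
    have zc: "z \<in> carrier PA" using S_carrier[OF z(1)] .
    let ?z = "z [^]\<^bsub>PA\<^esub> ?Q"
    obtain Q' where Q': "?Q = Suc Q'" using Q by (metis gr0_implies_Suc)
    have zP: "?z \<notin> P" using hprime_pow[OF hp z(1) _ z(2), of Q'] z(3) unfolding Q' by blast
    have zN: "z \<boxtimes> f \<in> N" if f: "f \<in> P" for f
    proof -
      have fS: "f \<in> S" using gsubD(2)[OF gP] f by auto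
      have "z \<boxtimes> f \<in> J" if J: "J \<in> PS" for J
      proof (cases "J = P")
        case False
        then have "f \<boxtimes> z \<in> J" using gsubD(3)[OF hprimeD(1)[OF PS(2)[OF J]] fS] z(4) J by blast
        then show ?thesis using zc S_carrier[OF fS] by (simp add: A.m_comm)
      qed (use gsubD(3)[OF gP z(1) f] in simp)
      then show ?thesis using S_mult[OF z(1) fS] by (auto simp: N_def)
    qed
    have zF: "?z \<boxtimes> g \<in> frobI e N" if g: "g \<in> frobI e P" for g
    proof -
      have "frobI e P \<subseteq> {g \<in> carrier PA. ?z \<boxtimes> g \<in> frobI e N}"
      proof (rule frobI_least[OF gP])
        show "sub {g \<in> carrier PA. ?z \<boxtimes> g \<in> frobI e N}" using zc by (intro sub_vimage_mult gsubD(1)[OF gFN]) simp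
        fix \<alpha> f assume af: "\<alpha> \<in> Lam ?Q" "f \<in> P"
        have fc: "f \<in> carrier PA" using gsubD(5)[OF gP af(2)] .
        have "?z \<boxtimes> (monom K \<one> \<alpha> \<boxtimes> f [^]\<^bsub>PA\<^esub> ?Q) = monom K \<one> \<alpha> \<boxtimes> (z \<boxtimes> f) [^]\<^bsub>PA\<^esub> ?Q"
          using zc fc by (simp add: A.nat_pow_distrib A.m_lcomm)
        then show "monom K \<one> \<alpha> \<boxtimes> f [^]\<^bsub>PA\<^esub> ?Q \<in> {g \<in> carrier PA. ?z \<boxtimes> g \<in> frobI e N}"
          using frobI_gen[OF gN af(1) zN[OF af(2)]] fc by simp
      qed
      then show ?thesis using g by auto
    qed
    have "real (length (filter (\<lambda>(a, Q). Q = P) l)) \<le> real r * (real ?Q ^ s / real ?Q ^ D)"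
    proof (rule multiplicity_bound[OF tP e1])
      fix t :: real assume t: "0 \<le> t" "t < 1"
      have tQ: "0 \<le> t ^ ?Q" "t ^ ?Q < 1" using t Q by (auto simp: power_less_one_iff)
      have "(\<Sum>(a, Q)\<leftarrow>l. if Q = P then t ^ a * Hs Bs P t else 0) \<le> Hs (Bv r) (vcolon (Bv r) X ?z) t"
        by (rule prime_filt_multiplicity[OF l nB hp S_pow[OF z(1)] Hm_pow[OF z(2)] zP t])
      also have "\<dots> \<le> Hs (Bv r) (extJ r 0 (frobI e P)) t"
      proof -
        have "extJ r 0 (frobI e P) \<subseteq> vcolon (Bv r) X ?z"
          using zF gsubD(3)[OF gsub_Pol[OF nB] S_pow[OF z(1)]] coord_mult[OF S_pow[OF z(1)]] PolD
          by (auto simp: vcolon_def X_def extJ_def)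
        then show ?thesis
          using t gsubD(1,2)[OF gsub_extJ[OF gsub_frobI[OF gP]]] gsubD(1,2)[OF gsub_vcolon[OF nB gX S_pow[OF z(1)] Hm_pow[OF z(2)]]]
          by (intro Hs_mono nB) auto
      qed
      also have "\<dots> = (\<Sum>l<r. t ^ w (s + l)) * Hs Bs (frobI e P) t" by (rule Hs_extJ[OF gsub_frobI[OF gP] t])
      also have "\<dots> \<le> real r * Hs Bs (frobI e P) t"
      proof (rule mult_right_mono)
        have "(\<Sum>l<r. t ^ w (s + l)) \<le> (\<Sum>l<r. 1)" using t by (intro sum_mono power_le_one) auto
        then show "(\<Sum>l<r. t ^ w (s + l)) \<le> real r" by simp
      qed (use Hs_pos[OF gsub_frobI[OF gP] t] in simp)
      also have "Hs Bs (frobI e P) t = ZQ ?Q t * Hs Bs P (t ^ ?Q)" by (rule Hs_frobI[OF gP t])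
      finally show "(\<Sum>(a, Q)\<leftarrow>l. if Q = P then t ^ a * Hs Bs P t else 0) \<le> real r * (ZQ ?Q t * Hs Bs P (t ^ ?Q))" .
    qed
    then show ?thesis by (simp add: k1_def k2_def l_def \<beta>_def)
  qed
  define a where "a P n = (1 - tt n) ^ D * Hs Bs (sm P (qq n)) (tt n)" for P n
  have "convergent (a P)" if "P \<in> T" for P
    using prime_convergent[OF tau T(2)[OF that], of I] by (simp add: a_def[abs_def])
  then obtain c where c: "\<And>P. P \<in> T \<Longrightarrow> a P \<longlonglongrightarrow> c P" unfolding convergent_def by metis
  have c0: "0 \<le> c P" if "P \<in> T" for P
  proof (rule LIMSEQ_le_const[OF c[OF that]])
    have "0 \<le> a P n" for n
      using Hs_pos[OF gsub_sm[OF top_gsub[OF T(2)[OF that]] gqq]] t01[of n] by (simp add: a_def)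
    then show "\<exists>N. \<forall>n\<ge>N. 0 \<le> a P n" by blast
  qed
  define b where "b n = (1 - tt n) ^ D * Hs (Bv r) (sm U (frobV I (Bv r) n)) (tt n)" for n
  obtain n0 where n0: "\<And>n. n0 \<le> n \<Longrightarrow> 1/2 \<le> tt n" using tn_half[OF tau] by blast
  have f1: "gsub Bs Q \<and> (Q \<in> T \<or> small D Q)" if "Q \<in> snd ` set l1" for Q
  proof -
    obtain a where "(a, Q) \<in> set l" using \<open>Q \<in> snd ` set l1\<close> unfolding l_def by force
    then show ?thesis by (rule factor)
  qed
  have f2: "gsub Bs Q \<and> (Q \<in> T \<or> small D Q)" if "Q \<in> snd ` set l2" for Q
  proof -
    obtain a where "(a, Q) \<in> set l" using \<open>Q \<in> snd ` set l2\<close> unfolding l_def by force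
    then show ?thesis by (rule factor)
  qed
  obtain C1 where C1: "\<And>q t. \<lbrakk>gsub Bs q; 1/2 \<le> t; t < 1\<rbrakk> \<Longrightarrow>
    (1 - t) ^ D * (\<Sum>(a, Q)\<leftarrow>l1. t ^ a * Hs Bs (sm Q q) t) \<le> (\<Sum>P\<in>T. k1 P * ((1 - t) ^ D * Hs Bs (sm P q) t)) + C1 * (1 - t)"
    using filtration_contribution[OF f1 T] unfolding k1_def by blast
  obtain C2 where C2: "\<And>q t. \<lbrakk>gsub Bs q; 1/2 \<le> t; t < 1\<rbrakk> \<Longrightarrow>
    (1 - t) ^ D * (\<Sum>(a, Q)\<leftarrow>l2. t ^ a * Hs Bs (sm Q q) t) \<le> (\<Sum>P\<in>T. k2 P * ((1 - t) ^ D * Hs Bs (sm P q) t)) + C2 * (1 - t)"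
    using filtration_contribution[OF f2 T] unfolding k2_def by blast
  obtain C3 where C3: "\<And>q t. \<lbrakk>gsub Bs q; 1/2 \<le> t; t < 1\<rbrakk> \<Longrightarrow>
    (\<Sum>P\<in>T. (1 - t) ^ D * Hs Bs (sm P q) t) \<le> (1 - t) ^ D * Hs Bs (sm (S \<inter> \<Inter>T) q) t + C3 * (1 - t)"
    using top_intersection[OF T] by blast
  have up: "b n \<le> (\<Sum>P\<in>T. k2 P * a P n) + C2 * (1 - tt n)" if "n0 \<le> n" for n
  proof -
    have "sm (Pol (Bv r)) (frobV I (Bv r) n) = Pol (Bv r)"
      using sm_least[OF sub_Pol, of "Pol (Bv r)" "Bv r" "frobV I (Bv r) n"] gsubD(1,2)[OF gqV]
        sm_upper1[OF sub_Pol gsubD(1)[OF gqV], of "Bv r"] by blast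
    then have "Hs (Bv r) (sm U (frobV I (Bv r) n)) (tt n) \<le> (\<Sum>(a, Q)\<leftarrow>l2. tt n ^ a * Hs Bs (sm Q (qq n)) (tt n))"
      using prime_filt_Hs_le[OF l2 nB gqV gqq, of n n "tt n"] frobV_mult[OF nB] t01[of n] by simp
    then have "b n \<le> (1 - tt n) ^ D * (\<Sum>(a, Q)\<leftarrow>l2. tt n ^ a * Hs Bs (sm Q (qq n)) (tt n))"
      unfolding b_def using t01[of n] by (intro mult_left_mono) auto
    then show ?thesis using C2[OF gqq n0[OF that] t01(2), of n] by (simp add: a_def)
  qed
  \<comment> \<open>The factor between the normalised series of \<open>V / N\<^sup>[\<^sup>Q\<^sup>] V\<close> at the n-th point and of S/N at the point e steps before.\<close>
  define W where "W n = (\<Sum>l<r. tt n ^ w (s + l)) * (ZQ ?Q (tt n) * ((1 - tt n) / (1 - tt (n - e))) ^ D)" for n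
  have W0: "0 \<le> W n" for n
    unfolding W_def ZQ_def using t01[of n] t01[of "n - e"] by (intro mult_nonneg_nonneg sum_nonneg) auto
  have low: "W n * ((\<Sum>P\<in>T. a P (n - e)) - C3 * (1 - tt (n - e))) - ((\<Sum>P\<in>T. k1 P * a P n) + C1 * (1 - tt n)) \<le> b n"
    if n: "n0 + e \<le> n" for n
  proof -
    let ?t = "tt n" and ?u = "tt (n - e)" and ?q = "qq (n - e)"
    have tu: "?t ^ ?Q = ?u" using tn_pow[OF tau, of "n - e" e] n by simp
    note t = t01[of n] and u = t01[of "n - e"]
    have gNq: "gsub Bs (sm N ?q)" and gFNq: "gsub Bs (sm (frobI e N) (qq n))" using gsub_sm[OF gN gqq] gsub_sm[OF gFN gqq] by auto
    have sN: "sub N" and sF: "sub (frobI e N)" and sq: "sub (qq n)" for n using gsubD(1) gN gFN gqq by auto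
    have "sm (frobI e N) (qq n) \<subseteq> frobI e (sm N ?q)"
      using frobI_mono[OF sm_upper1[OF sN sq], of e "n - e"] frobI_mono[OF sm_upper2[OF sN sq], of e "n - e"]
        frobV_frobI[of I "n - e" e] n
      by (intro sm_least gsubD(1)[OF gsub_frobI[OF gNq]]) auto
    then have 1: "Hs Bs (frobI e (sm N ?q)) ?t \<le> Hs Bs (sm (frobI e N) (qq n)) ?t"
      using gFNq gsub_frobI[OF gNq] t by (intro Hs_anti) auto
    have gE: "gsub (Bv r) (extJ r 0 (sm (frobI e N) (qq n)))" by (rule gsub_extJ[OF gFNq])
    have "sm X (frobV I (Bv r) n) \<subseteq> extJ r 0 (sm (frobI e N) (qq n))"
    proof (rule sm_least[OF gsubD(1)[OF gE]])
      show "X \<subseteq> extJ r 0 (sm (frobI e N) (qq n))" using sm_upper1[OF sF sq] by (auto simp: X_def extJ_def)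
      show "frobV I (Bv r) n \<subseteq> extJ r 0 (sm (frobI e N) (qq n))"
      proof (rule frobV_least[OF gsubD(1)[OF gE]])
        fix f v b assume f: "f \<in> I" "f \<in> S" "f \<in> Hm b" and v: "v \<in> Pol (Bv r)"
        have "f [^]\<^bsub>PA\<^esub> (p ^ n) \<boxtimes> v \<in> Pol (Bv r)" using gsubD(3)[OF gsub_Pol[OF nB] S_pow[OF f(2)] v] .
        moreover have "coord l (f [^]\<^bsub>PA\<^esub> (p ^ n) \<boxtimes> v) \<in> qq n" for l
          using coord_mult[OF S_pow[OF f(2)] PolD[OF v]] frobV_gen[OF f coord_S[OF PolD[OF v]], of n] by simp
        ultimately show "f [^]\<^bsub>PA\<^esub> (p ^ n) \<boxtimes> v \<in> extJ r 0 (sm (frobI e N) (qq n))"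
          using sm_upper2[OF sF sq] by (auto simp: extJ_def)
      qed
    qed
    then have 2: "Hs (Bv r) (extJ r 0 (sm (frobI e N) (qq n))) ?t \<le> Hs (Bv r) (sm X (frobV I (Bv r) n)) ?t"
      using gsubD(1,2)[OF gE] gsubD(1,2)[OF gsub_sm[OF gX gqV]] t by (intro Hs_mono nB) auto
    have 3: "Hs (Bv r) (sm X (frobV I (Bv r) n)) ?t
        \<le> Hs (Bv r) (sm U (frobV I (Bv r) n)) ?t + (\<Sum>(a, Q)\<leftarrow>l1. ?t ^ a * Hs Bs (sm Q (qq n)) ?t)"
      using prime_filt_Hs_le[OF l1 nB gqV gqq] frobV_mult[OF nB] t by simp
    have 4: "Hs Bs (sm (S \<inter> \<Inter>T) ?q) ?u \<le> Hs Bs (sm N ?q) ?u"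
    proof (rule Hs_anti)
      show "gsub Bs (sm (S \<inter> \<Inter>T) ?q)" using gsub_sm gsub_INT[OF T(1)] T(2) top_gsub gqq by blast
      show "sm N ?q \<subseteq> sm (S \<inter> \<Inter>T) ?q" by (rule sm_mono) (auto simp: N_def T_def)
    qed (use gNq u in auto)
    have nn: "n0 \<le> n - e" using n by simp
    have "(\<Sum>P\<in>T. a P (n - e)) - C3 * (1 - ?u) \<le> (1 - ?u) ^ D * Hs Bs (sm (S \<inter> \<Inter>T) ?q) ?u"
      using C3[OF gqq n0[OF nn] u(2), of "n - e"] by (simp add: a_def)
    also have "\<dots> \<le> (1 - ?u) ^ D * Hs Bs (sm N ?q) ?u" using 4 u by (intro mult_left_mono) auto
    finally have "W n * ((\<Sum>P\<in>T. a P (n - e)) - C3 * (1 - ?u)) \<le> W n * ((1 - ?u) ^ D * Hs Bs (sm N ?q) ?u)"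
      using W0 by (intro mult_left_mono) auto
    also have "\<dots> = (1 - ?t) ^ D * ((\<Sum>l<r. ?t ^ w (s + l)) * Hs Bs (frobI e (sm N ?q)) ?t)"
      using Hs_frobI[OF gNq, of ?t e] t u by (simp add: W_def tu power_divide)
    also have "\<dots> \<le> (1 - ?t) ^ D * ((\<Sum>l<r. ?t ^ w (s + l)) * Hs Bs (sm (frobI e N) (qq n)) ?t)"
      using 1 t by (intro mult_left_mono sum_nonneg) auto
    also have "(\<Sum>l<r. ?t ^ w (s + l)) * Hs Bs (sm (frobI e N) (qq n)) ?t = Hs (Bv r) (extJ r 0 (sm (frobI e N) (qq n))) ?t"
      using Hs_extJ[OF gFNq] t by simp
    also have "(1 - ?t) ^ D * \<dots> \<le> (1 - ?t) ^ D * (Hs (Bv r) (sm U (frobV I (Bv r) n)) ?t + (\<Sum>(a, Q)\<leftarrow>l1. ?t ^ a * Hs Bs (sm Q (qq n)) ?t))"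
      using 2 3 t by (intro mult_left_mono) auto
    also have "\<dots> \<le> b n + ((\<Sum>P\<in>T. k1 P * a P n) + C1 * (1 - ?t))"
      using C1[OF gqq n0 t(2), of n] n by (simp add: b_def a_def distrib_left)
    finally show ?thesis by simp
  qed
  \<comment> \<open>Both bounds converge, and the multiplicity bound puts the limit of the lower one on top.\<close>
  have tl: "tt \<longlonglongrightarrow> 1" by (rule tn_lim[OF tau])
  have off: "filterlim (\<lambda>n. n - e) sequentially sequentially" by (rule filterlim_minus_const_nat_at_top)
  define Lu where "Lu = (\<Sum>P\<in>T. k2 P * c P) + C2 * (1 - 1)"
  have up_lim: "(\<lambda>n. (\<Sum>P\<in>T. k2 P * a P n) + C2 * (1 - tt n)) \<longlonglongrightarrow> Lu"
    unfolding Lu_def by (intro tendsto_intros c tl)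
  have "W \<longlonglongrightarrow> (\<Sum>l<r. 1 ^ w (s + l)) * (real (?Q ^ s) * (1 / real ?Q) ^ D)"
  proof -
    obtain A where A: "\<And>t. 0 \<le> t \<Longrightarrow> t \<le> 1 \<Longrightarrow> real (?Q ^ s) * t ^ A \<le> ZQ ?Q t"
      using ZQ_bounds(2)[OF Q, of 0] by auto
    have zl: "(\<lambda>n. ZQ ?Q (tt n)) \<longlonglongrightarrow> real (?Q ^ s)"
    proof (rule tendsto_sandwich)
      show "\<forall>\<^sub>F n in sequentially. real (?Q ^ s) * tt n ^ A \<le> ZQ ?Q (tt n)" using A t01 by (auto intro!: always_eventually simp: less_imp_le)
      show "\<forall>\<^sub>F n in sequentially. ZQ ?Q (tt n) \<le> real (?Q ^ s)"
        using ZQ_bounds(1)[OF Q] t01 by (auto intro!: always_eventually simp: less_imp_le)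
      show "(\<lambda>n. real (?Q ^ s) * tt n ^ A) \<longlonglongrightarrow> real (?Q ^ s)"
        using tendsto_mult[OF tendsto_const tendsto_power[OF tl, of A], of "real (?Q ^ s)"] by simp
    qed simp
    have "\<forall>\<^sub>F n in sequentially. 1 / (\<Sum>i<?Q. tt n ^ i) = (1 - tt n) / (1 - tt (n - e))"
    proof (rule eventually_sequentiallyI[of e])
      fix n assume "e \<le> n"
      then have "tt (n - e) = tt n ^ ?Q" using tn_pow[OF tau, of "n - e" e] by simp
      then show "1 / (\<Sum>i<?Q. tt n ^ i) = (1 - tt n) / (1 - tt (n - e))"
        using one_diff_power_eq[of "tt n" ?Q] t01[of n] by simp
    qed
    moreover have "(\<lambda>n. 1 / (\<Sum>i<?Q. tt n ^ i)) \<longlonglongrightarrow> 1 / (\<Sum>i<?Q. 1 ^ i)"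
      using Q by (intro tendsto_intros tl) auto
    ultimately have rl: "(\<lambda>n. (1 - tt n) / (1 - tt (n - e))) \<longlonglongrightarrow> 1 / real ?Q"
      using Lim_transform_eventually by fastforce
    show ?thesis unfolding W_def by (intro tendsto_mult tendsto_power tendsto_sum tl zl rl)
  qed
  then have "W \<longlonglongrightarrow> \<beta>" by (simp add: \<beta>_def power_divide mult_ac)
  define Ll where "Ll = \<beta> * ((\<Sum>P\<in>T. c P) - C3 * (1 - 1)) - ((\<Sum>P\<in>T. k1 P * c P) + C1 * (1 - 1))"
  have low_lim: "(\<lambda>n. W n * ((\<Sum>P\<in>T. a P (n - e)) - C3 * (1 - tt (n - e))) - ((\<Sum>P\<in>T. k1 P * a P n) + C1 * (1 - tt n))) \<longlonglongrightarrow> Ll"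
    unfolding Ll_def by (intro tendsto_intros \<open>W \<longlonglongrightarrow> \<beta>\<close> c tl filterlim_compose[OF c off] filterlim_compose[OF tl off])
  have "Lu \<le> Ll"
  proof -
    have "(\<Sum>P\<in>T. (k1 P + k2 P) * c P) \<le> (\<Sum>P\<in>T. \<beta> * c P)" using mult c0 by (intro sum_mono mult_right_mono)
    then show ?thesis by (simp add: Lu_def Ll_def algebra_simps sum.distrib sum_distrib_left)
  qed
  have ev_up: "\<forall>\<^sub>F n in sequentially. b n \<le> (\<Sum>P\<in>T. k2 P * a P n) + C2 * (1 - tt n)"
    using up by (auto simp: eventually_sequentially)
  have ev_low: "\<forall>\<^sub>F n in sequentially. W n * ((\<Sum>P\<in>T. a P (n - e)) - C3 * (1 - tt (n - e))) - ((\<Sum>P\<in>T. k1 P * a P n) + C1 * (1 - tt n)) \<le> b n"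
    using low by (auto simp: eventually_sequentially)
  have "Ll \<le> Lu"
    by (rule tendsto_le[OF _ up_lim low_lim]) (use ev_up ev_low in \<open>auto elim: eventually_elim2\<close>)
  with \<open>Lu \<le> Ll\<close> have "Ll = Lu" by simp
  then have "b \<longlonglongrightarrow> Lu" using tendsto_sandwich[OF ev_low ev_up low_lim[unfolded \<open>Ll = Lu\<close>] up_lim] by simp
  then show ?thesis unfolding convergent_def b_def[abs_def] by blast
qed

end
end

section \<open>Chains of primes in the polynomial ring\<close>

context graded_poly begin

text \<open>
  Prime ideals of S, homogeneous or not: preimages of primes of R need not be homogeneous.
\<close>

definition sprime :: "(nat multiset \<Rightarrow> 'a) set \<Rightarrow> bool" where
  "sprime P \<longleftrightarrow> sub P \<and> P \<subseteq> S \<and> (\<forall>g\<in>S. \<forall>f\<in>P. g \<boxtimes> f \<in> P) \<and> \<one>\<^bsub>PA\<^esub> \<notin> P \<and>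
     (\<forall>f\<in>S. \<forall>g\<in>S. f \<boxtimes> g \<in> P \<longrightarrow> f \<in> P \<or> g \<in> P)"

abbreviation "Le m \<equiv> Pol {a \<in> Bs. wt a \<le> m}"

lemma Le_S: "Le m \<subseteq> S" by (rule Pol_mono) auto

lemma Le_finite: "finite {a \<in> Bs. wt a \<le> m}" "card {a \<in> Bs. wt a \<le> m} \<le> (m + 1) ^ s"
  using finite_monos[of Bs s m] by (auto simp: Bs_def)

definition growth :: "(nat multiset \<Rightarrow> 'a) set \<Rightarrow> nat \<Rightarrow> nat" where
  "growth P m = the_enat (len (P \<inter> Le m) (Le m))"

lemma growth_len: "sub P \<Longrightarrow> enat (growth P m) = len (P \<inter> Le m) (Le m) \<and> growth P m \<le> (m + 1) ^ s"
proof -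
  assume P: "sub P"
  have "len (P \<inter> Le m) (Le m) \<le> len (Pol {}) (Le m)"
    using subD(2)[OF sub_Int[OF P sub_Pol]] by (intro L.len_mono) (auto simp: Pol_empty)
  also have "\<dots> = enat (card {a \<in> Bs. wt a \<le> m})" by (rule len_Pol[OF Le_finite(1)])
  also have "\<dots> \<le> enat ((m + 1) ^ s)" using Le_finite(2) by simp
  finally have "len (P \<inter> Le m) (Le m) \<le> enat ((m + 1) ^ s)" .
  then show ?thesis unfolding growth_def by (cases "len (P \<inter> Le m) (Le m)") auto
qed

text \<open>
  If f of degree at most e lies in a prime Q but not in P, multiplication by f embeds S/P into
  Q/P, so the growth of S/P exceeds that of S/Q by the growth of S/P itself, up to the shift by e.
\<close>

lemma growth_step:
  assumes P: "sprime P" and Q: "sprime Q" and PQ: "P \<subseteq> Q" and f: "f \<in> Q" "f \<notin> P" "f \<in> Le e"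
  shows "growth Q (m + e) + growth P m \<le> growth P (m + e)"
proof -
  have sP: "sub P" and sQ: "sub Q" using P Q by (auto simp: sprime_def)
  have fS: "f \<in> S" "f \<in> carrier PA" using f(3) Le_S PolD by auto
  have i: "sub (P \<inter> Le k)" "sub (Q \<inter> Le k)" for k using sub_Int sP sQ sub_Pol by auto
  have deg: "g \<boxtimes> f \<in> Le (m + e)" if "g \<in> Le m" for g
    by (rule mult_Pol[OF that f(3)]) (auto intro: Bs_add)
  have im: "sub {g \<boxtimes> f | g. g \<in> Y}" if Y: "sub Y" for Y
    unfolding sub_def
  proof (intro conjI ballI)
    show "{g \<boxtimes> f | g. g \<in> Y} \<subseteq> carrier PA" using fS subD(5)[OF Y] by auto
    show "\<zero>\<^bsub>PA\<^esub> \<in> {g \<boxtimes> f | g. g \<in> Y}" using subD(2)[OF Y] fS by (intro CollectI exI[of _ "\<zero>\<^bsub>PA\<^esub>"]) simp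
  next
    fix x y assume "x \<in> {g \<boxtimes> f | g. g \<in> Y}" "y \<in> {g \<boxtimes> f | g. g \<in> Y}"
    then obtain g h where "x = g \<boxtimes> f" "y = h \<boxtimes> f" "g \<in> Y" "h \<in> Y" by auto
    moreover from this have "x \<boxplus> y = (g \<boxplus> h) \<boxtimes> f" using fS subD(5)[OF Y] by (simp add: A.l_distr)
    ultimately show "x \<boxplus> y \<in> {g \<boxtimes> f | g. g \<in> Y}" using subD(3)[OF Y] by blast
  next
    fix c x assume c: "c \<in> carrier K" and "x \<in> {g \<boxtimes> f | g. g \<in> Y}"
    then obtain g where "x = g \<boxtimes> f" "g \<in> Y" by auto
    moreover from this have "cst c \<boxtimes> x = (cst c \<boxtimes> g) \<boxtimes> f" using c fS subD(5)[OF Y] by (simp add: A.m_assoc)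
    ultimately show "cst c \<boxtimes> x \<in> {g \<boxtimes> f | g. g \<in> Y}" using subD(4)[OF Y] c by blast
  qed
  have "len (P \<inter> Le m) (Le m) \<le> len (P \<inter> Le (m + e)) (Q \<inter> Le (m + e))"
    unfolding L.len_def
  proof (rule chain_len_map[where g = "\<lambda>Y. sm (P \<inter> Le (m + e)) {g \<boxtimes> f | g. g \<in> Y}"], goal_cases)
    case (1 Y)
    then have Y: "sub Y" by simp
    have "g \<boxtimes> f \<in> Q" if "g \<in> Y" for g using 1 that Le_S[of m] Q f(1) unfolding sprime_def by blast
    then have "sm (P \<inter> Le (m + e)) {g \<boxtimes> f | g. g \<in> Y} \<subseteq> Q \<inter> Le (m + e)"
      using 1 PQ deg by (intro sm_least i) auto
    then show ?case using sub_sm[OF i(1) im[OF Y]] sm_upper1[OF i(1) im[OF Y]] by blast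
  next
    case (2 Y Z)
    have Y: "sub Y" "P \<inter> Le m \<subseteq> Y" "Y \<subseteq> Le m" and Z: "sub Z" "Z \<subseteq> Le m" and YZ: "Y \<subset> Z" using 2 by auto
    have le: "sm (P \<inter> Le (m + e)) {g \<boxtimes> f | g. g \<in> Y} \<subseteq> sm (P \<inter> Le (m + e)) {g \<boxtimes> f | g. g \<in> Z}"
      using YZ by (intro sm_mono) auto
    obtain y where y: "y \<in> Z" "y \<notin> Y" using YZ by auto
    have yc: "y \<in> carrier PA" "y \<in> S" using y Z Le_S PolD by blast+
    have "y \<boxtimes> f \<in> sm (P \<inter> Le (m + e)) {g \<boxtimes> f | g. g \<in> Z}"
      using sm_upper2[OF i(1) im[OF Z(1)]] y by blast
    moreover have "y \<boxtimes> f \<notin> sm (P \<inter> Le (m + e)) {g \<boxtimes> f | g. g \<in> Y}"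
    proof
      assume "y \<boxtimes> f \<in> sm (P \<inter> Le (m + e)) {g \<boxtimes> f | g. g \<in> Y}"
      then obtain u g where ug: "y \<boxtimes> f = u \<boxplus> g \<boxtimes> f" "u \<in> P" "g \<in> Y" by (auto elim!: smE)
      have gc: "g \<in> carrier PA" "u \<in> carrier PA" using ug Y(1) sP subD(5) by auto
      have "(y \<ominus>\<^bsub>PA\<^esub> g) \<boxtimes> f = y \<boxtimes> f \<ominus>\<^bsub>PA\<^esub> g \<boxtimes> f"
        using yc gc fS by (simp add: A.minus_eq A.l_distr A.l_minus)
      also have "\<dots> = u" using ug(1) gc fS by (simp add: A.minus_eq A.a_assoc A.r_neg)
      finally have "(y \<ominus>\<^bsub>PA\<^esub> g) \<boxtimes> f \<in> P" using ug by simp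
      moreover have yg: "y \<ominus>\<^bsub>PA\<^esub> g \<in> Le m" using sub_diff[OF sub_Pol, of y _ g] y Z ug Y by blast
      ultimately have "y \<ominus>\<^bsub>PA\<^esub> g \<in> P" using P f(2) fS(1) Le_S[of m] unfolding sprime_def by blast
      then have "y \<ominus>\<^bsub>PA\<^esub> g \<in> Y" using yg Y by blast
      then have "y \<ominus>\<^bsub>PA\<^esub> g \<boxplus> g \<in> Y" using subD(3)[OF Y(1)] ug by blast
      then show False using y gc yc by (simp add: A.minus_eq A.a_assoc A.l_neg)
    qed
    ultimately show ?case using le by blast
  qed
  then have 1: "enat (growth P m) \<le> len (P \<inter> Le (m + e)) (Q \<inter> Le (m + e))" using growth_len[OF sP] by metis
  have 2: "enat (growth P (m + e)) = len (P \<inter> Le (m + e)) (Q \<inter> Le (m + e)) + enat (growth Q (m + e))"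
    using L.len_add[of "P \<inter> Le (m + e)" "Q \<inter> Le (m + e)" "Le (m + e)"] i sub_Pol PQ growth_len[OF sP] growth_len[OF sQ]
    by auto
  from 1 2 show ?thesis by (cases "len (P \<inter> Le (m + e)) (Q \<inter> Le (m + e))") auto
qed

text \<open>
  By the growth estimate each step of a chain raises the order of growth of S/P by one: with i primes above P the
  growth at \<open>E m\<close> is at least \<open>m choose i\<close>. The number of monomials bounds the growth by a polynomial of degree s.
\<close>

theorem sprime_chain_bound:
  assumes P: "\<And>i. i \<le> n \<Longrightarrow> sprime (P i)" and lt: "\<And>i. i < n \<Longrightarrow> P i \<subset> P (Suc i)"
  shows "n \<le> s"
proof (rule ccontr)
  assume "\<not> n \<le> s"
  then have ns: "s < n" by simp
  have "\<exists>f e. f \<in> P (Suc i) \<and> f \<notin> P i \<and> f \<in> Le e" if "i < n" for i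
  proof -
    obtain f where f: "f \<in> P (Suc i)" "f \<notin> P i" using lt[OF \<open>i < n\<close>] by blast
    have fS: "f \<in> S" using P[of "Suc i"] f \<open>i < n\<close> by (auto simp: sprime_def)
    define e where "e = (\<Sum>m\<in>{m. f m \<noteq> \<zero>}. wt m)"
    have "wt m \<le> e" if "f m \<noteq> \<zero>" for m
      unfolding e_def using that S_carrier[OF fS] by (intro member_le_sum) (auto simp: PA_simps)
    then have "f \<in> Le e" using fS by (auto simp: Pol_def)
    then show ?thesis using f by blast
  qed
  then have "\<forall>i\<in>{..<n}. \<exists>f. \<exists>e. f \<in> P (Suc i) \<and> f \<notin> P i \<and> f \<in> Le e" by blast
  from bchoice[OF this] obtain f where
    "\<forall>i\<in>{..<n}. \<exists>e. f i \<in> P (Suc i) \<and> f i \<notin> P i \<and> f i \<in> Le e" by (elim exE)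
  from bchoice[OF this] obtain e where
    e: "\<forall>i\<in>{..<n}. f i \<in> P (Suc i) \<and> f i \<notin> P i \<and> f i \<in> Le (e i)" by (elim exE)
  have fe: "f i \<in> P (Suc i)" "f i \<notin> P i" "f i \<in> Le (e i)" if "i < n" for i
    using bspec[OF e, of i] that by simp_all
  define E where "E = Suc (\<Sum>i<n. e i)"
  have fE: "f i \<in> Le E" if "i < n" for i
  proof -
    have "e i \<le> E" unfolding E_def using that member_le_sum[of i "{..<n}" e] by simp
    then have "Le (e i) \<subseteq> Le E" by (intro Pol_mono) auto
    then show ?thesis using fe(3)[OF that] by blast
  qed
  have "i \<le> n \<Longrightarrow> (m choose i) \<le> growth (P (n - i)) (E * m)" for i m
  proof (induction i arbitrary: m)
    case 0
    have s: "sub (P n)" using P[of n] by (simp add: sprime_def)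
    have "\<one>\<^bsub>PA\<^esub> \<in> Le (E * m)" using monom_Pol[of \<one> "{#}"] by (simp add: PA_simps)
    moreover have "\<one>\<^bsub>PA\<^esub> \<notin> P n" using P[of n] by (simp add: sprime_def)
    ultimately have "1 \<le> len (P n \<inter> Le (E * m)) (Le (E * m))"
      using s by (intro L.len_ge_1 sub_Int sub_Pol) auto
    then show ?case using growth_len[OF s, of "E * m"] by (metis diff_zero enat_ord_simps(1) binomial_n_0 one_enat_def)
  next
    case (Suc i)
    let ?k = "n - Suc i"
    have k: "?k < n" "Suc ?k = n - i" using Suc.prems by auto
    have IH: "(m' choose i) \<le> growth (P (n - i)) (E * m')" for m' using Suc.IH Suc.prems by simp
    show ?case
    proof (induction m)
      case (Suc m)
      have "(Suc m choose Suc i) = (m choose i) + (m choose Suc i)" by simp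
      also have "\<dots> \<le> (Suc m choose i) + growth (P ?k) (E * m)"
        using Suc by (intro add_mono) (cases i, auto)
      also have "\<dots> \<le> growth (P (n - i)) (E * Suc m) + growth (P ?k) (E * m)"
        using IH[of "Suc m"] by simp
      also have "\<dots> \<le> growth (P ?k) (E * Suc m)"
        using growth_step[OF P[of ?k] P[of "Suc ?k"] _ fe(1,2)[OF k(1)] fE[OF k(1)], of "E * m"] lt[OF k(1)] k
        by (simp add: algebra_simps)
      finally show ?case .
    qed simp
  qed
  from this[of n] have low: "(m choose n) \<le> (E * m + 1) ^ s" for m
    using growth_len[of "P 0" "E * m"] P[of 0] by (auto simp: sprime_def intro: order_trans)
  define F where "F = E + 1"
  define m where "m = n ^ n * F ^ s + n"
  have nm: "n \<le> m" "1 \<le> m" "0 < n" using ns by (auto simp: m_def)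
  have "(real m / real n) ^ n \<le> real (m choose n)" using binomial_ge_n_over_k_pow_k[OF nm(1), where ?'a = real] by simp
  also have "\<dots> \<le> real ((E * m + 1) ^ s)" using low by (simp only: of_nat_le_iff)
  also have "\<dots> \<le> real ((F * m) ^ s)"
    using nm by (simp only: of_nat_le_iff, intro power_mono) (auto simp: F_def algebra_simps)
  finally have "real m ^ n / real n ^ n \<le> real F ^ s * real m ^ s"
    by (simp add: power_divide power_mult_distrib)
  then have "real m ^ n \<le> real m ^ s * (real n ^ n * real F ^ s)"
    using nm by (simp add: pos_divide_le_eq mult_ac)
  moreover have "real m ^ n = real m ^ s * real m ^ (n - s)" using ns by (simp flip: power_add)
  ultimately have "real m ^ (n - s) \<le> real n ^ n * real F ^ s" using nm by simp
  then have "real m ^ 1 \<le> real n ^ n * real F ^ s"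
    using nm ns by (intro order_trans[OF power_increasing[of 1 "n - s"]]) auto
  then have "real m \<le> real n ^ n * real F ^ s" by (simp only: power_one_right)
  then have "real m \<le> real (n ^ n * F ^ s)" by simp
  then show False using nm by (simp only: of_nat_le_iff m_def)
qed

end

section \<open>Internal direct sums\<close>

context abelian_group begin

lemma ids_finsum_unique:
  assumes ids: "internal_direct_sum G A" and F: "finite F" and a: "\<And>i. i \<in> F \<Longrightarrow> a i \<in> A i"
    and sum: "(\<Oplus>i\<in>F. a i) = b" and b: "b \<in> A j"
  shows "i \<in> F \<Longrightarrow> a i = (if i = j then b else \<zero>)" "j \<notin> F \<Longrightarrow> b = \<zero>"
proof -
  have sg: "additive_subgroup (A i) G" for i using ids by (simp add: internal_direct_sum_def)
  have z: "\<zero> \<in> A i" and sub: "A i \<subseteq> carrier G" for i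
    using additive_subgroup.zero_closed[OF sg] additive_subgroup.a_subset[OF sg] by auto
  define a' where "a' i = (if i \<in> F then a i else \<zero>)" for i
  define b' where "b' i = (if i = j then b else \<zero>)" for i
  have ac: "a' i \<in> A i" "b' i \<in> A i" for i using a b z by (auto simp: a'_def b'_def)
  have "{i. a' i \<noteq> \<zero>} \<subseteq> F" by (auto simp: a'_def)
  then have fa: "finite {i. a' i \<noteq> \<zero>}" using F finite_subset by blast
  have fb: "finite {i. b' i \<noteq> \<zero>}" by (rule finite_subset[of _ "{j}"]) (auto simp: b'_def)
  have sa: "finsum G a' {i. a' i \<noteq> \<zero>} = b"
  proof -
    have "finsum G a' {i. a' i \<noteq> \<zero>} = finsum G a F"
      by (rule add.finprod_mono_neutral_cong_left) (use F a sub in \<open>auto simp: a'_def\<close>)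
    then show ?thesis using sum by simp
  qed
  have bc: "b \<in> carrier G" using b sub by auto
  have sb: "finsum G b' {i. b' i \<noteq> \<zero>} = b"
  proof -
    have "finsum G b' {i. b' i \<noteq> \<zero>} = finsum G b' {j}"
      by (rule add.finprod_mono_neutral_cong_left) (use b sub in \<open>auto simp: b'_def\<close>)
    also have "\<dots> = b" using bc by (subst finsum_insert) (auto simp: b'_def)
    finally show ?thesis .
  qed
  have "\<exists>!f. (\<forall>i. f i \<in> A i) \<and> finite {i. f i \<noteq> \<zero>} \<and> b = finsum G f {i. f i \<noteq> \<zero>}"
    using ids bc by (simp add: internal_direct_sum_def)
  then have e: "a' = b'" using ac fa fb sa sb by (metis (no_types, lifting))
  show "i \<in> F \<Longrightarrow> a i = (if i = j then b else \<zero>)" using fun_cong[OF e, of i] by (simp add: a'_def b'_def)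
  show "j \<notin> F \<Longrightarrow> b = \<zero>" using fun_cong[OF e, of j] by (simp add: a'_def b'_def)
qed

lemma ids_decompose:
  assumes "internal_direct_sum G A" "x \<in> carrier G"
  obtains f where "\<And>i. f i \<in> A i" "finite {i. f i \<noteq> \<zero>}" "x = finsum G f {i. f i \<noteq> \<zero>}"
  using assms unfolding internal_direct_sum_def by blast

lemma ids_carrier: "internal_direct_sum G A \<Longrightarrow> A i \<subseteq> carrier G"
  by (simp add: internal_direct_sum_def additive_subgroup.a_subset)

lemma ids_closed:
  assumes "internal_direct_sum G A"
  shows "\<zero> \<in> A i" "\<lbrakk>x \<in> A i; y \<in> A i\<rbrakk> \<Longrightarrow> x \<oplus> y \<in> A i"
proof -
  have sg: "additive_subgroup (A i) G" using assms by (simp add: internal_direct_sum_def)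
  show "\<zero> \<in> A i" "\<lbrakk>x \<in> A i; y \<in> A i\<rbrakk> \<Longrightarrow> x \<oplus> y \<in> A i"
    using additive_subgroup.zero_closed[OF sg] additive_subgroup.a_closed[OF sg] by auto
qed

end

section \<open>Evaluation of polynomials in a module\<close>

text \<open>
  Evaluation of polynomials with coefficients in k, linear in prescribed values of the monomials. With N = R
  it gives the presentation of the ring, with N = M the one of the module.
\<close>

locale lin_eval = graded_poly "R\<lparr>carrier := k\<rparr>" w s + N: module R N
  for R :: "('a, 'r) ring_scheme" and k w s and N :: "('a, 'm, 's) module_scheme" +
  fixes Nm :: "nat multiset \<Rightarrow> 'm"
  assumes k_sub: "k \<subseteq> carrier R" and Nm_closed: "\<And>m. Nm m \<in> carrier N"
begin

definition lin :: "(nat multiset \<Rightarrow> 'a) \<Rightarrow> 'm" where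
  "lin f = (\<Oplus>\<^bsub>N\<^esub>m\<in>{m. f m \<noteq> \<zero>\<^bsub>R\<^esub>}. f m \<odot>\<^bsub>N\<^esub> Nm m)"

lemma K_closed: "f \<in> carrier PA \<Longrightarrow> f m \<in> carrier R"
  using k_sub by (auto simp: PA_simps)

lemma lin_eq:
  assumes "f \<in> carrier PA" "finite F" "{m. f m \<noteq> \<zero>\<^bsub>R\<^esub>} \<subseteq> F"
  shows "lin f = (\<Oplus>\<^bsub>N\<^esub>m\<in>F. f m \<odot>\<^bsub>N\<^esub> Nm m)"
  unfolding lin_def
  by (rule N.add.finprod_mono_neutral_cong_left) (use assms K_closed Nm_closed in auto)

lemma lin_closed: "f \<in> carrier PA \<Longrightarrow> lin f \<in> carrier N"
  unfolding lin_def using K_closed Nm_closed by (intro N.M.finsum_closed) auto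

lemma fin_supp: "f \<in> carrier PA \<Longrightarrow> finite {m. f m \<noteq> \<zero>\<^bsub>R\<^esub>}"
  by (simp add: PA_simps)

lemma lin_add:
  assumes f: "f \<in> carrier PA" and g: "g \<in> carrier PA"
  shows "lin (f \<oplus>\<^bsub>PA\<^esub> g) = lin f \<oplus>\<^bsub>N\<^esub> lin g"
proof -
  let ?F = "{m. f m \<noteq> \<zero>\<^bsub>R\<^esub>} \<union> {m. g m \<noteq> \<zero>\<^bsub>R\<^esub>}"
  have F: "finite ?F" using fin_supp f g by auto
  have fg: "(f \<oplus>\<^bsub>PA\<^esub> g) m = f m \<oplus>\<^bsub>R\<^esub> g m" for m by (simp add: PA_simps(2))
  have "{m. (f \<oplus>\<^bsub>PA\<^esub> g) m \<noteq> \<zero>\<^bsub>R\<^esub>} \<subseteq> ?F" using N.R.l_zero by (auto simp: fg)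
  then have "lin (f \<oplus>\<^bsub>PA\<^esub> g) = (\<Oplus>\<^bsub>N\<^esub>m\<in>?F. (f \<oplus>\<^bsub>PA\<^esub> g) m \<odot>\<^bsub>N\<^esub> Nm m)" using f g F by (intro lin_eq) auto
  also have "\<dots> = (\<Oplus>\<^bsub>N\<^esub>m\<in>?F. f m \<odot>\<^bsub>N\<^esub> Nm m \<oplus>\<^bsub>N\<^esub> g m \<odot>\<^bsub>N\<^esub> Nm m)"
    using K_closed[OF f] K_closed[OF g] Nm_closed by (intro N.M.finsum_cong') (auto simp: fg N.smult_l_distr)
  also have "\<dots> = lin f \<oplus>\<^bsub>N\<^esub> lin g"
    using lin_eq[OF f F] lin_eq[OF g F] K_closed[OF f] K_closed[OF g] Nm_closed by (simp add: N.M.finsum_addf)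
  finally show ?thesis .
qed

lemma lin_zero: "lin \<zero>\<^bsub>PA\<^esub> = \<zero>\<^bsub>N\<^esub>"
  by (simp add: lin_def PA_zero_fun)

lemma lin_monom: assumes "c \<in> k" shows "lin (monom (R\<lparr>carrier := k\<rparr>) c m) = c \<odot>\<^bsub>N\<^esub> Nm m"
proof -
  have c: "monom (R\<lparr>carrier := k\<rparr>) c m \<in> carrier PA" using assms by simp
  have "lin (monom (R\<lparr>carrier := k\<rparr>) c m) = (\<Oplus>\<^bsub>N\<^esub>m'\<in>{m}. monom (R\<lparr>carrier := k\<rparr>) c m m' \<odot>\<^bsub>N\<^esub> Nm m')"
    by (rule lin_eq[OF c]) (auto simp: monom_def)
  also have "\<dots> = c \<odot>\<^bsub>N\<^esub> Nm m" using assms k_sub Nm_closed by (subst N.M.finsum_insert) (auto simp: monom_def)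
  finally show ?thesis .
qed

lemma lin_cst:
  assumes c: "c \<in> k" and f: "f \<in> carrier PA"
  shows "lin (cst c \<otimes>\<^bsub>PA\<^esub> f) = c \<odot>\<^bsub>N\<^esub> lin f"
proof -
  have "f \<in> Pol UNIV" using f by (simp add: Pol_UNIV)
  then show ?thesis
  proof (induction rule: Pol_induct)
    case zero then show ?case using c k_sub by (auto simp: lin_zero)
  next
    case (add f d m)
    have fc: "f \<in> carrier PA" using add by (simp add: Pol_UNIV)
    have cR: "c \<in> carrier R" "d \<in> carrier R" using c add k_sub by auto
    have cd: "c \<otimes>\<^bsub>R\<^esub> d \<in> k" using cst_monom[of c d m] c add m_closed[of c d] by simp
    have "cst c \<otimes>\<^bsub>PA\<^esub> (f \<oplus>\<^bsub>PA\<^esub> monom (R\<lparr>carrier := k\<rparr>) d m) = cst c \<otimes>\<^bsub>PA\<^esub> f \<oplus>\<^bsub>PA\<^esub> monom (R\<lparr>carrier := k\<rparr>) (c \<otimes>\<^bsub>R\<^esub> d) m"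
      using c add fc cst_monom[of c d m] by (simp add: A.r_distr)
    then have "lin (cst c \<otimes>\<^bsub>PA\<^esub> (f \<oplus>\<^bsub>PA\<^esub> monom (R\<lparr>carrier := k\<rparr>) d m)) = lin (cst c \<otimes>\<^bsub>PA\<^esub> f) \<oplus>\<^bsub>N\<^esub> (c \<otimes>\<^bsub>R\<^esub> d) \<odot>\<^bsub>N\<^esub> Nm m"
      using c fc cd by (simp add: lin_add lin_monom)
    also have "\<dots> = c \<odot>\<^bsub>N\<^esub> lin f \<oplus>\<^bsub>N\<^esub> c \<odot>\<^bsub>N\<^esub> (d \<odot>\<^bsub>N\<^esub> Nm m)"
      using add cR Nm_closed by (simp add: N.smult_assoc1)
    also have "\<dots> = c \<odot>\<^bsub>N\<^esub> lin (f \<oplus>\<^bsub>PA\<^esub> monom (R\<lparr>carrier := k\<rparr>) d m)"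
      using add cR Nm_closed fc lin_closed[OF fc] by (simp add: lin_add lin_monom N.smult_r_distr)
    finally show ?case .
  qed
qed

lemma lin_in:
  assumes f: "f \<in> Pol X" and z: "\<zero>\<^bsub>N\<^esub> \<in> Y" and a: "\<And>x y. \<lbrakk>x \<in> Y; y \<in> Y\<rbrakk> \<Longrightarrow> x \<oplus>\<^bsub>N\<^esub> y \<in> Y"
    and m: "\<And>c m. \<lbrakk>c \<in> k; m \<in> X\<rbrakk> \<Longrightarrow> c \<odot>\<^bsub>N\<^esub> Nm m \<in> Y"
  shows "lin f \<in> Y"
  using f
proof (induction rule: Pol_induct)
  case zero then show ?case using z by (simp add: lin_zero)
next
  case (add f c m)
  then show ?case using a[OF add(4) assms(4)[of c m]] PolD[OF add(1)] by (simp add: lin_add lin_monom)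
qed

lemma sub_lin_vimage:
  assumes z: "\<zero>\<^bsub>N\<^esub> \<in> Y" and a: "\<And>x y. \<lbrakk>x \<in> Y; y \<in> Y\<rbrakk> \<Longrightarrow> x \<oplus>\<^bsub>N\<^esub> y \<in> Y"
    and m: "\<And>c y. \<lbrakk>c \<in> k; y \<in> Y\<rbrakk> \<Longrightarrow> c \<odot>\<^bsub>N\<^esub> y \<in> Y"
  shows "sub {f \<in> carrier PA. lin f \<in> Y}"
  unfolding sub_def using assms by (auto simp: lin_zero lin_add lin_cst)

lemma lin_finsum_cmp:
  assumes f: "f \<in> carrier PA"
  shows "\<exists>J. finite J \<and> (\<forall>j. j \<notin> J \<longrightarrow> cmp j f = \<zero>\<^bsub>PA\<^esub>) \<and> lin f = (\<Oplus>\<^bsub>N\<^esub>j\<in>J. lin (cmp j f))"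
proof -
  have "lin (restr {m. wt m \<in> J} f) = (\<Oplus>\<^bsub>N\<^esub>j\<in>J. lin (cmp j f))" if "finite J" for J
    using that
  proof (induction J)
    case empty
    have "restr {m. wt m \<in> {}} f = \<zero>\<^bsub>PA\<^esub>" by (rule ext) (simp add: restr_def PA_zero_fun)
    then show ?case by (simp add: lin_zero)
  next
    case (insert j J)
    have e: "{m. wt m \<in> insert j J} = Dg j \<union> {m. wt m \<in> J}" by auto
    have "restr {m. wt m \<in> insert j J} f = cmp j f \<oplus>\<^bsub>PA\<^esub> restr {m. wt m \<in> J} f"
      unfolding e using insert by (intro restr_Un[OF f]) auto
    then show ?case using insert f lin_closed by (simp add: lin_add)
  qed
  from this[of "wt ` {m. f m \<noteq> \<zero>\<^bsub>R\<^esub>}"]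
  have 1: "lin (restr {m. wt m \<in> wt ` {m. f m \<noteq> \<zero>\<^bsub>R\<^esub>}} f) = (\<Oplus>\<^bsub>N\<^esub>j\<in>wt ` {m. f m \<noteq> \<zero>\<^bsub>R\<^esub>}. lin (cmp j f))"
    using fin_supp[OF f] by simp
  have 2: "restr {m. wt m \<in> wt ` {m. f m \<noteq> \<zero>\<^bsub>R\<^esub>}} f = f" by (rule ext) (auto simp: restr_def)
  have "cmp j f = \<zero>\<^bsub>PA\<^esub>" if "j \<notin> wt ` {m. f m \<noteq> \<zero>\<^bsub>R\<^esub>}" for j
    using that by (intro ext) (auto simp: restr_def PA_zero_fun)
  then show ?thesis using 1 2 fin_supp[OF f] by (intro exI[of _ "wt ` {m. f m \<noteq> \<zero>\<^bsub>R\<^esub>}"]) auto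
qed

text \<open>
  The values of the homogeneous components are a decomposition in the graded module N, so they are the components of the
  value.
\<close>

lemma lin_homogeneous_unique:
  assumes f: "f \<in> carrier PA" and ids: "internal_direct_sum N D" and inj: "inj \<delta>"
    and d: "\<And>j. lin (cmp j f) \<in> D (\<delta> j)" and b: "lin f = b" "b \<in> D (\<delta> i)"
  shows "lin (cmp j f) = (if j = i then b else \<zero>\<^bsub>N\<^esub>)"
proof -
  obtain J where J: "finite J" "\<And>j. j \<notin> J \<Longrightarrow> cmp j f = \<zero>\<^bsub>PA\<^esub>" "lin f = (\<Oplus>\<^bsub>N\<^esub>j\<in>J. lin (cmp j f))"
    using lin_finsum_cmp[OF f] by blast
  define a where "a e = lin (cmp (inv_into UNIV \<delta> e) f)" for e
  have ad: "a (\<delta> j) = lin (cmp j f)" for j using inj by (simp add: a_def)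
  have "(\<Oplus>\<^bsub>N\<^esub>e\<in>\<delta> ` J. a e) = (\<Oplus>\<^bsub>N\<^esub>j\<in>J. a (\<delta> j))"
    using inj f lin_closed by (intro N.M.finsum_reindex) (auto simp: ad intro: inj_on_subset)
  then have sum: "(\<Oplus>\<^bsub>N\<^esub>e\<in>\<delta> ` J. a e) = b" using J(3) b by (simp add: ad)
  have aD: "a e \<in> D e" if "e \<in> \<delta> ` J" for e using that d ad by auto
  note u = N.M.ids_finsum_unique[OF ids _ aD sum b(2)]
  show ?thesis
  proof (cases "j \<in> J")
    case True
    then have "a (\<delta> j) = (if \<delta> j = \<delta> i then b else \<zero>\<^bsub>N\<^esub>)" using u(1)[of "\<delta> j"] J(1) by auto
    then show ?thesis using inj by (simp add: ad inj_eq)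
  next
    case False
    then have "lin (cmp j f) = \<zero>\<^bsub>N\<^esub>" using J(2) by (simp add: lin_zero)
    moreover have "b = \<zero>\<^bsub>N\<^esub>" if "j = i" using u(2) False that J(1) inj by (auto simp: inj_image_mem_iff)
    ultimately show ?thesis by auto
  qed
qed

lemma lin_homogeneous_zero:
  assumes f: "f \<in> carrier PA" and ids: "internal_direct_sum N D" and inj: "inj \<delta>"
    and d: "\<And>j. lin (cmp j f) \<in> D (\<delta> j)" and b: "lin f = \<zero>\<^bsub>N\<^esub>"
  shows "lin (cmp j f) = \<zero>\<^bsub>N\<^esub>"
  using lin_homogeneous_unique[OF f ids inj d b N.M.ids_closed(1)[OF ids], where i = 0 and j = j] by simp

lemma lin_minus:
  assumes "f \<in> carrier PA" "g \<in> carrier PA"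
  shows "lin (f \<ominus>\<^bsub>PA\<^esub> g) = lin f \<ominus>\<^bsub>N\<^esub> lin g"
proof -
  have "f = (f \<ominus>\<^bsub>PA\<^esub> g) \<oplus>\<^bsub>PA\<^esub> g" using assms by (simp add: A.minus_eq A.a_assoc A.l_neg)
  then have "lin f = lin (f \<ominus>\<^bsub>PA\<^esub> g) \<oplus>\<^bsub>N\<^esub> lin g" using assms lin_add[of "f \<ominus>\<^bsub>PA\<^esub> g" g] by simp
  then show ?thesis using lin_closed assms
    by (simp add: N.M.minus_eq N.M.a_assoc N.M.r_neg)
qed

end

section \<open>Quotient modules\<close>

lemma submoduleD:
  assumes "submodule X R M"
  shows "X \<subseteq> carrier M" "\<zero>\<^bsub>M\<^esub> \<in> X" "\<lbrakk>x \<in> X; y \<in> X\<rbrakk> \<Longrightarrow> x \<oplus>\<^bsub>M\<^esub> y \<in> X" "\<lbrakk>a \<in> carrier R; x \<in> X\<rbrakk> \<Longrightarrow> a \<odot>\<^bsub>M\<^esub> x \<in> X"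
proof -
  interpret submodule X R M by fact
  show "X \<subseteq> carrier M" using subset by simp
  show "\<zero>\<^bsub>M\<^esub> \<in> X" using one_closed by simp
  show "\<lbrakk>x \<in> X; y \<in> X\<rbrakk> \<Longrightarrow> x \<oplus>\<^bsub>M\<^esub> y \<in> X" using m_closed[of x y] by simp
  show "\<lbrakk>a \<in> carrier R; x \<in> X\<rbrakk> \<Longrightarrow> a \<odot>\<^bsub>M\<^esub> x \<in> X" by simp
qed

context module begin

lemma submoduleI':
  assumes "X \<subseteq> carrier M" "\<zero>\<^bsub>M\<^esub> \<in> X" "\<And>x y. \<lbrakk>x \<in> X; y \<in> X\<rbrakk> \<Longrightarrow> x \<oplus>\<^bsub>M\<^esub> y \<in> X"
    "\<And>a x. \<lbrakk>a \<in> carrier R; x \<in> X\<rbrakk> \<Longrightarrow> a \<odot>\<^bsub>M\<^esub> x \<in> X"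
  shows "submodule X R M"
proof (rule submoduleI)
  fix x assume x: "x \<in> X"
  have "\<ominus>\<^bsub>M\<^esub> x = (\<ominus> \<one>) \<odot>\<^bsub>M\<^esub> x" using x assms(1) by (auto simp: smult_l_minus)
  then show "\<ominus>\<^bsub>M\<^esub> x \<in> X" using assms(4)[OF _ x, of "\<ominus> \<one>"] by simp
qed (use assms in auto)

lemma submodule_neg: "submodule X R M \<Longrightarrow> x \<in> X \<Longrightarrow> \<ominus>\<^bsub>M\<^esub> x \<in> X"
  using submoduleE(3) by blast

context
  fixes X assumes X: "submodule X R M"
begin

lemma X_subgroup: "abelian_subgroup X M"
  using X by (intro abelian_subgroupI3 additive_subgroupI) (auto simp: submodule_def M.abelian_group_axioms)

lemma coset_mem: "x \<in> carrier M \<Longrightarrow> y \<in> X +>\<^bsub>M\<^esub> x \<longleftrightarrow> (\<exists>h\<in>X. y = h \<oplus>\<^bsub>M\<^esub> x)"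
  by (auto simp: a_r_coset_def')

lemma coset_eq:
  assumes "x \<in> carrier M" "y \<in> carrier M"
  shows "X +>\<^bsub>M\<^esub> x = X +>\<^bsub>M\<^esub> y \<longleftrightarrow> x \<ominus>\<^bsub>M\<^esub> y \<in> X"
proof
  note Xc = submoduleD[OF X]
  assume "X +>\<^bsub>M\<^esub> x = X +>\<^bsub>M\<^esub> y"
  moreover have "x \<in> X +>\<^bsub>M\<^esub> x" using assms Xc(2) coset_mem[OF assms(1), of x] by (auto intro!: bexI[of _ "\<zero>\<^bsub>M\<^esub>"])
  ultimately obtain h where "h \<in> X" "x = h \<oplus>\<^bsub>M\<^esub> y" using coset_mem[OF assms(2)] by auto
  then show "x \<ominus>\<^bsub>M\<^esub> y \<in> X" using Xc(1) assms by (auto simp: M.minus_eq M.a_assoc M.r_neg)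
next
  note Xc = submoduleD[OF X]
  assume d: "x \<ominus>\<^bsub>M\<^esub> y \<in> X"
  have e: "h \<oplus>\<^bsub>M\<^esub> a = (h \<oplus>\<^bsub>M\<^esub> (a \<ominus>\<^bsub>M\<^esub> b)) \<oplus>\<^bsub>M\<^esub> b" if "h \<in> X" "a \<in> carrier M" "b \<in> carrier M" for h a b
  proof -
    have "h \<in> carrier M" using that Xc(1) by auto
    then show ?thesis using that by (simp add: M.minus_eq M.a_assoc M.l_neg)
  qed
  have d': "y \<ominus>\<^bsub>M\<^esub> x \<in> X"
  proof -
    have "\<ominus>\<^bsub>M\<^esub> (x \<ominus>\<^bsub>M\<^esub> y) = y \<ominus>\<^bsub>M\<^esub> x" using assms by (simp add: M.minus_eq M.minus_add M.a_comm)
    then show ?thesis using submodule_neg[OF X d] by simp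
  qed
  show "X +>\<^bsub>M\<^esub> x = X +>\<^bsub>M\<^esub> y"
  proof (intro equalityI subsetI)
    fix z assume "z \<in> X +>\<^bsub>M\<^esub> x"
    then obtain h where "h \<in> X" "z = h \<oplus>\<^bsub>M\<^esub> x" using coset_mem assms by auto
    then show "z \<in> X +>\<^bsub>M\<^esub> y" using e[of h x y] assms Xc(3)[of h "x \<ominus>\<^bsub>M\<^esub> y"] d coset_mem[OF assms(2)] by auto
  next
    fix z assume "z \<in> X +>\<^bsub>M\<^esub> y"
    then obtain h where "h \<in> X" "z = h \<oplus>\<^bsub>M\<^esub> y" using coset_mem assms by auto
    then show "z \<in> X +>\<^bsub>M\<^esub> x" using e[of h y x] assms Xc(3)[of h "y \<ominus>\<^bsub>M\<^esub> x"] d' coset_mem[OF assms(1)] by auto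
  qed
qed

lemma coset_add: "\<lbrakk>x \<in> carrier M; y \<in> carrier M\<rbrakk> \<Longrightarrow> set_add M (X +>\<^bsub>M\<^esub> x) (X +>\<^bsub>M\<^esub> y) = X +>\<^bsub>M\<^esub> (x \<oplus>\<^bsub>M\<^esub> y)"
  by (rule abelian_subgroup.a_rcos_sum[OF X_subgroup])

lemma coset_smult:
  assumes "a \<in> carrier R" "x \<in> carrier M"
  shows "(\<Union>y\<in>X +>\<^bsub>M\<^esub> x. X +>\<^bsub>M\<^esub> (a \<odot>\<^bsub>M\<^esub> y)) = X +>\<^bsub>M\<^esub> (a \<odot>\<^bsub>M\<^esub> x)"
proof -
  note Xc = submoduleD[OF X]
  have "X +>\<^bsub>M\<^esub> (a \<odot>\<^bsub>M\<^esub> y) = X +>\<^bsub>M\<^esub> (a \<odot>\<^bsub>M\<^esub> x)" if y: "y \<in> X +>\<^bsub>M\<^esub> x" for y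
  proof -
    obtain h where h: "h \<in> X" "y = h \<oplus>\<^bsub>M\<^esub> x" using y coset_mem assms by auto
    have c: "h \<in> carrier M" using h Xc by auto
    have "a \<odot>\<^bsub>M\<^esub> y \<ominus>\<^bsub>M\<^esub> a \<odot>\<^bsub>M\<^esub> x = a \<odot>\<^bsub>M\<^esub> h"
      using h c assms by (simp add: smult_r_distr M.minus_eq M.a_assoc M.r_neg)
    then show ?thesis using coset_eq[of "a \<odot>\<^bsub>M\<^esub> y" "a \<odot>\<^bsub>M\<^esub> x"] Xc(4)[OF assms(1) h(1)] h c assms by simp
  qed
  moreover have "x \<in> X +>\<^bsub>M\<^esub> x" using assms Xc(2) coset_mem[OF assms(2), of x] by (auto intro!: bexI[of _ "\<zero>\<^bsub>M\<^esub>"])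
  ultimately show ?thesis by blast
qed

lemma coset_zero: "X +>\<^bsub>M\<^esub> \<zero>\<^bsub>M\<^esub> = X"
  using submoduleD(1)[OF X] by simp

text \<open>
  The image of a subset of the carrier in the quotient module, with the operations of the quotient; the degree pieces
  of a graded quotient and the quotient itself are of this form.
\<close>

definition piece where
  "piece Y = (quotient_module M X)\<lparr>carrier := (\<lambda>x. X +>\<^bsub>M\<^esub> x) ` Y\<rparr>"

lemma submodule_piece:
  assumes Y: "Y \<subseteq> Y0" "Y0 \<subseteq> carrier M" "\<zero>\<^bsub>M\<^esub> \<in> Y" "\<And>x y. \<lbrakk>x \<in> Y; y \<in> Y\<rbrakk> \<Longrightarrow> x \<oplus>\<^bsub>M\<^esub> y \<in> Y"
    "\<And>x. x \<in> Y \<Longrightarrow> \<ominus>\<^bsub>M\<^esub> x \<in> Y"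
    and Kc: "carrier K' \<subseteq> carrier R" "\<And>c x. \<lbrakk>c \<in> carrier K'; x \<in> Y\<rbrakk> \<Longrightarrow> c \<odot>\<^bsub>M\<^esub> x \<in> Y"
  shows "submodule ((\<lambda>x. X +>\<^bsub>M\<^esub> x) ` Y) K' (piece Y0)"
proof -
  have Yc: "x \<in> carrier M" if "x \<in> Y" for x using that Y by auto
  have op: "mult (add_monoid (piece Y0)) = set_add M" "one (add_monoid (piece Y0)) = X"
    "carrier (add_monoid (piece Y0)) = (\<lambda>x. X +>\<^bsub>M\<^esub> x) ` Y0"
    by (simp_all add: piece_def quotient_module_def)
  show ?thesis
  proof (intro submodule.intro subgroup.intro submodule_axioms.intro)
    show "(\<lambda>x. X +>\<^bsub>M\<^esub> x) ` Y \<subseteq> carrier (add_monoid (piece Y0))" unfolding op(3) using Y(1) by (rule image_mono)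
    show "\<one>\<^bsub>add_monoid (piece Y0)\<^esub> \<in> (\<lambda>x. X +>\<^bsub>M\<^esub> x) ` Y"
      unfolding op using Y(3) coset_zero by (metis imageI)
  next
    fix A B assume "A \<in> (\<lambda>x. X +>\<^bsub>M\<^esub> x) ` Y" "B \<in> (\<lambda>x. X +>\<^bsub>M\<^esub> x) ` Y"
    then show "A \<otimes>\<^bsub>add_monoid (piece Y0)\<^esub> B \<in> (\<lambda>x. X +>\<^bsub>M\<^esub> x) ` Y"
      unfolding op using Yc Y(4) by (auto simp: coset_add)
  next
    fix A assume "A \<in> (\<lambda>x. X +>\<^bsub>M\<^esub> x) ` Y"
    then obtain x where x: "A = X +>\<^bsub>M\<^esub> x" "x \<in> Y" by auto
    have "inv\<^bsub>add_monoid (piece Y0)\<^esub> A = X +>\<^bsub>M\<^esub> (\<ominus>\<^bsub>M\<^esub> x)"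
      unfolding m_inv_def op
    proof (rule the_equality)
      show "X +>\<^bsub>M\<^esub> (\<ominus>\<^bsub>M\<^esub> x) \<in> (\<lambda>x. X +>\<^bsub>M\<^esub> x) ` Y0 \<and> set_add M A (X +>\<^bsub>M\<^esub> (\<ominus>\<^bsub>M\<^esub> x)) = X \<and> set_add M (X +>\<^bsub>M\<^esub> (\<ominus>\<^bsub>M\<^esub> x)) A = X"
        using x Y(5)[OF x(2)] Y(1) Yc coset_zero by (auto simp: coset_add M.l_neg M.r_neg)
    next
      fix B assume B: "B \<in> (\<lambda>x. X +>\<^bsub>M\<^esub> x) ` Y0 \<and> set_add M A B = X \<and> set_add M B A = X"
      then obtain y where y: "B = X +>\<^bsub>M\<^esub> y" "y \<in> carrier M" using Y by auto
      have "X +>\<^bsub>M\<^esub> (y \<oplus>\<^bsub>M\<^esub> x) = X +>\<^bsub>M\<^esub> \<zero>\<^bsub>M\<^esub>" using B x y Yc coset_zero by (simp add: coset_add)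
      moreover have "\<ominus>\<^bsub>M\<^esub> \<zero>\<^bsub>M\<^esub> = \<zero>\<^bsub>M\<^esub>" by (rule M.minus_equality) auto
      ultimately have "y \<oplus>\<^bsub>M\<^esub> x \<in> X" using coset_eq[of "y \<oplus>\<^bsub>M\<^esub> x" "\<zero>\<^bsub>M\<^esub>"] x y Yc by (simp add: M.minus_eq)
      then have "y \<ominus>\<^bsub>M\<^esub> (\<ominus>\<^bsub>M\<^esub> x) \<in> X" using x y Yc by (simp add: M.minus_eq)
      then show "B = X +>\<^bsub>M\<^esub> (\<ominus>\<^bsub>M\<^esub> x)" using coset_eq[of y "\<ominus>\<^bsub>M\<^esub> x"] x y Yc by simp
    qed
    then show "inv\<^bsub>add_monoid (piece Y0)\<^esub> A \<in> (\<lambda>x. X +>\<^bsub>M\<^esub> x) ` Y" using Y(5) x by auto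
  next
    fix c A assume c: "c \<in> carrier K'" and "A \<in> (\<lambda>x. X +>\<^bsub>M\<^esub> x) ` Y"
    then obtain x where x: "A = X +>\<^bsub>M\<^esub> x" "x \<in> Y" by auto
    have "c \<odot>\<^bsub>piece Y0\<^esub> A = X +>\<^bsub>M\<^esub> (c \<odot>\<^bsub>M\<^esub> x)"
      using coset_smult[of c x] c x Kc Yc by (auto simp: piece_def quotient_module_def)
    then show "c \<odot>\<^bsub>piece Y0\<^esub> A \<in> (\<lambda>x. X +>\<^bsub>M\<^esub> x) ` Y" using Kc(2) c x by auto
  qed
qed

lemma piece_submoduleD:
  assumes C: "submodule C K' (piece Y0)" and K: "carrier K' \<subseteq> carrier R"
  shows "C \<subseteq> (\<lambda>x. X +>\<^bsub>M\<^esub> x) ` Y0" "X \<in> C"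
    "\<lbrakk>x \<in> carrier M; y \<in> carrier M; X +>\<^bsub>M\<^esub> x \<in> C; X +>\<^bsub>M\<^esub> y \<in> C\<rbrakk> \<Longrightarrow> X +>\<^bsub>M\<^esub> (x \<oplus>\<^bsub>M\<^esub> y) \<in> C"
    "\<lbrakk>c \<in> carrier K'; x \<in> carrier M; X +>\<^bsub>M\<^esub> x \<in> C\<rbrakk> \<Longrightarrow> X +>\<^bsub>M\<^esub> (c \<odot>\<^bsub>M\<^esub> x) \<in> C"
proof -
  note D = submoduleD[OF C]
  show "C \<subseteq> (\<lambda>x. X +>\<^bsub>M\<^esub> x) ` Y0" "X \<in> C" using D(1,2) by (simp_all add: piece_def quotient_module_def)
  show "X +>\<^bsub>M\<^esub> (x \<oplus>\<^bsub>M\<^esub> y) \<in> C" if "x \<in> carrier M" "y \<in> carrier M" "X +>\<^bsub>M\<^esub> x \<in> C" "X +>\<^bsub>M\<^esub> y \<in> C"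
    using D(3)[OF that(3,4)] that by (simp add: piece_def quotient_module_def coset_add)
  show "X +>\<^bsub>M\<^esub> (c \<odot>\<^bsub>M\<^esub> x) \<in> C" if "c \<in> carrier K'" "x \<in> carrier M" "X +>\<^bsub>M\<^esub> x \<in> C"
    using D(4)[OF that(1,3)] that K coset_smult[of c x] by (auto simp: piece_def quotient_module_def)
qed

lemma quotient_module_piece: "piece (carrier M) = quotient_module M X"
  by (simp add: piece_def quotient_module_def A_RCOSETS_defs RCOSETS_def a_r_coset_def UNION_singleton_eq_range)

lemma quotient_piece_piece: "quotient_piece M Mg X j = piece (Mg j)"
  by (simp add: piece_def quotient_piece_def)

end

lemma submodule_generated_least: "\<lbrakk>submodule N R M; A \<subseteq> N\<rbrakk> \<Longrightarrow> submodule_generated R M A \<subseteq> N"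
  by (auto simp: submodule_generated_def)

lemma submodule_generated_upper: "A \<subseteq> submodule_generated R M A"
  by (auto simp: submodule_generated_def)

lemma submodule_generated_submodule:
  assumes "A \<subseteq> carrier M" shows "submodule (submodule_generated R M A) R M"
proof (rule submoduleI')
  show "submodule_generated R M A \<subseteq> carrier M"
    using submodule_generated_least[OF carrier_is_submodule assms] .
qed (auto simp: submodule_generated_def dest: submoduleD(2-4))

end

lemma module_length_chain_len: "module_length R M = chain_len (\<lambda>C. submodule C R M)"
  by (simp add: module_length_def chain_len_def)

lemma krull_dim_chain_len: "krull_dim R = chain_len (\<lambda>P. primeideal P R)"
  by (simp add: krull_dim_def chain_len_def)

lemma (in cring) module_regular: "module R (regular_module R)"
proof -
  show ?thesis
  proof (rule moduleI)
    show "abelian_group (regular_module R)"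
    proof (rule abelian_groupI)
      fix x assume "x \<in> carrier (regular_module R)"
      then show "\<exists>y\<in>carrier (regular_module R). y \<oplus>\<^bsub>regular_module R\<^esub> x = \<zero>\<^bsub>regular_module R\<^esub>"
        by (intro bexI[of _ "\<ominus> x"]) (auto simp: regular_module_def l_neg)
    qed (simp_all add: regular_module_def a_assoc, simp_all add: a_comm)
  qed (auto simp: regular_module_def l_distr r_distr m_assoc is_cring)
qed

lemma (in cring) idealI':
  assumes X: "X \<subseteq> carrier R" "\<zero> \<in> X" "\<And>x y. \<lbrakk>x \<in> X; y \<in> X\<rbrakk> \<Longrightarrow> x \<oplus> y \<in> X"
    and m: "\<And>a x. \<lbrakk>a \<in> carrier R; x \<in> X\<rbrakk> \<Longrightarrow> a \<otimes> x \<in> X"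
  shows "ideal X R"
proof (rule idealI)
  show "ring R" ..
  show "subgroup X (add_monoid R)"
  proof (intro subgroup.intro)
    fix x assume x: "x \<in> X"
    have "\<ominus> x = (\<ominus> \<one>) \<otimes> x" using x X(1) by (auto simp: l_minus)
    then show "inv\<^bsub>add_monoid R\<^esub> x \<in> X" using m[OF _ x, of "\<ominus> \<one>"] by (simp add: a_inv_def)
  qed (use X in auto)
  fix a x assume a: "a \<in> X" "x \<in> carrier R"
  then show "x \<otimes> a \<in> X" by (rule m[rotated])
  then show "a \<otimes> x \<in> X" using a X(1) m_comm[of a x] by auto
qed

section \<open>Evaluation and multiplication\<close>

context lin_eval begin

lemma lin_mult:
  assumes E: "lin_eval R k w (regular_module R) \<rho>"
    and \<rho>: "\<And>a m. \<lbrakk>a \<in> Bs; m \<in> B\<rbrakk> \<Longrightarrow> Nm (a + m) = \<rho> a \<odot>\<^bsub>N\<^esub> Nm m"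
    and f: "f \<in> S" and g: "g \<in> Pol B"
  shows "lin (f \<otimes>\<^bsub>PA\<^esub> g) = lin_eval.lin R (regular_module R) \<rho> f \<odot>\<^bsub>N\<^esub> lin g"
proof -
  interpret E: lin_eval R k w s "regular_module R" \<rho> by fact
  have rc: "\<rho> a \<in> carrier R" for a using E.Nm_closed by (simp add: regular_module_def)
  have Ec: "E.lin f \<in> carrier R" if "f \<in> carrier PA" for f using E.lin_closed[OF that] by (simp add: regular_module_def)
  have kR: "c \<in> carrier R" if "c \<in> k" for c using that k_sub by auto
  have gc: "g \<in> carrier PA" using PolD[OF g] .
  have mono: "lin (monom (R\<lparr>carrier := k\<rparr>) c a \<otimes>\<^bsub>PA\<^esub> g) = (c \<otimes>\<^bsub>R\<^esub> \<rho> a) \<odot>\<^bsub>N\<^esub> lin g" if c: "c \<in> k" and a: "a \<in> Bs" for c a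
    using g
  proof (induction rule: Pol_induct)
    case zero then show ?case using c kR rc by (simp add: lin_zero)
  next
    case (add g d m)
    have gc: "g \<in> carrier PA" and d: "d \<in> k" using PolD add by auto
    have cd: "c \<otimes>\<^bsub>R\<^esub> d \<in> k" using m_closed[of c d] c d by simp
    have "monom (R\<lparr>carrier := k\<rparr>) c a \<otimes>\<^bsub>PA\<^esub> (g \<oplus>\<^bsub>PA\<^esub> monom (R\<lparr>carrier := k\<rparr>) d m) =
        monom (R\<lparr>carrier := k\<rparr>) c a \<otimes>\<^bsub>PA\<^esub> g \<oplus>\<^bsub>PA\<^esub> monom (R\<lparr>carrier := k\<rparr>) (c \<otimes>\<^bsub>R\<^esub> d) (a + m)"
      using c d gc monom_monom[of c d a m] by (simp add: A.r_distr)
    then have "lin (monom (R\<lparr>carrier := k\<rparr>) c a \<otimes>\<^bsub>PA\<^esub> (g \<oplus>\<^bsub>PA\<^esub> monom (R\<lparr>carrier := k\<rparr>) d m)) =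
        (c \<otimes>\<^bsub>R\<^esub> \<rho> a) \<odot>\<^bsub>N\<^esub> lin g \<oplus>\<^bsub>N\<^esub> (c \<otimes>\<^bsub>R\<^esub> d) \<odot>\<^bsub>N\<^esub> (\<rho> a \<odot>\<^bsub>N\<^esub> Nm m)"
      using c d gc cd add \<rho>[OF a] by (simp add: lin_add lin_monom)
    also have "(c \<otimes>\<^bsub>R\<^esub> d) \<odot>\<^bsub>N\<^esub> (\<rho> a \<odot>\<^bsub>N\<^esub> Nm m) = (c \<otimes>\<^bsub>R\<^esub> \<rho> a) \<odot>\<^bsub>N\<^esub> (d \<odot>\<^bsub>N\<^esub> Nm m)"
    proof -
      have "(c \<otimes>\<^bsub>R\<^esub> d) \<otimes>\<^bsub>R\<^esub> \<rho> a = (c \<otimes>\<^bsub>R\<^esub> \<rho> a) \<otimes>\<^bsub>R\<^esub> d"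
        using kR[OF c] kR[OF d] rc by (simp add: N.R.m_assoc N.R.m_comm[of d])
      then show ?thesis using kR[OF c] kR[OF d] rc Nm_closed by (simp flip: N.smult_assoc1)
    qed
    also have "(c \<otimes>\<^bsub>R\<^esub> \<rho> a) \<odot>\<^bsub>N\<^esub> lin g \<oplus>\<^bsub>N\<^esub> (c \<otimes>\<^bsub>R\<^esub> \<rho> a) \<odot>\<^bsub>N\<^esub> (d \<odot>\<^bsub>N\<^esub> Nm m) =
        (c \<otimes>\<^bsub>R\<^esub> \<rho> a) \<odot>\<^bsub>N\<^esub> lin (g \<oplus>\<^bsub>PA\<^esub> monom (R\<lparr>carrier := k\<rparr>) d m)"
      using kR[OF c] kR[OF d] d rc Nm_closed gc lin_closed[OF gc] by (simp add: lin_add lin_monom N.smult_r_distr)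
    finally show ?case .
  qed
  show ?thesis using f
  proof (induction rule: Pol_induct)
    case zero
    have "E.lin \<zero>\<^bsub>PA\<^esub> = \<zero>\<^bsub>R\<^esub>" using E.lin_zero by (simp add: regular_module_def)
    then show ?case using gc lin_closed[OF gc] by (simp add: lin_zero)
  next
    case (add f c a)
    have fc: "f \<in> carrier PA" and c: "c \<in> k" using PolD add by auto
    have "E.lin (f \<oplus>\<^bsub>PA\<^esub> monom (R\<lparr>carrier := k\<rparr>) c a) = E.lin f \<oplus>\<^bsub>R\<^esub> c \<otimes>\<^bsub>R\<^esub> \<rho> a"
      using E.lin_add[OF fc, of "monom (R\<lparr>carrier := k\<rparr>) c a"] E.lin_monom[OF c, of a] c by (simp add: regular_module_def)
    then show ?case
      using add fc c gc mono lin_closed[OF gc] Ec[OF fc] rc kR[OF c] by (simp add: A.l_distr lin_add N.smult_l_distr)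
  qed
qed

lemma lin_homogeneous_outside:
  assumes f: "f \<in> carrier PA" and ids: "internal_direct_sum N D" and inj: "inj \<delta>"
    and d: "\<And>j. lin (cmp j f) \<in> D (\<delta> j)" and b: "lin f \<in> D e" "e \<notin> range \<delta>"
  shows "lin f = \<zero>\<^bsub>N\<^esub>"
proof -
  obtain J where J: "finite J" "\<And>j. j \<notin> J \<Longrightarrow> cmp j f = \<zero>\<^bsub>PA\<^esub>" "lin f = (\<Oplus>\<^bsub>N\<^esub>j\<in>J. lin (cmp j f))"
    using lin_finsum_cmp[OF f] by blast
  define a where "a e = lin (cmp (inv_into UNIV \<delta> e) f)" for e
  have ad: "a (\<delta> j) = lin (cmp j f)" for j using inj by (simp add: a_def)
  have "(\<Oplus>\<^bsub>N\<^esub>e\<in>\<delta> ` J. a e) = (\<Oplus>\<^bsub>N\<^esub>j\<in>J. a (\<delta> j))"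
    using inj f lin_closed by (intro N.M.finsum_reindex) (auto simp: ad intro: inj_on_subset)
  then have sum: "(\<Oplus>\<^bsub>N\<^esub>e\<in>\<delta> ` J. a e) = lin f" using J(3) by (simp add: ad)
  have aD: "a e \<in> D e" if "e \<in> \<delta> ` J" for e using that d ad by auto
  show ?thesis using N.M.ids_finsum_unique(2)[OF ids _ aD sum b(1)] J(1) b(2) by auto
qed

end

section \<open>Graded presentations\<close>

text \<open>
  Homogeneous generators \<open>x i\<close> of R and \<open>u l\<close> of M. The shift sh is there because module generators may have negative
  degree, whereas the weights of variables have to be positive.
\<close>

locale gens = R: fg_graded_algebra R k Rg + frob_poly "R\<lparr>carrier := k\<rparr>" w s p
  for R :: "('a, 'r) ring_scheme" (structure) and k Rg w s p +
  fixes M :: "('a, 'm, 'q) module_scheme" and Mg :: "int \<Rightarrow> 'm set"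
    and r :: nat and x :: "nat \<Rightarrow> 'a" and u :: "nat \<Rightarrow> 'm" and sh :: int and I :: "'a set"
  assumes graded_M: "graded_module R Rg M Mg"
    and x_deg: "\<And>i. x i \<in> Rg (w i)" and u_deg: "\<And>l. u l \<in> Mg (int (w (s + l)) - sh)"
    and gen_R: "generate_ring R (k \<union> x ` {..<s}) = carrier R"
    and gen_M: "submodule_generated R M (u ` {..<r}) = carrier M"
    and hom_I: "homogeneous_ideal R Rg I" and fin_I: "finite_colength R I"
begin

abbreviation gmul (infixl "\<boxtimes>" 70) where "f \<boxtimes> g \<equiv> f \<otimes>\<^bsub>PA\<^esub> g"
abbreviation gadd (infixl "\<boxplus>" 65) where "f \<boxplus> g \<equiv> f \<oplus>\<^bsub>PA\<^esub> g"

definition rp :: "nat multiset \<Rightarrow> 'a" where "rp m = (\<Otimes>i\<in>{..<s}. x i [^] count m i)"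
text \<open>
  On a monomial of the free module the maximum is its basis variable.
\<close>

definition um :: "nat multiset \<Rightarrow> 'm" where "um m = rp m \<odot>\<^bsub>M\<^esub> u (Max (set_mset m) - s)"

lemma module_M: "module R M" and ids_M: "internal_direct_sum M Mg"
  and graded_smult: "\<lbrakk>a \<in> Rg i; y \<in> Mg j\<rbrakk> \<Longrightarrow> a \<odot>\<^bsub>M\<^esub> y \<in> Mg (int i + j)"
  using graded_M by (auto simp: graded_module_def)

sublocale M: module R M by (rule module_M)

lemma Rg_sub: "Rg i \<subseteq> carrier R" using R.ids_carrier[OF R.ring_decomposition] .
lemma Mg_sub: "Mg i \<subseteq> carrier M" using M.M.ids_carrier[OF ids_M] .

lemma k_closed: "c \<in> k \<Longrightarrow> c \<in> carrier R" using Rg_sub[of 0] R.degree_zero by auto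

lemma one_deg: "\<one> \<in> Rg 0"
proof -
  interpret k: subfield k R by (rule R.field_k)
  show ?thesis using k.one_closed R.degree_zero by simp
qed

lemma one_k: "\<one> \<in> k" using one_deg R.degree_zero by simp

lemma x_closed: "x i \<in> carrier R" using x_deg Rg_sub by blast
lemma u_closed: "u l \<in> carrier M" using u_deg Mg_sub by blast

lemma rp_closed: "rp m \<in> carrier R"
  unfolding rp_def using x_closed by (intro R.finprod_closed) auto

lemma rp_add: "rp (a + b) = rp a \<otimes> rp b"
proof -
  have "rp (a + b) = (\<Otimes>i\<in>{..<s}. x i [^] count a i \<otimes> x i [^] count b i)"
    unfolding rp_def using x_closed by (intro R.finprod_cong') (auto simp: R.nat_pow_mult)
  then show ?thesis unfolding rp_def using x_closed by (subst (asm) R.finprod_multf) auto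
qed

lemma rp_empty: "rp {#} = \<one>"
  by (simp add: rp_def)

lemma rp_single: "rp {#i#} = (if i < s then x i else \<one>)"
proof -
  have "rp {#i#} = (\<Otimes>j\<in>{..<s}. if i = j then x j else \<one>)"
    unfolding rp_def using x_closed by (intro R.finprod_cong') auto
  also have "\<dots> = (if i < s then x i else \<one>)"
  proof (cases "i < s")
    case True then show ?thesis using x_closed R.finprod_singleton[of i "{..<s}" x] by auto
  next
    case False
    then have "(\<Otimes>j\<in>{..<s}. if i = j then x j else \<one>) = (\<Otimes>j\<in>{..<s}. \<one>)" by (intro R.finprod_cong') auto
    then show ?thesis using False by simp
  qed
  finally show ?thesis .
qed

lemma rp_deg: "a \<in> Bs \<Longrightarrow> rp a \<in> Rg (wt a)"
proof (induction a)
  case empty then show ?case using one_deg by (simp add: rp_empty)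
next
  case (add i a)
  then have "i < s" "a \<in> Bs" by (auto simp: Bs_def)
  have "rp (add_mset i a) = x i \<otimes> rp a" using rp_add[of "{#i#}" a] rp_single \<open>i < s\<close> by simp
  moreover have "wt (add_mset i a) = w i + wt a" by (simp add: wt_def)
  ultimately show ?case using R.graded_mult[OF x_deg add.IH[OF \<open>a \<in> Bs\<close>]] by simp
qed

lemma um_Bv:
  assumes "l < r" "a \<in> Bs"
  shows "um (add_mset (s + l) a) = rp a \<odot>\<^bsub>M\<^esub> u l"
proof -
  have "Max (set_mset (add_mset (s + l) a)) = s + l"
    using assms by (intro Max_eqI) (auto simp: Bs_def)
  moreover have "rp (add_mset (s + l) a) = rp a"
    using rp_add[of "{#s + l#}" a] rp_single[of "s + l"] rp_closed by simp
  ultimately show ?thesis by (simp add: um_def)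
qed

lemma um_add: assumes a: "a \<in> Bs" and m: "m \<in> Bv r" shows "um (a + m) = rp a \<odot>\<^bsub>M\<^esub> um m"
proof -
  obtain l b where lb: "m = add_mset (s + l) b" "l < r" "b \<in> Bs" using m by (auto simp: Bv_def)
  have "um (a + m) = (rp a \<otimes> rp b) \<odot>\<^bsub>M\<^esub> u l"
    using um_Bv[of l "a + b"] lb Bs_add[OF a lb(3)] by (simp add: rp_add)
  then show ?thesis using um_Bv[of l b] lb rp_closed u_closed by (simp add: M.smult_assoc1)
qed

lemma um_deg: assumes m: "m \<in> Bv r" shows "um m \<in> Mg (int (wt m) - sh)"
proof -
  obtain l b where lb: "m = add_mset (s + l) b" "l < r" "b \<in> Bs" using m by (auto simp: Bv_def)
  have "int (wt m) - sh = int (wt b) + (int (w (s + l)) - sh)" using lb by (simp add: wt_def)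
  then show ?thesis using graded_smult[OF rp_deg[OF lb(3)] u_deg[of l]] um_Bv[OF lb(2,3)] lb(1) by (simp add: add_diff_eq)
qed

sublocale e: lin_eval R k w s "regular_module R" rp
  using graded_poly_axioms R.module_regular k_closed rp_closed
  by (auto intro!: lin_eval.intro lin_eval_axioms.intro simp: regular_module_def)

sublocale v: lin_eval R k w s M um
  using graded_poly_axioms M.module_axioms k_closed rp_closed u_closed
  by (auto intro!: lin_eval.intro lin_eval_axioms.intro simp: um_def)

abbreviation "\<pi> \<equiv> e.lin"
abbreviation "\<phi> \<equiv> v.lin"

lemma regular_simps [simp]:
  "carrier (regular_module R) = carrier R" "zero (regular_module R) = \<zero>" "add (regular_module R) = add R"
  "smult (regular_module R) = mult R"
  by (simp_all add: regular_module_def)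

lemma ids_regular: "internal_direct_sum (regular_module R) Rg"
proof -
  have 1: "finsum (regular_module R) f A = finsum R f A" for f :: "nat \<Rightarrow> 'a" and A
    by (simp add: finsum_def finprod_def)
  have 2: "additive_subgroup H (regular_module R)" if "additive_subgroup H R" for H
    using that by (simp add: additive_subgroup_def subgroup_def m_inv_def)
  show ?thesis using R.ring_decomposition 2 by (simp add: internal_direct_sum_def 1)
qed

lemma pi_closed: "f \<in> carrier PA \<Longrightarrow> \<pi> f \<in> carrier R" using e.lin_closed by simp

lemma pi_add: "\<lbrakk>f \<in> carrier PA; g \<in> carrier PA\<rbrakk> \<Longrightarrow> \<pi> (f \<boxplus> g) = \<pi> f \<oplus> \<pi> g"
  using e.lin_add by simp

lemma pi_zero: "\<pi> \<zero>\<^bsub>PA\<^esub> = \<zero>" using e.lin_zero by simp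

lemma pi_mult: "\<lbrakk>f \<in> S; g \<in> S\<rbrakk> \<Longrightarrow> \<pi> (f \<boxtimes> g) = \<pi> f \<otimes> \<pi> g"
  using e.lin_mult[OF e.lin_eval_axioms, where B = Bs and f = f and g = g] by (simp add: rp_add)

lemma pi_one: "\<pi> \<one>\<^bsub>PA\<^esub> = \<one>"
  using e.lin_monom[of \<one> "{#}"] one_deg R.degree_zero by (simp add: PA_simps rp_empty)

lemma pi_pow: "f \<in> S \<Longrightarrow> \<pi> (f [^]\<^bsub>PA\<^esub> (n :: nat)) = \<pi> f [^] n"
  by (induction n) (auto simp: pi_one pi_mult S_pow)

lemma phi_mult: "\<lbrakk>f \<in> S; g \<in> Pol (Bv r)\<rbrakk> \<Longrightarrow> \<phi> (f \<boxtimes> g) = \<pi> f \<odot>\<^bsub>M\<^esub> \<phi> g"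
  using v.lin_mult[OF e.lin_eval_axioms um_add, where f = f and g = g] by simp

lemma pi_deg: "\<lbrakk>f \<in> S; f \<in> Hm j\<rbrakk> \<Longrightarrow> \<pi> f \<in> Rg j"
proof -
  assume f: "f \<in> S" "f \<in> Hm j"
  have "f \<in> Pol (Bs \<inter> Dg j)" using f Pol_Int by blast
  then show "\<pi> f \<in> Rg j"
    by (rule e.lin_in) (use R.ids_closed[OF R.ring_decomposition] R.graded_mult[OF _ rp_deg, of _ 0] in \<open>auto simp: R.degree_zero\<close>)
qed

lemma phi_deg: "\<lbrakk>f \<in> Pol (Bv r); f \<in> Hm j\<rbrakk> \<Longrightarrow> \<phi> f \<in> Mg (int j - sh)"
proof -
  assume f: "f \<in> Pol (Bv r)" "f \<in> Hm j"
  have "f \<in> Pol (Bv r \<inter> Dg j)" using f Pol_Int by blast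
  then show "\<phi> f \<in> Mg (int j - sh)"
    by (rule v.lin_in) (use M.M.ids_closed[OF ids_M] graded_smult[OF _ um_deg, of _ 0] in \<open>auto simp: R.degree_zero\<close>)
qed

lemma pi_surj: assumes "a \<in> carrier R" shows "\<exists>f\<in>S. \<pi> f = a"
proof -
  have "a \<in> generate_ring R (k \<union> x ` {..<s})" using gen_R assms by simp
  then show ?thesis
  proof (induction rule: generate_ring.induct)
    case one then show ?case using pi_one one_S by auto
  next
    case (incl h)
    then consider "h \<in> k" | i where "i < s" "h = x i" by auto
    then show ?case
    proof cases
      case 1
      then show ?thesis using e.lin_monom[of h "{#}"] k_closed[of h] cst_S[of h] by (auto simp: rp_empty)
    next
      case 2
      have "monom (R\<lparr>carrier := k\<rparr>) \<one> {#i#} \<in> S" using 2 one_k by (intro monom_Pol) (auto simp: Bs_def)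
      moreover have "\<pi> (monom (R\<lparr>carrier := k\<rparr>) \<one> {#i#}) = x i"
        using e.lin_monom[of \<one> "{#i#}"] 2 one_deg R.degree_zero x_closed by (simp add: rp_single)
      ultimately show ?thesis using 2 by blast
    qed
  next
    case (a_inv h)
    then obtain f where f: "f \<in> S" "\<pi> f = h" by auto
    have "\<ominus>\<^bsub>PA\<^esub> f \<in> S" using sub_neg[OF sub_Pol f(1)] .
    moreover have "\<pi> (\<ominus>\<^bsub>PA\<^esub> f) = \<ominus> h"
    proof -
      have fc: "f \<in> carrier PA" using S_carrier[OF f(1)] .
      have "\<pi> (\<ominus>\<^bsub>PA\<^esub> f) \<oplus> \<pi> f = \<zero>" using fc pi_add[of "\<ominus>\<^bsub>PA\<^esub> f" f] by (simp add: A.l_neg pi_zero)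
      then show ?thesis using fc pi_closed[OF fc] pi_closed[of "\<ominus>\<^bsub>PA\<^esub> f"] f R.minus_equality[of "\<pi> (\<ominus>\<^bsub>PA\<^esub> f)" h] by simp
    qed
    ultimately show ?case by blast
  next
    case (eng_add h1 h2)
    then obtain f g where "f \<in> S" "g \<in> S" "\<pi> f = h1" "\<pi> g = h2" by auto
    then show ?case using pi_add S_carrier subD(3)[OF sub_Pol] by (intro bexI[of _ "f \<boxplus> g"]) auto
  next
    case (eng_mult h1 h2)
    then obtain f g where "f \<in> S" "g \<in> S" "\<pi> f = h1" "\<pi> g = h2" by auto
    then show ?case using pi_mult S_mult by (intro bexI[of _ "f \<boxtimes> g"]) auto
  qed
qed

lemma phi_image:
  assumes U: "sub U" "U \<subseteq> Pol (Bv r)" "\<And>g f. \<lbrakk>g \<in> S; f \<in> U\<rbrakk> \<Longrightarrow> g \<boxtimes> f \<in> U"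
  shows "submodule (\<phi> ` U) R M"
proof (rule M.submoduleI')
  show "\<phi> ` U \<subseteq> carrier M" using v.lin_closed U PolD by blast
  show "\<zero>\<^bsub>M\<^esub> \<in> \<phi> ` U" using v.lin_zero subD(2)[OF U(1)] by (metis imageI)
next
  fix y z assume "y \<in> \<phi> ` U" "z \<in> \<phi> ` U"
  then obtain f g where "y = \<phi> f" "z = \<phi> g" "f \<in> U" "g \<in> U" by auto
  then show "y \<oplus>\<^bsub>M\<^esub> z \<in> \<phi> ` U"
    using v.lin_add[of f g] subD(3,5)[OF U(1)] by (intro image_eqI[of _ _ "f \<boxplus> g"]) auto
next
  fix a y assume a: "a \<in> carrier R" and "y \<in> \<phi> ` U"
  then obtain f where f: "y = \<phi> f" "f \<in> U" by auto
  obtain g where g: "g \<in> S" "\<pi> g = a" using pi_surj[OF a] by auto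
  have "a \<odot>\<^bsub>M\<^esub> y = \<phi> (g \<boxtimes> f)" using phi_mult[of g f] f g U(2) by auto
  then show "a \<odot>\<^bsub>M\<^esub> y \<in> \<phi> ` U" using U(3)[OF g(1) f(2)] by blast
qed

lemma phi_surj: assumes "y \<in> carrier M" shows "\<exists>f\<in>Pol (Bv r). \<phi> f = y"
proof -
  have "submodule_generated R M (u ` {..<r}) \<subseteq> \<phi> ` Pol (Bv r)"
  proof (rule M.submodule_generated_least)
    show "submodule (\<phi> ` Pol (Bv r)) R M"
      using gsubD[OF gsub_Pol[OF nice_Bv]] by (intro phi_image) auto
    have "u l \<in> \<phi> ` Pol (Bv r)" if "l < r" for l
    proof -
      have "\<phi> (basis_vec l) = u l"
        unfolding basis_vec_def using v.lin_monom[of \<one> "{#s + l#}"] um_Bv[OF that, of "{#}"] one_deg R.degree_zero u_closed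
        by (simp add: rp_empty)
      then show ?thesis using basis_vec(2)[OF that] by force
    qed
    then show "u ` {..<r} \<subseteq> \<phi> ` Pol (Bv r)" by auto
  qed
  then show ?thesis using gen_M assms by auto
qed

definition U0 where "U0 = {f \<in> Pol (Bv r). \<phi> f = \<zero>\<^bsub>M\<^esub>}"
definition I0 where "I0 = {f \<in> S. \<pi> f \<in> I}"

lemma inj_shift: "inj (\<lambda>j::nat. int j - sh)" by (auto simp: inj_def)

lemma phi_cmp_deg: "f \<in> Pol (Bv r) \<Longrightarrow> \<phi> (cmp j f) \<in> Mg (int j - sh)"
  by (intro phi_deg restr_Pol restr_closed PolD)

lemma pi_cmp_deg: "f \<in> S \<Longrightarrow> \<pi> (cmp j f) \<in> Rg j"
  by (intro pi_deg restr_Pol restr_closed PolD)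

lemma gsub_U0: "gsub (Bv r) U0"
  unfolding gsub_def
proof (intro conjI ballI allI)
  have "U0 = {f \<in> carrier PA. \<phi> f \<in> {\<zero>\<^bsub>M\<^esub>}} \<inter> Pol (Bv r)" using PolD by (auto simp: U0_def)
  moreover have "sub {f \<in> carrier PA. \<phi> f \<in> {\<zero>\<^bsub>M\<^esub>}}" by (rule v.sub_lin_vimage) (auto simp: k_closed)
  ultimately show "sub U0" using sub_Int sub_Pol by simp
  show "U0 \<subseteq> Pol (Bv r)" by (auto simp: U0_def)
next
  fix g f assume "g \<in> S" "f \<in> U0"
  then show "g \<boxtimes> f \<in> U0"
    using phi_mult[of g f] pi_closed[OF S_carrier, of g] gsubD(3)[OF gsub_Pol[OF nice_Bv, of r], of g f] by (simp add: U0_def)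
next
  fix j f assume f: "f \<in> U0"
  then have "\<phi> (cmp j f) = \<zero>\<^bsub>M\<^esub>"
    using PolD phi_cmp_deg by (intro v.lin_homogeneous_zero[OF _ ids_M inj_shift]) (auto simp: U0_def)
  then show "cmp j f \<in> U0" using f restr_Pol by (simp add: U0_def)
qed

lemma ideal_I: "ideal I R" using hom_I by (simp add: homogeneous_ideal_def)

lemma I_mem: "I \<subseteq> carrier R" "\<zero> \<in> I" "\<lbrakk>a \<in> I; b \<in> I\<rbrakk> \<Longrightarrow> a \<oplus> b \<in> I" "\<lbrakk>a \<in> carrier R; b \<in> I\<rbrakk> \<Longrightarrow> a \<otimes> b \<in> I"
proof -
  interpret I: ideal I R by (rule ideal_I)
  show "I \<subseteq> carrier R" using I.a_subset .
  show "\<zero> \<in> I" using I.zero_closed .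
  show "\<lbrakk>a \<in> I; b \<in> I\<rbrakk> \<Longrightarrow> a \<oplus> b \<in> I" using I.a_closed .
  show "\<lbrakk>a \<in> carrier R; b \<in> I\<rbrakk> \<Longrightarrow> a \<otimes> b \<in> I" using I.I_l_closed .
qed

lemma pi_image_ideal:
  assumes J: "sub J" "J \<subseteq> S" "\<And>g f. \<lbrakk>g \<in> S; f \<in> J\<rbrakk> \<Longrightarrow> g \<boxtimes> f \<in> J"
  shows "ideal (\<pi> ` J) R"
proof (rule R.idealI')
  show "\<pi> ` J \<subseteq> carrier R" using pi_closed J(2) S_carrier by blast
  show "\<zero> \<in> \<pi> ` J" using pi_zero subD(2)[OF J(1)] by (metis imageI)
next
  fix y z assume "y \<in> \<pi> ` J" "z \<in> \<pi> ` J"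
  then obtain f g where "y = \<pi> f" "z = \<pi> g" "f \<in> J" "g \<in> J" by auto
  then show "y \<oplus> z \<in> \<pi> ` J"
    using pi_add[of f g] subD(3,5)[OF J(1)] by (intro image_eqI[of _ _ "f \<boxplus> g"]) auto
next
  fix a y assume a: "a \<in> carrier R" and "y \<in> \<pi> ` J"
  then obtain f where f: "y = \<pi> f" "f \<in> J" by auto
  obtain g where g: "g \<in> S" "\<pi> g = a" using pi_surj[OF a] by auto
  have "a \<otimes> y = \<pi> (g \<boxtimes> f)" using pi_mult[of g f] f g J(2) by auto
  then show "a \<otimes> y \<in> \<pi> ` J" using J(3)[OF g(1) f(2)] by blast
qed

lemma sub_I0: "sub I0"
proof -
  have "I0 = {f \<in> carrier PA. \<pi> f \<in> I} \<inter> S" using S_carrier by (auto simp: I0_def)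
  moreover have "sub {f \<in> carrier PA. \<pi> f \<in> I}" by (rule e.sub_lin_vimage) (auto simp: k_closed I_mem)
  ultimately show "sub I0" using sub_Int sub_Pol by simp
qed

lemma I0_mult: "\<lbrakk>g \<in> S; f \<in> I0\<rbrakk> \<Longrightarrow> g \<boxtimes> f \<in> I0"
  using pi_mult[of g f] pi_closed[OF S_carrier, of g] I_mem(4) S_mult by (simp add: I0_def)

text \<open>
  I is generated by homogeneous elements, and these have homogeneous preimages. So the elements of S all of whose components
  map into I form an ideal with image I.
\<close>

lemma gsub_I0: "gsub Bs I0"
proof -
  define J where "J = {f \<in> S. \<forall>j. cmp j f \<in> I0}"
  have J: "sub J"
    unfolding sub_def J_def using subD[OF sub_I0] subD[OF sub_Pol] by (auto simp: restr_add restr_cst PolD)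
  have Jm: "g \<boxtimes> f \<in> J" if "g \<in> S" "f \<in> J" for g f
    using J _ that
  proof (rule S_closedI)
    fix a f assume a: "a \<in> Bs" and f: "f \<in> J"
    have m: "monom (R\<lparr>carrier := k\<rparr>) \<one> a \<in> S" "\<one> \<in> k" using monom_Pol[of \<one> a Bs] one_k a by auto
    have "cmp j (monom (R\<lparr>carrier := k\<rparr>) \<one> a \<boxtimes> f) \<in> I0" for j
      using f m(2) I0_mult[OF m(1)] subD(2)[OF sub_I0] S_carrier by (subst cmp_monom_mult) (auto simp: J_def)
    then show "monom (R\<lparr>carrier := k\<rparr>) \<one>\<^bsub>R\<lparr>carrier := k\<rparr>\<^esub> a \<boxtimes> f \<in> J" using S_mult[OF m(1)] f by (simp add: J_def)
  qed
  have "I \<subseteq> \<pi> ` J"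
  proof -
    have "I \<inter> (\<Union>i. Rg i) \<subseteq> \<pi> ` J"
    proof
      fix y assume "y \<in> I \<inter> (\<Union>i. Rg i)"
      then obtain i where y: "y \<in> I" "y \<in> Rg i" by auto
      obtain f where f: "f \<in> S" "\<pi> f = y" using pi_surj y I_mem(1) by blast
      have "\<pi> (cmp j f) = (if j = i then y else \<zero>)" for j
        using e.lin_homogeneous_unique[where f = f and D = Rg and \<delta> = "\<lambda>i. i" and b = y and i = i and j = j]
          S_carrier f y pi_cmp_deg[OF f(1)] ids_regular by simp
      then have "f \<in> J" using f y I_mem(2) restr_Pol by (simp add: J_def I0_def)
      then show "y \<in> \<pi> ` J" using f by blast
    qed
    then have "Idl (I \<inter> (\<Union>i. Rg i)) \<subseteq> \<pi> ` J"
      using pi_image_ideal[OF J _ Jm] by (intro R.genideal_minimal) (auto simp: J_def)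
    then show ?thesis using hom_I by (simp add: homogeneous_ideal_def)
  qed
  have "cmp j f \<in> I0" if f: "f \<in> I0" for j f
  proof -
    obtain g where g: "g \<in> J" "\<pi> g = \<pi> f" using f \<open>I \<subseteq> \<pi> ` J\<close> by (auto simp: I0_def)
    have c: "f \<in> S" "g \<in> S" "f \<in> carrier PA" "g \<in> carrier PA" using f g S_carrier by (auto simp: J_def I0_def)
    have d: "f \<ominus>\<^bsub>PA\<^esub> g \<in> S" using sub_diff[OF sub_Pol] c by auto
    have "\<pi> (f \<ominus>\<^bsub>PA\<^esub> g) \<oplus> \<pi> g = \<pi> f"
      using pi_add[of "f \<ominus>\<^bsub>PA\<^esub> g" g] c by (simp add: A.minus_eq A.a_assoc A.l_neg)
    then have z: "\<pi> (f \<ominus>\<^bsub>PA\<^esub> g) = \<zero>"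
      using g c pi_closed[OF c(3)] pi_closed[of "f \<ominus>\<^bsub>PA\<^esub> g"] by (metis A.minus_closed R.add.r_cancel_one')
    have "\<pi> (cmp j (f \<ominus>\<^bsub>PA\<^esub> g)) = \<zero>"
      using e.lin_homogeneous_zero[where f = "f \<ominus>\<^bsub>PA\<^esub> g" and D = Rg and \<delta> = "\<lambda>i. i" and j = j]
        S_carrier[OF d] z pi_cmp_deg[OF d] ids_regular by simp
    moreover have "cmp j f = cmp j (f \<ominus>\<^bsub>PA\<^esub> g) \<boxplus> cmp j g"
      using c by (simp add: A.minus_eq A.a_assoc A.l_neg flip: restr_add)
    ultimately have "\<pi> (cmp j f) = \<pi> (cmp j g)"
      using c S_carrier[OF d] pi_closed by (simp add: pi_add)
    then show ?thesis using g c restr_Pol by (auto simp: J_def I0_def)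
  qed
  then show ?thesis unfolding gsub_def using sub_I0 I0_mult by (auto simp: I0_def)
qed

definition Xn :: "nat \<Rightarrow> 'm set" where
  "Xn n = ideal_smult_module R (frobenius_power R I (p ^ n)) M"

lemma frob_sub: "(\<lambda>y. y [^] (p ^ n :: nat)) ` I \<subseteq> carrier R" using I_mem(1) by auto

lemma frob_ideal: "ideal (frobenius_power R I (p ^ n)) R"
  unfolding frobenius_power_def by (rule R.genideal_ideal[OF frob_sub])

lemma submodule_Xn: "submodule (Xn n) R M"
  unfolding Xn_def ideal_smult_module_def
  using ideal.Icarr[OF frob_ideal] by (intro M.submodule_generated_submodule) auto

text \<open>
  The image of \<open>frobV I0\<close> is a submodule of M, and the ring elements mapping M into it form an ideal that contains the
  \<open>p ^ n\<close>-th powers of the elements of I.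
\<close>

lemma Xn_vimage: "{f \<in> Pol (Bv r). \<phi> f \<in> Xn n} = sm U0 (frobV I0 (Bv r) n)"
proof
  note Xd = submoduleD[OF submodule_Xn[of n]] and gQ = gsub_frobV[OF nice_Bv, of r I0 n]
  have s: "sub {f \<in> Pol (Bv r). \<phi> f \<in> Xn n}"
  proof -
    have "{f \<in> Pol (Bv r). \<phi> f \<in> Xn n} = {f \<in> carrier PA. \<phi> f \<in> Xn n} \<inter> Pol (Bv r)" using PolD by auto
    moreover have "sub {f \<in> carrier PA. \<phi> f \<in> Xn n}" by (rule v.sub_lin_vimage) (auto simp: k_closed Xd)
    ultimately show ?thesis using sub_Int sub_Pol by simp
  qed
  show "sm U0 (frobV I0 (Bv r) n) \<subseteq> {f \<in> Pol (Bv r). \<phi> f \<in> Xn n}"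
  proof (rule sm_least[OF s])
    show "U0 \<subseteq> {f \<in> Pol (Bv r). \<phi> f \<in> Xn n}" using Xd(2) by (auto simp: U0_def)
    show "frobV I0 (Bv r) n \<subseteq> {f \<in> Pol (Bv r). \<phi> f \<in> Xn n}"
    proof (rule frobV_least[OF s])
      fix f v a assume f: "f \<in> I0" "f \<in> S" and v: "v \<in> Pol (Bv r)"
      have m: "f [^]\<^bsub>PA\<^esub> (p ^ n) \<boxtimes> v \<in> Pol (Bv r)" using gsubD(3)[OF gsub_Pol[OF nice_Bv] S_pow[OF f(2)] v] .
      have fI: "\<pi> f [^] (p ^ n) \<in> frobenius_power R I (p ^ n)"
        unfolding frobenius_power_def using R.genideal_self[OF frob_sub, of n] f(1) by (auto simp: I0_def)
      have "\<pi> f [^] (p ^ n) \<odot>\<^bsub>M\<^esub> \<phi> v \<in> Xn n"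
        unfolding Xn_def ideal_smult_module_def
        using fI v.lin_closed[OF PolD[OF v]] by (intro subsetD[OF M.submodule_generated_upper]) auto
      then show "f [^]\<^bsub>PA\<^esub> (p ^ n) \<boxtimes> v \<in> {f \<in> Pol (Bv r). \<phi> f \<in> Xn n}"
        using m phi_mult[OF S_pow[OF f(2)] v] pi_pow[OF f(2)] by simp
    qed
  qed
  show "{f \<in> Pol (Bv r). \<phi> f \<in> Xn n} \<subseteq> sm U0 (frobV I0 (Bv r) n)"
  proof
    have im: "submodule (\<phi> ` frobV I0 (Bv r) n) R M" using phi_image gsubD[OF gQ] by auto
    note imd = submoduleD[OF im]
    have "Xn n \<subseteq> \<phi> ` frobV I0 (Bv r) n"
      unfolding Xn_def ideal_smult_module_def
    proof (rule M.submodule_generated_least[OF im])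
      let ?A = "{a \<in> carrier R. \<forall>y\<in>carrier M. a \<odot>\<^bsub>M\<^esub> y \<in> \<phi> ` frobV I0 (Bv r) n}"
      have "ideal ?A R"
        by (rule R.idealI') (use imd in \<open>auto simp: M.smult_l_distr M.smult_assoc1\<close>)
      moreover have "(\<lambda>y. y [^] (p ^ n :: nat)) ` I \<subseteq> ?A"
      proof clarify
        fix b assume b: "b \<in> I"
        obtain f where f: "f \<in> S" "\<pi> f = b" using pi_surj b I_mem(1) by blast
        have "b [^] (p ^ n) \<odot>\<^bsub>M\<^esub> y \<in> \<phi> ` frobV I0 (Bv r) n" if y: "y \<in> carrier M" for y
        proof -
          obtain v where v: "v \<in> Pol (Bv r)" "\<phi> v = y" using phi_surj[OF y] by auto
          have "f [^]\<^bsub>PA\<^esub> (p ^ n) \<boxtimes> v \<in> frobV I0 (Bv r) n"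
            by (rule frobV_pow[OF gsub_I0 nice_Bv _ v(1)]) (use f b in \<open>auto simp: I0_def\<close>)
          moreover have "\<phi> (f [^]\<^bsub>PA\<^esub> (p ^ n) \<boxtimes> v) = b [^] (p ^ n) \<odot>\<^bsub>M\<^esub> y"
            using phi_mult[OF S_pow[OF f(1)] v(1)] pi_pow[OF f(1)] f v by simp
          ultimately show ?thesis by (metis imageI)
        qed
        then show "b [^] (p ^ n) \<in> carrier R \<and> (\<forall>y\<in>carrier M. b [^] (p ^ n) \<odot>\<^bsub>M\<^esub> y \<in> \<phi> ` frobV I0 (Bv r) n)"
          using b I_mem(1) by auto
      qed
      ultimately have "frobenius_power R I (p ^ n) \<subseteq> ?A"
        unfolding frobenius_power_def by (intro R.genideal_minimal)
      then show "{a \<odot>\<^bsub>M\<^esub> x | a x. a \<in> frobenius_power R I (p ^ n) \<and> x \<in> carrier M} \<subseteq> \<phi> ` frobV I0 (Bv r) n" by auto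
    qed
    moreover fix f assume f: "f \<in> {f \<in> Pol (Bv r). \<phi> f \<in> Xn n}"
    ultimately obtain g where g: "g \<in> frobV I0 (Bv r) n" "\<phi> g = \<phi> f" by auto
    have c: "f \<in> carrier PA" "g \<in> carrier PA" "g \<in> Pol (Bv r)" using f g PolD gsubD(2,5)[OF gQ] by auto
    have "f \<ominus>\<^bsub>PA\<^esub> g \<in> U0"
      using v.lin_minus[OF c(1,2)] g v.lin_closed[OF c(1)] sub_diff[OF sub_Pol] f c
      by (simp add: U0_def M.M.minus_eq M.M.r_neg)
    moreover have "f = (f \<ominus>\<^bsub>PA\<^esub> g) \<boxplus> g" using c by (simp add: A.minus_eq A.a_assoc A.l_neg)
    ultimately show "f \<in> sm U0 (frobV I0 (Bv r) n)" using smI g(1) by metis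
  qed
qed

end

section \<open>Lengths of graded pieces\<close>

context gens begin

abbreviation "Kk \<equiv> R\<lparr>carrier := k\<rparr>"

lemma phi_surj_deg: assumes "y \<in> Mg (int j - sh)" shows "\<exists>f\<in>Pol (Bv r) \<inter> Hm j. \<phi> f = y"
proof -
  obtain f where f: "f \<in> Pol (Bv r)" "\<phi> f = y" using phi_surj assms Mg_sub by blast
  have "\<phi> (cmp j f) = y"
    using v.lin_homogeneous_unique[where f = f and D = Mg and \<delta> = "\<lambda>j. int j - sh" and b = y and i = j and j = j]
      PolD[OF f(1)] f assms phi_cmp_deg[OF f(1)] ids_M inj_shift by simp
  moreover have "cmp j f \<in> Pol (Bv r) \<inter> Hm j" using restr_Pol[OF f(1)] restr_closed[OF PolD[OF f(1)]] by blast
  ultimately show ?thesis by blast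
qed

definition Vn :: "nat \<Rightarrow> (nat multiset \<Rightarrow> 'a) set" where "Vn n = sm U0 (frobV I0 (Bv r) n)"

lemma gsub_Vn: "gsub (Bv r) (Vn n)"
  unfolding Vn_def by (intro gsub_sm gsub_U0 gsub_frobV nice_Bv)

lemma Vn_mem: "f \<in> Pol (Bv r) \<Longrightarrow> f \<in> Vn n \<longleftrightarrow> \<phi> f \<in> Xn n"
  using Xn_vimage[of n] by (auto simp: Vn_def)

lemma coset_phi_eq:
  assumes "f \<in> Pol (Bv r)" "g \<in> Pol (Bv r)"
  shows "Xn n +>\<^bsub>M\<^esub> \<phi> f = Xn n +>\<^bsub>M\<^esub> \<phi> g \<longleftrightarrow> f \<ominus>\<^bsub>PA\<^esub> g \<in> Vn n"
  using M.coset_eq[OF submodule_Xn v.lin_closed v.lin_closed, of f g n] v.lin_minus[of f g] PolD[OF assms(1)] PolD[OF assms(2)]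
    Vn_mem[OF sub_diff[OF sub_Pol assms]] by simp

text \<open>
  Taking images and preimages turns chains of subspaces between \<open>U + I\<^sup>[\<^sup>q\<^sup>] V\<close> and V in
  degree j into chains of subspaces of the degree piece and back.
\<close>

theorem module_length_piece:
  "module_length Kk (quotient_piece M Mg (Xn n) (int j - sh)) = enat (HF (Bv r) (Vn n) j)"
proof -
  let ?d = "int j - sh" and ?W = "Pol (Bv r) \<inter> Hm j" and ?X = "Xn n"
  note X = submodule_Xn[of n] and gV = gsub_Vn[of n]
  have kR: "carrier Kk \<subseteq> carrier R" using k_closed by auto
  have Wc: "f \<in> Pol (Bv r)" "f \<in> carrier PA" "\<phi> f \<in> Mg ?d" "\<phi> f \<in> carrier M" if "f \<in> ?W" for f
    using that PolD phi_deg[of f j] v.lin_closed by auto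
  have sW: "sub ?W" using sub_Int sub_Pol by blast
  let ?C = "\<lambda>C. submodule C Kk (M.piece ?X (Mg ?d))" and ?L = "\<lambda>L. sub L \<and> Vn n \<inter> Hm j \<subseteq> L \<and> L \<subseteq> ?W"
  have "chain_len ?L \<le> chain_len ?C"
  proof (rule chain_len_map[where g = "\<lambda>L. (\<lambda>y. ?X +>\<^bsub>M\<^esub> y) ` \<phi> ` L"])
    fix L assume L: "?L L"
    then have sL: "sub L" and LW: "L \<subseteq> ?W" by auto
    show "submodule ((\<lambda>y. ?X +>\<^bsub>M\<^esub> y) ` \<phi> ` L) Kk (M.piece ?X (Mg ?d))"
    proof (rule M.submodule_piece[OF X])
      show "\<phi> ` L \<subseteq> Mg ?d" using LW Wc by blast
      show "Mg ?d \<subseteq> carrier M" by (rule Mg_sub)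
      show "\<zero>\<^bsub>M\<^esub> \<in> \<phi> ` L" using v.lin_zero subD(2)[OF sL] by (intro image_eqI[of _ _ "\<zero>\<^bsub>PA\<^esub>"]) auto
      show "carrier Kk \<subseteq> carrier R" by (rule kR)
    next
      fix y z assume "y \<in> \<phi> ` L" "z \<in> \<phi> ` L"
      then obtain f g where "y = \<phi> f" "z = \<phi> g" "f \<in> L" "g \<in> L" by auto
      then show "y \<oplus>\<^bsub>M\<^esub> z \<in> \<phi> ` L" using v.lin_add[of f g] subD(3,5)[OF sL] by (intro image_eqI[of _ _ "f \<boxplus> g"]) auto
    next
      fix y assume "y \<in> \<phi> ` L"
      then obtain f where f: "y = \<phi> f" "f \<in> L" by auto
      have "\<phi> (\<ominus>\<^bsub>PA\<^esub> f) = \<ominus>\<^bsub>M\<^esub> y"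
        using v.lin_minus[of "\<zero>\<^bsub>PA\<^esub>" f] f subD(5)[OF sL] v.lin_closed v.lin_zero by (simp add: A.minus_eq M.M.minus_eq)
      then show "\<ominus>\<^bsub>M\<^esub> y \<in> \<phi> ` L" using sub_neg[OF sL f(2)] by (metis imageI)
    next
      fix a y assume a: "a \<in> carrier Kk" and "y \<in> \<phi> ` L"
      then obtain f where f: "y = \<phi> f" "f \<in> L" by auto
      show "a \<odot>\<^bsub>M\<^esub> y \<in> \<phi> ` L"
        using v.lin_cst[of a f] a f subD(4,5)[OF sL] by (intro image_eqI[of _ _ "cst a \<boxtimes> f"]) auto
    qed
  next
    fix L L' assume L: "?L L" "?L L'" "L \<subset> L'"
    then obtain f where f: "f \<in> L'" "f \<notin> L" by blast
    have "?X +>\<^bsub>M\<^esub> \<phi> f \<notin> (\<lambda>y. ?X +>\<^bsub>M\<^esub> y) ` \<phi> ` L"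
    proof
      assume "?X +>\<^bsub>M\<^esub> \<phi> f \<in> (\<lambda>y. ?X +>\<^bsub>M\<^esub> y) ` \<phi> ` L"
      then obtain g where g: "g \<in> L" "?X +>\<^bsub>M\<^esub> \<phi> f = ?X +>\<^bsub>M\<^esub> \<phi> g" by auto
      have fg: "f \<in> ?W" "g \<in> ?W" using f g L by auto
      have "f \<ominus>\<^bsub>PA\<^esub> g \<in> Vn n" using coset_phi_eq[of f g n] g fg by auto
      moreover have "f \<ominus>\<^bsub>PA\<^esub> g \<in> Hm j" using sub_diff[OF sub_Pol] fg by blast
      ultimately have "f \<ominus>\<^bsub>PA\<^esub> g \<in> L" using L by blast
      moreover have "f = (f \<ominus>\<^bsub>PA\<^esub> g) \<boxplus> g" using Wc fg by (simp add: A.minus_eq A.a_assoc A.l_neg)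
      ultimately have "f \<in> L" using subD(3)[of L] L g by metis
      then show False using f by simp
    qed
    then show "(\<lambda>y. ?X +>\<^bsub>M\<^esub> y) ` \<phi> ` L \<subset> (\<lambda>y. ?X +>\<^bsub>M\<^esub> y) ` \<phi> ` L'" using L f by blast
  qed
  moreover have "chain_len ?C \<le> chain_len ?L"
  proof (rule chain_len_map[where g = "\<lambda>C. {f \<in> ?W. ?X +>\<^bsub>M\<^esub> \<phi> f \<in> C}"])
    fix C assume C: "?C C"
    note D = M.piece_submoduleD[OF X C kR]
    have "sub {f \<in> ?W. ?X +>\<^bsub>M\<^esub> \<phi> f \<in> C}"
      unfolding sub_def
    proof (intro conjI ballI)
      show "{f \<in> ?W. ?X +>\<^bsub>M\<^esub> \<phi> f \<in> C} \<subseteq> carrier PA" using Wc by blast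
      show "\<zero>\<^bsub>PA\<^esub> \<in> {f \<in> ?W. ?X +>\<^bsub>M\<^esub> \<phi> f \<in> C}"
        using subD(2)[OF sW] D(2) M.coset_zero[OF X] v.lin_zero by simp
    next
      fix f g assume fg: "f \<in> {f \<in> ?W. ?X +>\<^bsub>M\<^esub> \<phi> f \<in> C}" "g \<in> {f \<in> ?W. ?X +>\<^bsub>M\<^esub> \<phi> f \<in> C}"
      then have "f \<in> ?W" "g \<in> ?W" by auto
      then show "f \<boxplus> g \<in> {f \<in> ?W. ?X +>\<^bsub>M\<^esub> \<phi> f \<in> C}"
        using subD(3)[OF sW, of f g] D(3)[of "\<phi> f" "\<phi> g"] Wc[of f] Wc[of g] fg v.lin_add[of f g] by simp
    next
      fix a f assume a: "a \<in> carrier Kk" and f: "f \<in> {f \<in> ?W. ?X +>\<^bsub>M\<^esub> \<phi> f \<in> C}"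
      then have "f \<in> ?W" by auto
      then show "cst a \<boxtimes> f \<in> {f \<in> ?W. ?X +>\<^bsub>M\<^esub> \<phi> f \<in> C}"
        using subD(4)[OF sW a] D(4)[OF a] Wc[of f] f v.lin_cst[of a f] a by simp
    qed
    moreover have "Vn n \<inter> Hm j \<subseteq> {f \<in> ?W. ?X +>\<^bsub>M\<^esub> \<phi> f \<in> C}"
    proof
      fix f assume f: "f \<in> Vn n \<inter> Hm j"
      then have fW: "f \<in> ?W" using gsubD(2)[OF gV] by auto
      have z: "\<zero>\<^bsub>PA\<^esub> \<in> Pol (Bv r)" using subD(2)[OF sub_Pol] .
      have "f \<ominus>\<^bsub>PA\<^esub> \<zero>\<^bsub>PA\<^esub> \<in> Vn n" using f sub_diff[OF gsubD(1)[OF gV]] subD(2)[OF gsubD(1)[OF gV]] by blast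
      then have "?X +>\<^bsub>M\<^esub> \<phi> f = ?X +>\<^bsub>M\<^esub> \<zero>\<^bsub>M\<^esub>" using coset_phi_eq[OF Wc(1)[OF fW] z] v.lin_zero by simp
      then show "f \<in> {f \<in> ?W. ?X +>\<^bsub>M\<^esub> \<phi> f \<in> C}" using fW M.coset_zero[OF X] D(2) by simp
    qed
    ultimately show "?L {f \<in> ?W. ?X +>\<^bsub>M\<^esub> \<phi> f \<in> C}" by blast
  next
    fix C C' assume C: "?C C" "?C C'" "C \<subset> C'"
    then obtain A where A: "A \<in> C'" "A \<notin> C" by blast
    then obtain y where y: "A = ?X +>\<^bsub>M\<^esub> y" "y \<in> Mg ?d" using M.piece_submoduleD(1)[OF X C(2) kR] by blast
    obtain f where "f \<in> ?W" "\<phi> f = y" using phi_surj_deg[OF y(2)] by blast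
    then have "f \<in> {f \<in> ?W. ?X +>\<^bsub>M\<^esub> \<phi> f \<in> C'}" "f \<notin> {f \<in> ?W. ?X +>\<^bsub>M\<^esub> \<phi> f \<in> C}" using A y by auto
    then show "{f \<in> ?W. ?X +>\<^bsub>M\<^esub> \<phi> f \<in> C} \<subset> {f \<in> ?W. ?X +>\<^bsub>M\<^esub> \<phi> f \<in> C'}" using C(3) by blast
  qed
  ultimately show ?thesis
    using HF_len[OF nice_Bv gsubD(1,2)[OF gV], of j]
    by (simp add: module_length_chain_len M.quotient_piece_piece[OF X] L.len_def)
qed

text \<open>
  The presentation has no elements in these degrees.
\<close>

theorem module_length_piece_neg:
  assumes "e < - sh" shows "module_length Kk (quotient_piece M Mg (Xn n) e) = 0"
proof -
  note X = submodule_Xn[of n]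
  have kR: "carrier Kk \<subseteq> carrier R" using k_closed by auto
  have "y = \<zero>\<^bsub>M\<^esub>" if y: "y \<in> Mg e" for y
  proof -
    obtain f where f: "f \<in> Pol (Bv r)" "\<phi> f = y" using phi_surj y Mg_sub by blast
    show ?thesis
      using v.lin_homogeneous_outside[where f = f and D = Mg and \<delta> = "\<lambda>j. int j - sh" and e = e]
        PolD[OF f(1)] f y phi_cmp_deg[OF f(1)] ids_M inj_shift assms by force
  qed
  then have im: "(\<lambda>y. Xn n +>\<^bsub>M\<^esub> y) ` Mg e \<subseteq> {Xn n}" using M.coset_zero[OF X] by auto
  have "chain_len (\<lambda>C. submodule C Kk (M.piece (Xn n) (Mg e))) \<le> 0"
  proof (rule chain_len_le)
    fix m and C :: "nat \<Rightarrow> 'm set set"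
    assume C: "\<And>i. i \<le> m \<Longrightarrow> submodule (C i) Kk (M.piece (Xn n) (Mg e))" "\<And>i. i < m \<Longrightarrow> C i \<subset> C (Suc i)"
    have "C i = {Xn n}" if "i \<le> m" for i using M.piece_submoduleD(1,2)[OF X C(1)[OF that] kR] im by blast
    then have "m = 0" using C(2)[of 0] by (cases m) auto
    then show "enat m \<le> 0" by (simp add: zero_enat_def)
  qed
  then show ?thesis by (simp add: module_length_chain_len M.quotient_piece_piece[OF X])
qed

section \<open>Vanishing in high degrees\<close>

lemma submodule_I: "submodule I R (regular_module R)"
  by (rule e.N.submoduleI') (use I_mem in auto)

text \<open>
  Otherwise the images of the ideals of elements without components of degree below j would decrease strictly
  at infinitely many j, contradicting finite colength.
\<close>

lemma I0_high: "\<exists>N. \<forall>j\<ge>N. S \<inter> Hm j \<subseteq> I0"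
proof (rule ccontr)
  assume "\<not> ?thesis"
  then have "\<forall>N. \<exists>j\<ge>N. \<not> S \<inter> Hm j \<subseteq> I0" by auto
  then have inf: "infinite {j. \<not> S \<inter> Hm j \<subseteq> I0}" by (simp add: infinite_nat_iff_unbounded_le)
  define b where "b = enumerate {j. \<not> S \<inter> Hm j \<subseteq> I0}"
  have b: "strict_mono b" "\<not> S \<inter> Hm (b i) \<subseteq> I0" for i
    using strict_mono_enumerate[OF inf] enumerate_in_set[OF inf] by (auto simp: b_def)
  have "\<forall>i. \<exists>h. h \<in> S \<and> h \<in> Hm (b i) \<and> h \<notin> I0" using b(2) by blast
  then obtain h where h: "h i \<in> S" "h i \<in> Hm (b i)" "h i \<notin> I0" for i by metis
  define E where "E j = {f \<in> S. \<forall>i<j. cmp i f = \<zero>\<^bsub>PA\<^esub>}" for j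
  have sE: "sub (E j)" for j
    unfolding sub_def E_def using subD[OF sub_Pol] by (auto simp: restr_add restr_cst PolD)
  have Em: "g \<boxtimes> f \<in> E j" if "g \<in> S" "f \<in> E j" for g f j
    using sE _ that
  proof (rule S_closedI)
    fix a f assume a: "a \<in> Bs" and f: "f \<in> E j"
    have m: "monom Kk \<one> a \<in> S" using monom_Pol[of \<one> a Bs] one_k a by auto
    have "cmp i (monom Kk \<one> a \<boxtimes> f) = \<zero>\<^bsub>PA\<^esub>" if "i < j" for i
      using f one_k S_carrier[OF m] S_carrier that by (subst cmp_monom_mult) (auto simp: E_def)
    then show "monom Kk \<one>\<^bsub>Kk\<^esub> a \<boxtimes> f \<in> E j" using S_mult[OF m] f by (simp add: E_def)
  qed
  define G where "G j = (\<lambda>y. I +>\<^bsub>regular_module R\<^esub> y) ` \<pi> ` E j" for j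
  have Gs: "submodule (G j) R (e.N.piece I (carrier (regular_module R)))" for j
  proof -
    interpret J: ideal "\<pi> ` E j" R by (rule pi_image_ideal) (use sE Em in \<open>auto simp: E_def\<close>)
    show ?thesis
      unfolding G_def
    proof (rule e.N.submodule_piece[OF submodule_I])
      show "\<pi> ` E j \<subseteq> carrier (regular_module R)" using J.a_subset by simp
      show "\<zero>\<^bsub>regular_module R\<^esub> \<in> \<pi> ` E j" using J.zero_closed by simp
      fix y assume y: "y \<in> \<pi> ` E j"
      have "\<ominus>\<^bsub>regular_module R\<^esub> y = \<ominus> y" by (simp add: a_inv_def m_inv_def)
      then show "\<ominus>\<^bsub>regular_module R\<^esub> y \<in> \<pi> ` E j" using J.a_inv_closed[OF y] by simp
    qed (use J.a_closed J.I_l_closed in auto)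
  qed
  obtain n where n: "module_length R (quotient_module (regular_module R) I) = enat n"
    using fin_I by (auto simp: finite_colength_def)
  have "enat (Suc n) \<le> chain_len (\<lambda>C. submodule C R (e.N.piece I (carrier (regular_module R))))"
  proof (rule chain_len_ge[where C = "\<lambda>i. G (b (Suc n - i))"])
    fix i assume i: "i < Suc n"
    define l where "l = Suc n - Suc i"
    have bl: "b l < b (Suc l)" using b(1) by (simp add: strict_mono_def)
    have "E (b (Suc l)) \<subseteq> E (b l)" using bl by (auto simp: E_def)
    then have sub: "G (b (Suc l)) \<subseteq> G (b l)" unfolding G_def by (intro image_mono)
    have hE: "h l \<in> E (b l)" using h(1,2)[of l] by (auto simp: E_def cmp_Hm)
    have "I +>\<^bsub>regular_module R\<^esub> \<pi> (h l) \<notin> G (b (Suc l))"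
    proof
      assume "I +>\<^bsub>regular_module R\<^esub> \<pi> (h l) \<in> G (b (Suc l))"
      then obtain g where g: "g \<in> E (b (Suc l))" "I +>\<^bsub>regular_module R\<^esub> \<pi> (h l) = I +>\<^bsub>regular_module R\<^esub> \<pi> g"
        by (auto simp: G_def)
      have c: "g \<in> S" "g \<in> carrier PA" "h l \<in> S" "h l \<in> carrier PA" using g h(1)[of l] S_carrier by (auto simp: E_def)
      have d: "h l \<ominus>\<^bsub>PA\<^esub> g \<in> S" using sub_diff[OF sub_Pol] c by auto
      have "\<pi> (h l) \<ominus>\<^bsub>regular_module R\<^esub> \<pi> g \<in> I"
        using e.N.coset_eq[OF submodule_I, of "\<pi> (h l)" "\<pi> g"] g(2) c pi_closed by simp
      then have "h l \<ominus>\<^bsub>PA\<^esub> g \<in> I0" using e.lin_minus[of "h l" g] c d by (simp add: I0_def)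
      then have "cmp (b l) (h l \<ominus>\<^bsub>PA\<^esub> g) \<in> I0" by (rule gsubD(4)[OF gsub_I0])
      moreover have "cmp (b l) (h l \<ominus>\<^bsub>PA\<^esub> g) = h l"
      proof -
        have "h l = (h l \<ominus>\<^bsub>PA\<^esub> g) \<boxplus> g" using c by (simp add: A.minus_eq A.a_assoc A.l_neg)
        then have "cmp (b l) (h l) = cmp (b l) (h l \<ominus>\<^bsub>PA\<^esub> g) \<boxplus> cmp (b l) g" by (metis restr_add)
        moreover have "cmp (b l) g = \<zero>\<^bsub>PA\<^esub>" using g(1) bl by (auto simp: E_def)
        ultimately show ?thesis using cmp_Hm[OF h(2)[of l], of "b l"] c S_carrier[OF d] by simp
      qed
      ultimately show False using h(3) by simp
    qed
    then have "G (b (Suc l)) \<subset> G (b l)" using sub hE by (auto simp: G_def)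
    moreover have "Suc n - i = Suc l" using i by (simp add: l_def)
    ultimately show "G (b (Suc n - i)) \<subset> G (b (Suc n - Suc i))" by (simp add: l_def)
  qed (rule Gs)
  then show False using n e.N.quotient_module_piece[OF submodule_I] by (simp add: module_length_chain_len)
qed

text \<open>
  A monomial of large degree contains some variable of S more than \<open>N p ^ n\<close> times, hence is a multiple of the
  \<open>p ^ n\<close>-th power of an element of degree at least N, which lies in the ideal.
\<close>

theorem HF_Vn_high: "\<exists>C. \<forall>n j. C * p ^ n < j \<longrightarrow> HF (Bv r) (Vn n) j = 0"
proof -
  obtain N where N: "\<And>j. N \<le> j \<Longrightarrow> S \<inter> Hm j \<subseteq> I0" using I0_high by blast
  define C where "C = (\<Sum>i<s. w i) * N + (\<Sum>l<r. w (s + l))"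
  have "HF (Bv r) (Vn n) j = 0" if j: "C * p ^ n < j" for n j
  proof -
    let ?q = "p ^ n"
    have q: "1 \<le> ?q" using prime_gt_0_nat[OF prime_p] by (simp add: Suc_le_eq)
    note gV = gsub_Vn[of n] and gQ = gsub_frobV[OF nice_Bv, of r I0 n]
    have mon: "monom Kk c m \<in> Vn n" if c: "c \<in> k" and m: "m \<in> Bv r" "wt m = j" for c m
    proof -
      obtain l a where la: "m = add_mset (s + l) a" "l < r" "a \<in> Bs" using m by (auto simp: Bv_def)
      have "w (s + l) \<le> (\<Sum>l<r. w (s + l))" using la(2) by (intro member_le_sum) auto
      also have "\<dots> \<le> (\<Sum>l<r. w (s + l)) * ?q" using q by simp
      finally have "(\<Sum>i<s. w i) * N * ?q < wt a" using j m la by (simp add: C_def wt_def algebra_simps)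
      moreover have "wt a = (\<Sum>i<s. w i * count a i)"
      proof -
        have "set_mset a \<subseteq> {..<s}" using la by (simp add: Bs_def)
        then show ?thesis
        proof (induction a)
          case (add i a)
          have "(\<Sum>j<s. w j * count (add_mset i a) j) = (\<Sum>j<s. w j * count a j + (if j = i then w j else 0))"
            by (intro sum.cong) auto
          also have "\<dots> = (\<Sum>j<s. w j * count a j) + w i" using add(2) by (simp add: sum.distrib)
          finally show ?case using add by (simp add: wt_def)
        qed simp
      qed
      ultimately have lt: "(\<Sum>i<s. w i * (N * ?q)) < (\<Sum>i<s. w i * count a i)" by (simp add: sum_distrib_right mult.assoc)
      obtain i where i: "i < s" "N * ?q < count a i"
      proof (rule ccontr)
        assume "\<not> thesis"
        then have "count a i \<le> N * ?q" if "i < s" for i using \<open>\<And>i. \<lbrakk>i < s; N * ?q < count a i\<rbrakk> \<Longrightarrow> thesis\<close> that by (meson not_le)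
        then have "(\<Sum>i<s. w i * count a i) \<le> (\<Sum>i<s. w i * (N * ?q))" by (intro sum_mono mult_left_mono) auto
        then show False using lt by simp
      qed
      define b where "b = replicate_mset N i"
      have bB: "b \<in> Bs" using i by (auto simp: b_def Bs_def)
      have "repeat_mset ?q b \<subseteq># a"
        using i by (auto simp: b_def subseteq_mset_def mult.commute)
      then obtain a' where a': "a = repeat_mset ?q b + a'" by (metis subset_mset.add_diff_inverse)
      have "wt b = N * w i" by (simp add: b_def wt_def)
      then have "N \<le> wt b" using w_pos[of i] by simp
      moreover have "monom Kk \<one> b \<in> S \<inter> Hm (wt b)" using one_k bB monom_Pol[of \<one> b Bs] monom_Pol[of \<one> b "Dg (wt b)"] by auto
      ultimately have bI: "monom Kk \<one> b \<in> I0" using N by blast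
      have a'm: "add_mset (s + l) a' \<in> Bv r" using la a' by (auto simp: Bv_def Bs_def)
      have "monom Kk \<one> b [^]\<^bsub>PA\<^esub> ?q \<boxtimes> monom Kk c (add_mset (s + l) a') \<in> frobV I0 (Bv r) n"
        by (rule frobV_pow[OF gsub_I0 nice_Bv bI]) (use monom_Pol[of c "add_mset (s + l) a'" "Bv r"] c a'm in auto)
      moreover have "monom Kk \<one> b [^]\<^bsub>PA\<^esub> ?q \<boxtimes> monom Kk c (add_mset (s + l) a') = monom Kk c m"
      proof -
        have "\<one>\<^bsub>Kk\<^esub> [^]\<^bsub>Kk\<^esub> ?q = \<one>\<^bsub>Kk\<^esub>" by (rule nat_pow_one)
        then have "monom Kk \<one> b [^]\<^bsub>PA\<^esub> ?q = monom Kk \<one> (repeat_mset ?q b)"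
          using monom_pow[of \<one> b ?q] one_k by simp
        moreover have "\<one> \<otimes> c = c" using k_closed[OF c] by simp
        ultimately show ?thesis
          using monom_monom[of \<one> c "repeat_mset ?q b" "add_mset (s + l) a'"] one_k c a' la by simp
      qed
      ultimately have "monom Kk c m \<in> frobV I0 (Bv r) n" by simp
      then show ?thesis unfolding Vn_def using sm_upper2[OF gsubD(1)[OF gsub_U0] gsubD(1)[OF gQ]] by blast
    qed
    have "Pol (Bv r) \<inter> Hm j \<subseteq> Vn n"
    proof
      fix f assume "f \<in> Pol (Bv r) \<inter> Hm j"
      then have "f \<in> Pol (Bv r \<inter> Dg j)" by (simp add: Pol_Int)
      then show "f \<in> Vn n"
      proof (induction rule: Pol_induct)
        case zero then show ?case using subD(2)[OF gsubD(1)[OF gV]] .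
      next
        case (add f c m) then show ?case using mon[of c m] subD(3)[OF gsubD(1)[OF gV]] by simp
      qed
    qed
    then have "Vn n \<inter> Hm j = Pol (Bv r) \<inter> Hm j" using gsubD(2)[OF gV] by blast
    then show ?thesis by (simp add: HF_def zero_enat_def)
  qed
  then show ?thesis by blast
qed

end

section \<open>Comparison of dimensions\<close>

context graded_poly begin

abbreviation "Ge j \<equiv> Pol {m. j \<le> wt m}"

text \<open>
  Compare the lowest components that do not lie in P.
\<close>

lemma hprime_prime:
  assumes P: "hprime P" and f: "f \<in> S" "f \<notin> P" and g: "g \<in> S" "g \<notin> P"
  shows "f \<boxtimes> g \<notin> P"
proof
  note gP = hprimeD(1)[OF P] and sP = gsubD(1)[OF hprimeD(1)[OF P]]
  assume fg: "f \<boxtimes> g \<in> P"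
  have split: "\<exists>a f0 f1. h = f0 \<boxplus> (cmp a h \<boxplus> f1) \<and> f0 \<in> P \<and> f1 \<in> S \<and> f1 \<in> Ge (Suc a) \<and> cmp a h \<notin> P"
    if h: "h \<in> S" "h \<notin> P" for h
  proof -
    have hc: "h \<in> carrier PA" using S_carrier[OF h(1)] .
    have "\<exists>a. cmp a h \<notin> P" using sub_of_cmp[OF sP hc] h(2) by blast
    then obtain a where a: "cmp a h \<notin> P" "\<And>i. i < a \<Longrightarrow> cmp i h \<in> P"
      using exists_least_iff[of "\<lambda>a. cmp a h \<notin> P"] by blast
    let ?f0 = "restr {m. wt m < a} h" and ?f1 = "restr {m. Suc a \<le> wt m} h"
    have "?f0 \<in> P"
    proof (rule sub_of_cmp[OF sP])
      fix i
      have "cmp i ?f0 = (if i < a then cmp i h else \<zero>\<^bsub>PA\<^esub>)" by (rule ext) (auto simp: restr_def PA_zero_fun)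
      then show "cmp i ?f0 \<in> P" using a(2) subD(2)[OF sP] by simp
    qed (use hc in simp)
    moreover have "h = ?f0 \<boxplus> (cmp a h \<boxplus> ?f1)"
    proof -
      have "cmp a h \<boxplus> ?f1 = restr (Dg a \<union> {m. Suc a \<le> wt m}) h" by (rule restr_Un[OF hc, symmetric]) auto
      moreover have "?f0 \<boxplus> restr (Dg a \<union> {m. Suc a \<le> wt m}) h = restr ({m. wt m < a} \<union> (Dg a \<union> {m. Suc a \<le> wt m})) h"
        by (rule restr_Un[OF hc, symmetric]) auto
      moreover have "restr ({m. wt m < a} \<union> (Dg a \<union> {m. Suc a \<le> wt m})) h = h"
        by (rule ext) (auto simp: restr_def)
      ultimately show ?thesis by simp
    qed
    ultimately show ?thesis using a(1) restr_Pol[OF h(1)] restr_closed[OF hc] by blast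
  qed
  obtain a f0 f1 where F: "f = f0 \<boxplus> (cmp a f \<boxplus> f1)" "f0 \<in> P" "f1 \<in> S" "f1 \<in> Ge (Suc a)" "cmp a f \<notin> P"
    using split[OF f] by blast
  obtain b g0 g1 where G: "g = g0 \<boxplus> (cmp b g \<boxplus> g1)" "g0 \<in> P" "g1 \<in> S" "g1 \<in> Ge (Suc b)" "cmp b g \<notin> P"
    using split[OF g] by blast
  let ?fa = "cmp a f" and ?gb = "cmp b g"
  have S: "f0 \<in> S" "g0 \<in> S" "?fa \<in> S" "?gb \<in> S" using F(2) G(2) gsubD(2)[OF gP] restr_Pol f(1) g(1) by auto
  note c = S[THEN S_carrier] F(3)[THEN S_carrier] G(3)[THEN S_carrier] f(1)[THEN S_carrier] g(1)[THEN S_carrier]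
  have H: "?fa \<in> Hm a" "?gb \<in> Hm b" using restr_closed c by auto
  \<comment> \<open>Modulo P both factors start with the displayed components, whose product leads the product.\<close>
  let ?h = "(?fa \<boxplus> f1) \<boxtimes> (?gb \<boxplus> g1)"
  have hP: "?h \<in> P"
  proof -
    have f': "f \<boxtimes> g = f0 \<boxtimes> g \<boxplus> (?fa \<boxplus> f1) \<boxtimes> g"
      by (subst F(1)) (use c in \<open>simp add: A.l_distr\<close>)
    have g': "(?fa \<boxplus> f1) \<boxtimes> g = (?fa \<boxplus> f1) \<boxtimes> g0 \<boxplus> ?h"
      by (subst G(1)) (use c in \<open>simp add: A.r_distr\<close>)
    have "f0 \<boxtimes> g \<in> P" using gsubD(3)[OF gP g(1) F(2)] c by (simp add: A.m_comm)
    then have "(?fa \<boxplus> f1) \<boxtimes> g \<in> P" using sub_add_cancel[OF sP, of "f0 \<boxtimes> g" "(?fa \<boxplus> f1) \<boxtimes> g"] fg c f' by simp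
    moreover have "(?fa \<boxplus> f1) \<boxtimes> g0 \<in> P" using gsubD(3)[OF gP subD(3)[OF sub_Pol S(3) F(3)] G(2)] .
    ultimately show ?thesis using sub_add_cancel[OF sP, of "(?fa \<boxplus> f1) \<boxtimes> g0" ?h] c g' by simp
  qed
  have "?h = ?fa \<boxtimes> ?gb \<boxplus> (?fa \<boxtimes> g1 \<boxplus> f1 \<boxtimes> (?gb \<boxplus> g1))"
    using c by (simp add: A.l_distr A.r_distr A.a_ac)
  then have "cmp (a + b) ?h = cmp (a + b) (?fa \<boxtimes> ?gb) \<boxplus> (cmp (a + b) (?fa \<boxtimes> g1) \<boxplus> cmp (a + b) (f1 \<boxtimes> (?gb \<boxplus> g1)))"
    by (simp add: restr_add)
  also have "cmp (a + b) (?fa \<boxtimes> ?gb) = ?fa \<boxtimes> ?gb"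
    by (rule restr_id) (rule mult_Pol[OF H], auto)
  also have "cmp (a + b) (?fa \<boxtimes> g1) = \<zero>\<^bsub>PA\<^esub>"
  proof -
    have "?fa \<boxtimes> g1 \<in> Ge (Suc (a + b))" by (rule mult_Pol[OF H(1) G(4)]) auto
    then show ?thesis by (intro ext) (auto simp: restr_apply PA_zero_fun intro: Pol_coeff)
  qed
  also have "cmp (a + b) (f1 \<boxtimes> (?gb \<boxplus> g1)) = \<zero>\<^bsub>PA\<^esub>"
  proof -
    have "Hm b \<subseteq> Ge b" by (rule Pol_mono) auto
    moreover have "Ge (Suc b) \<subseteq> Ge b" by (rule Pol_mono) auto
    ultimately have "?gb \<in> Ge b" "g1 \<in> Ge b" using H(2) G(4) by auto
    then have "?gb \<boxplus> g1 \<in> Ge b" using subD(3)[OF sub_Pol] by auto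
    then have "f1 \<boxtimes> (?gb \<boxplus> g1) \<in> Ge (Suc (a + b))" by (rule mult_Pol[OF F(4)]) auto
    then show ?thesis by (intro ext) (auto simp: restr_apply PA_zero_fun intro: Pol_coeff)
  qed
  finally have "?fa \<boxtimes> ?gb \<in> P" using gsubD(4)[OF gP hP, of "a + b"] c by simp
  then show False using hprimeD(3)[OF P S(3) H(1) S(4) H(2)] F(5) G(5) by blast
qed

end

context gens begin

abbreviation "Ann \<equiv> annihilator R M"

lemma ideal_Ann: "ideal Ann R"
  by (rule R.idealI') (auto simp: annihilator_def M.smult_l_distr M.smult_assoc1)

abbreviation "T \<equiv> R Quot Ann"
abbreviation "\<Theta> f \<equiv> Ann +> \<pi> f"

interpretation T: cring T by (rule ideal.quotient_is_cring[OF ideal_Ann R.is_cring])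
interpretation Ah: ring_hom_cring R T "(+>) Ann" by (rule ideal.rcos_ring_hom_cring[OF ideal_Ann R.is_cring])

lemma Theta_closed: "f \<in> S \<Longrightarrow> \<Theta> f \<in> carrier T"
  using Ah.hom_closed[OF pi_closed[OF S_carrier]] .

lemma Theta_add: "\<lbrakk>f \<in> S; g \<in> S\<rbrakk> \<Longrightarrow> \<Theta> (f \<boxplus> g) = \<Theta> f \<oplus>\<^bsub>T\<^esub> \<Theta> g"
  using Ah.hom_add[of "\<pi> f" "\<pi> g"] pi_add[of f g] pi_closed S_carrier by simp

lemma Theta_mult: "\<lbrakk>f \<in> S; g \<in> S\<rbrakk> \<Longrightarrow> \<Theta> (f \<boxtimes> g) = \<Theta> f \<otimes>\<^bsub>T\<^esub> \<Theta> g"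
  using Ah.hom_mult[of "\<pi> f" "\<pi> g"] pi_mult[of f g] pi_closed S_carrier by simp

lemma Theta_one: "\<Theta> \<one>\<^bsub>PA\<^esub> = \<one>\<^bsub>T\<^esub>"
  using Ah.hom_one by (simp add: pi_one)

lemma Theta_zero: "\<Theta> \<zero>\<^bsub>PA\<^esub> = \<zero>\<^bsub>T\<^esub>"
  using Ah.hom_zero by (simp add: pi_zero)

lemma Theta_surj: assumes "y \<in> carrier T" shows "\<exists>f\<in>S. \<Theta> f = y"
proof -
  obtain a where a: "a \<in> carrier R" "y = Ann +> a" using assms unfolding FactRing_def A_RCOSETS_def' by auto
  then show ?thesis using pi_surj[OF a(1)] by auto
qed

lemma Theta_eq:
  assumes "f \<in> S" "g \<in> S" "\<Theta> f = \<Theta> g" "v \<in> Pol (Bv r)"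
  shows "(f \<ominus>\<^bsub>PA\<^esub> g) \<boxtimes> v \<in> U0"
proof -
  have c: "f \<in> carrier PA" "g \<in> carrier PA" using assms S_carrier by auto
  have d: "f \<ominus>\<^bsub>PA\<^esub> g \<in> S" using sub_diff[OF sub_Pol] assms by auto
  have "\<pi> f \<in> Ann +> \<pi> f" using abelian_subgroup.a_rcos_self[OF abelian_subgroupI3 pi_closed[OF c(1)]] ideal.axioms(1)[OF ideal_Ann] R.abelian_group_axioms by blast
  then obtain h where h: "h \<in> Ann" "\<pi> f = h \<oplus> \<pi> g" using assms(3) by (auto simp: a_r_coset_def')
  have hc: "h \<in> carrier R" using h by (simp add: annihilator_def)
  have "f = (f \<ominus>\<^bsub>PA\<^esub> g) \<boxplus> g" using c by (simp add: A.minus_eq A.a_assoc A.l_neg)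
  then have "\<pi> f = \<pi> (f \<ominus>\<^bsub>PA\<^esub> g) \<oplus> \<pi> g" using pi_add[of "f \<ominus>\<^bsub>PA\<^esub> g" g] c by simp
  then have "\<pi> (f \<ominus>\<^bsub>PA\<^esub> g) = h" using h hc pi_closed[OF c(2)] pi_closed[OF S_carrier[OF d]] R.add.right_cancel by simp
  then have "\<phi> ((f \<ominus>\<^bsub>PA\<^esub> g) \<boxtimes> v) = \<zero>\<^bsub>M\<^esub>"
    using phi_mult[OF d assms(4)] h(1) v.lin_closed[OF PolD[OF assms(4)]] by (simp add: annihilator_def)
  then show ?thesis using gsubD(3)[OF gsub_Pol[OF nice_Bv] d assms(4)] by (simp add: U0_def)
qed

lemma Theta_image_primeideal:
  assumes Q: "hprime Q" and K: "\<And>g. \<lbrakk>g \<in> S; \<And>v. v \<in> Pol (Bv r) \<Longrightarrow> g \<boxtimes> v \<in> U0\<rbrakk> \<Longrightarrow> g \<in> Q"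
  shows "primeideal (\<Theta> ` Q) T" and "\<lbrakk>f \<in> S; \<Theta> f \<in> \<Theta> ` Q\<rbrakk> \<Longrightarrow> f \<in> Q"
proof -
  note gQ = hprimeD(1)[OF Q] and sQ = gsubD(1)[OF hprimeD(1)[OF Q]]
  have QS: "f \<in> S" if "f \<in> Q" for f using that gsubD(2)[OF gQ] by auto
  have mem: "f \<in> Q" if f: "f \<in> S" "\<Theta> f \<in> \<Theta> ` Q" for f
  proof -
    obtain g where g: "g \<in> Q" "\<Theta> f = \<Theta> g" using f by auto
    have "f \<ominus>\<^bsub>PA\<^esub> g \<in> Q" using Theta_eq[OF f(1) QS[OF g(1)] g(2)] f(1) QS[OF g(1)] sub_diff[OF sub_Pol] by (intro K) auto
    moreover have "f = (f \<ominus>\<^bsub>PA\<^esub> g) \<boxplus> g"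
      using S_carrier[OF f(1)] S_carrier[OF QS[OF g(1)]] by (simp add: A.minus_eq A.a_assoc A.l_neg)
    ultimately show ?thesis using subD(3)[OF sQ] g(1) by metis
  qed
  then show "\<lbrakk>f \<in> S; \<Theta> f \<in> \<Theta> ` Q\<rbrakk> \<Longrightarrow> f \<in> Q" .
  have id: "ideal (\<Theta> ` Q) T"
  proof (rule T.idealI')
    show "\<Theta> ` Q \<subseteq> carrier T" using Theta_closed QS by blast
    show "\<zero>\<^bsub>T\<^esub> \<in> \<Theta> ` Q" using Theta_zero subD(2)[OF sQ] by (intro image_eqI[of _ _ "\<zero>\<^bsub>PA\<^esub>"]) auto
  next
    fix y z assume "y \<in> \<Theta> ` Q" "z \<in> \<Theta> ` Q"
    then obtain f g where fg: "y = \<Theta> f" "z = \<Theta> g" "f \<in> Q" "g \<in> Q" by auto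
    then show "y \<oplus>\<^bsub>T\<^esub> z \<in> \<Theta> ` Q"
      using Theta_add[OF QS QS, of f g] subD(3)[OF sQ] by (intro image_eqI[of _ _ "f \<boxplus> g"]) auto
  next
    fix y z assume y: "y \<in> carrier T" and "z \<in> \<Theta> ` Q"
    then obtain f g where fg: "\<Theta> f = y" "f \<in> S" "z = \<Theta> g" "g \<in> Q" using Theta_surj[OF y] by auto
    then show "y \<otimes>\<^bsub>T\<^esub> z \<in> \<Theta> ` Q"
      using Theta_mult[OF fg(2) QS[OF fg(4)]] gsubD(3)[OF gQ] by (intro image_eqI[of _ _ "f \<boxtimes> g"]) auto
  qed
  show "primeideal (\<Theta> ` Q) T"
  proof (rule primeidealI[OF id T.is_cring])
    show "carrier T \<noteq> \<Theta> ` Q"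
      using mem[OF one_S] hprimeD(2)[OF Q] Theta_closed[OF one_S] by auto
    fix y z assume yz: "y \<in> carrier T" "z \<in> carrier T" "y \<otimes>\<^bsub>T\<^esub> z \<in> \<Theta> ` Q"
    obtain f g where fg: "f \<in> S" "\<Theta> f = y" "g \<in> S" "\<Theta> g = z" using Theta_surj yz by metis
    have "f \<boxtimes> g \<in> Q" using mem[OF S_mult[OF fg(1,3)]] Theta_mult[OF fg(1,3)] fg yz(3) by simp
    then have "f \<in> Q \<or> g \<in> Q" using hprime_prime[OF Q fg(1) _ fg(3)] by blast
    then show "y \<in> \<Theta> ` Q \<or> z \<in> \<Theta> ` Q" using fg by auto
  qed
qed

lemma Theta_vimage_sprime:
  assumes P: "primeideal P T" shows "sprime {f \<in> S. \<Theta> f \<in> P}"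
proof -
  interpret P: primeideal P T by fact
  have one: "\<one>\<^bsub>T\<^esub> \<notin> P" using P.one_imp_carrier P.I_notcarr by auto
  have cs: "\<Theta> (cst c \<boxtimes> f) \<in> P" if "c \<in> carrier Kk" "f \<in> S" "\<Theta> f \<in> P" for c f
    using Theta_mult[OF cst_S[OF that(1)] that(2)] P.I_l_closed[OF that(3) Theta_closed[OF cst_S[OF that(1)]]] by simp
  show ?thesis
    unfolding sprime_def
  proof (intro conjI ballI impI)
    show "sub {f \<in> S. \<Theta> f \<in> P}"
      unfolding sub_def
    proof (intro conjI ballI)
      show "{f \<in> S. \<Theta> f \<in> P} \<subseteq> carrier PA" using S_carrier by auto
      show "\<zero>\<^bsub>PA\<^esub> \<in> {f \<in> S. \<Theta> f \<in> P}" using subD(2)[OF sub_Pol] Theta_zero P.zero_closed by simp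
    next
      fix f g assume "f \<in> {f \<in> S. \<Theta> f \<in> P}" "g \<in> {f \<in> S. \<Theta> f \<in> P}"
      then show "f \<boxplus> g \<in> {f \<in> S. \<Theta> f \<in> P}" using subD(3)[OF sub_Pol] Theta_add P.a_closed by simp
    next
      fix c f assume "c \<in> carrier Kk" "f \<in> {f \<in> S. \<Theta> f \<in> P}"
      then show "cst c \<boxtimes> f \<in> {f \<in> S. \<Theta> f \<in> P}" using subD(4)[OF sub_Pol] cs by simp
    qed
    show "{f \<in> S. \<Theta> f \<in> P} \<subseteq> S" by auto
    show "\<one>\<^bsub>PA\<^esub> \<notin> {f \<in> S. \<Theta> f \<in> P}" using one Theta_one by simp
  next
    fix g f assume "g \<in> S" "f \<in> {f \<in> S. \<Theta> f \<in> P}"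
    then show "g \<boxtimes> f \<in> {f \<in> S. \<Theta> f \<in> P}" using S_mult Theta_mult P.I_l_closed Theta_closed by simp
  next
    fix f g assume fg: "f \<in> S" "g \<in> S" "f \<boxtimes> g \<in> {f \<in> S. \<Theta> f \<in> P}"
    then have "\<Theta> f \<otimes>\<^bsub>T\<^esub> \<Theta> g \<in> P" using Theta_mult by simp
    then have "\<Theta> f \<in> P \<or> \<Theta> g \<in> P" using P.I_prime Theta_closed fg by simp
    then show "f \<in> {f \<in> S. \<Theta> f \<in> P} \<or> g \<in> {f \<in> S. \<Theta> f \<in> P}" using fg by simp
  qed
qed

lemma krull_dim_finite: "module_dim R M \<le> enat s"
  unfolding module_dim_def krull_dim_chain_len
proof (rule chain_len_le)
  fix n and P :: "nat \<Rightarrow> 'a set set"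
  assume P: "\<And>i. i \<le> n \<Longrightarrow> primeideal (P i) T" "\<And>i. i < n \<Longrightarrow> P i \<subset> P (Suc i)"
  have "n \<le> s"
  proof (rule sprime_chain_bound[where P = "\<lambda>i. {f \<in> S. \<Theta> f \<in> P i}"])
    fix i assume "i \<le> n" then show "sprime {f \<in> S. \<Theta> f \<in> P i}" using Theta_vimage_sprime P(1) by simp
  next
    fix i assume i: "i < n"
    then obtain y where y: "y \<in> P (Suc i)" "y \<notin> P i" using P(2) by blast
    interpret Pi: primeideal "P (Suc i)" T using P(1) i by simp
    obtain f where "f \<in> S" "\<Theta> f = y" using Theta_surj y(1) Pi.a_subset by blast
    then show "{f \<in> S. \<Theta> f \<in> P i} \<subset> {f \<in> S. \<Theta> f \<in> P (Suc i)}" using P(2)[OF i] y by blast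
  qed
  then show "enat n \<le> enat s" by simp
qed

abbreviation "Dm \<equiv> the_enat (module_dim R M)"

text \<open>
  The chain of homogeneous primes above P that accompanies the order of its pole maps to a chain of primes of \<open>R / Ann M\<close>.
\<close>

theorem prime_dichotomy:
  assumes P: "hprime P" and K: "\<And>g. \<lbrakk>g \<in> S; \<And>v. v \<in> Pol (Bv r) \<Longrightarrow> g \<boxtimes> v \<in> U0\<rbrakk> \<Longrightarrow> g \<in> P"
  shows "topdim Dm P \<or> small Dm P"
proof -
  obtain d C where d: "grows d P" and C: "C 0 = P" "\<And>i. i \<le> d \<Longrightarrow> hprime (C i)" "\<And>i. i < d \<Longrightarrow> C i \<subset> C (Suc i)"
    using hprime_growth[OF P] by blast
  have PC: "P \<subseteq> C i" if "i \<le> d" for i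
    using that
  proof (induction i)
    case 0 then show ?case using C(1) by simp
  next
    case (Suc i) then show ?case using C(3)[of i] by auto
  qed
  have KC: "g \<in> C i" if "i \<le> d" "g \<in> S" "\<And>v. v \<in> Pol (Bv r) \<Longrightarrow> g \<boxtimes> v \<in> U0" for g i
    using K[OF that(2,3)] PC[OF that(1)] by auto
  have "enat d \<le> module_dim R M"
    unfolding module_dim_def krull_dim_chain_len
  proof (rule chain_len_ge[where C = "\<lambda>i. \<Theta> ` C i"])
    fix i assume "i \<le> d" then show "primeideal (\<Theta> ` C i) T" by (intro Theta_image_primeideal(1) C(2) KC)
  next
    fix i assume i: "i < d"
    then have i': "i \<le> d" by simp
    obtain f where f: "f \<in> C (Suc i)" "f \<notin> C i" using C(3)[OF i] by blast
    have "f \<in> S" using gsubD(2)[OF hprimeD(1)[OF C(2)[of "Suc i"]]] i f(1) by auto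
    then have "\<Theta> f \<notin> \<Theta> ` C i" using Theta_image_primeideal(2)[OF C(2)[OF i'] KC[OF i']] f(2) by blast
    then show "\<Theta> ` C i \<subset> \<Theta> ` C (Suc i)" using C(3)[OF i] f(1) by blast
  qed
  then have "d \<le> Dm" using krull_dim_finite by (cases "module_dim R M") auto
  then show ?thesis
    using d P grows_small[OF hprimeD(1)[OF P] d, of Dm] unfolding topdim_def by (cases "d = Dm") auto
qed

theorem Hs_Vn_convergent:
  assumes "0 < \<tau>" shows "convergent (\<lambda>n. (1 - tn \<tau> n) ^ Dm * Hs (Bv r) (Vn n) (tn \<tau> n))"
  unfolding Vn_def
proof (rule module_convergent[OF assms gsub_U0])
  fix P assume P: "hprime P" and K: "\<And>g. \<lbrakk>g \<in> S; \<And>v. v \<in> Pol (Bv r) \<Longrightarrow> g \<boxtimes> v \<in> U0\<rbrakk> \<Longrightarrow> g \<in> P"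
  show "topdim Dm P \<or> small Dm P" by (rule prime_dichotomy[OF P K])
qed

end

section \<open>From a ray to the whole plane\<close>

text \<open>
  Every subsequence has a locally uniformly convergent subsequence by Montel's theorem. All limits agree on the
  ray and hence everywhere, which forces the whole sequence to converge.
\<close>

lemma locally_uniform_limit_from_ray:
  fixes F :: "nat \<Rightarrow> complex \<Rightarrow> complex"
  assumes hol: "\<And>n. F n holomorphic_on UNIV"
    and bound: "\<And>b. \<exists>B. \<forall>n z. norm z \<le> b \<longrightarrow> norm (F n z) \<le> B"
    and ray: "\<And>\<tau>::real. 0 < \<tau> \<Longrightarrow> convergent (\<lambda>n. F n (- \<i> * of_real \<tau>))"
  shows "\<exists>G. G holomorphic_on UNIV \<and> (\<forall>K. compact K \<longrightarrow> uniform_limit K F G sequentially)"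
proof -
  define R where "R = (\<lambda>\<tau>. - \<i> * complex_of_real \<tau>) ` {0<..}"
  have bK: "\<exists>B. \<forall>n. \<forall>z\<in>K. norm (F n z) \<le> B" if K: "compact K" for K
  proof -
    obtain b where "\<forall>z\<in>K. norm z \<le> b" using compact_imp_bounded[OF K] by (auto simp: bounded_iff)
    then show ?thesis using bound[of b] by meson
  qed
  have ex: "\<exists>G q. G holomorphic_on UNIV \<and> strict_mono (q :: nat \<Rightarrow> nat) \<and>
      (\<forall>z. (\<lambda>n. F (a (q n)) z) \<longlonglongrightarrow> G z) \<and> (\<forall>K. compact K \<longrightarrow> uniform_limit K ((\<lambda>n. F (a n)) \<circ> q) G sequentially)"
    for a :: "nat \<Rightarrow> nat"
    by (rule Montel[of UNIV "range F" "\<lambda>n. F (a n)"]) (use hol bK in auto)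
  obtain G q0 where G: "G holomorphic_on UNIV" "strict_mono q0" "\<And>z. (\<lambda>n. F (q0 n) z) \<longlonglongrightarrow> G z"
    using ex[of "\<lambda>n. n"] by auto
  have rayG: "(\<lambda>n. F n z) \<longlonglongrightarrow> G z" if "z \<in> R" for z
  proof -
    obtain l where l: "(\<lambda>n. F n z) \<longlonglongrightarrow> l" using ray \<open>z \<in> R\<close> by (auto simp: R_def convergent_def)
    have "(\<lambda>n. F (q0 n) z) \<longlonglongrightarrow> l" using LIMSEQ_subseq_LIMSEQ[OF l G(2)] by (simp add: o_def)
    then show ?thesis using LIMSEQ_unique[OF G(3)] l by blast
  qed
  have lp: "(- \<i>) islimpt R"
    unfolding islimpt_sequential
  proof (intro exI conjI allI)
    show "- \<i> * complex_of_real (1 + inverse (real (Suc n))) \<in> R - {- \<i>}" for n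
    proof -
      have pos: "0 < 1 + inverse (real (Suc n))" by (intro add_pos_pos) auto
      have "- \<i> * complex_of_real (1 + inverse (real (Suc n))) \<in> R"
        unfolding R_def by (rule image_eqI[OF refl]) (use pos in simp)
      moreover have "- \<i> * complex_of_real (1 + inverse (real (Suc n))) \<noteq> - \<i>"
      proof
        assume "- \<i> * complex_of_real (1 + inverse (real (Suc n))) = - \<i>"
        then have "Im (- \<i> * complex_of_real (1 + inverse (real (Suc n)))) = Im (- \<i>)" by (rule arg_cong)
        then show False by simp
      qed
      ultimately show ?thesis by simp
    qed
    have "(\<lambda>n. - \<i> * complex_of_real (1 + inverse (real (Suc n)))) \<longlonglongrightarrow> - \<i> * complex_of_real (1 + 0)"
      by (intro tendsto_intros LIMSEQ_inverse_real_of_nat)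
    then show "(\<lambda>n. - \<i> * complex_of_real (1 + inverse (real (Suc n)))) \<longlonglongrightarrow> - \<i>" by simp
  qed
  have uni: "uniform_limit K F G sequentially" if K: "compact K" for K
  proof (rule ccontr)
    assume "\<not> uniform_limit K F G sequentially"
    then obtain e where e: "0 < e" "\<not> (\<forall>\<^sub>F n in sequentially. \<forall>x\<in>K. dist (F n x) (G x) < e)"
      by (auto simp: uniform_limit_iff)
    then have "infinite {n. \<not> (\<forall>x\<in>K. dist (F n x) (G x) < e)}"
      by (simp add: eventually_sequentially infinite_nat_iff_unbounded_le)
    then obtain a :: "nat \<Rightarrow> nat" where a: "strict_mono a" "\<And>n. a n \<in> {n. \<not> (\<forall>x\<in>K. dist (F n x) (G x) < e)}"
      using infinite_enumerate by blast
    obtain G' q where G': "G' holomorphic_on UNIV" "strict_mono q" "\<And>z. (\<lambda>n. F (a (q n)) z) \<longlonglongrightarrow> G' z"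
        "uniform_limit K ((\<lambda>n. F (a n)) \<circ> q) G' sequentially"
      using ex[of a] K by blast
    have "G' z - G z = 0" if "z \<in> R" for z
    proof -
      have "strict_mono (\<lambda>n. a (q n))" using a(1) G'(2) by (simp add: strict_mono_def)
      then have "(\<lambda>n. F (a (q n)) z) \<longlonglongrightarrow> G z" using LIMSEQ_subseq_LIMSEQ[OF rayG[OF that]] by (simp add: o_def)
      then show ?thesis using LIMSEQ_unique[OF G'(3)] by simp
    qed
    then have eq: "G' z = G z" for z
      using analytic_continuation[of "\<lambda>z. G' z - G z" UNIV R "- \<i>" z] lp G(1) G'(1) by (auto intro: holomorphic_on_diff)
    have "\<forall>\<^sub>F n in sequentially. \<forall>x\<in>K. dist (((\<lambda>n. F (a n)) \<circ> q) n x) (G' x) < e"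
      by (rule uniform_limitD[OF G'(4) e(1)])
    then obtain n where "\<forall>x\<in>K. dist (F (a (q n)) x) (G x) < e" by (auto simp: eventually_sequentially eq)
    then show False using a(2)[of "q n"] by auto
  qed
  show ?thesis using G(1) uni by blast
qed

section \<open>The normalised Hilbert series as a finite sum\<close>

context gens begin

abbreviation "Fn n y \<equiv> frobenius_poincare_term R k p I M Mg n y"
abbreviation "hf n j \<equiv> HF (Bv r) (Vn n) j"

lemma p_gt_0: "0 < p" using prime_gt_0_nat[OF prime_p] .

lemma Fn_sum:
  assumes C: "\<forall>n j. C * p ^ n < j \<longrightarrow> hf n j = 0"
  shows "Fn n y = (1 / of_nat (p ^ n)) ^ Dm *
    (\<Sum>j\<le>C * p ^ n. of_nat (hf n j) * exp (- \<i> * y * of_int (int j - sh) / of_nat (p ^ n)))"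
proof -
  let ?l = "\<lambda>e. the_enat (module_length Kk (quotient_piece M Mg (Xn n) e))"
  let ?f = "\<lambda>e. of_nat (?l e) * exp (- \<i> * y * of_int e / of_nat (p ^ n)) :: complex"
  let ?\<delta> = "\<lambda>j. int j - sh"
  have l: "?l (int j - sh) = hf n j" for j by (simp add: module_length_piece)
  have z: "?f e = 0" if "e \<notin> ?\<delta> ` {..C * p ^ n}" for e
  proof (cases "e < - sh")
    case True then show ?thesis using module_length_piece_neg[of e n] by (simp add: zero_enat_def)
  next
    case False
    then have e: "e = int (nat (e + sh)) - sh" by simp
    have "\<not> nat (e + sh) \<le> C * p ^ n"
    proof
      assume "nat (e + sh) \<le> C * p ^ n"
      then have "e \<in> ?\<delta> ` {..C * p ^ n}" using e by (intro image_eqI[of _ _ "nat (e + sh)"]) auto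
      then show False using that by simp
    qed
    then have "?l e = 0" by (subst e, subst l) (simp add: C)
    then show ?thesis by simp
  qed
  have "infsum ?f UNIV = infsum ?f (?\<delta> ` {..C * p ^ n})" by (rule infsum_cong_neutral) (use z in auto)
  also have "\<dots> = sum ?f (?\<delta> ` {..C * p ^ n})" by simp
  also have "\<dots> = (\<Sum>j\<le>C * p ^ n. ?f (?\<delta> j))" by (subst sum.reindex) (auto simp: inj_on_def)
  finally show ?thesis unfolding frobenius_poincare_term_def Xn_def[symmetric] by (simp add: l)
qed

lemma Hs_finite:
  assumes C: "\<forall>n j. C * p ^ n < j \<longrightarrow> hf n j = 0"
  shows "Hs (Bv r) (Vn n) t = (\<Sum>j\<le>C * p ^ n. real (hf n j) * t ^ j)"
  unfolding Hs_def by (rule suminf_finite) (use C in auto)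

lemma tn_eq: "0 < \<tau> \<Longrightarrow> tn \<tau> n = exp (- \<tau> / real (p ^ n))"
  by (simp add: tn_def)

text \<open>On the negative imaginary axis the sum is a Hilbert series at a real point below 1.\<close>

lemma Fn_ray:
  assumes C: "\<forall>n j. C * p ^ n < j \<longrightarrow> hf n j = 0" and \<tau>: "0 < \<tau>"
  shows "Fn n (- \<i> * of_real \<tau>) =
    of_real (exp (\<tau> * of_int sh / real (p ^ n)) * ((1 / real (p ^ n)) ^ Dm * Hs (Bv r) (Vn n) (tn \<tau> n)))"
proof -
  define q where "q = p ^ n"
  have q0: "0 < q" using p_gt_0 by (simp add: q_def)
  have e: "exp (- \<i> * (- \<i> * of_real \<tau>) * of_int (int j - sh) / of_nat q) =
      complex_of_real (exp (\<tau> * of_int sh / real q) * tn \<tau> n ^ j)" for j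
  proof -
    have "- \<i> * (- \<i> * of_real \<tau>) * of_int (int j - sh) / of_nat q =
        complex_of_real (\<tau> * of_int sh / real q + real j * (- \<tau> / real q))"
      using q0 by (simp add: field_simps)
    moreover have "exp (\<tau> * of_int sh / real q + real j * (- \<tau> / real q)) = exp (\<tau> * of_int sh / real q) * tn \<tau> n ^ j"
      unfolding tn_eq[OF \<tau>] q_def[symmetric] exp_add exp_of_nat_mult ..
    ultimately show ?thesis by (simp only: exp_of_real)
  qed
  have "Fn n (- \<i> * of_real \<tau>) = (1 / of_nat q) ^ Dm *
      (\<Sum>j\<le>C * q. of_nat (hf n j) * complex_of_real (exp (\<tau> * of_int sh / real q) * tn \<tau> n ^ j))"
    unfolding Fn_sum[OF C] q_def[symmetric] e ..
  also have "\<dots> = of_real ((1 / real q) ^ Dm * (\<Sum>j\<le>C * q. real (hf n j) * (exp (\<tau> * of_int sh / real q) * tn \<tau> n ^ j)))"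
    by simp
  also have "(\<Sum>j\<le>C * q. real (hf n j) * (exp (\<tau> * of_int sh / real q) * tn \<tau> n ^ j)) =
      exp (\<tau> * of_int sh / real q) * Hs (Bv r) (Vn n) (tn \<tau> n)"
    unfolding Hs_finite[OF C] q_def[symmetric] sum_distrib_left by (simp only: mult.left_commute)
  finally show ?thesis unfolding q_def by (simp only: mult.left_commute)
qed

lemma inverse_p_lim: "(\<lambda>n. 1 / real (p ^ n)) \<longlonglongrightarrow> 0"
proof -
  have "(\<lambda>n. (1 / real p) ^ n) \<longlonglongrightarrow> 0" using prime_gt_1_nat[OF prime_p] by (intro LIMSEQ_power_zero) simp
  then show ?thesis by (simp add: power_divide)
qed

lemma ratio_lim:
  assumes "0 < \<tau>" shows "(\<lambda>n. (1 / real (p ^ n)) / (1 - tn \<tau> n)) \<longlonglongrightarrow> 1 / \<tau>"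
proof -
  have "((\<lambda>x::real. 1 - exp (- \<tau> * x)) has_real_derivative \<tau>) (at 0)"
    by (auto intro!: derivative_eq_intros)
  then have "(\<lambda>x. (1 - exp (- \<tau> * x)) / x) \<midarrow>0\<rightarrow> \<tau>" by (simp add: DERIV_def)
  then have "(\<lambda>x. inverse ((1 - exp (- \<tau> * x)) / x)) \<midarrow>0\<rightarrow> inverse \<tau>" using assms by (intro tendsto_inverse) auto
  moreover have "filterlim (\<lambda>n. 1 / real (p ^ n)) (at 0) sequentially"
    unfolding filterlim_at using inverse_p_lim p_gt_0 by simp
  ultimately have "(\<lambda>n. inverse ((1 - exp (- \<tau> * (1 / real (p ^ n)))) / (1 / real (p ^ n)))) \<longlonglongrightarrow> inverse \<tau>"
    by (rule filterlim_compose)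
  moreover have "inverse ((1 - exp (- \<tau> * (1 / real (p ^ n)))) / (1 / real (p ^ n))) = (1 / real (p ^ n)) / (1 - tn \<tau> n)" for n
    by (simp only: tn_eq[OF assms] inverse_divide times_divide_eq_right mult_1_right)
  ultimately show ?thesis by (simp only: inverse_eq_divide)
qed

lemma Fn_ray_convergent:
  assumes C: "\<forall>n j. C * p ^ n < j \<longrightarrow> hf n j = 0" and \<tau>: "0 < \<tau>"
  shows "convergent (\<lambda>n. (1 / real (p ^ n)) ^ Dm * Hs (Bv r) (Vn n) (tn \<tau> n))"
    and "convergent (\<lambda>n. Fn n (- \<i> * of_real \<tau>))"
proof -
  obtain L where L: "(\<lambda>n. (1 - tn \<tau> n) ^ Dm * Hs (Bv r) (Vn n) (tn \<tau> n)) \<longlonglongrightarrow> L"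
    using Hs_Vn_convergent[OF \<tau>] by (auto simp: convergent_def)
  have "(\<lambda>n. ((1 / real (p ^ n)) / (1 - tn \<tau> n)) ^ Dm * ((1 - tn \<tau> n) ^ Dm * Hs (Bv r) (Vn n) (tn \<tau> n))) \<longlonglongrightarrow> (1 / \<tau>) ^ Dm * L"
    by (intro tendsto_mult tendsto_power ratio_lim[OF \<tau>] L)
  moreover have "(a / (1 - tn \<tau> n)) ^ Dm * ((1 - tn \<tau> n) ^ Dm * X) = a ^ Dm * X" for n X a
  proof -
    have "1 - tn \<tau> n \<noteq> 0" using tn_less[OF \<tau>, of n] by simp
    then show ?thesis by (simp add: power_divide)
  qed
  ultimately have 1: "(\<lambda>n. (1 / real (p ^ n)) ^ Dm * Hs (Bv r) (Vn n) (tn \<tau> n)) \<longlonglongrightarrow> (1 / \<tau>) ^ Dm * L" by (simp only:)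
  then show "convergent (\<lambda>n. (1 / real (p ^ n)) ^ Dm * Hs (Bv r) (Vn n) (tn \<tau> n))" by (rule convergentI)
  have "(\<lambda>n. exp (\<tau> * of_int sh * (1 / real (p ^ n)))) \<longlonglongrightarrow> exp (\<tau> * of_int sh * 0)"
    by (intro tendsto_exp tendsto_mult tendsto_const inverse_p_lim)
  then have 2: "(\<lambda>n. exp (\<tau> * of_int sh / real (p ^ n))) \<longlonglongrightarrow> 1" by simp
  have "(\<lambda>n. complex_of_real (exp (\<tau> * of_int sh / real (p ^ n)) * ((1 / real (p ^ n)) ^ Dm * Hs (Bv r) (Vn n) (tn \<tau> n))))
      \<longlonglongrightarrow> complex_of_real (1 * ((1 / \<tau>) ^ Dm * L))"
    by (rule tendsto_of_real[OF tendsto_mult[OF 2 1]])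
  then show "convergent (\<lambda>n. Fn n (- \<i> * of_real \<tau>))" unfolding Fn_ray[OF C \<tau>] by (rule convergentI)
qed

text \<open>
  For \<open>\<bar>y\<bar> \<le> b\<close> the exponentials are bounded, since only degrees up to C q occur. The remaining sum of lengths
  is comparable with the Hilbert series at \<open>t\<^sub>n\<close> for \<open>\<tau> = 1\<close>, because \<open>t\<^sub>n ^ j\<close> is bounded below in these degrees.
\<close>

lemma Fn_bounded:
  assumes C: "\<forall>n j. C * p ^ n < j \<longrightarrow> hf n j = 0"
  shows "\<exists>B. \<forall>n y. norm y \<le> b \<longrightarrow> norm (Fn n y) \<le> B"
proof -
  obtain A where A: "\<And>n. norm ((1 / real (p ^ n)) ^ Dm * Hs (Bv r) (Vn n) (tn 1 n)) \<le> A"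
    using convergent_imp_Bseq[OF Fn_ray_convergent(1)[OF C zero_less_one]] by (auto simp: Bseq_def)
  define E where "E = real C + \<bar>of_int sh\<bar>"
  have "norm (Fn n y) \<le> exp (b * E) * (exp (real C) * A)" if y: "norm y \<le> b" for n y
  proof -
    define q where "q = p ^ n"
    have q0: "0 < real q" and q: "1 \<le> real q" using p_gt_0 by (simp_all add: q_def Suc_le_eq)
    have b0: "0 \<le> b" using y norm_ge_zero order_trans by blast
    let ?e = "\<lambda>j. exp (- \<i> * y * of_int (int j - sh) / of_nat q)"
    have t1: "norm (?e j) \<le> exp (b * E)" if j: "j \<le> C * q" for j
    proof -
      have "norm (?e j) \<le> exp (norm (- \<i> * y * of_int (int j - sh) / of_nat q))"
        by (rule norm_exp)
      also have "norm (- \<i> * y * of_int (int j - sh) / of_nat q) = norm y * (\<bar>real_of_int (int j - sh)\<bar> / real q)"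
        by (simp only: norm_mult norm_divide norm_of_int norm_of_nat norm_minus_cancel norm_ii mult_1 times_divide_eq_right)
      also have "\<dots> \<le> b * E"
      proof (rule mult_mono[OF y _ b0])
        have "\<bar>real_of_int (int j - sh)\<bar> \<le> real j + \<bar>of_int sh\<bar>" by simp
        also have "\<dots> \<le> real C * real q + \<bar>of_int sh\<bar> * real q"
        proof (rule add_mono)
          show "real j \<le> real C * real q" using j by (metis of_nat_le_iff of_nat_mult)
          show "\<bar>real_of_int sh\<bar> \<le> \<bar>of_int sh\<bar> * real q" using mult_left_mono[OF q, of "\<bar>real_of_int sh\<bar>"] by simp
        qed
        also have "\<dots> = E * real q" by (simp add: E_def algebra_simps)
        finally show "\<bar>real_of_int (int j - sh)\<bar> / real q \<le> E" using q0 by (simp only: pos_divide_le_eq)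
      qed simp
      finally show ?thesis by simp
    qed
    have t2: "1 \<le> exp (real C) * tn 1 n ^ j" if j: "j \<le> C * q" for j
    proof -
      have "real j \<le> real C * real q" using j by (metis of_nat_le_iff of_nat_mult)
      then have "real j / real q \<le> real C" using q0 by (simp only: pos_divide_le_eq)
      then have "1 \<le> exp (real C + real j * (- 1 / real q))" by simp
      also have "\<dots> = exp (real C) * tn 1 n ^ j"
        unfolding tn_eq[OF zero_less_one] q_def[symmetric] exp_add exp_of_nat_mult ..
      finally show ?thesis .
    qed
    have "norm (Fn n y) = norm ((1 / of_nat q) ^ Dm * (\<Sum>j\<le>C * q. of_nat (hf n j) * ?e j))"
      unfolding Fn_sum[OF C] q_def[symmetric] ..
    also have "\<dots> = (1 / real q) ^ Dm * norm (\<Sum>j\<le>C * q. of_nat (hf n j) * ?e j)"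
      by (simp only: norm_mult norm_power norm_divide norm_one norm_of_nat)
    also have "\<dots> \<le> (1 / real q) ^ Dm * (\<Sum>j\<le>C * q. exp (b * E) * (exp (real C) * (real (hf n j) * tn 1 n ^ j)))"
    proof (intro mult_left_mono sum_norm_le)
      fix j assume "j \<in> {..C * q}"
      then have j: "j \<le> C * q" by simp
      have "norm (of_nat (hf n j) * ?e j) \<le> real (hf n j) * exp (b * E)"
        unfolding norm_mult norm_of_nat by (rule mult_left_mono[OF t1[OF j]]) simp
      also have "\<dots> \<le> (real (hf n j) * exp (b * E)) * (exp (real C) * tn 1 n ^ j)"
        using mult_left_mono[OF t2[OF j], of "real (hf n j) * exp (b * E)"] by simp
      finally show "norm (of_nat (hf n j) * ?e j)
          \<le> exp (b * E) * (exp (real C) * (real (hf n j) * tn 1 n ^ j))" by (simp only: mult_ac)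
    qed (use q0 in simp)
    also have "(\<Sum>j\<le>C * q. exp (b * E) * (exp (real C) * (real (hf n j) * tn 1 n ^ j))) = exp (b * E) * (exp (real C) * Hs (Bv r) (Vn n) (tn 1 n))"
      unfolding Hs_finite[OF C] q_def[symmetric] sum_distrib_left ..
    also have "(1 / real q) ^ Dm * (exp (b * E) * (exp (real C) * Hs (Bv r) (Vn n) (tn 1 n))) =
        exp (b * E) * (exp (real C) * ((1 / real q) ^ Dm * Hs (Bv r) (Vn n) (tn 1 n)))" by (simp only: mult_ac)
    also have "\<dots> \<le> exp (b * E) * (exp (real C) * A)"
      using abs_le_D1[OF A[of n, unfolded real_norm_def]] unfolding q_def by (intro mult_left_mono) auto
    finally show ?thesis .
  qed
  then show ?thesis by blast
qed

theorem frobenius_limit: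
  "\<exists>G. G holomorphic_on UNIV \<and> (\<forall>K. compact K \<longrightarrow> uniform_limit K (\<lambda>n. Fn n) G sequentially)"
proof -
  obtain C where C: "\<forall>n j. C * p ^ n < j \<longrightarrow> hf n j = 0" using HF_Vn_high by blast
  show ?thesis
  proof (rule locally_uniform_limit_from_ray)
    show "(\<lambda>y. Fn n y) holomorphic_on UNIV" for n
      using p_gt_0 by (subst Fn_sum[OF C, abs_def]) (intro holomorphic_intros, auto)
  qed (use Fn_bounded[OF C] Fn_ray_convergent(2)[OF C] in auto)
qed

end

section \<open>Homogeneous generators\<close>

lemma (in field) prime_characteristic:
  assumes p: "ring_characteristic R = p" "p > 0"
  shows "prime p" "add_pow R p \<one> = \<zero>"
proof -
  have dv: "add_pow R n \<one> = \<zero> \<longleftrightarrow> p dvd n" for n :: nat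
    using group.pow_eq_id[OF a_group, of \<one> n] p by (simp add: ring_characteristic_def add_pow_def)
  then show "add_pow R p \<one> = \<zero>" by simp
  have "prime_elem p"
  proof (rule prime_elemI)
    show "p \<noteq> 0" using p by simp
    show "\<not> is_unit p"
    proof
      assume "is_unit p"
      then have "add_pow R (1::nat) \<one> = \<zero>" using dv[of 1] by simp
      then show False by simp
    qed
    fix a b assume "p dvd a * b"
    then have "add_pow R (a * b) \<one> = \<zero>" using dv by simp
    moreover have "add_pow R a \<one> \<otimes> add_pow R b \<one> = add_pow R (a * b) \<one>"
      by (simp add: add_pow_ldistr add.nat_pow_pow mult.commute)
    ultimately have "add_pow R a \<one> = \<zero> \<or> add_pow R b \<one> = \<zero>" using integral by simp
    then show "p dvd a \<or> p dvd b" using dv by simp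
  qed
  then show "prime p" by (intro primeI) simp_all
qed

text \<open>
  The homogeneous components of the elements of X; the degrees are recorded along with them.
\<close>

lemma (in abelian_group) homogeneous_generators:
  assumes ids: "internal_direct_sum G A" and X: "finite X" "X \<subseteq> carrier G"
  obtains P where "finite P" "\<And>i a. (i, a) \<in> P \<Longrightarrow> a \<in> A i"
    "\<And>Y. \<lbrakk>\<zero> \<in> Y; \<And>x y. \<lbrakk>x \<in> Y; y \<in> Y\<rbrakk> \<Longrightarrow> x \<oplus> y \<in> Y; snd ` P \<subseteq> Y\<rbrakk> \<Longrightarrow> X \<subseteq> Y"
proof -
  have "\<forall>x\<in>X. \<exists>f. (\<forall>i. f i \<in> A i) \<and> finite {i. f i \<noteq> \<zero>} \<and> x = finsum G f {i. f i \<noteq> \<zero>}"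
  proof
    fix x assume "x \<in> X"
    then have "x \<in> carrier G" using X by auto
    from ids_decompose[OF ids this] show "\<exists>f. (\<forall>i. f i \<in> A i) \<and> finite {i. f i \<noteq> \<zero>} \<and> x = finsum G f {i. f i \<noteq> \<zero>}"
      by blast
  qed
  then obtain f where f: "\<And>x i. x \<in> X \<Longrightarrow> f x i \<in> A i" "\<And>x. x \<in> X \<Longrightarrow> finite {i. f x i \<noteq> \<zero>}"
      "\<And>x. x \<in> X \<Longrightarrow> x = finsum G (f x) {i. f x i \<noteq> \<zero>}" by metis
  define P where "P = (\<Union>x\<in>X. (\<lambda>i. (i, f x i)) ` {i. f x i \<noteq> \<zero>})"
  show thesis
  proof (rule that)
    show "finite P" using X f by (auto simp: P_def)
    show "(i, a) \<in> P \<Longrightarrow> a \<in> A i" for i a using f(1) by (auto simp: P_def)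
    fix Y assume Y: "\<zero> \<in> Y" "\<And>x y. \<lbrakk>x \<in> Y; y \<in> Y\<rbrakk> \<Longrightarrow> x \<oplus> y \<in> Y" "snd ` P \<subseteq> Y"
    show "X \<subseteq> Y"
    proof
      fix x assume x: "x \<in> X"
      have "finsum G (f x) J \<in> Y" if "finite J" "J \<subseteq> {i. f x i \<noteq> \<zero>}" for J
        using that
      proof (induction J)
        case (insert i J)
        have "f x i \<in> carrier G" for i using f(1)[OF x] ids_carrier[OF ids] by blast
        moreover have "(i, f x i) \<in> P" using x insert by (auto simp: P_def)
        then have "f x i \<in> Y" using Y(3) by force
        ultimately show ?case using insert Y(2) by (subst finsum_insert) auto
      qed (use Y in simp)
      from this[OF f(2)[OF x]] show "x \<in> Y" using f(3)[OF x] by simp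
    qed
  qed
qed

theorem theorem3p1:
  fixes R :: "('a, 'r) ring_scheme" and k :: "'a set" and Rg :: "nat \<Rightarrow> 'a set"
    and p :: nat and I :: "'a set"
    and M :: "('a, 'm, 's) module_scheme" and Mg :: "int \<Rightarrow> 'm set"
  assumes "fg_graded_algebra R k Rg"
    and "ring_characteristic (R\<lparr>carrier := k\<rparr>) = p" and "p > 0"
    and "homogeneous_ideal R Rg I" and "finite_colength R I"
    and "graded_module R Rg M Mg" and "fg_module R M"
  shows "\<exists>F :: complex \<Rightarrow> complex.
      (\<forall>y. (\<lambda>n. frobenius_poincare_term R k p I M Mg n y) \<longlonglongrightarrow> F y) \<and>
      (\<forall>K. compact K \<longrightarrow>
         uniform_limit K (\<lambda>n. frobenius_poincare_term R k p I M Mg n) F sequentially) \<and>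
      F holomorphic_on UNIV"
proof -
  interpret R: fg_graded_algebra R k Rg by fact
  interpret M: module R M using assms(6) by (simp add: graded_module_def)
  interpret Kf: field "R\<lparr>carrier := k\<rparr>" using R.subfield_iff(2) R.field_k .
  have idM: "internal_direct_sum M Mg" using assms(6) by (simp add: graded_module_def)
  obtain XR where XR: "finite XR" "XR \<subseteq> carrier R" "generate_ring R (k \<union> XR) = carrier R"
    using R.finitely_generated by blast
  obtain XM where XM: "finite XM" "XM \<subseteq> carrier M" "submodule_generated R M XM = carrier M"
    using assms(7) by (auto simp: fg_module_def)
  obtain P where P: "finite P" "\<And>i a. (i, a) \<in> P \<Longrightarrow> a \<in> Rg i"
    "\<And>Y. \<lbrakk>\<zero>\<^bsub>R\<^esub> \<in> Y; \<And>x y. \<lbrakk>x \<in> Y; y \<in> Y\<rbrakk> \<Longrightarrow> x \<oplus>\<^bsub>R\<^esub> y \<in> Y; snd ` P \<subseteq> Y\<rbrakk> \<Longrightarrow> XR \<subseteq> Y"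
    using R.homogeneous_generators[OF R.ring_decomposition XR(1,2)] by metis
  obtain Q where Q: "finite Q" "\<And>i a. (i, a) \<in> Q \<Longrightarrow> a \<in> Mg i"
    "\<And>Y. \<lbrakk>\<zero>\<^bsub>M\<^esub> \<in> Y; \<And>x y. \<lbrakk>x \<in> Y; y \<in> Y\<rbrakk> \<Longrightarrow> x \<oplus>\<^bsub>M\<^esub> y \<in> Y; snd ` Q \<subseteq> Y\<rbrakk> \<Longrightarrow> XM \<subseteq> Y"
    using M.M.homogeneous_generators[OF idM XM(1,2)] by metis
  have Rsub: "Rg i \<subseteq> carrier R" and Msub: "Mg e \<subseteq> carrier M" for i e
    using R.ids_carrier[OF R.ring_decomposition] M.M.ids_carrier[OF idM] by auto
  obtain xs where xs: "set xs = {z \<in> P. 1 \<le> fst z}" using P(1) finite_list[of "{z \<in> P. 1 \<le> fst z}"] by auto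
  obtain ys where ys: "set ys = Q" using Q(1) finite_list by auto
  define s r where "s = length xs" and "r = length ys"
  \<comment> \<open>The shift makes all module generators live in positive degrees.\<close>
  define sh where "sh = 1 + (\<Sum>z\<in>Q. \<bar>fst z\<bar>)"
  define w where "w i = (if i < s then fst (xs ! i) else if i < s + r then nat (fst (ys ! (i - s)) + sh) else 1)" for i
  define x where "x i = (if i < s then snd (xs ! i) else \<zero>\<^bsub>R\<^esub>)" for i
  define u where "u l = (if l < r then snd (ys ! l) else \<zero>\<^bsub>M\<^esub>)" for l
  have xsP: "xs ! i \<in> P" "1 \<le> fst (xs ! i)" if "i < s" for i using nth_mem[of i xs] that xs by (auto simp: s_def)
  have ysQ: "ys ! l \<in> Q" if "l < r" for l using nth_mem[of l ys] that ys by (auto simp: r_def)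
  have ysh: "1 \<le> fst (ys ! l) + sh" if "l < r" for l
    using member_le_sum[OF ysQ[OF that], of "\<lambda>z. \<bar>fst z\<bar>"] Q(1) by (simp add: sh_def)
  have xim: "x ` {..<s} = snd ` {z \<in> P. 1 \<le> fst z}"
    unfolding xs[symmetric] set_conv_nth by (force simp: x_def s_def)
  have uim: "u ` {..<r} = snd ` Q"
    unfolding ys[symmetric] set_conv_nth by (force simp: u_def r_def)
  have kx: "k \<union> x ` {..<s} \<subseteq> carrier R"
    using Rsub[of 0] R.degree_zero P(2) Rsub unfolding xim by (auto, blast)
  interpret G: gens R k Rg w s p M Mg r x u sh I
  proof unfold_locales
    show "1 \<le> w i" for i
    proof (cases "s \<le> i \<and> i < s + r")
      case True
      then have "1 \<le> fst (ys ! (i - s)) + sh" by (intro ysh) auto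
      then show ?thesis using True by (simp add: w_def nat_le_iff le_nat_iff)
    next
      case False then show ?thesis using xsP(2)[of i] by (auto simp: w_def)
    qed
    show "prime p" "add_pow (R\<lparr>carrier := k\<rparr>) p \<one>\<^bsub>R\<lparr>carrier := k\<rparr>\<^esub> = \<zero>\<^bsub>R\<lparr>carrier := k\<rparr>\<^esub>"
      using Kf.prime_characteristic[OF assms(2,3)] .
    show "graded_module R Rg M Mg" "homogeneous_ideal R Rg I" "finite_colength R I" by fact+
    show "x i \<in> Rg (w i)" for i
      using P(2)[of "fst (xs ! i)" "snd (xs ! i)"] xsP(1)[of i] R.ids_closed(1)[OF R.ring_decomposition] by (simp add: x_def w_def)
    show "u l \<in> Mg (int (w (s + l)) - sh)" for l
    proof (cases "l < r")
      case True
      then show ?thesis using Q(2)[of "fst (ys ! l)" "snd (ys ! l)"] ysQ ysh[of l] by (simp add: u_def w_def)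
    next
      case False then show ?thesis using M.M.ids_closed(1)[OF idM] by (simp add: u_def)
    qed
    show "generate_ring R (k \<union> x ` {..<s}) = carrier R"
    proof
      let ?Y = "generate_ring R (k \<union> x ` {..<s})"
      show "?Y \<subseteq> carrier R" by (rule R.generate_ring_incl[OF kx])
      have "XR \<subseteq> ?Y"
      proof (rule P(3))
        show "\<zero>\<^bsub>R\<^esub> \<in> ?Y" by (rule R.zero_in_generate)
        show "snd ` P \<subseteq> ?Y"
        proof
          fix b assume "b \<in> snd ` P"
          then obtain i where "(i, b) \<in> P" by auto
          then have "b \<in> k \<union> x ` {..<s}"
            using P(2)[of i b] R.degree_zero unfolding xim by (cases "i = 0") force+
          then show "b \<in> ?Y" by (rule generate_ring.incl)
        qed
      qed (rule generate_ring.eng_add)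
      then have "k \<union> XR \<subseteq> ?Y" using generate_ring.incl[of _ "k \<union> x ` {..<s}" R] by auto
      then show "carrier R \<subseteq> ?Y"
        using R.generate_ring_min_subring1[of "k \<union> XR" ?Y] R.generate_ring_is_subring[OF kx] XR(2,3) kx by auto
    qed
    show "submodule_generated R M (u ` {..<r}) = carrier M"
    proof -
      have uc: "u ` {..<r} \<subseteq> carrier M" using Q(2) Msub unfolding uim by (auto, blast)
      note sm = M.submodule_generated_submodule[OF uc]
      have "XM \<subseteq> submodule_generated R M (u ` {..<r})"
        using submoduleD(2,3)[OF sm] M.submodule_generated_upper[of "u ` {..<r}"] uim by (intro Q(3)) auto
      then have "carrier M \<subseteq> submodule_generated R M (u ` {..<r})"
        using M.submodule_generated_least[OF sm] XM(3) by blast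
      then show ?thesis using submoduleD(1)[OF sm] by blast
    qed
  qed
  obtain F where F: "F holomorphic_on UNIV"
      "\<And>K. compact K \<Longrightarrow> uniform_limit K (\<lambda>n. frobenius_poincare_term R k p I M Mg n) F sequentially"
    using G.frobenius_limit by blast
  have "(\<lambda>n. frobenius_poincare_term R k p I M Mg n y) \<longlonglongrightarrow> F y" for y
    using tendsto_uniform_limitI[OF F(2)[of "{y}"], of y] by simp
  then show ?thesis using F by blast
qed

end
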